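(* In quantitative reachability games, the Nash rational verification problem and the deterministic Nash rational verification problem are both $\mathsf{coNP}$-complete.
   Context: Games. A game $G=(\Pi,V,(V_i)_{i\in\Pi},E,\mu)$ consists of a finite set $\Pi$ of players, a finite directed graph $(V,E)$ in which every vertex has at least one outgoing edge, a partition $(V_i)_{i\in\Pi}$ of $V$ (parts may be empty; $V_i$ is controlled by $i$), and a payoff function $\mu=(\mu_i)_{i\in\Pi}$ mapping plays (infinite paths) to $\mathbb R^\Pi$. Histories are finite paths. $G_{\upharpoonright v_0}$ denotes the game with initial vertex $v_0$ (plays and histories start at $v_0$). It is a quantitative reachability game if each player $i$ has a target set $T_i\subseteq V$ such that $\mu_i(\pi)=\frac1{1+\inf\{n\in\mathbb N:\pi_n\in T_i\}}$ for every play $\pi$ (with $\inf\emptyset=+\infty$ and $\frac1{+\infty}=0$). Strategies and equilibria. A strategy $\sigma_i$ of player $i$ maps each history $hv$ from $v_0$ with $v\in V_i$ to a successor of $v$; a profile $\bar\sigma=(\sigma_i)_{i\in\Pi}$ has a unique compatible play, its outcome $\langle\bar\sigma\rangle$. A distinguished player, Leader, is denoted $\mathbb L\in\Pi$. $\bar\sigma$ is an $\mathbb L$-fixed NE if $\mu_i(\langle\sigma'_i,\bar\sigma_{-i}\rangle)\le\mu_i(\langle\bar\sigma\rangle)$ for all players $i\ne\mathbb L$ and all strategies $\sigma'_i$. Mealy machines. A Mealy machine for Leader on $G$ is $M=(Q,q_0,\Delta)$ with $Q$ finite, $q_0\in Q$, $\Delta\subseteq(Q\times(V\setminus V_{\mathbb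 L})\times Q)\cup(Q\times V_{\mathbb L}\times Q\times V)$ with $uv\in E$ for every $(p,u,q,v)\in\Delta$, such that for all $p\in Q,u\in V$ there is at least one transition $(p,u,q)$ or $(p,u,q,v)$ in $\Delta$; it is deterministic if there is exactly one for all $p,u$. $\sigma_{\mathbb L}\in\mathrm{Comp}_{\upharpoonright v_0}(M)$ if there is a map $h\mapsto q_h\in Q$ (on histories from $v_0$ and the empty history, the latter mapped to $q_0$) such that, for each history $hv$ from $v_0$, $(q_h,v,q_{hv})\in\Delta$ if $v\notin V_{\mathbb L}$ and $(q_h,v,q_{hv},\sigma_{\mathbb L}(hv))\in\Delta$ if $v\in V_{\mathbb L}$. Problem. The (deterministic) Nash rational verification problem in a class $\mathcal C$: given $G_{\upharpoonright v_0}\in\mathcal C$, $t\in\mathbb Q$ and a (deterministic) Mealy machine $M$ for Leader on $G$, does every $\mathbb L$-fixed NE $\bar\sigma$ with $\sigma_{\mathbb L}\in\mathrm{Comp}_{\upharpoonright v_0}(M)$ satisfy $\mu_{\mathbb L}(\langle\bar\sigma\rangle)>t$? *)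

theory Defs
  imports
    Complex_Main
    "HOL-Library.Extended_Nat"
    "HOL-Computational_Algebra.Polynomial"
begin

section \<open>Polynomial time and coNP\<close>

text \<open>
  Deterministic Turing machines with any number of two-way infinite tapes over a finite alphabet.
  The tape symbols are the numbers below \<open>tm_symbols\<close>, where 0 is the blank, and 1 and 2 are
  the bits \<open>False\<close> and \<open>True\<close>. The states are the numbers below \<open>tm_states\<close>, and 0 is
  the initial state. The machine halts when \<open>tm_delta\<close> yields \<open>None\<close>; otherwise
  \<open>tm_delta\<close> yields the next state and, for each tape, the symbol to write and the head move.
\<close>

datatype move = Move_Left | Stay | Move_Right

record tm =
  tm_tapes :: nat
  tm_states :: nat
  tm_symbols :: nat
  tm_delta :: "nat \<Rightarrow> nat list \<Rightarrow> (nat \<times> (nat \<times> move) list) option"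

definition wf_tm :: "tm \<Rightarrow> bool" where
  "wf_tm M \<longleftrightarrow> tm_tapes M \<ge> 1 \<and> tm_states M \<ge> 1 \<and> tm_symbols M \<ge> 3 \<and>
     (\<forall>q < tm_states M. \<forall>ss. length ss = tm_tapes M \<and> set ss \<subseteq> {..<tm_symbols M} \<longrightarrow>
        (case tm_delta M q ss of
           None \<Rightarrow> True
         | Some (q', acts) \<Rightarrow> q' < tm_states M \<and> length acts = tm_tapes M \<and>
             (\<forall>(s, d) \<in> set acts. s < tm_symbols M)))"

text \<open>A tape consists of its content and the position of its head.\<close>

type_synonym tape = "(int \<Rightarrow> nat) \<times> int"
type_synonym config = "nat \<times> tape list"

fun move_offset :: "move \<Rightarrow> int" where
  "move_offset Move_Left = -1"
| "move_offset Stay = 0"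
| "move_offset Move_Right = 1"

fun tape_read :: "tape \<Rightarrow> nat" where
  "tape_read (f, p) = f p"

fun tape_act :: "tape \<Rightarrow> nat \<times> move \<Rightarrow> tape" where
  "tape_act (f, p) (s, d) = (f(p := s), p + move_offset d)"

fun tm_step :: "tm \<Rightarrow> config \<Rightarrow> config option" where
  "tm_step M (q, ts) =
     (case tm_delta M q (map tape_read ts) of
        None \<Rightarrow> None
      | Some (q', acts) \<Rightarrow> Some (q', map2 tape_act ts acts))"

definition word_content :: "bool list \<Rightarrow> int \<Rightarrow> nat" where
  "word_content w i = (if 0 \<le> i \<and> i < int (length w) then (if w ! nat i then 2 else 1) else 0)"

text \<open>The input is written on the first tape, the output is read off the last one.\<close>

definition tm_init :: "tm \<Rightarrow> bool list \<Rightarrow> config" where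
  "tm_init M x = (0, (word_content x, 0) # replicate (tm_tapes M - 1) (word_content [], 0))"

definition tm_computes_within :: "tm \<Rightarrow> bool list \<Rightarrow> bool list \<Rightarrow> nat \<Rightarrow> bool" where
  "tm_computes_within M x y n \<longleftrightarrow>
     (\<exists>m \<le> n. \<exists>c. (tm_init M x, c) \<in> {(c, c'). tm_step M c = Some c'} ^^ m \<and>
        tm_step M c = None \<and> fst (last (snd c)) = word_content y)"

definition polytime_computable :: "(bool list \<Rightarrow> bool list) \<Rightarrow> bool" where
  "polytime_computable f \<longleftrightarrow>
     (\<exists>M (p :: nat poly). wf_tm M \<and> (\<forall>x. tm_computes_within M x (f x) (poly p (length x))))"

type_synonym language = "bool list set"

definition class_P :: "language set" where
  "class_P = {L. polytime_computable (\<lambda>x. [x \<in> L])}"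

text \<open>
  Structured data is written as a string over the four symbols 0, 1, \<open>(\<close> and \<open>)\<close>, each of
  which takes two bits. Numbers are written in binary, least significant bit first, without
  leading zeros.
\<close>

definition enc_paren :: "bool list list \<Rightarrow> bool list" where
  "enc_paren ws = [True, False] @ concat ws @ [True, True]"

definition enc_list :: "('a \<Rightarrow> bool list) \<Rightarrow> 'a list \<Rightarrow> bool list" where
  "enc_list f xs = enc_paren (map f xs)"

definition enc_bit :: "bool \<Rightarrow> bool list" where
  "enc_bit b = [False, b]"

fun nat_bits :: "nat \<Rightarrow> bool list" where
  "nat_bits n = (if n = 0 then [] else odd n # nat_bits (n div 2))"

declare nat_bits.simps [simp del]

definition enc_nat :: "nat \<Rightarrow> bool list" where
  "enc_nat n = enc_list enc_bit (nat_bits n)"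

definition enc_int :: "int \<Rightarrow> bool list" where
  "enc_int a = enc_paren [enc_bit (a < 0), enc_nat (nat \<bar>a\<bar>)]"

definition enc_pair :: "bool list \<Rightarrow> bool list \<Rightarrow> bool list" where
  "enc_pair x u = enc_paren [enc_list enc_bit x, enc_list enc_bit u]"

subsection \<open>Unique readability\<close>

text \<open>
  \<open>item_enc f\<close>: codes are never proper prefixes of each other and never start with the
  closing parenthesis.
\<close>

definition item_enc :: "('a \<Rightarrow> bool list) \<Rightarrow> bool" where
  "item_enc f \<longleftrightarrow> (\<forall>x y r s. f x @ r = f y @ s \<longrightarrow> x = y \<and> r = s) \<and>
     (\<forall>x. \<exists>a b w. f x = a # b # w \<and> \<not> (a \<and> b))"

lemma item_encD: "item_enc f \<Longrightarrow> f x @ r = f y @ s \<longleftrightarrow> x = y \<and> r = s"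
  unfolding item_enc_def by blast

lemma item_enc_not_close: "item_enc f \<Longrightarrow> f x @ r \<noteq> True # True # s"
  unfolding item_enc_def by (metis append_Cons list.inject)

lemma item_enc_eq_iff: "item_enc f \<Longrightarrow> f x = f y \<longleftrightarrow> x = y"
  using item_encD[of f x "[]" y "[]"] by simp

lemma item_enc_bit: "item_enc enc_bit"
  by (auto simp: item_enc_def enc_bit_def)

lemma item_enc_parenI:
  assumes "\<And>x y r s. concat (g x) @ [True, True] @ r = concat (g y) @ [True, True] @ s \<Longrightarrow> x = y \<and> r = s"
  shows "item_enc (\<lambda>x. enc_paren (g x))"
  using assms by (auto simp: item_enc_def enc_paren_def)

lemma item_enc_list:
  assumes f: "item_enc f"
  shows "item_enc (enc_list f)"
proof -
  have "xs = ys \<and> r = s"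
    if "concat (map f xs) @ [True, True] @ r = concat (map f ys) @ [True, True] @ s" for xs ys r s
    using that
  proof (induction xs arbitrary: ys)
    case Nil
    then show ?case
      using item_enc_not_close[OF f] by (cases ys) (auto dest: sym)
  next
    case (Cons x xs)
    then show ?case
      using item_enc_not_close[OF f] item_encD[OF f] by (cases ys) auto
  qed
  then show ?thesis
    unfolding enc_list_def by (intro item_enc_parenI) auto
qed

lemma nat_bits_inj: "nat_bits m = nat_bits n \<Longrightarrow> m = n"
proof (induction m arbitrary: n rule: nat_bits.induct)
  case (1 m)
  show ?case
  proof (cases "m = 0 \<or> n = 0")
    case True
    then show ?thesis
      using "1.prems" by (auto simp: nat_bits.simps[of m] nat_bits.simps[of n] split: if_splits)
  next
    case False
    then have "odd m = odd n" "nat_bits (m div 2) = nat_bits (n div 2)"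
      using "1.prems" by (simp_all add: nat_bits.simps[of m] nat_bits.simps[of n])
    with 1 False have "m div 2 = n div 2" "m mod 2 = n mod 2"
      by (auto simp: parity_cases) presburger
    then show ?thesis
      by (metis div_mult_mod_eq)
  qed
qed

lemma item_enc_comp:
  assumes "item_enc f" "inj g"
  shows "item_enc (\<lambda>x. f (g x))"
  using assms unfolding item_enc_def inj_def by blast

lemma item_enc_nat: "item_enc enc_nat"
  using item_enc_comp[OF item_enc_list[OF item_enc_bit], of nat_bits] nat_bits_inj
  by (simp add: enc_nat_def[abs_def] inj_def)

lemma item_enc_int: "item_enc enc_int"
  unfolding enc_int_def[abs_def]
  by (rule item_enc_parenI)
     (auto simp: item_encD[OF item_enc_bit] item_encD[OF item_enc_nat] split: if_splits)

lemma enc_pair_eq_iff: "enc_pair x u = enc_pair y v \<longleftrightarrow> x = y \<and> u = v"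
  by (auto simp: enc_pair_def enc_paren_def item_encD[OF item_enc_list[OF item_enc_bit]]
      item_enc_eq_iff[OF item_enc_list[OF item_enc_bit]])


subsection \<open>NP and coNP\<close>

definition class_NP :: "language set" where
  "class_NP = {L. \<exists>R \<in> class_P. \<exists>p :: nat poly. \<forall>x.
     x \<in> L \<longleftrightarrow> (\<exists>u. length u \<le> poly p (length x) \<and> enc_pair x u \<in> R)}"

definition class_coNP :: "language set" where
  "class_coNP = {L. - L \<in> class_NP}"

definition polytime_reducible :: "language \<Rightarrow> language \<Rightarrow> bool" where
  "polytime_reducible A B \<longleftrightarrow> (\<exists>f. polytime_computable f \<and> (\<forall>x. x \<in> A \<longleftrightarrow> f x \<in> B))"

definition coNP_complete :: "language \<Rightarrow> bool" where
  "coNP_complete L \<longleftrightarrow> L \<in> class_coNP \<and> (\<forall>A \<in> class_coNP. polytime_reducible A L)"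


section \<open>Games\<close>

record ('p, 'v) game =
  players :: "'p set"
  verts :: "'v set"
  part :: "'p \<Rightarrow> 'v set"
  edges :: "('v \<times> 'v) set"
  payoff :: "'p \<Rightarrow> (nat \<Rightarrow> 'v) \<Rightarrow> real"

definition wf_game :: "('p, 'v) game \<Rightarrow> bool" where
  "wf_game G \<longleftrightarrow> finite (players G) \<and> finite (verts G) \<and>
     edges G \<subseteq> verts G \<times> verts G \<and>
     (\<forall>u \<in> verts G. \<exists>v. (u, v) \<in> edges G) \<and>
     (\<Union>i \<in> players G. part G i) = verts G \<and>
     (\<forall>i \<in> players G. \<forall>j \<in> players G. i \<noteq> j \<longrightarrow> part G i \<inter> part G j = {})"

definition is_play :: "('p, 'v) game \<Rightarrow> (nat \<Rightarrow> 'v) \<Rightarrow> bool" where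
  "is_play G \<pi> \<longleftrightarrow> (\<forall>n. \<pi> n \<in> verts G \<and> (\<pi> n, \<pi> (Suc n)) \<in> edges G)"

definition is_history :: "('p, 'v) game \<Rightarrow> 'v \<Rightarrow> 'v list \<Rightarrow> bool" where
  "is_history G v0 h \<longleftrightarrow> h \<noteq> [] \<and> hd h = v0 \<and> set h \<subseteq> verts G \<and>
     successively (\<lambda>u v. (u, v) \<in> edges G) h"

text \<open>The reachability payoff 1/(1+d), where d is the (possibly infinite) hitting time of \<open>T\<close>.\<close>

definition reach_payoff :: "'v set \<Rightarrow> (nat \<Rightarrow> 'v) \<Rightarrow> real" where
  "reach_payoff T \<pi> =
     (case Inf (enat ` {n. \<pi> n \<in> T}) of enat d \<Rightarrow> 1 / (1 + real d) | \<infinity> \<Rightarrow> 0)"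

lemma reach_payoff_eq:
  "reach_payoff T \<pi> = (if \<exists>n. \<pi> n \<in> T then 1 / (1 + real (LEAST n. \<pi> n \<in> T)) else 0)"
proof (cases "\<exists>n. \<pi> n \<in> T")
  case True
  let ?d = "LEAST n. \<pi> n \<in> T"
  have "\<pi> ?d \<in> T"
    using True by (rule LeastI_ex)
  then have "Inf (enat ` {n. \<pi> n \<in> T}) \<le> enat ?d"
    by (intro Inf_lower imageI CollectI)
  moreover have "enat ?d \<le> Inf (enat ` {n. \<pi> n \<in> T})"
  proof (rule Inf_greatest)
    fix x
    assume "x \<in> enat ` {n. \<pi> n \<in> T}"
    then obtain n where "x = enat n" "\<pi> n \<in> T"
      by blast
    then show "enat ?d \<le> x"
      using Least_le[of "\<lambda>n. \<pi> n \<in> T" n] by simp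
  qed
  ultimately have "Inf (enat ` {n. \<pi> n \<in> T}) = enat ?d"
    by (rule antisym)
  with True show ?thesis by (simp add: reach_payoff_def)
next
  case False
  then show ?thesis by (simp add: reach_payoff_def top_enat_def)
qed

definition quantitative_reachability_game :: "('p, 'v) game \<Rightarrow> bool" where
  "quantitative_reachability_game G \<longleftrightarrow> wf_game G \<and>
     (\<exists>T. \<forall>i \<in> players G. T i \<subseteq> verts G \<and> (\<forall>\<pi>. is_play G \<pi> \<longrightarrow> payoff G i \<pi> = reach_payoff (T i) \<pi>))"


subsection \<open>Strategies and equilibria\<close>

text \<open>A strategy is only constrained on the histories that end in a vertex of its player.\<close>

definition is_strategy :: "('p, 'v) game \<Rightarrow> 'v \<Rightarrow> 'p \<Rightarrow> ('v list \<Rightarrow> 'v) \<Rightarrow> bool" where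
  "is_strategy G v0 i s \<longleftrightarrow>
     (\<forall>h. is_history G v0 h \<and> last h \<in> part G i \<longrightarrow> (last h, s h) \<in> edges G)"

definition is_profile :: "('p, 'v) game \<Rightarrow> 'v \<Rightarrow> ('p \<Rightarrow> 'v list \<Rightarrow> 'v) \<Rightarrow> bool" where
  "is_profile G v0 \<sigma> \<longleftrightarrow> (\<forall>i \<in> players G. is_strategy G v0 i (\<sigma> i))"

definition compatible_play ::
    "('p, 'v) game \<Rightarrow> 'v \<Rightarrow> ('p \<Rightarrow> 'v list \<Rightarrow> 'v) \<Rightarrow> (nat \<Rightarrow> 'v) \<Rightarrow> bool" where
  "compatible_play G v0 \<sigma> \<pi> \<longleftrightarrow> is_play G \<pi> \<and> \<pi> 0 = v0 \<and>
     (\<forall>i \<in> players G. \<forall>n. \<pi> n \<in> part G i \<longrightarrow> \<pi> (Suc n) = \<sigma> i (map \<pi> [0..<Suc n]))"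

definition outcome :: "('p, 'v) game \<Rightarrow> 'v \<Rightarrow> ('p \<Rightarrow> 'v list \<Rightarrow> 'v) \<Rightarrow> nat \<Rightarrow> 'v" where
  "outcome G v0 \<sigma> = (THE \<pi>. compatible_play G v0 \<sigma> \<pi>)"

text \<open>The play in \<open>outcome\<close> exists and is unique.\<close>

lemma ex1_compatible_play:
  assumes G: "wf_game G" and v0: "v0 \<in> verts G" and \<sigma>: "is_profile G v0 \<sigma>"
  shows "\<exists>!\<pi>. compatible_play G v0 \<sigma> \<pi>"
proof -
  define own where "own v = (SOME i. i \<in> players G \<and> v \<in> part G i)" for v
  have own: "own v \<in> players G \<and> v \<in> part G (own v)" if "v \<in> verts G" for v
    unfolding own_def by (rule someI_ex) (use that G in \<open>auto simp: wf_game_def\<close>)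
  have own_eq: "i = own v" if "i \<in> players G" "v \<in> part G i" for i v
  proof -
    have "v \<in> verts G" using that G by (auto simp: wf_game_def)
    from own[OF this] that G show ?thesis unfolding wf_game_def by blast
  qed
  define H where "H n = ((\<lambda>h. h @ [\<sigma> (own (last h)) h]) ^^ n) [v0]" for n
  define \<pi> where "\<pi> n = last (H n)" for n
  have H0: "H 0 = [v0]" and HSuc: "H (Suc n) = H n @ [\<sigma> (own (last (H n))) (H n)]" for n
    by (simp_all add: H_def)
  have \<pi>0: "\<pi> 0 = v0" by (simp add: \<pi>_def H0)
  have \<pi>Suc: "\<pi> (Suc n) = \<sigma> (own (\<pi> n)) (H n)" for n by (simp add: \<pi>_def HSuc)
  have H: "H n = map \<pi> [0..<Suc n]" for n
  proof (induction n)
    case (Suc n)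
    then show ?case by (simp add: HSuc \<pi>Suc \<pi>_def)
  qed (simp add: H0 \<pi>0)
  have hist: "is_history G v0 (H n)" for n
  proof (induction n)
    case 0
    then show ?case using v0 by (simp add: is_history_def H0)
  next
    case (Suc n)
    then have ne: "H n \<noteq> []" "last (H n) \<in> verts G"
      by (auto simp: is_history_def)
    then have "(last (H n), \<sigma> (own (last (H n))) (H n)) \<in> edges G"
      using own[OF ne(2)] \<sigma> Suc by (auto simp: is_profile_def is_strategy_def)
    then show ?case
      using Suc G by (auto simp: HSuc is_history_def successively_append_iff wf_game_def)
  qed
  have V: "\<pi> n \<in> verts G" for n
    using hist[of n] by (auto simp: is_history_def \<pi>_def)
  have comp: "compatible_play G v0 \<sigma> \<pi>"
    unfolding compatible_play_def is_play_def
  proof (intro conjI allI ballI impI)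
    show "(\<pi> n, \<pi> (Suc n)) \<in> edges G" for n
    proof -
      have "(last (H n), \<sigma> (own (\<pi> n)) (H n)) \<in> edges G"
        using own[OF V[of n]] \<sigma> hist[of n]
        unfolding \<pi>_def is_profile_def is_strategy_def by blast
      then show ?thesis
        unfolding \<pi>Suc by (simp add: \<pi>_def)
    qed
    show "\<pi> (Suc n) = \<sigma> i (map \<pi> [0..<Suc n])" if "i \<in> players G" "\<pi> n \<in> part G i" for i n
      using own_eq[OF that] by (simp add: \<pi>Suc H del: upt_Suc)
  qed (use V \<pi>0 in auto)
  have "\<rho> n = \<pi> n" if \<rho>: "compatible_play G v0 \<sigma> \<rho>" for \<rho> n
  proof (induction n rule: less_induct)
    case (less n)
    show ?case
    proof (cases n)
      case 0
      then show ?thesis using \<rho> \<pi>0 by (simp add: compatible_play_def)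
    next
      case (Suc m)
      then have eq: "map \<rho> [0..<Suc m] = map \<pi> [0..<Suc m]" "\<rho> m = \<pi> m"
        using less by auto
      have "own (\<rho> m) \<in> players G" "\<rho> m \<in> part G (own (\<rho> m))"
        using own[OF V[of m]] eq(2) by simp_all
      then have "\<rho> (Suc m) = \<sigma> (own (\<rho> m)) (map \<rho> [0..<Suc m])"
        using \<rho> unfolding compatible_play_def by blast
      then have "\<rho> (Suc m) = \<sigma> (own (\<pi> m)) (map \<pi> [0..<Suc m])"
        unfolding eq .
      then show ?thesis by (simp add: Suc \<pi>Suc H del: upt_Suc)
    qed
  qed
  then have "\<rho> = \<pi>" if "compatible_play G v0 \<sigma> \<rho>" for \<rho>
    using that by (intro ext)
  with comp show ?thesis by (rule ex1I)
qed

definition fixed_NE ::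
    "('p, 'v) game \<Rightarrow> 'v \<Rightarrow> 'p \<Rightarrow> ('p \<Rightarrow> 'v list \<Rightarrow> 'v) \<Rightarrow> bool" where
  "fixed_NE G v0 L \<sigma> \<longleftrightarrow> is_profile G v0 \<sigma> \<and>
     (\<forall>i \<in> players G - {L}. \<forall>s. is_strategy G v0 i s \<longrightarrow>
        payoff G i (outcome G v0 (\<sigma>(i := s))) \<le> payoff G i (outcome G v0 \<sigma>))"


subsection \<open>Mealy machines\<close>

text \<open>
  \<open>Read p u q\<close> is the transition (p,u,q), \<open>Act p u q v\<close> is the transition (p,u,q,v).
\<close>

datatype ('q, 'v) trans = Read 'q 'v 'q | Act 'q 'v 'q 'v

fun trans_key :: "('q, 'v) trans \<Rightarrow> 'q \<times> 'v" where
  "trans_key (Read p u q) = (p, u)"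
| "trans_key (Act p u q v) = (p, u)"

record ('q, 'v) mealy =
  mealy_states :: "'q set"
  mealy_init :: 'q
  mealy_trans :: "('q, 'v) trans set"

definition wf_mealy :: "('p, 'v) game \<Rightarrow> 'p \<Rightarrow> ('q, 'v) mealy \<Rightarrow> bool" where
  "wf_mealy G L M \<longleftrightarrow> finite (mealy_states M) \<and> mealy_init M \<in> mealy_states M \<and>
     mealy_trans M \<subseteq>
       {Read p u q | p u q. p \<in> mealy_states M \<and> u \<in> verts G - part G L \<and> q \<in> mealy_states M} \<union>
       {Act p u q v | p u q v. p \<in> mealy_states M \<and> u \<in> part G L \<and> q \<in> mealy_states M \<and>
          v \<in> verts G \<and> (u, v) \<in> edges G} \<and>
     (\<forall>p \<in> mealy_states M. \<forall>u \<in> verts G. \<exists>\<tau> \<in> mealy_trans M. trans_key \<tau> = (p, u))"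

definition deterministic_mealy :: "('p, 'v) game \<Rightarrow> ('q, 'v) mealy \<Rightarrow> bool" where
  "deterministic_mealy G M \<longleftrightarrow>
     (\<forall>p \<in> mealy_states M. \<forall>u \<in> verts G. \<exists>!\<tau>. \<tau> \<in> mealy_trans M \<and> trans_key \<tau> = (p, u))"

definition Comp :: "('p, 'v) game \<Rightarrow> 'v \<Rightarrow> 'p \<Rightarrow> ('q, 'v) mealy \<Rightarrow> ('v list \<Rightarrow> 'v) set" where
  "Comp G v0 L M = {s. is_strategy G v0 L s \<and>
     (\<exists>st. st [] = mealy_init M \<and>
       (\<forall>h v. is_history G v0 (h @ [v]) \<longrightarrow>
          (if v \<in> part G L
           then Act (st h) v (st (h @ [v])) (s (h @ [v])) \<in> mealy_trans M
           else Read (st h) v (st (h @ [v])) \<in> mealy_trans M)))}"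

definition rational_verification ::
    "('p, 'v) game \<Rightarrow> 'v \<Rightarrow> 'p \<Rightarrow> ('q, 'v) mealy \<Rightarrow> rat \<Rightarrow> bool" where
  "rational_verification G v0 L M t \<longleftrightarrow>
     (\<forall>\<sigma>. fixed_NE G v0 L \<sigma> \<and> \<sigma> L \<in> Comp G v0 L M \<longrightarrow>
        payoff G L (outcome G v0 \<sigma>) > real_of_rat t)"


section \<open>The decision problems\<close>

text \<open>
  Up to renaming, vertices, players and machine states are initial segments of the natural numbers.
  A game is presented by the list \<open>inst_owner\<close>, which maps each vertex to the player controlling
  it, the list \<open>inst_targets\<close>, which maps each player to (a list of) its target set, and the list
  of edges. The threshold is the fraction \<open>inst_num\<close> / \<open>inst_den\<close>, not necessarily reduced.
\<close>

record inst =
  inst_owner :: "nat list"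
  inst_targets :: "nat list list"
  inst_edges :: "(nat \<times> nat) list"
  inst_start :: nat
  inst_leader :: nat
  inst_num :: int
  inst_den :: nat
  inst_states :: nat
  inst_init :: nat
  inst_read :: "(nat \<times> nat \<times> nat) list"
  inst_act :: "(nat \<times> nat \<times> nat \<times> nat) list"

definition inst_game :: "inst \<Rightarrow> (nat, nat) game" where
  "inst_game I =
     \<lparr> players = {..<length (inst_targets I)},
       verts = {..<length (inst_owner I)},
       part = (\<lambda>i. {v. v < length (inst_owner I) \<and> inst_owner I ! v = i}),
       edges = set (inst_edges I),
       payoff = (\<lambda>i. reach_payoff (set (inst_targets I ! i))) \<rparr>"

definition inst_mealy :: "inst \<Rightarrow> (nat, nat) mealy" where
  "inst_mealy I =
     \<lparr> mealy_states = {..<inst_states I},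
       mealy_init = inst_init I,
       mealy_trans = {Read p u q | p u q. (p, u, q) \<in> set (inst_read I)} \<union>
                     {Act p u q v | p u q v. (p, u, q, v) \<in> set (inst_act I)} \<rparr>"

definition inst_threshold :: "inst \<Rightarrow> rat" where
  "inst_threshold I = of_int (inst_num I) / of_nat (inst_den I)"

definition valid_inst :: "inst \<Rightarrow> bool" where
  "valid_inst I \<longleftrightarrow> quantitative_reachability_game (inst_game I) \<and>
     (\<forall>T \<in> set (inst_targets I). set T \<subseteq> verts (inst_game I)) \<and>
     inst_start I \<in> verts (inst_game I) \<and>
     inst_leader I \<in> players (inst_game I) \<and>
     inst_den I > 0 \<and>
     wf_mealy (inst_game I) (inst_leader I) (inst_mealy I)"

definition inst_rational_verification :: "inst \<Rightarrow> bool" where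
  "inst_rational_verification I \<longleftrightarrow>
     rational_verification (inst_game I) (inst_start I) (inst_leader I) (inst_mealy I)
       (inst_threshold I)"

definition encode_inst :: "inst \<Rightarrow> bool list" where
  "encode_inst I = enc_paren
     [ enc_list enc_nat (inst_owner I),
       enc_list (enc_list enc_nat) (inst_targets I),
       enc_list (\<lambda>(u, v). enc_list enc_nat [u, v]) (inst_edges I),
       enc_nat (inst_start I),
       enc_nat (inst_leader I),
       enc_int (inst_num I),
       enc_nat (inst_den I),
       enc_nat (inst_states I),
       enc_nat (inst_init I),
       enc_list (\<lambda>(p, u, q). enc_list enc_nat [p, u, q]) (inst_read I),
       enc_list (\<lambda>(p, u, q, v). enc_list enc_nat [p, u, q, v]) (inst_act I) ]"

lemma inj_encode_inst: "inj encode_inst"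
proof (rule injI)
  fix I J :: inst
  have e: "enc_list enc_nat u @ r = enc_list enc_nat v @ s \<longleftrightarrow> u = v \<and> r = s" for u v r s
    by (rule item_encD) (intro item_enc_list item_enc_nat)
  have i2: "item_enc (\<lambda>(u, v). enc_list enc_nat [u, v])"
    using item_enc_comp[OF item_enc_list[OF item_enc_nat], of "\<lambda>(u, v). [u, v]"]
    by (simp add: inj_def split_def prod_eq_iff)
  have i3: "item_enc (\<lambda>(p, u, q). enc_list enc_nat [p, u, q])"
    using item_enc_comp[OF item_enc_list[OF item_enc_nat], of "\<lambda>(p, u, q). [p, u, q]"]
    by (simp add: inj_def split_def prod_eq_iff)
  have i4: "item_enc (\<lambda>(p, u, q, v). enc_list enc_nat [p, u, q, v])"
    using item_enc_comp[OF item_enc_list[OF item_enc_nat], of "\<lambda>(p, u, q, v). [p, u, q, v]"]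
    by (simp add: inj_def split_def prod_eq_iff)
  note iffs = e item_encD[OF item_enc_nat] item_encD[OF item_enc_int]
    item_encD[OF item_enc_list[OF item_enc_list[OF item_enc_nat]]]
    item_encD[OF item_enc_list[OF i2]] item_encD[OF item_enc_list[OF i3]]
    item_encD[OF item_enc_list[OF i4]]
  assume "encode_inst I = encode_inst J"
  then show "I = J"
    unfolding encode_inst_def enc_paren_def concat.simps append_assoc append_Cons append_Nil list.inject
      iffs
    by (cases I, cases J) simp
qed

definition nash_rational_verification :: language where
  "nash_rational_verification =
     {encode_inst I | I. valid_inst I \<and> inst_rational_verification I}"

definition det_nash_rational_verification :: language where
  "det_nash_rational_verification =
     {encode_inst I | I. valid_inst I \<and> deterministic_mealy (inst_game I) (inst_mealy I) \<and>
        inst_rational_verification I}"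

end

theory Submission
  imports Defs "HOL-Library.More_List"
begin

text \<open>
  Leader can be held to a payoff of at most \<open>t\<close> iff the product of game and Mealy machine has a path
  on which no other player can profitably deviate. Whether a player who leaves the path can still
  reach the target in time is a reachability game against a coalition of all others, which also
  resolves the nondeterminism of the machine, and its attractor is computed in polynomial time.
  At most one first visit per player matters, so cycles can be cut out between these visits and the
  path can be taken to be a lasso of polynomial length: the complement is in NP.

  For hardness, the accepting computations of an NP verifier are the solutions of a constraint
  satisfaction problem of polynomial size. One player writes down an assignment, and then every
  clause is a player who controls one vertex and may end the play at a vertex that is in the target
  of Leader. A clause can only gain by that if none of its literals was visited, so Leader gets
  nothing in some equilibrium iff the clauses are satisfiable. Leader controls no vertex, so the
  machine can be trivial, and in particular deterministic.

  Polynomial time is handled through a class of functions on binary trees that is closed under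
  the usual programming constructs, and whose programs are compiled to Turing machines.
\<close>

section \<open>Structured tape programs\<close>

text \<open>Payoffs depend on when a target is reached, so a deviation is judged by its deadline:
  \<open>win\<close> carries a number of steps, and the punishing coalition needs one move that is
  good for every deadline at once. Deadlines beyond the number of product states add nothing,
  because the attractor is stable by then; this makes the certificates finite and short. Vertices,
  players and machine states are written in binary, but in a valid instance each of them is bounded
  by the lengths of lists. So the arithmetic can be unary, except for the threshold: there one
  binary numeral is compared with a small multiple of another, bit by bit. Languages consist of all
  words, so the verifier has to parse exactly: whatever is not the code of a valid instance belongs
  to the complement and must be accepted. In the reduction, time, tape width and certificate length
  are polynomials in the input, while the alphabet, the number of tapes and the local constraints
  depend only on the machine that is simulated. They are constants of the program that computes the
  reduction.\<close>

datatype com =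
    Prim nat "nat \<Rightarrow> nat \<times> move"
  | Seq com com
  | Branch nat "nat set" com com
  | Loop nat "nat set" com

text \<open>Control only: the result is the rest of the program and at most one tape action, given
  the scanned symbols. This is the shape of a transition function whose states are lists of pending
  commands.\<close>

fun com_next :: "com list \<Rightarrow> (nat \<Rightarrow> nat) \<Rightarrow> (com list \<times> (nat \<times> nat \<times> move) option) option" where
  "com_next [] r = None"
| "com_next (Prim j a # C) r = Some (C, Some (j, a (r j)))"
| "com_next (Seq c d # C) r = Some (c # d # C, None)"
| "com_next (Branch j S c d # C) r = Some ((if r j \<in> S then c else d) # C, None)"
| "com_next (Loop j S c # C) r = Some (if r j \<in> S then c # Loop j S c # C else C, None)"

fun com_step :: "com list \<times> (nat \<Rightarrow> tape) \<Rightarrow> (com list \<times> (nat \<Rightarrow> tape)) option" where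
  "com_step (C, \<tau>) = (case com_next C (\<lambda>j. tape_read (\<tau> j)) of
      None \<Rightarrow> None
    | Some (C', None) \<Rightarrow> Some (C', \<tau>)
    | Some (C', Some (j, act)) \<Rightarrow> Some (C', \<tau>(j := tape_act (\<tau> j) act)))"

text \<open>The pending commands \<open>C\<close> are arbitrary, so runs of consecutive commands can
  be chained.\<close>

definition runs :: "com \<Rightarrow> (nat \<Rightarrow> tape) \<Rightarrow> nat \<Rightarrow> (nat \<Rightarrow> tape) \<Rightarrow> bool" where
  "runs c \<tau> n \<tau>' \<longleftrightarrow> (\<forall>C. ((c # C, \<tau>), (C, \<tau>')) \<in> {(x, y). com_step x = Some y} ^^ n)"

lemma runs_step:
  assumes "\<And>C. com_step (c # C, \<tau>) = Some (C, \<tau>')"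
  shows "runs c \<tau> 1 \<tau>'"
  using assms by (simp add: runs_def)

lemma relpow_step:
  assumes "com_step x = Some y" "(y, z) \<in> {(x, y). com_step x = Some y} ^^ n"
  shows "(x, z) \<in> {(x, y). com_step x = Some y} ^^ Suc n"
  using assms by (intro relpow_Suc_I2[of x y]) auto

lemma runs_Seq:
  assumes "runs c \<tau> m \<tau>1" "runs d \<tau>1 n \<tau>2"
  shows "runs (Seq c d) \<tau> (Suc (m + n)) \<tau>2"
  unfolding runs_def
proof
  fix C
  have "((c # d # C, \<tau>), (C, \<tau>2)) \<in> {(x, y). com_step x = Some y} ^^ (m + n)"
    using assms unfolding runs_def relpow_add by blast
  then show "((Seq c d # C, \<tau>), (C, \<tau>2)) \<in> {(x, y). com_step x = Some y} ^^ Suc (m + n)"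
    by (rule relpow_step[rotated]) simp
qed

lemma runs_Branch:
  assumes "runs (if tape_read (\<tau> j) \<in> S then c else d) \<tau> n \<tau>'"
  shows "runs (Branch j S c d) \<tau> (Suc n) \<tau>'"
  using assms unfolding runs_def by (auto intro!: relpow_step simp del: relpow.simps)

lemma runs_Loop_end:
  assumes "tape_read (\<tau> j) \<notin> S"
  shows "runs (Loop j S c) \<tau> 1 \<tau>"
  using assms by (intro runs_step) simp

lemma runs_Loop_step:
  assumes "tape_read (\<tau> j) \<in> S" "runs c \<tau> m \<tau>1" "runs (Loop j S c) \<tau>1 n \<tau>2"
  shows "runs (Loop j S c) \<tau> (Suc (m + n)) \<tau>2"
  unfolding runs_def
proof
  fix C
  have "((c # Loop j S c # C, \<tau>), (C, \<tau>2)) \<in> {(x, y). com_step x = Some y} ^^ (m + n)"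
    using assms(2,3) unfolding runs_def relpow_add by blast
  then show "((Loop j S c # C, \<tau>), (C, \<tau>2)) \<in> {(x, y). com_step x = Some y} ^^ Suc (m + n)"
    by (rule relpow_step[rotated]) (simp add: assms(1))
qed

fun wf_com :: "nat \<Rightarrow> com \<Rightarrow> bool" where
  "wf_com K (Prim j a) \<longleftrightarrow> j < K \<and> (\<forall>s < 3. fst (a s) < 3)"
| "wf_com K (Seq c d) \<longleftrightarrow> wf_com K c \<and> wf_com K d"
| "wf_com K (Branch j S c d) \<longleftrightarrow> j < K \<and> wf_com K c \<and> wf_com K d"
| "wf_com K (Loop j S c) \<longleftrightarrow> j < K \<and> wf_com K c"

lemma wf_com_mono: "wf_com K c \<Longrightarrow> K \<le> K' \<Longrightarrow> wf_com K' c"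
  by (induction c) auto

text \<open>The control states of the machine for \<open>c\<close> are the continuations that can arise.\<close>

fun conts :: "com \<Rightarrow> com list \<Rightarrow> com list set" where
  "conts (Prim j a) C = {Prim j a # C, C}"
| "conts (Seq c d) C = {Seq c d # C} \<union> conts c (d # C) \<union> conts d C"
| "conts (Branch j S c d) C = {Branch j S c d # C} \<union> conts c C \<union> conts d C"
| "conts (Loop j S c) C = {Loop j S c # C, C} \<union> conts c (Loop j S c # C)"

lemma finite_conts: "finite (conts c C)"
  by (induction c arbitrary: C) auto

lemma conts_start: "c # C \<in> conts c C"
  by (cases c) auto

lemma conts_end: "C \<in> conts c C"
  by (induction c arbitrary: C) auto

text \<open>The continuation \<open>C\<close> itself is excluded, since its next step already
  belongs to what follows \<open>c\<close>.\<close>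

lemma conts_closed:
  "D \<in> conts c C \<Longrightarrow> D \<noteq> C \<Longrightarrow> com_next D r = Some (D', a) \<Longrightarrow> D' \<in> conts c C"
proof (induction c arbitrary: C D)
  case (Seq c d)
  then show ?case
    using conts_start[of c "d # C"] conts_start[of d C] by auto
next
  case (Branch j S c d)
  then show ?case
    using conts_start[of c C] conts_start[of d C] by (auto split: if_splits)
next
  case (Loop j S c)
  show ?case
  proof (cases "D = Loop j S c # C")
    case True
    then show ?thesis
      using Loop.prems conts_start[of c "Loop j S c # C"] by (auto split: if_splits)
  next
    case False
    then show ?thesis
      using Loop by auto
  qed
qed auto

lemma conts_wf: "D \<in> conts c C \<Longrightarrow> wf_com K c \<Longrightarrow> list_all (wf_com K) C \<Longrightarrow> list_all (wf_com K) D"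
proof (induction c arbitrary: C D)
  case (Seq c d)
  then show ?case by auto
next
  case (Loop j S c)
  then have "D = Loop j S c # C \<or> D = C \<or> D \<in> conts c (Loop j S c # C)" by simp
  then show ?case using Loop by fastforce
qed auto

section \<open>Compilation to Turing machines\<close>

text \<open>The base is at least 2, so that constants are absorbed by the exponent and a sum of two
  bounds costs only further factors of the base.\<close>

definition polybd :: "('a \<Rightarrow> nat) \<Rightarrow> ('a \<Rightarrow> nat) \<Rightarrow> bool" where
  "polybd m g \<longleftrightarrow> (\<exists>d. \<forall>x. g x \<le> (m x + 2) ^ d)"

lemma polybd_mono: "polybd m g \<Longrightarrow> (\<And>x. h x \<le> g x) \<Longrightarrow> polybd m h"
  unfolding polybd_def by (meson order_trans)

lemma polybd_const: "polybd m (\<lambda>x. c)"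
proof -
  have "c \<le> (k + 2) ^ c" for k :: nat
  proof -
    have "c \<le> 2 ^ c" by (simp add: less_imp_le)
    also have "\<dots> \<le> (k + 2) ^ c" by (intro power_mono) auto
    finally show ?thesis .
  qed
  then show ?thesis unfolding polybd_def by blast
qed

lemma polybd_self: "polybd m m"
  unfolding polybd_def by (rule exI[of _ 1]) simp

lemma polybd_mult: "polybd m g \<Longrightarrow> polybd m h \<Longrightarrow> polybd m (\<lambda>x. g x * h x)"
proof -
  assume "polybd m g" "polybd m h"
  then obtain a b where "\<And>x. g x \<le> (m x + 2) ^ a" "\<And>x. h x \<le> (m x + 2) ^ b"
    unfolding polybd_def by blast
  then have "g x * h x \<le> (m x + 2) ^ (a + b)" for x
    unfolding power_add by (intro mult_mono) auto
  then show ?thesis unfolding polybd_def by blast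
qed

lemma polybd_add: "polybd m g \<Longrightarrow> polybd m h \<Longrightarrow> polybd m (\<lambda>x. g x + h x)"
proof -
  assume "polybd m g" "polybd m h"
  then have "polybd m (\<lambda>x. (g x + 1) * (h x + 1))" if "polybd m (\<lambda>x. g x + 1)" "polybd m (\<lambda>x. h x + 1)"
    using polybd_mult that by blast
  moreover have "polybd m (\<lambda>x. f x + 1)" if f: "polybd m f" for f
  proof -
    from f obtain a where a: "\<And>x. f x \<le> (m x + 2) ^ a"
      unfolding polybd_def by blast
    have "f x + 1 \<le> (m x + 2) ^ (a + 1)" for x
    proof -
      have "1 \<le> (m x + 2) ^ a" by simp
      then have "f x + 1 \<le> (m x + 2) ^ a * 2" using a[of x] by linarith
      also have "\<dots> \<le> (m x + 2) ^ a * (m x + 2)" by simp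
      finally show ?thesis by (simp add: mult.commute)
    qed
    then show ?thesis unfolding polybd_def by blast
  qed
  ultimately show ?thesis
    using \<open>polybd m g\<close> \<open>polybd m h\<close> by (auto intro: polybd_mono)
qed

lemma polybd_power: "polybd m g \<Longrightarrow> polybd m (\<lambda>x. g x ^ k)"
  by (induction k) (auto intro: polybd_const polybd_mult)

lemma polybd_comp:
  assumes "polybd m' g" "polybd m (\<lambda>x. m' (f x))"
  shows "polybd m (\<lambda>x. g (f x))"
proof -
  obtain d where "\<And>y. g y \<le> (m' y + 2) ^ d"
    using assms(1) unfolding polybd_def by blast
  moreover have "polybd m (\<lambda>x. (m' (f x) + 2) ^ d)"
    by (intro polybd_power polybd_add assms(2) polybd_const)
  ultimately show ?thesis by (rule polybd_mono[rotated])
qed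

lemmas polybd_intros = polybd_const polybd_self polybd_add polybd_mult polybd_power

lemma polybd_Suc: "polybd m g \<Longrightarrow> polybd m (\<lambda>x. Suc (g x))"
  using polybd_add[OF _ polybd_const[of m 1]] by simp

lemma poly_nat_mono: "m \<le> n \<Longrightarrow> poly (p :: nat poly) m \<le> poly p n"
  by (induction p) (auto intro: add_mono mult_mono)

lemma polybd_length_imp_poly:
  assumes "polybd length g"
  shows "\<exists>p :: nat poly. \<forall>x. g x \<le> poly p (length x)"
proof -
  obtain d where "\<And>x. g x \<le> (length x + 2) ^ d"
    using assms unfolding polybd_def by blast
  then show ?thesis
    by (intro exI[of _ "[:2, 1:] ^ d"]) (simp add: poly_power add.commute)
qed

section \<open>The Turing machine of a structured program\<close>

definition init_tapes :: "bool list \<Rightarrow> nat \<Rightarrow> tape" where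
  "init_tapes x j = (if j = 0 then word_content x else word_content [], 0)"

lemma tape_read_eq: "tape_read t = fst t (snd t)"
  by (cases t) simp

text \<open>The states of the machine are the finitely many continuations of \<open>c\<close>. One
  step of the program is exactly one step of the machine, so the time bound carries over unchanged,
  and the machine halts in the empty continuation.\<close>

lemma polytime_computable_com:
  assumes wf: "wf_com K c" and K: "K \<ge> 1" and bd: "polybd length b"
    and run: "\<And>x. \<exists>n \<le> b x. \<exists>\<tau>. runs c (init_tapes x) n \<tau> \<and> fst (\<tau> (K - 1)) = word_content (f x)"
  shows "polytime_computable f"
proof -
  define S where "S = conts c []"
  \<comment> \<open>An arbitrary numbering of the continuations is composed with the transposition
    that makes \<open>[c]\<close> the initial state 0.\<close>
  have "\<exists>e. bij_betw e S {..<card S} \<and> e [c] = 0"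
  proof -
    obtain g where g: "bij_betw g S {..<card S}"
      using finite_conts ex_bij_betw_finite_nat[of S] by (auto simp: S_def lessThan_atLeast0)
    have c: "[c] \<in> S" by (simp add: S_def conts_start)
    then have "card S > 0" using finite_conts[of c "[]"] by (auto simp: S_def card_gt_0_iff)
    have gc: "g [c] < card S" using g c by (auto simp: bij_betw_def)
    have "bij_betw (transpose (g [c]) 0) {..<card S} {..<card S}"
      if "transpose = (\<lambda>a b x. if x = a then b else if x = b then a else x :: nat)" for transpose
      using gc \<open>card S > 0\<close> by (intro bij_betw_byWitness[where f' = "transpose (g [c]) 0"]) (auto simp: that)
    then have "bij_betw (\<lambda>x. if x = g [c] then 0 else if x = 0 then g [c] else x) {..<card S} {..<card S}"
      by metis
    from bij_betw_trans[OF g this]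
    show ?thesis by (rule_tac x = "(\<lambda>x. if x = g [c] then 0 else if x = 0 then g [c] else x) \<circ> g" in exI) auto
  qed
  then obtain e where e: "bij_betw e S {..<card S}" "e [c] = 0" by blast
  define dec where "dec = inv_into S e"
  have dec: "dec (e D) = D" if "D \<in> S" for D
    using that e(1) by (simp add: dec_def bij_betw_def)
  have decS: "dec q \<in> S" if "q < card S" for q
    using that e(1) unfolding dec_def bij_betw_def by (metis inv_into_into lessThan_iff)
  have eS: "e D < card S" if "D \<in> S" for D
    using that e(1) by (auto simp: bij_betw_def)
  \<comment> \<open>A pure control step has to act on every tape as well: each head writes back what
    it reads and stays.\<close>
  define M where "M = \<lparr>tm_tapes = K, tm_states = card S, tm_symbols = 3,
    tm_delta = (\<lambda>q ss. case com_next (dec q) (\<lambda>j. ss ! j) of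
        None \<Rightarrow> None
      | Some (C', None) \<Rightarrow> Some (e C', map (\<lambda>s. (s, Stay)) ss)
      | Some (C', Some (j, act)) \<Rightarrow> Some (e C', (map (\<lambda>s. (s, Stay)) ss)[j := act]))\<rparr>"
  have closed: "D' \<in> S" if "D \<in> S" "com_next D r = Some (D', a)" for D D' r a
    using conts_closed[of D c "[]" r D' a] that by (cases "D = []") (auto simp: S_def)
  have wfD: "list_all (wf_com K) D" if "D \<in> S" for D
    using conts_wf[of D c "[]" K] that wf by (simp add: S_def)
  have actK: "j < K \<and> fst act < 3"
    if "D \<in> S" "com_next D r = Some (D', Some (j, act))" "\<And>i. i < K \<Longrightarrow> r i < 3" for D D' r j act
    using wfD[OF that(1)] that(2,3) by (induction D r rule: com_next.induct) (auto split: if_splits)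
  have "card S \<ge> 1"
    using eS[of "[c]"] conts_start[of c "[]"] by (simp add: S_def)
  have "wf_tm M"
    unfolding wf_tm_def
  proof (intro conjI allI impI)
    fix q ss assume q: "q < tm_states M" and ss: "length ss = tm_tapes M \<and> set ss \<subseteq> {..<tm_symbols M}"
    have ssj: "ss ! i < 3" if "i < K" for i
      using ss that by (auto simp: M_def subset_iff)
    show "case tm_delta M q ss of None \<Rightarrow> True
         | Some (q', acts) \<Rightarrow> q' < tm_states M \<and> length acts = tm_tapes M \<and>
             (\<forall>(s, d) \<in> set acts. s < tm_symbols M)"
    proof (cases "com_next (dec q) (\<lambda>j. ss ! j)")
      case None
      then show ?thesis by (simp add: M_def)
    next
      case (Some p)
      obtain C' a where p: "p = (C', a)" by (cases p)
      have dq: "dec q \<in> S" using q by (simp add: M_def decS)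
      then have C': "e C' < card S" using closed Some p eS by blast
      show ?thesis
      proof (cases a)
        case None
        then show ?thesis using Some p C' ss ssj by (auto simp: M_def)
      next
        case a: (Some ja)
        obtain j act where ja: "ja = (j, act)" by (cases ja)
        have "j < K" "fst act < 3"
          using actK[OF dq, of "\<lambda>j. ss ! j" C' j act] Some p a ja ssj by auto
        then show ?thesis using Some p a ja C' ss
          by (auto simp: M_def dest!: subsetD[OF set_update_subset_insert])
      qed
    qed
  qed (use K \<open>card S \<ge> 1\<close> in \<open>auto simp: M_def\<close>)
  have mapupd: "map2 tape_act (map \<tau> [0..<K]) (map (\<lambda>s. (s, Stay)) (map tape_read (map \<tau> [0..<K])))
      = map \<tau> [0..<K]" for \<tau> :: "nat \<Rightarrow> tape"
    by (rule nth_equalityI) (auto simp: case_prod_beta simp flip: prod.collapse, metis fun_upd_triv tape_act.simps tape_read.simps move_offset.simps(2) add.right_neutral surj_pair)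
  have mapupd': "map2 tape_act (map \<tau> [0..<K]) ((map (\<lambda>s. (s, Stay)) (map tape_read (map \<tau> [0..<K])))[j := act])
      = map (\<tau>(j := tape_act (\<tau> j) act)) [0..<K]" if "j < K" for \<tau> :: "nat \<Rightarrow> tape" and j act
  proof (rule nth_equalityI)
    fix i assume "i < length (map2 tape_act (map \<tau> [0..<K]) ((map (\<lambda>s. (s, Stay)) (map tape_read (map \<tau> [0..<K])))[j := act]))"
    then have i: "i < K" by simp
    have "tape_act t (tape_read t, Stay) = t" for t
      by (cases t) simp
    then show "map2 tape_act (map \<tau> [0..<K]) ((map (\<lambda>s. (s, Stay)) (map tape_read (map \<tau> [0..<K])))[j := act]) ! i
      = map (\<tau>(j := tape_act (\<tau> j) act)) [0..<K] ! i"
      using i that by (simp add: nth_list_update)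
  qed simp
  define cfg :: "com list \<times> (nat \<Rightarrow> tape) \<Rightarrow> config" where "cfg = (\<lambda>(D, \<tau>). (e D, map \<tau> [0..<K]))"
  have next_r: "com_next D (\<lambda>j. map tape_read (map \<tau> [0..<K]) ! j) = com_next D (\<lambda>j. tape_read (\<tau> j))"
    if "D \<in> S" for D \<tau>
    using wfD[OF that] by (induction D "\<lambda>j. tape_read (\<tau> j)" rule: com_next.induct) auto
  have step: "D' \<in> S \<and> tm_step M (cfg (D, \<tau>)) = Some (cfg (D', \<tau>'))"
    if D: "D \<in> S" and s: "com_step (D, \<tau>) = Some (D', \<tau>')"
      and r: "\<And>i. i < K \<Longrightarrow> tape_read (\<tau> i) < 3" for D \<tau> D' \<tau>'
  proof -
    let ?r = "\<lambda>j. tape_read (\<tau> j)"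
    from s obtain a where n: "com_next D ?r = Some (D', a)"
      by (auto split: option.splits)
    have "a = Some (j, act) \<Longrightarrow> j < K" for j act
      using actK[OF D, of ?r D' j act] n r by auto
    then show ?thesis
      using s n closed[OF D n] next_r[OF D, of \<tau>] mapupd[of \<tau>] mapupd'[of _ \<tau>]
      by (auto simp: M_def cfg_def dec[OF D] simp del: map_map split: option.splits)
  qed
  \<comment> \<open>\<open>wf_com\<close> restricts an action only on symbols below 3, so the
    invariant must cover every cell of the tapes in use and not just those under the heads.\<close>
  define ok where "ok = (\<lambda>(D :: com list, \<tau> :: nat \<Rightarrow> tape). D \<in> S \<and> (\<forall>i < K. \<forall>p. fst (\<tau> i) p < 3))"
  have ok_step: "ok y \<and> tm_step M (cfg x) = Some (cfg y)" if "ok x" "com_step x = Some y" for x y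
  proof -
    obtain D \<tau> D' \<tau>' where xy: "x = (D, \<tau>)" "y = (D', \<tau>')" by (cases x, cases y)
    have rd: "tape_read (\<tau> i) < 3" if "i < K" for i
      using \<open>ok x\<close> that xy by (simp add: ok_def tape_read_eq)
    have D: "D \<in> S" using \<open>ok x\<close> xy by (simp add: ok_def)
    have st: "D' \<in> S \<and> tm_step M (cfg (D, \<tau>)) = Some (cfg (D', \<tau>'))"
        "com_step (D, \<tau>) = Some (D', \<tau>')"
      using step[OF D, of \<tau> D' \<tau>'] rd that(2) unfolding xy by blast+
    have "fst (\<tau>' i) p < 3" if i: "i < K" for i p
    proof -
      have old: "fst (\<tau> i) p < 3" using \<open>ok x\<close> i xy by (simp add: ok_def)
      from st(2) obtain a where n: "com_next D (\<lambda>j. tape_read (\<tau> j)) = Some (D', a)"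
        by (auto split: option.splits)
      show ?thesis
      proof (cases a)
        case None
        then show ?thesis using old st(2) n by auto
      next
        case (Some ja)
        obtain j s m where ja: "ja = (j, (s, m))" by (cases ja) auto
        have "s < 3" using actK[OF D n[unfolded Some ja]] rd by simp
        then show ?thesis using old st(2) n Some ja by (cases "\<tau> j") (auto split: if_splits)
      qed
    qed
    then show ?thesis using st xy by (auto simp: ok_def)
  qed
  have sim: "ok y \<and> (cfg x, cfg y) \<in> {(c, c'). tm_step M c = Some c'} ^^ n"
    if "ok x" "(x, y) \<in> {(x, y). com_step x = Some y} ^^ n" for x y n
    using that(2)
  proof (induction n arbitrary: y)
    case 0
    then show ?case using that(1) by simp
  next
    case (Suc n)
    then obtain z where z: "(x, z) \<in> {(x, y). com_step x = Some y} ^^ n" "com_step z = Some y"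
      by auto
    then show ?case using Suc.IH[OF z(1)] ok_step[of z y] by auto
  qed
  obtain p :: "nat poly" where p: "\<And>x. b x \<le> poly p (length x)"
    using polybd_length_imp_poly[OF bd] by blast
  have "tm_computes_within M x (f x) (poly p (length x))" for x
  proof -
    obtain n \<tau> where n: "n \<le> b x" and r: "runs c (init_tapes x) n \<tau>"
      and out: "fst (\<tau> (K - 1)) = word_content (f x)"
      using run by blast
    have cS: "[c] \<in> S" by (simp add: S_def conts_start)
    have "ok ([c], init_tapes x)"
      using cS by (auto simp: ok_def init_tapes_def word_content_def)
    from sim[OF this] r have s: "(cfg ([c], init_tapes x), cfg ([], \<tau>)) \<in> {(c, c'). tm_step M c = Some c'} ^^ n"
      unfolding runs_def by blast
    have i: "cfg ([c], init_tapes x) = tm_init M x"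
    proof -
      have "[0..<K] = 0 # [1..<K]" using K by (simp add: upt_conv_Cons)
      moreover have "map (init_tapes x) [1..<K] = replicate (K - 1) (word_content [], 0)"
        by (rule nth_equalityI) (auto simp: init_tapes_def)
      ultimately show ?thesis
        using K by (simp add: cfg_def tm_init_def M_def e(2) init_tapes_def)
    qed
    have "[] \<in> S" by (simp add: S_def conts_end)
    then have "tm_step M (cfg ([], \<tau>)) = None"
      by (simp add: cfg_def M_def dec)
    moreover have "fst (last (snd (cfg ([], \<tau>)))) = word_content (f x)"
      using K out by (simp add: cfg_def last_map last_upt)
    ultimately show ?thesis
      using s n p[of x] unfolding tm_computes_within_def i by (meson order_trans)
  qed
  with \<open>wf_tm M\<close> show ?thesis unfolding polytime_computable_def by blast
qed

section \<open>Stack programs\<close>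

text \<open>A tape that holds a stack: its top is under the head, its bottom ends before the cell \<open>e\<close>.\<close>

definition stape :: "int \<Rightarrow> bool list \<Rightarrow> tape" where
  "stape e xs = ((\<lambda>i. word_content xs (i - (e - int (length xs)))), e - int (length xs))"

definition top_symbol :: "bool list \<Rightarrow> nat" where
  "top_symbol xs = (case xs of [] \<Rightarrow> 0 | b # _ \<Rightarrow> if b then 2 else 1)"

lemma top_symbol_simps [simp]:
  "top_symbol [] = 0" "top_symbol (True # xs) = 2" "top_symbol (False # xs) = 1"
  by (simp_all add: top_symbol_def)

lemma word_content_Cons:
  "word_content (b # xs) i = (if i = 0 then if b then 2 else 1 else word_content xs (i - 1))"
  by (auto simp: word_content_def nth_Cons' nat_diff_distrib)

lemma tape_read_stape [simp]: "tape_read (stape e xs) = top_symbol xs"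
  by (auto simp: stape_def word_content_def top_symbol_def split: list.split)

text \<open>Stacks grow to the left: the head leaves the old top intact and writes on the next cell.
  \<open>Pop\<close> blanks the cell that it leaves, so that a tape is determined by its stack and
  the position of the bottom.\<close>

definition Push :: "nat \<Rightarrow> bool \<Rightarrow> com" where
  "Push j b = Seq (Prim j (\<lambda>s. (s, Move_Left))) (Prim j (\<lambda>_. (if b then 2 else 1, Stay)))"

definition Pop :: "nat \<Rightarrow> com" where
  "Pop j = Prim j (\<lambda>_. (0, Move_Right))"

lemma wf_Push [simp]: "wf_com K (Push j b) \<longleftrightarrow> j < K"
  by (auto simp: Push_def)

lemma wf_Pop [simp]: "wf_com K (Pop j) \<longleftrightarrow> j < K"
  by (auto simp: Pop_def)

lemma runs_Prim: "runs (Prim j a) \<tau> 1 (\<tau>(j := tape_act (\<tau> j) (a (tape_read (\<tau> j)))))"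
  by (rule runs_step) simp

lemma runs_Push: "\<tau> j = stape e xs \<Longrightarrow> runs (Push j b) \<tau> 3 (\<tau>(j := stape e (b # xs)))"
proof -
  assume j: "\<tau> j = stape e xs"
  have "tape_act (tape_act (stape e xs) (top_symbol xs, Move_Left)) (if b then 2 else 1, Stay) = stape e (b # xs)"
    by (auto simp: stape_def fun_eq_iff word_content_Cons algebra_simps)
      (auto simp: top_symbol_def word_content_def split: list.splits)
  then show ?thesis
    using runs_Seq[OF runs_Prim[of j "\<lambda>s. (s, Move_Left)" \<tau>] runs_Prim[of j "\<lambda>_. (if b then 2 else 1, Stay)"]] j
    by (simp add: Push_def numeral_3_eq_3)
qed

lemma runs_Pop: "\<tau> j = stape e (b # xs) \<Longrightarrow> runs (Pop j) \<tau> 1 (\<tau>(j := stape e xs))"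
proof -
  assume j: "\<tau> j = stape e (b # xs)"
  have "tape_act (stape e (b # xs)) (0, Move_Right) = stape e xs"
    by (auto simp: stape_def fun_eq_iff word_content_Cons algebra_simps) (auto simp: word_content_def)
  then show ?thesis
    using runs_Prim[of j "\<lambda>_. (0, Move_Right)" \<tau>] j by (simp add: Pop_def)
qed

text \<open>The bottoms \<open>E\<close> are arbitrary but fixed during the run. The input, with the
  head on its first bit, already is a stack whose bottom is at its length, whereas the empty tapes
  have their bottom at 0.\<close>

definition exec :: "com \<Rightarrow> (nat \<Rightarrow> bool list) \<Rightarrow> nat \<Rightarrow> (nat \<Rightarrow> bool list) \<Rightarrow> bool" where
  "exec c st b st' \<longleftrightarrow> (\<forall>E. \<exists>n \<le> b. runs c (\<lambda>j. stape (E j) (st j)) n (\<lambda>j. stape (E j) (st' j)))"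

lemma exec_weaken: "exec c st b st1 \<Longrightarrow> b \<le> b' \<Longrightarrow> st1 = st2 \<Longrightarrow> exec c st b' st2"
  unfolding exec_def by (meson order_trans)

lemma stape_upd: "(\<lambda>j. stape (E j) ((st(i := xs)) j)) = (\<lambda>j. stape (E j) (st j))(i := stape (E i) xs)"
  by auto

lemma exec_Push: "exec (Push j b) st 3 (st(j := b # st j))"
  unfolding exec_def stape_upd by (intro allI exI[of _ 3] conjI runs_Push) auto

lemma exec_Pop: "st j = b # xs \<Longrightarrow> exec (Pop j) st 1 (st(j := xs))"
  unfolding exec_def stape_upd by (intro allI exI[of _ 1] conjI runs_Pop) auto

lemma exec_Seq: "exec c st a st1 \<Longrightarrow> exec d st1 b st2 \<Longrightarrow> exec (Seq c d) st (a + b + 1) st2"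
  unfolding exec_def
proof
  fix E
  assume "\<forall>E. \<exists>n\<le>a. runs c (\<lambda>j. stape (E j) (st j)) n (\<lambda>j. stape (E j) (st1 j))"
    "\<forall>E. \<exists>n\<le>b. runs d (\<lambda>j. stape (E j) (st1 j)) n (\<lambda>j. stape (E j) (st2 j))"
  then obtain m n where "m \<le> a" "runs c (\<lambda>j. stape (E j) (st j)) m (\<lambda>j. stape (E j) (st1 j))"
    "n \<le> b" "runs d (\<lambda>j. stape (E j) (st1 j)) n (\<lambda>j. stape (E j) (st2 j))"
    by blast
  then show "\<exists>n\<le>a + b + 1. runs (Seq c d) (\<lambda>j. stape (E j) (st j)) n (\<lambda>j. stape (E j) (st2 j))"
    by (intro exI[of _ "Suc (m + n)"]) (auto intro: runs_Seq)
qed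

lemma exec_Branch:
  assumes "exec (if top_symbol (st j) \<in> S then c else d) st b st'"
  shows "exec (Branch j S c d) st (b + 1) st'"
  unfolding exec_def
proof
  fix E
  obtain n where n: "n \<le> b"
    "runs (if top_symbol (st j) \<in> S then c else d) (\<lambda>j. stape (E j) (st j)) n (\<lambda>j. stape (E j) (st' j))"
    using assms unfolding exec_def by blast
  have "runs (Branch j S c d) (\<lambda>j. stape (E j) (st j)) (Suc n) (\<lambda>j. stape (E j) (st' j))"
    using n(2) by (intro runs_Branch) simp
  then show "\<exists>n\<le>b + 1. runs (Branch j S c d) (\<lambda>j. stape (E j) (st j)) n (\<lambda>j. stape (E j) (st' j))"
    using n(1) by (intro exI[of _ "Suc n"]) auto
qed

lemma exec_Loop_end: "top_symbol (st j) \<notin> S \<Longrightarrow> exec (Loop j S c) st 1 st"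
  unfolding exec_def by (intro allI exI[of _ 1] conjI runs_Loop_end) auto

lemma exec_Loop_step:
  assumes "top_symbol (st j) \<in> S" "exec c st a st1" "exec (Loop j S c) st1 b st2"
  shows "exec (Loop j S c) st (a + b + 1) st2"
  unfolding exec_def
proof
  fix E
  obtain m n where "m \<le> a" "runs c (\<lambda>j. stape (E j) (st j)) m (\<lambda>j. stape (E j) (st1 j))"
    "n \<le> b" "runs (Loop j S c) (\<lambda>j. stape (E j) (st1 j)) n (\<lambda>j. stape (E j) (st2 j))"
    using assms unfolding exec_def by blast
  then show "\<exists>n\<le>a + b + 1. runs (Loop j S c) (\<lambda>j. stape (E j) (st j)) n (\<lambda>j. stape (E j) (st2 j))"
    using assms(1) by (intro exI[of _ "Suc (m + n)"]) (auto intro!: runs_Loop_step)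
qed

text \<open>The blank symbol 0 marks the bottom. A transfer reverses the content, a second one
  restores the order.\<close>

definition Move :: "nat \<Rightarrow> nat \<Rightarrow> com" where
  "Move i j = Loop i {1, 2}
     (Branch i {2} (Seq (Pop i) (Push j True)) (Seq (Pop i) (Push j False)))"

definition Move2 :: "nat \<Rightarrow> nat \<Rightarrow> nat \<Rightarrow> com" where
  "Move2 i j l = Loop i {1, 2}
     (Branch i {2} (Seq (Pop i) (Seq (Push j True) (Push l True)))
        (Seq (Pop i) (Seq (Push j False) (Push l False))))"

definition Clear :: "nat \<Rightarrow> com" where
  "Clear i = Loop i {1, 2} (Pop i)"

lemma wf_Move [simp]: "wf_com K (Move i j) \<longleftrightarrow> i < K \<and> j < K"
  by (auto simp: Move_def)

lemma wf_Move2 [simp]: "wf_com K (Move2 i j l) \<longleftrightarrow> i < K \<and> j < K \<and> l < K"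
  by (auto simp: Move2_def)

lemma wf_Clear [simp]: "wf_com K (Clear i) \<longleftrightarrow> i < K"
  by (auto simp: Clear_def)

lemma exec_Move:
  assumes "i \<noteq> j"
  shows "exec (Move i j) st (7 * length (st i) + 1) (st(i := [], j := rev (st i) @ st j))"
proof (induction "st i" arbitrary: st)
  case Nil
  then show ?case
    unfolding Move_def by (intro exec_weaken[OF exec_Loop_end]) (auto simp flip: Nil)
next
  case (Cons b xs)
  let ?st = "st(i := xs, j := b # st j)"
  have p: "exec (Seq (Pop i) (Push j b)) st 5 ?st"
    by (rule exec_weaken[OF exec_Seq[OF exec_Pop exec_Push]])
      (use assms Cons.hyps(2) in \<open>auto simp flip: Cons.hyps(2)\<close>)
  then have "exec (Branch i {2} (Seq (Pop i) (Push j True)) (Seq (Pop i) (Push j False))) st (5 + 1) ?st"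
    by (intro exec_Branch) (cases b; simp flip: Cons.hyps(2))
  moreover have "exec (Move i j) ?st (7 * length (?st i) + 1) (?st(i := [], j := rev (?st i) @ ?st j))"
    by (rule Cons.hyps(1)) (use assms in auto)
  ultimately show ?case
    unfolding Move_def
    by (intro exec_weaken[OF exec_Loop_step[of st i "{1,2}"]], unfold fun_upd_def)
      (use assms in \<open>cases b; auto simp flip: Cons.hyps(2)\<close>)+
qed

lemma exec_Move2:
  assumes "i \<noteq> j" "i \<noteq> l" "j \<noteq> l"
  shows "exec (Move2 i j l) st (11 * length (st i) + 1)
    (st(i := [], j := rev (st i) @ st j, l := rev (st i) @ st l))"
proof (induction "st i" arbitrary: st)
  case Nil
  then show ?case
    unfolding Move2_def by (intro exec_weaken[OF exec_Loop_end]) (auto simp flip: Nil)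
next
  case (Cons b xs)
  let ?st = "st(i := xs, j := b # st j, l := b # st l)"
  have p: "exec (Seq (Pop i) (Seq (Push j b) (Push l b))) st 9 ?st"
    by (rule exec_weaken[OF exec_Seq[OF exec_Pop exec_Seq[OF exec_Push exec_Push]]])
      (use assms Cons.hyps(2) in \<open>auto simp flip: Cons.hyps(2)\<close>)
  then have "exec (Branch i {2} (Seq (Pop i) (Seq (Push j True) (Push l True)))
        (Seq (Pop i) (Seq (Push j False) (Push l False)))) st (9 + 1) ?st"
    by (intro exec_Branch) (cases b; simp flip: Cons.hyps(2))
  moreover have "exec (Move2 i j l) ?st (11 * length (?st i) + 1)
      (?st(i := [], j := rev (?st i) @ ?st j, l := rev (?st i) @ ?st l))"
    by (rule Cons.hyps(1)) (use assms in auto)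
  ultimately show ?case
    unfolding Move2_def
    by (intro exec_weaken[OF exec_Loop_step[of st i "{1,2}"]], unfold fun_upd_def)
      (use assms in \<open>cases b; auto simp flip: Cons.hyps(2)\<close>)+
qed

lemma exec_Clear: "exec (Clear i) st (2 * length (st i) + 1) (st(i := []))"
proof (induction "st i" arbitrary: st)
  case Nil
  then show ?case
    unfolding Clear_def by (intro exec_weaken[OF exec_Loop_end]) (auto simp flip: Nil)
next
  case (Cons b xs)
  have "exec (Clear i) (st(i := xs)) (2 * length xs + 1) (st(i := []))"
    using Cons.hyps(1)[of "st(i := xs)"] by simp
  from exec_Loop_step[OF _ exec_Pop this[unfolded Clear_def]] Cons.hyps(2)
  show ?case
    unfolding Clear_def by (cases b) (auto simp flip: Cons.hyps(2) intro: exec_weaken)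
qed

section \<open>Polynomial-time functions on structured data\<close>

datatype tree = Lf | Nd tree tree

text \<open>Preorder with \<open>True\<close> for nodes is self-delimiting: two codes can lie on one
  stack and be separated again by counting pending subtrees.\<close>

fun ser :: "tree \<Rightarrow> bool list" where
  "ser Lf = [False]"
| "ser (Nd a b) = True # ser a @ ser b"

definition tsize :: "tree \<Rightarrow> nat" where
  "tsize t = length (ser t)"

lemma tsize_simps [simp]: "tsize Lf = 1" "tsize (Nd a b) = tsize a + tsize b + 1"
  by (simp_all add: tsize_def)

lemma length_ser: "length (ser t) = tsize t"
  by (simp add: tsize_def)

lemma top_symbol_ser: "top_symbol (ser t @ xs) = (if t = Lf then 1 else 2)"
  by (cases t) auto

class rep =
  fixes rep :: "'a \<Rightarrow> tree"
  assumes rep_inject: "rep x = rep y \<Longrightarrow> x = y"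

instantiation tree :: rep
begin
definition rep_tree :: "tree \<Rightarrow> tree" where [simp]: "rep_tree t = t"
instance by standard simp
end

instantiation bool :: rep
begin
definition rep_bool :: "bool \<Rightarrow> tree" where "rep_bool b = (if b then Nd Lf Lf else Lf)"
instance by standard (simp add: rep_bool_def split: if_splits)
end

text \<open>Natural numbers are unary: only quantities that are polynomial in the input are represented.\<close>

instantiation nat :: rep
begin
fun rep_nat :: "nat \<Rightarrow> tree" where
  "rep_nat 0 = Lf"
| "rep_nat (Suc n) = Nd Lf (rep_nat n)"
instance
proof
  show "rep m = rep n \<Longrightarrow> m = n" for m n :: nat
    by (induction m arbitrary: n; case_tac n) auto
qed
end

instantiation list :: (rep) rep
begin
fun rep_list :: "'a list \<Rightarrow> tree" where
  "rep_list [] = Lf"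
| "rep_list (x # xs) = Nd (rep x) (rep_list xs)"
instance
proof
  show "rep xs = rep ys \<Longrightarrow> xs = ys" for xs ys :: "'a list"
    by (induction xs arbitrary: ys; case_tac ys) (auto dest: rep_inject)
qed
end

instantiation prod :: (rep, rep) rep
begin
definition rep_prod :: "'a \<times> 'b \<Rightarrow> tree" where "rep_prod p = Nd (rep (fst p)) (rep (snd p))"
instance by standard (auto simp: rep_prod_def prod_eq_iff dest: rep_inject)
end

instantiation option :: (rep) rep
begin
definition rep_option :: "'a option \<Rightarrow> tree" where
  "rep_option z = (case z of None \<Rightarrow> Lf | Some x \<Rightarrow> Nd (rep x) Lf)"
instance by standard (auto simp: rep_option_def dest: rep_inject split: option.splits)
end

definition sz :: "'a :: rep \<Rightarrow> nat" where
  "sz x = tsize (rep x)"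

lemma sz_simps [simp]:
  "sz (x, y) = sz x + sz y + 1"
  "sz ([] :: 'a :: rep list) = 1" "sz (a # as) = sz a + sz as + 1"
  "sz (None :: 'a option) = 1" "sz (Some a) = sz a + 2"
  "sz False = 1" "sz True = 3" "sz (0 :: nat) = 1" "sz (Suc n) = sz n + 2"
  "sz Lf = 1" "sz (Nd t u) = sz t + sz u + 1"
  for x :: "'b :: rep" and y :: "'c :: rep"
  by (simp_all add: sz_def rep_prod_def rep_option_def rep_bool_def)

lemma length_code [simp]: "length (ser (rep x)) = sz x"
  by (simp add: sz_def length_ser)


text \<open>Stack 0 holds the argument and later the result, the stacks below \<open>k\<close> are
  empty scratch space, and all others may hold anything and are left as they were. A larger program
  can therefore park data from \<open>k\<close> on while it calls this one.\<close>

definition tprog :: "com \<Rightarrow> nat \<Rightarrow> ('a :: rep \<Rightarrow> nat) \<Rightarrow> ('a \<Rightarrow> 'b :: rep) \<Rightarrow> bool" where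
  "tprog c k b f \<longleftrightarrow> (\<forall>x st. st 0 = ser (rep x) \<and> (\<forall>i. 0 < i \<and> i < k \<longrightarrow> st i = []) \<longrightarrow>
     exec c st (b x) (st(0 := ser (rep (f x)))))"

text \<open>The size of the result is bounded separately, because it is the input size of whatever
  program runs next.\<close>

definition FP :: "('a :: rep \<Rightarrow> 'b :: rep) \<Rightarrow> bool" where
  "FP f \<longleftrightarrow> polybd sz (\<lambda>x. sz (f x)) \<and>
     (\<exists>c K k b. wf_com K c \<and> polybd sz b \<and> tprog c k b f)"

lemma tprogD:
  "tprog c k b f \<Longrightarrow> st 0 = ser (rep x) \<Longrightarrow> (\<And>i. 0 < i \<Longrightarrow> i < k \<Longrightarrow> st i = []) \<Longrightarrow>
    exec c st (b x) (st(0 := ser (rep (f x))))"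
  by (simp add: tprog_def)

lemma tprog_mono:
  fixes f :: "'a :: rep \<Rightarrow> 'b :: rep"
  assumes "tprog c k b f" "k \<le> k'"
  shows "tprog c k' b f"
  unfolding tprog_def
proof (intro allI impI)
  fix x :: 'a and st assume "st 0 = ser (rep x) \<and> (\<forall>i. 0 < i \<and> i < k' \<longrightarrow> st i = [])"
  then show "exec c st (b x) (st(0 := ser (rep (f x))))"
    using assms(2) by (intro tprogD[OF assms(1)]) simp_all
qed

lemma FPI:
  assumes "polybd sz (\<lambda>x. sz (f x))" "wf_com K c" "polybd sz b"
    "\<And>x st. st 0 = ser (rep x) \<Longrightarrow> (\<And>i. 0 < i \<Longrightarrow> i < k \<Longrightarrow> st i = []) \<Longrightarrow>
      exec c st (b x) (st(0 := ser (rep (f x))))"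
  shows "FP f"
  unfolding FP_def tprog_def using assms by (intro conjI exI[of _ c] exI[of _ K] exI[of _ k] exI[of _ b]) simp_all

text \<open>Finitely many programs can share the bounds \<open>K\<close> and \<open>k\<close> on the tapes that they use.\<close>

lemma FPE:
  assumes "FP f"
  obtains c k0 b where "polybd sz (\<lambda>x. sz (f x))" "polybd sz b"
    "\<And>k. k \<ge> k0 \<Longrightarrow> wf_com k c \<and> tprog c k b f"
proof -
  obtain c K k b where *: "wf_com K c" "polybd sz b" "tprog c k b f" "polybd sz (\<lambda>x. sz (f x))"
    using assms by (auto simp: FP_def)
  have "wf_com k' c \<and> tprog c k' b f" if "k' \<ge> max K k" for k'
    using that *(1,3) by (auto intro: wf_com_mono tprog_mono)
  then show ?thesis by (rule that[OF *(4) *(2)])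
qed

lemma FP_id: "FP (\<lambda>x. x)"
  \<comment> \<open>A loop that is never entered serves as the empty program.\<close>
  by (rule FPI[where K = 1 and c = "Loop 0 {} (Clear 0)" and b = "\<lambda>_. 1"])
    (auto intro!: polybd_intros exec_weaken[OF exec_Loop_end])

lemma FP_comp:
  fixes g :: "'a :: rep \<Rightarrow> 'b :: rep"
  assumes "FP f" "FP g"
  shows "FP (\<lambda>x. f (g x))"
proof -
  obtain cf kf bf where f: "polybd sz (\<lambda>x. sz (f x))" "polybd sz bf"
    "\<And>k. k \<ge> kf \<Longrightarrow> wf_com k cf \<and> tprog cf k bf f"
    using FPE[OF assms(1)] by metis
  obtain cg kg bg where g: "polybd sz (\<lambda>x. sz (g x))" "polybd sz bg"
    "\<And>k. k \<ge> kg \<Longrightarrow> wf_com k cg \<and> tprog cg k bg g"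
    using FPE[OF assms(2)] by metis
  let ?k = "max kf kg"
  show ?thesis
  proof (rule FPI[where K = ?k and k = ?k and c = "Seq cg cf" and b = "\<lambda>x. bg x + bf (g x) + 1"])
    show "polybd sz (\<lambda>x. sz (f (g x)))"
      using polybd_comp[OF f(1) g(1)] by simp
    show "polybd sz (\<lambda>x. bg x + bf (g x) + 1)"
      using polybd_comp[OF f(2) g(1)] by (intro polybd_intros g)
    show "wf_com ?k (Seq cg cf)" using f(3)[of ?k] g(3)[of ?k] by simp
    fix x :: 'a and st :: "nat \<Rightarrow> bool list"
    assume st: "st 0 = ser (rep x)" "\<And>i. 0 < i \<Longrightarrow> i < ?k \<Longrightarrow> st i = []"
    show "exec (Seq cg cf) st (bg x + bf (g x) + 1) (st(0 := ser (rep (f (g x)))))"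
      using exec_Seq[OF tprogD[of cg ?k bg g st x] tprogD[of cf ?k bf f "st(0 := ser (rep (g x)))" "g x"]]
        f(3)[of ?k] g(3)[of ?k] st by auto
  qed
qed

lemma FP_Lf: "FP (\<lambda>_ :: 'a :: rep. Lf)"
proof (rule FPI[where K = 1 and c = "Seq (Clear 0) (Push 0 False)" and b = "\<lambda>x. 2 * sz x + 1 + 3 + 1"])
  fix x :: 'a and st :: "nat \<Rightarrow> bool list" assume "st 0 = ser (rep x)"
  then show "exec (Seq (Clear 0) (Push 0 False)) st (2 * sz x + 1 + 3 + 1) (st(0 := ser (rep Lf)))"
    using exec_Seq[OF exec_Clear[of 0 st] exec_Push[of 0 False "st(0 := [])"]] by simp
qed (auto intro!: polybd_intros polybd_Suc)

definition Dup :: "nat \<Rightarrow> com" where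
  "Dup k = Seq (Move 0 (Suc k)) (Move2 (Suc k) 0 k)"

definition Restore :: "nat \<Rightarrow> com" where
  "Restore k = Seq (Move k (Suc k)) (Move (Suc k) 0)"

lemma wf_Dup [simp]: "wf_com K (Dup k) \<longleftrightarrow> Suc k < K"
  by (auto simp: Dup_def)

lemma wf_Restore [simp]: "wf_com K (Restore k) \<longleftrightarrow> Suc k < K"
  by (auto simp: Restore_def)

lemma exec_Dup:
  assumes "st 0 = xs" "st k = []" "st (Suc k) = []" "k > 0"
  shows "exec (Dup k) st (18 * length xs + 3) (st(k := xs))"
  unfolding Dup_def
  by (rule exec_weaken[OF exec_Seq[OF exec_Move exec_Move2]]) (use assms in \<open>auto simp: fun_eq_iff\<close>)

lemma exec_Restore:
  assumes "st k = xs" "st 0 = []" "st (Suc k) = []" "k > 0"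
  shows "exec (Restore k) st (14 * length xs + 3) (st(0 := xs, k := []))"
  unfolding Restore_def
  by (rule exec_weaken[OF exec_Seq[OF exec_Move exec_Move]]) (use assms in \<open>auto simp: fun_eq_iff\<close>)

text \<open>Stack \<open>k\<close> keeps a copy of the argument while \<open>f\<close> runs, stack
  \<open>k + 1\<close> is the buffer for copying, and stack \<open>k + 2\<close> holds the reversed
  code of \<open>f x\<close> while \<open>g\<close> runs. That code and a \<open>True\<close> on top
  of the code of \<open>g x\<close> form the code of the pair.\<close>

lemma FP_Pair:
  fixes f :: "'a :: rep \<Rightarrow> 'b :: rep"
  assumes "FP f" "FP g"
  shows "FP (\<lambda>x. (f x, g x))"
proof -
  obtain cf kf bf where f: "polybd sz (\<lambda>x. sz (f x))" "polybd sz bf"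
    "\<And>k. k \<ge> kf \<Longrightarrow> wf_com k cf \<and> tprog cf k bf f"
    using FPE[OF assms(1)] by metis
  obtain cg kg bg where g: "polybd sz (\<lambda>x. sz (g x))" "polybd sz bg"
    "\<And>k. k \<ge> kg \<Longrightarrow> wf_com k cg \<and> tprog cg k bg g"
    using FPE[OF assms(2)] by metis
  define k where "k = max 1 (max kf kg)"
  have k: "k > 0" "tprog cf k bf f" "tprog cg k bg g" "wf_com k cf" "wf_com k cg"
    using f(3)[of k] g(3)[of k] by (auto simp: k_def)
  let ?c = "Seq (Dup k) (Seq cf (Seq (Move 0 (k + 2)) (Seq (Restore k) (Seq cg
    (Seq (Move (k + 2) 0) (Push 0 True))))))"
  let ?b = "\<lambda>x. 18 * sz x + 3 + (bf x + (7 * sz (f x) + 1 + (14 * sz x + 3 + (bg x +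
    (7 * sz (f x) + 1 + 3 + 1) + 1) + 1) + 1) + 1) + 1"
  show ?thesis
  proof (rule FPI[where K = "k + 3" and k = "k + 3" and c = ?c and b = ?b])
    show "polybd sz (\<lambda>x. sz (f x, g x))"
      using f(1) g(1) by (auto intro!: polybd_intros polybd_Suc)
    show "wf_com (k + 3) ?c"
      using k wf_com_mono[of k _ "k + 3"] by auto
    show "polybd sz ?b"
      by (intro polybd_intros f g)
    fix x :: 'a and st :: "nat \<Rightarrow> bool list"
    assume st: "st 0 = ser (rep x)" "\<And>i. 0 < i \<Longrightarrow> i < k + 3 \<Longrightarrow> st i = []"
    let ?s1 = "st(k := ser (rep x))"
    let ?s2 = "?s1(0 := ser (rep (f x)))"
    let ?s3 = "?s2(0 := [], k + 2 := rev (ser (rep (f x))))"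
    let ?s4 = "?s3(0 := ser (rep x), k := [])"
    let ?s5 = "?s4(0 := ser (rep (g x)))"
    let ?s6 = "?s5(k + 2 := [], 0 := ser (rep (f x)) @ ser (rep (g x)))"
    have 1: "exec (Dup k) st (18 * sz x + 3) ?s1"
      using exec_Dup[of st "ser (rep x)" k] st k by simp
    have 2: "exec cf ?s1 (bf x) ?s2"
      by (rule tprogD[OF k(2)]) (use st k in auto)
    have 3: "exec (Move 0 (k + 2)) ?s2 (7 * sz (f x) + 1) ?s3"
      by (rule exec_weaken[OF exec_Move]) (use st k in \<open>auto\<close>)
    have 4: "exec (Restore k) ?s3 (14 * sz x + 3) ?s4"
      using exec_Restore[of ?s3 k "ser (rep x)"] st k by simp
    have 5: "exec cg ?s4 (bg x) ?s5"
      by (rule tprogD[OF k(3)]) (use st k in auto)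
    have 6: "exec (Move (k + 2) 0) ?s5 (7 * sz (f x) + 1) ?s6"
      by (rule exec_weaken[OF exec_Move]) (use st k in \<open>auto\<close>)
    show "exec ?c st (?b x) (st(0 := ser (rep (f x, g x))))"
      by (rule exec_weaken[OF exec_Seq[OF 1 exec_Seq[OF 2 exec_Seq[OF 3 exec_Seq[OF 4 exec_Seq[OF 5
        exec_Seq[OF 6 exec_Push]]]]]]]) (use st k in \<open>auto simp: fun_eq_iff rep_prod_def\<close>)
  qed
qed

text \<open>Programs only see codes, so functions whose results have the same codes share their
  programs. Many constructors are pairs in disguise.\<close>

lemma FP_transport:
  assumes "FP f" "\<And>x. rep (g x) = rep (f x)"
  shows "FP g"
proof -
  have "tprog c k b f = tprog c k b g" for c k b
    using assms(2) by (simp add: tprog_def)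
  moreover have "sz (g x) = sz (f x)" for x
    using assms(2) by (simp add: sz_def)
  ultimately show ?thesis
    using assms(1) by (simp add: FP_def)
qed

lemma FP_Nd: "FP f \<Longrightarrow> FP g \<Longrightarrow> FP (\<lambda>x. Nd (f x) (g x))"
  by (rule FP_transport[OF FP_Pair[of f g]]) (auto simp: rep_prod_def)

lemma FP_const: "FP (\<lambda>_ :: 'b :: rep. c)"
proof -
  have "FP (\<lambda>_ :: 'b. t)" for t :: tree
    by (induction t) (auto intro: FP_Lf FP_Nd)
  from this[of "rep c"] show ?thesis
    by (rule FP_transport) simp
qed

text \<open>The first symbol of a code tells \<open>Lf\<close> from a node, so a branch on the top
  of stack 0 decides the case; the argument is then restored from its copy.\<close>

lemma FP_if_Lf:
  fixes f :: "'a :: rep \<Rightarrow> 'b :: rep"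
  assumes "FP f" "FP g" "FP h"
  shows "FP (\<lambda>x. if rep (f x) = Lf then g x else h x)"
proof -
  obtain cf kf bf where f: "polybd sz (\<lambda>x. sz (f x))" "polybd sz bf"
    "\<And>k. k \<ge> kf \<Longrightarrow> wf_com k cf \<and> tprog cf k bf f"
    using FPE[OF assms(1)] by metis
  obtain cg kg bg where g: "polybd sz (\<lambda>x. sz (g x))" "polybd sz bg"
    "\<And>k. k \<ge> kg \<Longrightarrow> wf_com k cg \<and> tprog cg k bg g"
    using FPE[OF assms(2)] by metis
  obtain ch kh bh where h: "polybd sz (\<lambda>x. sz (h x))" "polybd sz bh"
    "\<And>k. k \<ge> kh \<Longrightarrow> wf_com k ch \<and> tprog ch k bh h"
    using FPE[OF assms(3)] by metis
  define k where "k = max 1 (max kf (max kg kh))"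
  have k: "k > 0" "tprog cf k bf f" "tprog cg k bg g" "tprog ch k bh h"
    "wf_com k cf" "wf_com k cg" "wf_com k ch"
    using f(3)[of k] g(3)[of k] h(3)[of k] by (auto simp: k_def)
  let ?r = "Seq (Clear 0) (Restore k)"
  let ?c = "Seq (Dup k) (Seq cf (Branch 0 {1} (Seq ?r cg) (Seq ?r ch)))"
  let ?b = "\<lambda>x. 18 * sz x + 3 + (bf x + ((2 * sz (f x) + 1 + (14 * sz x + 3) + 1 + (bg x + bh x) + 1) + 1)
      + 1) + 1"
  show ?thesis
  proof (rule FPI[where K = "k + 3" and k = "k + 3" and c = ?c and b = ?b])
    show "polybd sz (\<lambda>x. sz (if rep (f x) = Lf then g x else h x))"
      by (rule polybd_mono[OF polybd_add[OF g(1) h(1)]]) auto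
    show "wf_com (k + 3) ?c"
      using k wf_com_mono[of k _ "k + 3"] by auto
    show "polybd sz ?b"
      by (intro polybd_intros f g h)
    fix x :: 'a and st :: "nat \<Rightarrow> bool list"
    assume st: "st 0 = ser (rep x)" "\<And>i. 0 < i \<Longrightarrow> i < k + 3 \<Longrightarrow> st i = []"
    let ?s1 = "st(k := ser (rep x))"
    let ?s2 = "?s1(0 := ser (rep (f x)))"
    have 1: "exec (Dup k) st (18 * sz x + 3) ?s1"
      using exec_Dup[of st "ser (rep x)" k] st k by simp
    have 2: "exec cf ?s1 (bf x) ?s2"
      by (rule tprogD[OF k(2)]) (use st k in auto)
    have "exec (Clear 0) ?s2 (2 * sz (f x) + 1) (?s2(0 := []))"
      by (rule exec_weaken[OF exec_Clear]) (auto )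
    moreover have "exec (Restore k) (?s2(0 := [])) (14 * sz x + 3) st"
      by (rule exec_weaken[OF exec_Restore[of _ _ "ser (rep x)"]]) (use st k in \<open>auto simp: fun_eq_iff\<close>)
    ultimately have 3: "exec ?r ?s2 (2 * sz (f x) + 1 + (14 * sz x + 3) + 1) st"
      by (rule exec_Seq)
    have 4: "exec (if rep (f x) = Lf then cg else ch) st (bg x + bh x) (st(0 := ser (rep (if rep (f x) = Lf then g x else h x))))"
      using tprogD[OF k(3), of st x] tprogD[OF k(4), of st x] st
      by (auto intro: exec_weaken)
    have "exec (Branch 0 {1} (Seq ?r cg) (Seq ?r ch)) ?s2
      (2 * sz (f x) + 1 + (14 * sz x + 3) + 1 + (bg x + bh x) + 1 + 1)
      (st(0 := ser (rep (if rep (f x) = Lf then g x else h x))))"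
      using exec_Seq[OF 3 4] top_symbol_ser[of "rep (f x)" "[]"]
      by (intro exec_Branch) (auto split: if_splits)
    from exec_Seq[OF 1 exec_Seq[OF 2 this]]
    show "exec ?c st (?b x) (st(0 := ser (rep (if rep (f x) = Lf then g x else h x))))" .
  qed
qed

text \<open>Stack 2 counts the subtrees that remain to be moved from stack 0 to stack 1.\<close>

definition Move_trees :: com where
  "Move_trees = Loop 2 {1, 2} (Branch 0 {2}
     (Seq (Pop 0) (Seq (Push 1 True) (Push 2 True)))
     (Seq (Pop 0) (Seq (Push 1 False) (Pop 2))))"

text \<open>The rest of the run is a hypothesis, so that the two subtrees of a node can be passed
  one after the other. A node raises the counter by one, a leaf lowers it by one, and a symbol costs
  at most 12 steps.\<close>

lemma exec_Move_trees_step: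
  assumes "st 0 = ser t @ xs" "st 2 = True # cs"
    "exec Move_trees (st(0 := xs, 1 := rev (ser t) @ st 1, 2 := cs)) b st'"
  shows "exec Move_trees st (b + 12 * tsize t) st'"
  using assms
proof (induction t arbitrary: st xs cs b)
  case Lf
  have "exec (Seq (Pop 0) (Seq (Push 1 False) (Pop 2))) st 7 (st(0 := xs, 1 := False # st 1, 2 := cs))"
    by (rule exec_weaken[OF exec_Seq[OF exec_Pop exec_Seq[OF exec_Push exec_Pop]]])
      (use Lf in \<open>auto simp: fun_eq_iff\<close>)
  then have "exec (Branch 0 {2}
     (Seq (Pop 0) (Seq (Push 1 True) (Push 2 True)))
     (Seq (Pop 0) (Seq (Push 1 False) (Pop 2)))) st (7 + 1) (st(0 := xs, 1 := False # st 1, 2 := cs))"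
    by (intro exec_Branch) (simp add: Lf)
  moreover have "exec Move_trees (st(0 := xs, 1 := False # st 1, 2 := cs)) b st'"
    using Lf(3) by (simp del: fun_upd_apply add: fun_upd_same fun_upd_other)
  ultimately have "exec Move_trees st (7 + 1 + b + 1) st'"
    unfolding Move_trees_def by (rule exec_Loop_step[rotated]) (simp add: Lf(2))
  then show ?case by (rule exec_weaken) auto
next
  case (Nd t u)
  let ?s1 = "st(0 := ser t @ ser u @ xs, 1 := True # st 1, 2 := True # st 2)"
  let ?s2 = "?s1(0 := ser u @ xs, 1 := rev (ser t) @ ?s1 1, 2 := st 2)"
  have "exec (Seq (Pop 0) (Seq (Push 1 True) (Push 2 True))) st 9 ?s1"
    by (rule exec_weaken[OF exec_Seq[OF exec_Pop exec_Seq[OF exec_Push exec_Push]]])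
      (use Nd.prems in \<open>auto simp: fun_eq_iff\<close>)
  then have 1: "exec (Branch 0 {2}
     (Seq (Pop 0) (Seq (Push 1 True) (Push 2 True)))
     (Seq (Pop 0) (Seq (Push 1 False) (Pop 2)))) st (9 + 1) ?s1"
    by (intro exec_Branch) (simp add: Nd.prems)
  have "exec Move_trees (?s2(0 := xs, 1 := rev (ser u) @ ?s2 1, 2 := cs)) b st'"
    using Nd.prems(3) by (rule back_subst[of "\<lambda>s. exec Move_trees s b st'"]) (auto simp: fun_eq_iff)
  then have "exec Move_trees ?s2 (b + 12 * tsize u) st'"
    by (rule Nd.IH(2)[rotated 2]) (use Nd.prems in auto)
  then have "exec Move_trees ?s1 (b + 12 * tsize u + 12 * tsize t) st'"
    by (rule Nd.IH(1)[rotated 2]) simp_all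
  from exec_Loop_step[OF _ 1 this[unfolded Move_trees_def]]
  show ?case unfolding Move_trees_def using Nd.prems(2) by (auto intro: exec_weaken)
qed

definition Split :: com where
  "Split = Seq (Pop 0) (Seq (Push 2 True) Move_trees)"

lemma exec_Split:
  assumes "st 0 = True # ser t @ xs" "st 1 = []" "st 2 = []"
  shows "exec Split st (12 * tsize t + 7) (st(0 := xs, 1 := rev (ser t)))"
proof -
  let ?s = "st(0 := ser t @ xs, 2 := [True])"
  have "exec Move_trees (?s(0 := xs, 1 := rev (ser t) @ ?s 1, 2 := [])) 1 (st(0 := xs, 1 := rev (ser t)))"
    unfolding Move_trees_def
    by (rule exec_weaken[OF exec_Loop_end]) (use assms in \<open>auto simp: fun_eq_iff\<close>)
  then have "exec Move_trees ?s (1 + 12 * tsize t) (st(0 := xs, 1 := rev (ser t)))"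
    by (rule exec_Move_trees_step[rotated 2]) (use assms in auto)
  moreover have "exec (Push 2 True) (st(0 := ser t @ xs)) 3 ?s"
    by (rule exec_weaken[OF exec_Push]) (use assms in auto)
  moreover have "exec (Pop 0) st 1 (st(0 := ser t @ xs))"
    by (rule exec_Pop) (use assms in auto)
  ultimately show ?thesis
    unfolding Split_def by (intro exec_weaken[OF exec_Seq[OF _ exec_Seq]]) auto
qed

lemma sz_pos: "sz x > 0"
  by (cases "rep x") (auto simp: sz_def)

lemma FP_fst: "FP (fst :: 'a :: rep \<times> 'b :: rep \<Rightarrow> 'a)"
proof (rule FPI[where K = 3 and k = 3 and b = "\<lambda>x. 30 * sz x + 30" and
      c = "Seq Split (Seq (Clear 0) (Move 1 0))"])
  fix x :: "'a \<times> 'b" and st :: "nat \<Rightarrow> bool list"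
  assume st: "st 0 = ser (rep x)" "\<And>i. 0 < i \<Longrightarrow> i < 3 \<Longrightarrow> st i = []"
  show "exec (Seq Split (Seq (Clear 0) (Move 1 0))) st (30 * sz x + 30) (st(0 := ser (rep (fst x))))"
    by (rule exec_weaken[OF exec_Seq[OF exec_Split[of st "rep (fst x)" "ser (rep (snd x))"] exec_Seq[OF exec_Clear exec_Move]]])
      (use st in \<open>cases x; auto simp: length_ser rep_prod_def sz_def fun_eq_iff\<close>)+
next
  show "polybd sz (\<lambda>x :: 'a \<times> 'b. sz (fst x))"
    by (rule polybd_mono[OF polybd_self]) (auto simp: sz_def rep_prod_def)
qed (auto intro!: polybd_intros polybd_Suc simp: Split_def Move_trees_def)

lemma FP_snd: "FP (snd :: 'a :: rep \<times> 'b :: rep \<Rightarrow> 'b)"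
proof (rule FPI[where K = 3 and k = 3 and b = "\<lambda>x. 30 * sz x + 30" and c = "Seq Split (Clear 1)"])
  fix x :: "'a \<times> 'b" and st :: "nat \<Rightarrow> bool list"
  assume st: "st 0 = ser (rep x)" "\<And>i. 0 < i \<Longrightarrow> i < 3 \<Longrightarrow> st i = []"
  show "exec (Seq Split (Clear 1)) st (30 * sz x + 30) (st(0 := ser (rep (snd x))))"
    by (rule exec_weaken[OF exec_Seq[OF exec_Split[of st "rep (fst x)" "ser (rep (snd x))"] exec_Clear]])
      (use st in \<open>cases x; auto simp: length_ser rep_prod_def sz_def fun_eq_iff\<close>)+
next
  show "polybd sz (\<lambda>x :: 'a \<times> 'b. sz (snd x))"
    by (rule polybd_mono[OF polybd_self]) (auto simp: sz_def rep_prod_def)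
qed (auto intro!: polybd_intros polybd_Suc simp: Split_def Move_trees_def)

text \<open>The code of \<open>m x\<close> is parked on stack \<open>k + 2\<close> and serves as the
  counter: every symbol popped from it triggers one round. A bound \<open>B\<close> on all
  intermediate values is assumed, since iterating a function of polynomial growth can produce values
  of exponential size.\<close>

lemma FP_iter:
  fixes m :: "'a :: rep \<Rightarrow> 'b :: rep" and s :: "'c :: rep \<Rightarrow> 'c"
  assumes "FP s" "FP m" "FP h" "polybd sz B"
    and B: "\<And>x i. i \<le> sz (m x) \<Longrightarrow> sz ((s ^^ i) (h x)) \<le> B x"
  shows "FP (\<lambda>x. (s ^^ sz (m x)) (h x))"
proof -
  obtain cs ks bs where s: "polybd sz (\<lambda>x. sz (s x))" "polybd sz bs"
    "\<And>k. k \<ge> ks \<Longrightarrow> wf_com k cs \<and> tprog cs k bs s"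
    using FPE[OF assms(1)] by metis
  obtain cm km bm where m: "polybd sz (\<lambda>x. sz (m x))" "polybd sz bm"
    "\<And>k. k \<ge> km \<Longrightarrow> wf_com k cm \<and> tprog cm k bm m"
    using FPE[OF assms(2)] by metis
  obtain ch kh bh where h: "polybd sz (\<lambda>x. sz (h x))" "polybd sz bh"
    "\<And>k. k \<ge> kh \<Longrightarrow> wf_com k ch \<and> tprog ch k bh h"
    using FPE[OF assms(3)] by metis
  \<comment> \<open>The step time \<open>bs\<close> need not be monotone in the size, but its bound
    by a power is and can be evaluated at \<open>B x\<close>.\<close>
  obtain d where d: "\<And>x. bs x \<le> (sz x + 2) ^ d"
    using s(2) unfolding polybd_def by blast
  define k where "k = max 1 (max ks (max km kh))"
  have k: "k > 0" "tprog cs k bs s" "tprog cm k bm m" "tprog ch k bh h"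
    "wf_com k cs" "wf_com k cm" "wf_com k ch"
    using s(3)[of k] m(3)[of k] h(3)[of k] by (auto simp: k_def)
  let ?l = "Loop (k + 2) {1, 2} (Seq (Pop (k + 2)) cs)"
  let ?c = "Seq (Dup k) (Seq cm (Seq (Move 0 (k + 2)) (Seq (Restore k) (Seq ch ?l))))"
  let ?b = "\<lambda>x. 18 * sz x + 3 + (bm x + (7 * sz (m x) + 1 + (14 * sz x + 3 + (bh x +
    (sz (m x) * ((B x + 2) ^ d + 3) + 1) + 1) + 1) + 1) + 1) + 1"
  show ?thesis
  proof (rule FPI[where K = "k + 3" and k = "k + 3" and c = ?c and b = ?b])
    show "polybd sz (\<lambda>x. sz ((s ^^ sz (m x)) (h x)))"
      using polybd_mono[OF assms(4)] B by simp
    show "wf_com (k + 3) ?c"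
      using k wf_com_mono[of k _ "k + 3"] by auto
    show "polybd sz ?b"
      by (intro polybd_intros s m h assms(4))
    fix x :: 'a and st :: "nat \<Rightarrow> bool list"
    assume st: "st 0 = ser (rep x)" "\<And>i. 0 < i \<Longrightarrow> i < k + 3 \<Longrightarrow> st i = []"
    let ?s1 = "st(k := ser (rep x))"
    let ?s2 = "?s1(0 := ser (rep (m x)))"
    let ?s3 = "?s2(0 := [], k + 2 := rev (ser (rep (m x))))"
    let ?s4 = "?s3(0 := ser (rep x), k := [])"
    let ?s5 = "?s4(0 := ser (rep (h x)))"
    have 1: "exec (Dup k) st (18 * sz x + 3) ?s1"
      using exec_Dup[of st "ser (rep x)" k] st k by simp
    have 2: "exec cm ?s1 (bm x) ?s2"
      by (rule tprogD[OF k(3)]) (use st k in auto)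
    have 3: "exec (Move 0 (k + 2)) ?s2 (7 * sz (m x) + 1) ?s3"
      by (rule exec_weaken[OF exec_Move]) (use st k in \<open>auto\<close>)
    have 4: "exec (Restore k) ?s3 (14 * sz x + 3) ?s4"
      using exec_Restore[of ?s3 k "ser (rep x)"] st k by simp
    have 5: "exec ch ?s4 (bh x) ?s5"
      by (rule tprogD[OF k(4)]) (use st k in auto)
    have loop: "exec ?l s' (length ys * ((B x + 2) ^ d + 3) + 1) (st(0 := ser (rep ((s ^^ sz (m x)) (h x)))))"
      if "i + length ys = sz (m x)" "s' = st(k + 2 := ys, 0 := ser (rep ((s ^^ i) (h x))))" for ys s' i
      using that
    proof (induction ys arbitrary: i s')
      case Nil
      then show ?case
        by (intro exec_weaken[OF exec_Loop_end]) (use k st in \<open>auto simp: fun_eq_iff\<close>)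
    next
      case (Cons y ys)
      let ?s1 = "s'(k + 2 := ys)"
      let ?s2 = "?s1(0 := ser (rep ((s ^^ Suc i) (h x))))"
      have "exec (Pop (k + 2)) s' 1 ?s1"
        by (rule exec_Pop) (use Cons in simp)
      moreover have "exec cs ?s1 (bs ((s ^^ i) (h x))) ?s2"
        unfolding funpow.simps comp_apply by (rule tprogD[OF k(2)]) (use Cons st in auto)
      ultimately have "exec (Seq (Pop (k + 2)) cs) s' (1 + bs ((s ^^ i) (h x)) + 1) ?s2"
        by (rule exec_Seq)
      moreover have "exec ?l ?s2 (length ys * ((B x + 2) ^ d + 3) + 1) (st(0 := ser (rep ((s ^^ sz (m x)) (h x)))))"
        by (rule Cons.IH[of "Suc i"]) (use Cons.prems in auto)
      ultimately have "exec ?l s' (1 + bs ((s ^^ i) (h x)) + 1 + (length ys * ((B x + 2) ^ d + 3) + 1) + 1)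
          (st(0 := ser (rep ((s ^^ sz (m x)) (h x)))))"
        by (rule exec_Loop_step[rotated]) (use Cons.prems in \<open>cases y; simp\<close>)
      moreover have "bs ((s ^^ i) (h x)) \<le> (B x + 2) ^ d"
        using order_trans[OF d power_mono[of _ "B x + 2"]] B[of i x] Cons.prems(1) by simp
      ultimately show ?case
        by (elim exec_weaken) auto
    qed
    have 6: "exec ?l ?s5 (sz (m x) * ((B x + 2) ^ d + 3) + 1) (st(0 := ser (rep ((s ^^ sz (m x)) (h x)))))"
      using loop[of 0 "rev (ser (rep (m x)))" ?s5] st k by (auto simp: fun_eq_iff)
    show "exec ?c st (?b x) (st(0 := ser (rep ((s ^^ sz (m x)) (h x)))))"
      by (rule exec_Seq[OF 1 exec_Seq[OF 2 exec_Seq[OF 3 exec_Seq[OF 4 exec_Seq[OF 5 6]]]]])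
  qed
qed

subsection \<open>From words to trees and back\<close>

text \<open>This is \<open>rep\<close> on words, spelled out because the programs that read and
  write words work on the codes of the single bits.\<close>

fun tree_of_bits :: "bool list \<Rightarrow> tree" where
  "tree_of_bits [] = Lf"
| "tree_of_bits (b # bs) = Nd (if b then Nd Lf Lf else Lf) (tree_of_bits bs)"

lemma tsize_tree_of_bits: "length bs \<le> tsize (tree_of_bits bs)" "tsize (tree_of_bits bs) \<le> 4 * length bs + 1"
  by (induction bs) auto

text \<open>The reversing transfer presents the last bit first, so the code of the list is built on
  stack 0 from its end.\<close>

definition Read_word :: com where
  "Read_word = Seq (Move 0 1) (Seq (Push 0 False) (Loop 1 {1, 2} (Branch 1 {2}
     (Seq (Pop 1) (Seq (Push 0 False) (Seq (Push 0 False) (Seq (Push 0 True) (Push 0 True)))))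
     (Seq (Pop 1) (Seq (Push 0 False) (Push 0 True))))))"

lemma exec_Read_word:
  assumes "st 0 = xs" "st 1 = []"
  shows "exec Read_word st (30 * length xs + 10) (st(0 := ser (tree_of_bits xs)))"
proof -
  let ?b = "Branch 1 {2}
     (Seq (Pop 1) (Seq (Push 0 False) (Seq (Push 0 False) (Seq (Push 0 True) (Push 0 True)))))
     (Seq (Pop 1) (Seq (Push 0 False) (Push 0 True)))"
  have "exec (Loop 1 {1, 2} ?b) s (20 * length ys + 1) (st(0 := ser (tree_of_bits (rev ys @ zs))))"
    if "s = st(1 := ys, 0 := ser (tree_of_bits zs))" for ys zs s
    using that
  proof (induction ys arbitrary: zs s)
    case Nil
    then show ?case
      by (intro exec_weaken[OF exec_Loop_end]) (use assms in \<open>auto simp: fun_eq_iff\<close>)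
  next
    case (Cons y ys)
    let ?s = "st(1 := ys, 0 := ser (tree_of_bits (y # zs)))"
    have "exec ?b s (18 + 1) ?s"
    proof (rule exec_Branch, cases y)
      case True
      have "exec (Seq (Pop 1) (Seq (Push 0 False) (Seq (Push 0 False) (Seq (Push 0 True) (Push 0 True))))) s 18 ?s"
        by (rule exec_weaken[OF exec_Seq[OF exec_Pop exec_Seq[OF exec_Push exec_Seq[OF exec_Push
          exec_Seq[OF exec_Push exec_Push]]]]]) (use Cons.prems True in \<open>auto simp: fun_eq_iff\<close>)
      then show "exec (if top_symbol (s 1) \<in> {2} then
          Seq (Pop 1) (Seq (Push 0 False) (Seq (Push 0 False) (Seq (Push 0 True) (Push 0 True))))
          else Seq (Pop 1) (Seq (Push 0 False) (Push 0 True))) s 18 ?s"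
        using Cons.prems True by simp
    next
      case False
      have "exec (Seq (Pop 1) (Seq (Push 0 False) (Push 0 True))) s 18 ?s"
        by (rule exec_weaken[OF exec_Seq[OF exec_Pop exec_Seq[OF exec_Push exec_Push]]])
          (use Cons.prems False in \<open>auto simp: fun_eq_iff\<close>)
      then show "exec (if top_symbol (s 1) \<in> {2} then
          Seq (Pop 1) (Seq (Push 0 False) (Seq (Push 0 False) (Seq (Push 0 True) (Push 0 True))))
          else Seq (Pop 1) (Seq (Push 0 False) (Push 0 True))) s 18 ?s"
        using Cons.prems False by simp
    qed
    from exec_Loop_step[OF _ this Cons.IH[OF refl]] Cons.prems
    show ?case by (cases y) (auto intro: exec_weaken)
  qed
  from this[of _ "rev xs" "[]"]
  have 3: "exec (Loop 1 {1, 2} ?b) (st(1 := rev xs, 0 := [False])) (20 * length xs + 1) (st(0 := ser (tree_of_bits xs)))"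
    by simp
  have 2: "exec (Push 0 False) (st(0 := [], 1 := rev xs)) 3 (st(1 := rev xs, 0 := [False]))"
    by (rule exec_weaken[OF exec_Push]) (auto simp: fun_eq_iff)
  have 1: "exec (Move 0 1) st (7 * length xs + 1) (st(0 := [], 1 := rev xs))"
    by (rule exec_weaken[OF exec_Move]) (use assms in auto)
  show ?thesis
    unfolding Read_word_def by (rule exec_weaken[OF exec_Seq[OF 1 exec_Seq[OF 2 3]]]) auto
qed

text \<open>The output has to occupy the cells from 0 on, so the output tape is not a stack but is
  filled from left to right.\<close>

definition Emit :: "nat \<Rightarrow> bool \<Rightarrow> com" where
  "Emit k b = Prim k (\<lambda>_. (if b then 2 else 1, Move_Right))"

definition Write_word :: "nat \<Rightarrow> com" where
  "Write_word k = Loop 0 {2} (Seq (Pop 0) (Branch 0 {2}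
     (Seq (Pop 0) (Seq (Pop 0) (Seq (Pop 0) (Emit k True))))
     (Seq (Pop 0) (Emit k False))))"

lemma runs_Emit:
  assumes "\<tau> k = (word_content ys, int (length ys))"
  shows "runs (Emit k b) \<tau> 1 (\<tau>(k := (word_content (ys @ [b]), int (length (ys @ [b])))))"
proof -
  have "(word_content ys)(int (length ys) := (if b then 2 else 1)) = word_content (ys @ [b])"
    by (auto simp: fun_eq_iff word_content_def nth_append)
  then show ?thesis
    using runs_Prim[of k "\<lambda>_. (if b then 2 else 1, Move_Right)" \<tau>] assms
    by (cases b) (simp_all add: Emit_def algebra_simps)
qed

lemma runs_Write_word:
  assumes "k \<noteq> 0" "\<tau> 0 = stape e (ser (tree_of_bits xs))" "\<tau> k = (word_content ys, int (length ys))"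
  shows "\<exists>n \<le> 20 * length xs + 1. \<exists>\<tau>'. runs (Write_word k) \<tau> n \<tau>' \<and> fst (\<tau>' k) = word_content (ys @ xs)"
  using assms
proof (induction xs arbitrary: \<tau> ys)
  case Nil
  then show ?case
    unfolding Write_word_def by (intro exI[of _ 1] conjI exI[of _ \<tau>] runs_Loop_end) auto
next
  case (Cons x xs)
  let ?t = "ser (tree_of_bits xs)"
  let ?\<tau>1 = "\<tau>(0 := stape e (tl (ser (tree_of_bits (x # xs)))))"
  let ?\<tau>2 = "\<tau>(0 := stape e ?t, k := (word_content (ys @ [x]), int (length (ys @ [x]))))"
  have 1: "runs (Pop 0) \<tau> 1 ?\<tau>1"
    using runs_Pop[of \<tau> 0 e True "tl (ser (tree_of_bits (x # xs)))"] Cons.prems by simp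
  have "\<exists>n\<le>10. runs (Branch 0 {2}
     (Seq (Pop 0) (Seq (Pop 0) (Seq (Pop 0) (Emit k True))))
     (Seq (Pop 0) (Emit k False))) ?\<tau>1 n ?\<tau>2"
  proof (cases x)
    case True
    have e: "runs (Emit k True) (\<tau>(0 := stape e ?t)) 1 ?\<tau>2"
      using runs_Emit[of "\<tau>(0 := stape e ?t)" k ys True] Cons.prems True by simp
    have p1: "runs (Pop 0) (\<tau>(0 := stape e (False # ?t))) 1 (\<tau>(0 := stape e ?t))"
      using runs_Pop[of "\<tau>(0 := stape e (False # ?t))" 0 e False ?t] by simp
    have p2: "runs (Pop 0) (\<tau>(0 := stape e (False # False # ?t))) 1 (\<tau>(0 := stape e (False # ?t)))"
      using runs_Pop[of "\<tau>(0 := stape e (False # False # ?t))" 0 e False "False # ?t"] by simp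
    have p3: "runs (Pop 0) ?\<tau>1 1 (\<tau>(0 := stape e (False # False # ?t)))"
      using runs_Pop[of ?\<tau>1 0 e True "False # False # ?t"] True by simp
    have "runs (Branch 0 {2}
     (Seq (Pop 0) (Seq (Pop 0) (Seq (Pop 0) (Emit k True))))
     (Seq (Pop 0) (Emit k False))) ?\<tau>1 (Suc (Suc (1 + Suc (1 + Suc (1 + 1))))) ?\<tau>2"
      by (rule runs_Branch) (use runs_Seq[OF p3 runs_Seq[OF p2 runs_Seq[OF p1 e]]] True in simp)
    then show ?thesis by (intro exI conjI) simp_all
  next
    case False
    have e: "runs (Emit k False) (\<tau>(0 := stape e ?t)) 1 ?\<tau>2"
      using runs_Emit[of "\<tau>(0 := stape e ?t)" k ys False] Cons.prems False by simp
    have p1: "runs (Pop 0) ?\<tau>1 1 (\<tau>(0 := stape e ?t))"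
      using runs_Pop[of ?\<tau>1 0 e False ?t] False by simp
    have "runs (Branch 0 {2}
     (Seq (Pop 0) (Seq (Pop 0) (Seq (Pop 0) (Emit k True))))
     (Seq (Pop 0) (Emit k False))) ?\<tau>1 (Suc (Suc (1 + 1))) ?\<tau>2"
      by (rule runs_Branch) (use runs_Seq[OF p1 e] False in simp)
    then show ?thesis by (intro exI conjI) simp_all
  qed
  then obtain n where n: "n \<le> 10" "runs (Branch 0 {2}
     (Seq (Pop 0) (Seq (Pop 0) (Seq (Pop 0) (Emit k True))))
     (Seq (Pop 0) (Emit k False))) ?\<tau>1 n ?\<tau>2"
    by (elim exE conjE)
  note 2 = runs_Seq[OF 1 n(2)]
  obtain m \<tau>' where m: "m \<le> 20 * length xs + 1" "runs (Write_word k) ?\<tau>2 m \<tau>'"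
    "fst (\<tau>' k) = word_content ((ys @ [x]) @ xs)"
    using Cons.IH[of ?\<tau>2 "ys @ [x]"] Cons.prems by (simp del: fun_upd_apply add: fun_upd_same fun_upd_other) blast
  have "runs (Write_word k) \<tau> (Suc (Suc (1 + n) + m)) \<tau>'"
    unfolding Write_word_def
    by (rule runs_Loop_step[OF _ 2 m(2)[unfolded Write_word_def]]) (simp add: Cons.prems)
  then show ?case
    using n(1) m(1,3) by (intro exI[of _ "Suc (Suc (1 + n) + m)"] exI[of _ \<tau>'] conjI) simp_all
qed

lemma polytime_computable_FP:
  fixes f :: "bool list \<Rightarrow> bool list"
  assumes "FP f"
  shows "polytime_computable f"
proof -
  have r: "tree_of_bits bs = rep bs" for bs
    by (induction bs) (auto simp: rep_bool_def)
  obtain c k0 b where c: "polybd sz (\<lambda>x. sz (f x))" "polybd sz b"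
    "\<And>k. k \<ge> k0 \<Longrightarrow> wf_com k c \<and> tprog c k b f"
    using FPE[OF assms(1)] by metis
  define k where "k = max 2 k0"
  have k: "k \<ge> 2" "wf_com k c" "tprog c k b f"
    using c(3)[of k] by (auto simp: k_def)
  let ?c = "Seq Read_word (Seq c (Write_word k))"
  let ?b = "\<lambda>x :: bool list. 30 * length x + 10 + b x + 20 * sz (f x) + 10"
  show ?thesis
  \<comment> \<open>The program \<open>c\<close> uses only tapes below \<open>k\<close>, and tape
    \<open>k\<close>, the last one, receives the output.\<close>
  proof (rule polytime_computable_com[where K = "k + 1" and c = ?c and b = ?b])
    show "wf_com (k + 1) ?c"
      using k wf_com_mono[of k c "k + 1"] by (auto simp: Read_word_def Write_word_def Emit_def)
    have "sz x \<le> 4 * length x + 1" for x :: "bool list"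
      using tsize_tree_of_bits(2)[of x] by (simp add: r sz_def)
    then have s: "polybd length (\<lambda>x :: bool list. sz x)"
      by (rule polybd_mono[rotated]) (intro polybd_intros)
    show "polybd length ?b"
      using polybd_comp[OF c(1) s] polybd_comp[OF c(2) s] by (intro polybd_intros)
  next
    fix x :: "bool list"
    let ?st = "(\<lambda>_. [])(0 := x)"
    let ?st2 = "?st(0 := ser (rep x), 0 := ser (rep (f x)))"
    define E where "E j = (if j = 0 then int (length x) else 0)" for j :: nat
    have i: "init_tapes x = (\<lambda>j. stape (E j) (?st j))"
      by (auto simp: init_tapes_def stape_def E_def fun_eq_iff)
    have "exec Read_word ?st (30 * length x + 10) (?st(0 := ser (rep x)))"
      using exec_Read_word[of ?st x] by (simp add: r)
    then obtain n1 where n1: "n1 \<le> 30 * length x + 10"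
      "runs Read_word (init_tapes x) n1 (\<lambda>j. stape (E j) ((?st(0 := ser (rep x))) j))"
      unfolding exec_def i by blast
    have "exec c (?st(0 := ser (rep x))) (b x) ?st2"
      by (rule tprogD[OF k(3)]) auto
    then obtain n2 where n2: "n2 \<le> b x"
      "runs c (\<lambda>j. stape (E j) ((?st(0 := ser (rep x))) j)) n2 (\<lambda>j. stape (E j) (?st2 j))"
      unfolding exec_def by blast
    obtain n3 \<tau> where n3: "n3 \<le> 20 * length (f x) + 1"
      "runs (Write_word k) (\<lambda>j. stape (E j) (?st2 j)) n3 \<tau>" "fst (\<tau> k) = word_content ([] @ f x)"
      using runs_Write_word[of k "\<lambda>j. stape (E j) (?st2 j)" "E 0" "f x" "[]"] k
      by (auto simp: r stape_def E_def)
    have "n1 + Suc (n2 + n3) + 1 \<le> ?b x"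
      using n1(1) n2(1) n3(1) tsize_tree_of_bits(1)[of "f x"] by (simp add: r sz_def)
    then show "\<exists>n\<le>?b x. \<exists>\<tau>. runs ?c (init_tapes x) n \<tau> \<and> fst (\<tau> (k + 1 - 1)) = word_content (f x)"
      using runs_Seq[OF n1(2) runs_Seq[OF n2(2) n3(2)]] n3(3) by (intro exI[of _ "Suc (n1 + Suc (n2 + n3))"]) auto
  qed simp
qed

section \<open>Sizes of lists, and closure of \<open>FP\<close> under constructors and case
  distinctions\<close>

lemma sz_nat: "sz (n :: nat) = 2 * n + 1"
  by (induction n) auto

lemma sz_bool_le: "sz (b :: bool) \<le> 3"
  by (cases b) auto

lemma sz_append [simp]: "sz (xs @ ys) + 1 = sz xs + sz ys"
  by (induction xs) auto

lemma sz_append_le: "sz (xs @ ys) \<le> sz xs + sz ys"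
  using sz_append[of xs ys] by linarith

lemma sz_rev [simp]: "sz (rev xs) = sz xs"
proof (induction xs)
  case (Cons a xs)
  then show ?case using sz_append[of "rev xs" "[a]"] by simp
qed simp

lemma sz_mem: "x \<in> set xs \<Longrightarrow> sz x < sz xs"
  by (induction xs) auto

lemma length_less_sz: "length xs < sz xs"
  by (induction xs) (auto simp: sz_pos)

lemma sz_list_le:
  assumes "length xs \<le> n" "\<And>x. x \<in> set xs \<Longrightarrow> sz x \<le> m"
  shows "sz xs \<le> n * (m + 1) + 1"
proof -
  have "sz xs \<le> length xs * (m + 1) + 1"
    using assms(2)
  proof (induction xs)
    case (Cons a xs)
    then have "sz a \<le> m" "sz xs \<le> length xs * (m + 1) + 1" by auto
    then show ?case by simp
  qed simp
  also have "\<dots> \<le> n * (m + 1) + 1"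
    using assms(1) by (intro add_mono mult_mono) auto
  finally show ?thesis .
qed

lemma sz_filter_le: "sz (filter P xs) \<le> sz xs"
  by (induction xs) auto

lemma sz_take_le: "sz (take k xs) \<le> sz xs"
proof (induction xs arbitrary: k)
  case (Cons a xs)
  then show ?case by (cases k) auto
qed simp

lemma sz_drop_le: "sz (drop k xs) \<le> sz xs"
proof (induction xs arbitrary: k)
  case (Cons a xs)
  show ?case
  proof (cases k)
    case (Suc j)
    then show ?thesis using Cons[of j] by simp
  qed simp
qed simp

lemma polybd_FP: "FP f \<Longrightarrow> polybd sz (\<lambda>x. sz (f x))"
  by (simp add: FP_def)

lemma FP_cong: "FP f \<Longrightarrow> (\<And>x. g x = f x) \<Longrightarrow> FP g"
  by (erule FP_transport) simp

named_theorems FP_intros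

declare FP_id [FP_intros] FP_const [FP_intros] FP_Pair [FP_intros]

lemma FP_fst' [FP_intros]: "FP f \<Longrightarrow> FP (\<lambda>x. fst (f x))"
  by (rule FP_comp[OF FP_fst])

lemma FP_snd' [FP_intros]: "FP f \<Longrightarrow> FP (\<lambda>x. snd (f x))"
  by (rule FP_comp[OF FP_snd])

lemma FP_Cons [FP_intros]: "FP f \<Longrightarrow> FP g \<Longrightarrow> FP (\<lambda>x. f x # g x)"
  by (rule FP_transport[OF FP_Pair[of f g]]) (simp_all add: rep_prod_def)

lemma FP_Suc [FP_intros]: "FP f \<Longrightarrow> FP (\<lambda>x. Suc (f x))"
  by (rule FP_transport[OF FP_Pair[OF FP_const[of Lf], of f]]) (simp_all add: rep_prod_def)

lemma FP_Some [FP_intros]: "FP f \<Longrightarrow> FP (\<lambda>x. Some (f x))"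
  by (rule FP_transport[OF FP_Pair[of f, OF _ FP_const[of Lf]]]) (simp_all add: rep_prod_def rep_option_def)

lemma FP_rep: "FP f \<Longrightarrow> FP (\<lambda>x. rep (f x))"
  by (erule FP_transport) simp

lemma FP_if [FP_intros]:
  assumes "FP P" "FP f" "FP g"
  shows "FP (\<lambda>x. if P x then f x else g x)"
  by (rule FP_cong[OF FP_if_Lf[OF assms(1,3,2)]]) (simp add: rep_bool_def)

lemma FP_not [FP_intros]: "FP P \<Longrightarrow> FP (\<lambda>x. \<not> P x)"
  by (rule FP_cong[OF FP_if[of P "\<lambda>_. False" "\<lambda>_. True"]]) (auto intro: FP_const)

lemma FP_conj [FP_intros]: "FP P \<Longrightarrow> FP Q \<Longrightarrow> FP (\<lambda>x. P x \<and> Q x)"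
  by (rule FP_cong[OF FP_if[of P Q "\<lambda>_. False"]]) (auto intro: FP_const)

lemma FP_disj [FP_intros]: "FP P \<Longrightarrow> FP Q \<Longrightarrow> FP (\<lambda>x. P x \<or> Q x)"
  by (rule FP_cong[OF FP_if[of P "\<lambda>_. True" Q]]) (auto intro: FP_const)

lemma FP_imp [FP_intros]: "FP P \<Longrightarrow> FP Q \<Longrightarrow> FP (\<lambda>x. P x \<longrightarrow> Q x)"
  by (rule FP_cong[OF FP_if[of P Q "\<lambda>_. True"]]) (auto intro: FP_const)

text \<open>A nonempty list or a successor has the same code as the pair of its parts, so taking it
  apart does not change the code. The value \<open>u\<close> only makes the function total.\<close>

lemma FP_destructor:
  assumes "\<And>x. rep x \<noteq> Lf \<Longrightarrow> rep (d x) = rep x" "\<And>x. rep x = Lf \<Longrightarrow> d x = u"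
  shows "FP d"
  by (rule FP_transport[OF FP_if_Lf[OF FP_id FP_const[of "rep u"] FP_rep[OF FP_id]]]) (use assms in auto)

lemma FP_case_aux:
  assumes "FP l" "FP f" "FP g" "FP d" "\<And>x. k x = (if rep (l x) = Lf then f x else g (x, d (l x)))"
  shows "FP k"
  by (rule FP_cong[OF FP_if_Lf[OF assms(1,2) FP_comp[OF assms(3) FP_Pair[OF FP_id FP_comp[OF assms(4,1)]]]]])
    (rule assms(5))

lemma FP_case_list [FP_intros]:
  assumes "FP l" "FP f" "FP (\<lambda>p. g (fst p) (fst (snd p)) (snd (snd p)))"
  shows "FP (\<lambda>x. case l x of [] \<Rightarrow> f x | y # ys \<Rightarrow> g x y ys)"
  by (rule FP_case_aux[OF assms
      FP_destructor[of "\<lambda>l. case l of [] \<Rightarrow> undefined | y # ys \<Rightarrow> (y, ys)" undefined]])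
    (auto split: list.splits simp: rep_prod_def)

lemma rep_nat_eq_Lf [simp]: "rep (n :: nat) = Lf \<longleftrightarrow> n = 0"
  by (cases n) auto

lemma FP_case_nat [FP_intros]:
  assumes "FP l" "FP f" "FP (\<lambda>p. g (fst p) (snd p))"
  shows "FP (\<lambda>x. case l x of 0 \<Rightarrow> f x | Suc n \<Rightarrow> g x n)"
  by (rule FP_case_aux[OF assms(1,2) FP_comp[OF assms(3), of "\<lambda>p. (fst p, snd (snd p))"]
      FP_destructor[of "\<lambda>l. case l of 0 \<Rightarrow> undefined | Suc n \<Rightarrow> (Lf, n)" undefined]])
    (auto split: nat.splits simp: rep_prod_def intro!: FP_intros)

lemma FP_case_option [FP_intros]:
  assumes "FP l" "FP f" "FP (\<lambda>p. g (fst p) (snd p))"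
  shows "FP (\<lambda>x. case l x of None \<Rightarrow> f x | Some y \<Rightarrow> g x y)"
  by (rule FP_case_aux[OF assms(1,2) FP_comp[OF assms(3), of "\<lambda>p. (fst p, fst (snd p))"]
      FP_destructor[of "\<lambda>l. case l of None \<Rightarrow> undefined | Some y \<Rightarrow> (y, Lf)" undefined]])
    (auto split: option.splits simp: rep_prod_def rep_option_def intro!: FP_intros)

lemma FP_case_tree [FP_intros]:
  assumes "FP l" "FP f" "FP (\<lambda>p. g (fst p) (fst (snd p)) (snd (snd p)))"
  shows "FP (\<lambda>x. case l x of Lf \<Rightarrow> f x | Nd a b \<Rightarrow> g x a b)"
  by (rule FP_case_aux[OF assms
      FP_destructor[of "\<lambda>l. case l of Lf \<Rightarrow> undefined | Nd a b \<Rightarrow> (a, b)" undefined]])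
    (auto split: tree.splits simp: rep_prod_def)

lemma FP_Let [FP_intros]:
  assumes "FP f" "FP (\<lambda>p. g (fst p) (snd p))"
  shows "FP (\<lambda>x. let y = f x in g x y)"
  using FP_comp[OF assms(2) FP_Pair[OF FP_id assms(1)]] by simp

lemma FP_comp2:
  assumes "FP (\<lambda>p. h (fst p) (snd p))" "FP f" "FP g"
  shows "FP (\<lambda>x. h (f x) (g x))"
  using FP_comp[OF assms(1) FP_Pair[OF assms(2,3)]] by simp

lemma FP_comp3:
  assumes "FP (\<lambda>p. h (fst p) (fst (snd p)) (snd (snd p)))" "FP f" "FP g" "FP k"
  shows "FP (\<lambda>x. h (f x) (g x) (k x))"
  using FP_comp[OF assms(1) FP_Pair[OF assms(2) FP_Pair[OF assms(3,4)]]] by simp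

subsection \<open>Bounded iteration\<close>

text \<open>The parameter \<open>c\<close> travels along in the state, since the iterated program
  sees nothing but the state.\<close>

lemma FP_iterate:
  fixes f :: "'c :: rep \<Rightarrow> 'a :: rep \<Rightarrow> 'a"
  assumes "FP m" "FP a" "FP (\<lambda>p. f (fst p) (snd p))" "polybd sz B"
    and B: "\<And>c i. i \<le> sz (m c) \<Longrightarrow> sz ((f c ^^ i) (a c)) \<le> B c"
  shows "FP (\<lambda>c. (f c ^^ sz (m c)) (a c))"
proof -
  let ?s = "\<lambda>p. (fst p, f (fst p) (snd p))"
  have it: "(?s ^^ i) (c, x) = (c, (f c ^^ i) x)" for i c x
    by (induct i) simp_all
  have "FP (\<lambda>c. (?s ^^ sz (m c)) (c, a c))"
  proof (rule FP_iter[where B = "\<lambda>c. sz c + B c + 1"])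
    show "polybd sz (\<lambda>c. sz c + B c + 1)"
      by (intro polybd_intros assms(4))
    show "sz ((?s ^^ i) (c, a c)) \<le> sz c + B c + 1" if "i \<le> sz (m c)" for c i
      using B[OF that] by (simp add: it)
  qed (intro FP_intros assms)+
  from FP_comp[OF FP_snd this] show ?thesis by (simp add: it)
qed

text \<open>The state consists of the remaining list and the accumulator. There are
  \<open>sz (l c)\<close> rounds, which is more than the length of the list; the surplus rounds idle
  on the empty list.\<close>

lemma FP_fold:
  assumes "FP l" "FP a" "FP (\<lambda>p. f (fst p) (fst (snd p)) (snd (snd p)))" "polybd sz B"
    and B: "\<And>c k. k \<le> length (l c) \<Longrightarrow> sz (fold (f c) (take k (l c)) (a c)) \<le> B c"
  shows "FP (\<lambda>c. fold (f c) (l c) (a c))"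
proof -
  let ?s = "\<lambda>c p. case fst p of [] \<Rightarrow> p | x # xs \<Rightarrow> (xs, f c x (snd p))"
  have it: "(?s c ^^ i) (xs, x) = (drop i xs, fold (f c) (take i xs) x)" for i c xs x
  proof (induction i)
    case (Suc i)
    show ?case
    proof (cases "drop i xs")
      case Nil
      then show ?thesis using Suc by simp
    next
      case (Cons y ys)
      then have "i < length xs" "y = xs ! i" "ys = drop (Suc i) xs"
        by (metis drop_eq_Nil list.distinct(1) not_le, metis Cons_nth_drop_Suc drop_eq_Nil list.distinct(1) list.inject not_le,
          metis drop_Suc list.sel(3) tl_drop)
      then show ?thesis using Suc Cons by (simp add: take_Suc_conv_app_nth)
    qed
  qed simp
  have "FP (\<lambda>c. (?s c ^^ sz (l c)) (l c, a c))"
  proof (rule FP_iterate[where B = "\<lambda>c. sz (l c) + B c + 1"])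
    show "polybd sz (\<lambda>c. sz (l c) + B c + 1)"
      by (intro polybd_intros assms(4) polybd_FP assms(1))
    show "sz ((?s c ^^ i) (l c, a c)) \<le> sz (l c) + B c + 1" for c i
      using B[of "min i (length (l c))" c] sz_drop_le[of i "l c"] unfolding it
      by (cases "i \<le> length (l c)") simp_all
    have "FP (\<lambda>p. case fst (snd p) of [] \<Rightarrow> snd p | x # xs \<Rightarrow> (xs, f (fst p) x (snd (snd p))))"
      by (intro FP_intros FP_comp3[OF assms(3)])
    then show "FP (\<lambda>p. ?s (fst p) (snd p))" .
  qed (intro FP_intros assms)+
  from FP_comp[OF FP_snd this] show ?thesis
    using length_less_sz[of "l c" for c] by (simp add: it less_imp_le)
qed

subsection \<open>Lists and unary numbers\<close>

lemma polybd_FP_nat: "FP f \<Longrightarrow> polybd sz (\<lambda>x. f x :: nat)"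
  by (rule polybd_mono[OF polybd_FP]) (auto simp: sz_nat)

lemma polybd_FP_length: "FP f \<Longrightarrow> polybd sz (\<lambda>x. length (f x))"
  by (rule polybd_mono[OF polybd_FP]) (auto simp: length_less_sz less_imp_le)

lemma FP_funpow:
  fixes f :: "'c :: rep \<Rightarrow> 'a :: rep \<Rightarrow> 'a"
  assumes "FP n" "FP a" "FP (\<lambda>p. f (fst p) (snd p))" "polybd sz B"
    and B: "\<And>c i. i \<le> n c \<Longrightarrow> sz ((f c ^^ i) (a c)) \<le> B c"
  shows "FP (\<lambda>c. (f c ^^ n c) (a c))"
proof -
  \<comment> \<open>A unary number has the same code as a list of that many \<open>False\<close>, so
    the list to fold over comes for free.\<close>
  have r: "rep (replicate k False) = rep k" for k
    by (induction k) (auto simp: rep_bool_def)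
  have e: "fold (\<lambda>_. g) (replicate k False) = g ^^ k" for g :: "'a \<Rightarrow> 'a" and k
    by (induction k) (auto simp: funpow_swap1 fun_eq_iff)
  have l: "FP (\<lambda>c. replicate (n c) False)"
    by (rule FP_transport[OF assms(1)]) (rule r)
  have "FP (\<lambda>c. fold (\<lambda>_. f c) (replicate (n c) False) (a c))"
  proof (rule FP_fold[OF l assms(2) _ assms(4)])
    show "FP (\<lambda>p. f (fst p) (snd (snd p)))"
      by (intro FP_comp2[OF assms(3)] FP_intros)
  qed (use B in \<open>auto simp: e\<close>)
  then show ?thesis by (simp add: e)
qed

lemma FP_rev [FP_intros]: "FP l \<Longrightarrow> FP (\<lambda>c. rev (l c))"
  by (rule FP_cong[OF FP_fold[of l "\<lambda>_. []" "\<lambda>_. Cons" "\<lambda>c. sz (l c)"]])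
    (auto intro!: FP_intros polybd_FP simp: fold_Cons_rev sz_take_le)

lemma FP_append [FP_intros]: "FP l \<Longrightarrow> FP m \<Longrightarrow> FP (\<lambda>c. l c @ m c)"
proof (rule FP_cong[OF FP_fold[of "\<lambda>c. rev (l c)" m "\<lambda>_. Cons" "\<lambda>c. sz (l c) + sz (m c)"]])
  fix c k
  have "sz (fold Cons (take k (rev (l c))) (m c)) \<le> sz (take k (rev (l c))) + sz (m c)"
    using sz_append_le[of "rev (take k (rev (l c)))" "m c"] by (simp add: fold_Cons_rev)
  also have "\<dots> \<le> sz (l c) + sz (m c)"
    using sz_take_le[of k "rev (l c)"] by simp
  finally show "sz (fold Cons (take k (rev (l c))) (m c)) \<le> sz (l c) + sz (m c)" .
qed (auto intro!: FP_intros polybd_intros polybd_FP simp: fold_Cons_rev)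

lemma FP_map [FP_intros]:
  assumes f: "FP (\<lambda>p. f (fst p) (snd p))" and l: "FP l"
  shows "FP (\<lambda>c. map (f c) (l c))"
proof -
  obtain d where d: "\<And>p. sz (f (fst p) (snd p)) \<le> (sz p + 2) ^ d"
    using polybd_FP[OF f] unfolding polybd_def by blast
  let ?m = "\<lambda>c. (sz c + sz (l c) + 3) ^ d"
  let ?B = "\<lambda>c. length (l c) * (?m c + 1) + 1"
  have e: "fold (\<lambda>x s. f c x # s) xs [] = rev (map (f c) xs)" for c xs
    using fold_append[of "\<lambda>x s. f c x # s"] by (induction xs rule: rev_induct) auto
  have "FP (\<lambda>c. rev (fold (\<lambda>x s. f c x # s) (l c) []))"
  proof (intro FP_rev FP_fold[where B = ?B])
    show "polybd sz ?B"
      by (intro polybd_intros polybd_FP_length polybd_FP l)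
    show "sz (fold (\<lambda>x s. f c x # s) (take k (l c)) []) \<le> ?B c" for c k
      unfolding e sz_rev
    proof (rule sz_list_le)
      fix y assume "y \<in> set (map (f c) (take k (l c)))"
      then obtain x where x: "x \<in> set (l c)" "y = f c x"
        by (auto dest: in_set_takeD)
      then show "sz y \<le> ?m c"
        using d[of "(c, x)"] sz_mem[OF x(1)]
        by (auto intro: order_trans[OF _ power_mono])
    qed auto
  qed (intro FP_intros l FP_comp2[OF f])+
  then show ?thesis by (simp add: e)
qed

lemma FP_filter [FP_intros]:
  assumes P: "FP (\<lambda>p. P (fst p) (snd p))" and l: "FP l"
  shows "FP (\<lambda>c. filter (P c) (l c))"
proof -
  have e: "fold (\<lambda>x s. if P c x then x # s else s) xs [] = rev (filter (P c) xs)" for c xs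
    by (induction xs rule: rev_induct) auto
  have "FP (\<lambda>c. rev (fold (\<lambda>x s. if P c x then x # s else s) (l c) []))"
  proof (intro FP_rev FP_fold[where B = "\<lambda>c. sz (l c)"])
    show "sz (fold (\<lambda>x s. if P c x then x # s else s) (take k (l c)) []) \<le> sz (l c)" for c k
      unfolding e sz_rev by (rule order_trans[OF sz_filter_le sz_take_le])
  qed (intro FP_intros l FP_comp2[OF P] polybd_FP)+
  then show ?thesis by (simp add: e)
qed

lemma sz_concat_le: "sz (concat ls) \<le> sz ls"
proof (induction ls)
  case (Cons l ls)
  then show ?case using sz_append_le[of l "concat ls"] by simp
qed simp

lemma FP_concat [FP_intros]:
  fixes l :: "'a :: rep \<Rightarrow> 'b :: rep list list"
  assumes l: "FP l"
  shows "FP (\<lambda>c. concat (l c))"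
proof -
  have e: "fold (\<lambda>x s. s @ x) xs [] = concat xs" for xs :: "'b list list"
    by (induction xs rule: rev_induct) auto
  have "FP (\<lambda>c. fold (\<lambda>x s. s @ x) (l c) [])"
  proof (intro FP_fold[where B = "\<lambda>c. sz (l c)"])
    show "sz (fold (\<lambda>x s. s @ x) (take k (l c)) []) \<le> sz (l c)" for c k
      unfolding e by (rule order_trans[OF sz_concat_le sz_take_le])
  qed (intro FP_intros l polybd_FP)+
  then show ?thesis by (simp add: e)
qed

lemma FP_is_Nil:
  assumes "FP l"
  shows "FP (\<lambda>c. l c = [])"
  by (rule FP_cong[OF FP_case_list[OF assms, of "\<lambda>_. True" "\<lambda>_ _ _. False"]])
    (auto intro: FP_intros split: list.split)

lemma FP_Ball [FP_intros]:
  assumes "FP l" "FP (\<lambda>p. P (fst p) (snd p))"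
  shows "FP (\<lambda>c. \<forall>x \<in> set (l c). P c x)"
  by (rule FP_cong[OF FP_is_Nil[OF FP_filter[OF FP_not[OF assms(2)] assms(1)]]])
    (auto simp: filter_empty_conv)

lemma FP_Bex [FP_intros]:
  assumes "FP l" "FP (\<lambda>p. P (fst p) (snd p))"
  shows "FP (\<lambda>c. \<exists>x \<in> set (l c). P c x)"
  by (rule FP_cong[OF FP_not[OF FP_Ball[OF assms(1) FP_not[OF assms(2)]]]]) auto

lemma FP_length [FP_intros]:
  fixes l :: "'a :: rep \<Rightarrow> 'b :: rep list"
  assumes "FP l"
  shows "FP (\<lambda>c. length (l c))"
proof -
  have e: "fold (\<lambda>_. Suc) xs 0 = length xs" for xs :: "'b list"
    by (induction xs rule: rev_induct) auto
  have "FP (\<lambda>c. fold (\<lambda>_. Suc) (l c) 0)"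
  proof (intro FP_fold[where B = "\<lambda>c. 2 * length (l c) + 1"])
    show "sz (fold (\<lambda>_. Suc) (take k (l c)) 0) \<le> 2 * length (l c) + 1" for c k
      unfolding e by (simp add: sz_nat)
  qed (intro FP_intros assms polybd_intros polybd_FP_length)+
  then show ?thesis by (simp add: e)
qed

lemma FP_plus [FP_intros]:
  fixes m n :: "'a :: rep \<Rightarrow> nat"
  assumes "FP m" "FP n"
  shows "FP (\<lambda>c. m c + n c)"
proof -
  have e: "(Suc ^^ i) j = j + i" for i j
    by (induction i) auto
  have "FP (\<lambda>c. (Suc ^^ n c) (m c))"
  proof (intro FP_funpow[where B = "\<lambda>c. 2 * (m c + n c) + 1"])
    show "sz ((Suc ^^ i) (m c)) \<le> 2 * (m c + n c) + 1" if "i \<le> n c" for c i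
      using that unfolding e by (simp add: sz_nat)
  qed (intro FP_intros assms polybd_intros polybd_FP_nat)+
  then show ?thesis unfolding e .
qed

lemma FP_times [FP_intros]:
  fixes m n :: "'a :: rep \<Rightarrow> nat"
  assumes "FP m" "FP n"
  shows "FP (\<lambda>c. m c * n c)"
proof -
  have e: "((\<lambda>s. s + k) ^^ i) 0 = k * i" for i k :: nat
    by (induction i) auto
  have "FP (\<lambda>c. ((\<lambda>s. s + m c) ^^ n c) 0)"
  proof (intro FP_funpow[where B = "\<lambda>c. 2 * (m c * n c) + 1"])
    show "sz (((\<lambda>s. s + m c) ^^ i) 0) \<le> 2 * (m c * n c) + 1" if "i \<le> n c" for c i
      using that unfolding e by (simp add: sz_nat)
  qed (intro FP_intros assms polybd_intros polybd_FP_nat FP_comp[OF assms(1)])+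
  then show ?thesis by (simp add: e)
qed

lemma FP_diff [FP_intros]:
  fixes m n :: "'a :: rep \<Rightarrow> nat"
  assumes "FP m" "FP n"
  shows "FP (\<lambda>c. m c - n c)"
proof -
  let ?p = "\<lambda>k :: nat. case k of 0 \<Rightarrow> 0 | Suc j \<Rightarrow> j"
  have e: "(?p ^^ i) j = j - i" for i j
    by (induction i) (auto split: nat.split)
  have "FP (\<lambda>c. (?p ^^ n c) (m c))"
  proof (intro FP_funpow[where B = "\<lambda>c. 2 * m c + 1"])
    show "sz ((?p ^^ i) (m c)) \<le> 2 * m c + 1" for c i
      unfolding e by (simp add: sz_nat)
  qed (intro FP_intros assms polybd_intros polybd_FP_nat)+
  then show ?thesis by (simp add: e)
qed

lemma FP_is_0: "FP n \<Longrightarrow> FP (\<lambda>c. n c = (0 :: nat))"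
  by (rule FP_cong[OF FP_case_nat[of n "\<lambda>_. True" "\<lambda>_ _. False"]])
    (auto intro: FP_intros split: nat.split)

lemma FP_le [FP_intros]:
  fixes m n :: "'a :: rep \<Rightarrow> nat"
  shows "FP m \<Longrightarrow> FP n \<Longrightarrow> FP (\<lambda>c. m c \<le> n c)"
  by (rule FP_cong[OF FP_is_0[OF FP_diff[of m n]]]) auto

lemma FP_less [FP_intros]:
  fixes m n :: "'a :: rep \<Rightarrow> nat"
  shows "FP m \<Longrightarrow> FP n \<Longrightarrow> FP (\<lambda>c. m c < n c)"
  by (rule FP_cong[OF FP_le[OF FP_Suc[of m], of n]]) auto

lemma FP_min [FP_intros]:
  fixes m n :: "'a :: rep \<Rightarrow> nat"
  shows "FP m \<Longrightarrow> FP n \<Longrightarrow> FP (\<lambda>c. min (m c) (n c))"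
  unfolding min_def by (intro FP_intros)

lemma FP_upt [FP_intros]:
  fixes m n :: "'a :: rep \<Rightarrow> nat"
  assumes "FP m" "FP n"
  shows "FP (\<lambda>c. [m c..<n c])"
proof -
  have e: "((\<lambda>s. length s # s) ^^ i) [] = rev [0..<i]" for i
    by (induction i) auto
  have e2: "map ((+) a) [0..<b - a] = [a..<b]" for a b :: nat
    by (rule nth_equalityI) auto
  have "FP (\<lambda>c. map ((+) (m c)) (rev (((\<lambda>s. length s # s) ^^ (n c - m c)) [])))"
  proof (intro FP_map FP_rev FP_funpow[where B = "\<lambda>c. n c * (2 * n c + 2) + 1"])
    show "sz (((\<lambda>s. length s # s) ^^ i) []) \<le> n c * (2 * n c + 2) + 1" if "i \<le> n c - m c" for c i
      unfolding e sz_rev using that sz_list_le[of "[0..<i]" "n c" "2 * n c + 1"] by (auto simp: sz_nat)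
  qed (intro FP_intros assms polybd_intros polybd_FP_nat FP_comp[OF assms(1)])+
  then show ?thesis unfolding e rev_rev_ident e2 .
qed

lemma FP_all_less [FP_intros]:
  fixes n :: "'a :: rep \<Rightarrow> nat"
  assumes "FP n" "FP (\<lambda>p. P (fst p) (snd p))"
  shows "FP (\<lambda>c. \<forall>i < n c. P c i)"
  by (rule FP_cong[OF FP_Ball[OF FP_upt[OF FP_const[of 0] assms(1)] assms(2)]]) auto

lemma FP_ex_less [FP_intros]:
  fixes n :: "'a :: rep \<Rightarrow> nat"
  assumes "FP n" "FP (\<lambda>p. P (fst p) (snd p))"
  shows "FP (\<lambda>c. \<exists>i < n c. P c i)"
  by (rule FP_cong[OF FP_Bex[OF FP_upt[OF FP_const[of 0] assms(1)] assms(2)]]) auto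

lemma FP_replicate [FP_intros]:
  assumes "FP n" "FP x"
  shows "FP (\<lambda>c. replicate (n c) (x c))"
  by (rule FP_cong[OF FP_map[of "\<lambda>c _. x c", OF FP_comp[OF assms(2) FP_fst] FP_upt[OF FP_const[of 0] assms(1)]]])
    (simp add: map_replicate_const)

lemma FP_drop [FP_intros]:
  fixes l :: "'a :: rep \<Rightarrow> 'b :: rep list"
  assumes "FP n" "FP l"
  shows "FP (\<lambda>c. drop (n c) (l c))"
proof -
  let ?t = "\<lambda>k. case k of [] \<Rightarrow> [] | y # ys \<Rightarrow> ys"
  have e: "(?t ^^ i) xs = drop i xs" for i and xs :: "'b list"
  proof -
    have "?t = (tl :: 'b list \<Rightarrow> 'b list)"
      by (auto simp: fun_eq_iff split: list.split)
    then show ?thesis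
      by (induction i) (auto simp: drop_Suc tl_drop)
  qed
  have "FP (\<lambda>c. (?t ^^ n c) (l c))"
  proof (intro FP_funpow[where B = "\<lambda>c. sz (l c)"])
    show "sz ((?t ^^ i) (l c)) \<le> sz (l c)" for c i
      unfolding e by (rule sz_drop_le)
  qed (intro FP_intros assms polybd_FP)+
  then show ?thesis by (simp add: e)
qed

lemma FP_nth_default [FP_intros]:
  assumes "FP d" "FP l" "FP n"
  shows "FP (\<lambda>c. nth_default (d c) (l c) (n c))"
proof (rule FP_cong[OF FP_case_list[of "\<lambda>c. drop (n c) (l c)" d "\<lambda>_ y _. y"]])
  show "nth_default (d c) (l c) (n c) = (case drop (n c) (l c) of [] \<Rightarrow> d c | y # ys \<Rightarrow> y)" for c
    by (cases "n c < length (l c)")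
      (auto simp: nth_default_def Cons_nth_drop_Suc[symmetric])
qed (intro FP_intros assms)+

lemma FP_half: "FP n \<Longrightarrow> FP (\<lambda>c. (n c div 2, odd (n c :: nat)))"
proof -
  assume n: "FP n"
  let ?f = "\<lambda>p. if snd p then (Suc (fst p), False) else (fst p, True)"
  have e: "(?f ^^ i) (0, False) = (i div 2, odd i)" for i
    by (induction i) auto
  have "FP (\<lambda>c. (?f ^^ n c) (0, False))"
  proof (intro FP_funpow[where B = "\<lambda>c. 2 * n c + 5"])
    show "sz ((?f ^^ i) (0, False)) \<le> 2 * n c + 5" if "i \<le> n c" for c i
      unfolding e using that sz_bool_le[of "odd i"] by (simp add: sz_nat)
  qed (intro FP_intros n polybd_intros polybd_FP_nat)+
  then show ?thesis by (simp add: e)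
qed

lemma FP_div2 [FP_intros]: "FP n \<Longrightarrow> FP (\<lambda>c. n c div (2 :: nat))"
  using FP_comp[OF FP_fst FP_half, of n] by simp

lemma FP_odd [FP_intros]: "FP n \<Longrightarrow> FP (\<lambda>c. odd (n c :: nat))"
  using FP_comp[OF FP_snd FP_half, of n] by simp

subsection \<open>Equality\<close>

text \<open>Two trees are compared by working off a list of pairs of subtrees; the list is stuck at the
  first pair with distinct roots.\<close>

definition tree_eq_step :: "(tree \<times> tree) list \<Rightarrow> (tree \<times> tree) list" where
  "tree_eq_step w = (case w of [] \<Rightarrow> [] | p # w' \<Rightarrow>
     (case fst p of
        Lf \<Rightarrow> (case snd p of Lf \<Rightarrow> w' | Nd c d \<Rightarrow> w)
      | Nd a b \<Rightarrow> (case snd p of Lf \<Rightarrow> w | Nd c d \<Rightarrow> (a, c) # (b, d) # w')))"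

lemma sz_tree_eq_step: "sz ((tree_eq_step ^^ i) w) \<le> sz w"
proof (induction i)
  case (Suc i)
  have "sz (tree_eq_step w) \<le> sz w" for w
    by (auto simp: tree_eq_step_def split: list.split tree.split)
  from this[of "(tree_eq_step ^^ i) w"] Suc show ?case by simp
qed simp

text \<open>On equal pairs every step lowers the total size of the left trees by one, so the list
  runs empty in time. An unequal pair always leaves an unequal pair behind, so then the list never
  becomes empty.\<close>

lemma tree_eq_iterate:
  assumes "sum_list (map (\<lambda>p. tsize (fst p)) w) \<le> n"
  shows "(tree_eq_step ^^ n) w = [] \<longleftrightarrow> (\<forall>p \<in> set w. fst p = snd p)"
proof -
  have stuck: "(tree_eq_step ^^ n) [] = []" for n
    by (induction n) (auto simp: tree_eq_step_def)
  have neq: "\<exists>p \<in> set (tree_eq_step w). fst p \<noteq> snd p" if "\<exists>p \<in> set w. fst p \<noteq> snd p" for w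
    using that by (cases w) (auto simp: tree_eq_step_def split: tree.split)
  have neq_n: "\<exists>p \<in> set ((tree_eq_step ^^ n) w). fst p \<noteq> snd p" if "\<exists>p \<in> set w. fst p \<noteq> snd p" for n w
  proof (induction n)
    case (Suc n)
    then show ?case using neq[of "(tree_eq_step ^^ n) w"] by simp
  qed (use that in simp)
  have "(tree_eq_step ^^ n) w = []" if "\<forall>p \<in> set w. fst p = snd p"
    "sum_list (map (\<lambda>p. tsize (fst p)) w) \<le> n" for n w
    using that
  proof (induction n arbitrary: w)
    case 0
    have "tsize t \<noteq> 0" for t
      by (cases t) auto
    with 0 show ?case by (cases w) auto
  next
    case (Suc n)
    show ?case
    proof (cases w)
      case Nil
      then show ?thesis by (simp only: stuck)
    next
      case (Cons p w')
      have "(tree_eq_step ^^ n) (tree_eq_step w) = []"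
        by (rule Suc.IH) (use Suc.prems Cons in \<open>auto simp: tree_eq_step_def split: tree.split\<close>)
      then show ?thesis by (simp add: funpow_swap1)
    qed
  qed
  with neq_n[of w n] assms show ?thesis by fastforce
qed

lemma FP_eq [FP_intros]:
  assumes "FP f" "FP g"
  shows "FP (\<lambda>c. f c = g c)"
proof -
  have s: "FP (\<lambda>p :: 'a \<times> (tree \<times> tree) list. tree_eq_step (snd p))"
    unfolding tree_eq_step_def by (intro FP_intros)
  have "FP (\<lambda>c. (tree_eq_step ^^ sz (f c)) [(rep (f c), rep (g c))] = [])"
    by (intro FP_is_Nil FP_iterate[where B = "\<lambda>c. sz [(rep (f c), rep (g c))]"] polybd_FP
        FP_intros FP_rep assms s sz_tree_eq_step)
  moreover have "(f c = g c) = ((tree_eq_step ^^ sz (f c)) [(rep (f c), rep (g c))] = [])" for c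
    using rep_inject[of "f c" "g c"] by (subst tree_eq_iterate) (auto simp: sz_def)
  ultimately show ?thesis by (simp add: FP_cong)
qed

lemma FP_mem [FP_intros]: "FP x \<Longrightarrow> FP l \<Longrightarrow> FP (\<lambda>c. x c \<in> set (l c))"
  by (rule FP_cong[OF FP_Bex[of l "\<lambda>c y. x c = y"]]) (auto intro!: FP_intros intro: FP_comp)

section \<open>Fixed equilibria as secure paths\<close>

text \<open>The payoff strictly decreases with the hitting time, and any visit is better than none.
  In this form neither infimum nor real numbers occur.\<close>

lemma reach_payoff_le_iff:
  "reach_payoff T \<rho> \<le> reach_payoff T \<pi> \<longleftrightarrow> (\<forall>m. \<rho> m \<in> T \<longrightarrow> (\<exists>m' \<le> m. \<pi> m' \<in> T))"
proof
  assume le: "reach_payoff T \<rho> \<le> reach_payoff T \<pi>"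
  show "\<forall>m. \<rho> m \<in> T \<longrightarrow> (\<exists>m' \<le> m. \<pi> m' \<in> T)"
  proof (intro allI impI)
    fix m assume m: "\<rho> m \<in> T"
    let ?d = "LEAST n. \<rho> n \<in> T" and ?e = "LEAST n. \<pi> n \<in> T"
    have d: "?d \<le> m" using m by (rule Least_le)
    have "0 < 1 / (1 + real ?d)" by simp
    then have ex: "\<exists>n. \<pi> n \<in> T"
      using le m by (auto simp: reach_payoff_eq split: if_splits)
    then have "1 / (1 + real ?d) \<le> 1 / (1 + real ?e)"
      using le m by (auto simp: reach_payoff_eq split: if_splits)
    then have "?e \<le> ?d" by (simp add: field_simps)
    then show "\<exists>m' \<le> m. \<pi> m' \<in> T"
      using d LeastI_ex[OF ex] by (intro exI[of _ ?e]) simp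
  qed
next
  assume hit: "\<forall>m. \<rho> m \<in> T \<longrightarrow> (\<exists>m' \<le> m. \<pi> m' \<in> T)"
  show "reach_payoff T \<rho> \<le> reach_payoff T \<pi>"
  proof (cases "\<exists>n. \<rho> n \<in> T")
    case True
    let ?d = "LEAST n. \<rho> n \<in> T" and ?e = "LEAST n. \<pi> n \<in> T"
    obtain m' where "m' \<le> ?d" "\<pi> m' \<in> T"
      using hit LeastI_ex[OF True] by blast
    then have "?e \<le> ?d" "\<exists>n. \<pi> n \<in> T"
      using Least_le[of "\<lambda>n. \<pi> n \<in> T" m'] by auto
    then show ?thesis
      using True by (auto simp: reach_payoff_eq field_simps)
  next
    case False
    then show ?thesis by (simp add: reach_payoff_eq)
  qed
qed

text \<open>The first visit yields the largest fraction, so the bound can be demanded of all visits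
  and no minimum has to be found.\<close>

lemma reach_payoff_le_const_iff:
  "reach_payoff T \<pi> \<le> t \<longleftrightarrow> 0 \<le> t \<and> (\<forall>m. \<pi> m \<in> T \<longrightarrow> 1 / (1 + real m) \<le> t)"
proof (cases "\<exists>n. \<pi> n \<in> T")
  case True
  let ?d = "LEAST n. \<pi> n \<in> T"
  have d: "\<pi> ?d \<in> T" using True by (rule LeastI_ex)
  have "1 / (1 + real m) \<le> 1 / (1 + real ?d)" if "\<pi> m \<in> T" for m
    using Least_le[of "\<lambda>n. \<pi> n \<in> T", OF that] by (simp add: field_simps)
  moreover have "0 < 1 / (1 + real ?d)" by simp
  ultimately have "(1 / (1 + real ?d) \<le> t) \<longleftrightarrow> 0 \<le> t \<and> (\<forall>m. \<pi> m \<in> T \<longrightarrow> 1 / (1 + real m) \<le> t)"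
    using d by (meson less_imp_le order_trans)
  then show ?thesis using True by (simp add: reach_payoff_eq)
qed (auto simp: reach_payoff_eq)

locale leader_game =
  fixes G :: "('p, 'v) game" and v0 :: 'v and L :: 'p and M :: "('q, 'v) mealy" and T :: "'p \<Rightarrow> 'v set"
  assumes G: "wf_game G" and v0: "v0 \<in> verts G" and L: "L \<in> players G" and M: "wf_mealy G L M"
    and payoff: "\<And>i \<pi>. i \<in> players G \<Longrightarrow> is_play G \<pi> \<Longrightarrow> payoff G i \<pi> = reach_payoff (T i) \<pi>"
begin

abbreviation states :: "('q \<times> 'v) set" where
  "states \<equiv> mealy_states M \<times> verts G"

text \<open>In the state \<open>(q, u)\<close> the machine is in state \<open>q\<close> and about to read \<open>u\<close>.\<close>

definition move :: "'q \<times> 'v \<Rightarrow> 'q \<times> 'v \<Rightarrow> bool" where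
  "move x y \<longleftrightarrow> (if snd x \<in> part G L
     then Act (fst x) (snd x) (fst y) (snd y) \<in> mealy_trans M
     else Read (fst x) (snd x) (fst y) \<in> mealy_trans M \<and> (snd x, snd y) \<in> edges G)"

text \<open>\<open>win i k\<close>: player \<open>i\<close> can enforce a visit to the target within \<open>k\<close> steps, against
  all other players and against the nondeterminism of the machine.\<close>

definition win_step :: "'p \<Rightarrow> ('q \<times> 'v) set \<Rightarrow> ('q \<times> 'v) set" where
  "win_step i W = {x \<in> states. snd x \<in> T i \<or>
     (if snd x \<in> part G i \<and> i \<noteq> L
      then \<forall>q'. Read (fst x) (snd x) q' \<in> mealy_trans M \<longrightarrow> (\<exists>v. (snd x, v) \<in> edges G \<and> (q', v) \<in> W)
      else \<forall>y. move x y \<longrightarrow> y \<in> W)}"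

fun win :: "'p \<Rightarrow> nat \<Rightarrow> ('q \<times> 'v) set" where
  "win i 0 = {x \<in> states. snd x \<in> T i}"
| "win i (Suc k) = win_step i (win i k)"

definition path :: "(nat \<Rightarrow> 'q \<times> 'v) \<Rightarrow> bool" where
  "path \<rho> \<longleftrightarrow> \<rho> 0 = (mealy_init M, v0) \<and> (\<forall>n. move (\<rho> n) (\<rho> (Suc n)))"

text \<open>At position \<open>n\<close> the machine reads a vertex of \<open>i\<close>, and its
  next state is fixed before the vertex is chosen: after a move to \<open>v\<close> the product is
  in \<open>(fst (\<rho> (Suc n)), v)\<close> at time \<open>n + 1\<close>. A visit that can be
  forced within \<open>k\<close> further steps must not beat the path.\<close>

definition secure :: "(nat \<Rightarrow> 'q \<times> 'v) \<Rightarrow> bool" where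
  "secure \<rho> \<longleftrightarrow> (\<forall>i \<in> players G - {L}. \<forall>n v k. snd (\<rho> n) \<in> part G i \<and> (snd (\<rho> n), v) \<in> edges G \<and>
     (fst (\<rho> (Suc n)), v) \<in> win i k \<longrightarrow> (\<exists>m \<le> n + 1 + k. snd (\<rho> m) \<in> T i))"

lemma edge_verts: "(u, v) \<in> edges G \<Longrightarrow> u \<in> verts G \<and> v \<in> verts G"
  using G by (auto simp: wf_game_def)

lemma owner_unique: "i \<in> players G \<Longrightarrow> j \<in> players G \<Longrightarrow> u \<in> part G i \<Longrightarrow> u \<in> part G j \<Longrightarrow> i = j"
  using G unfolding wf_game_def by blast

lemma part_verts: "i \<in> players G \<Longrightarrow> u \<in> part G i \<Longrightarrow> u \<in> verts G"
  using G by (auto simp: wf_game_def)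

lemma owner_exists: "u \<in> verts G \<Longrightarrow> \<exists>i \<in> players G. u \<in> part G i"
  using G by (auto simp: wf_game_def)

lemma finite_states: "finite states"
  using G M by (auto simp: wf_game_def wf_mealy_def)

lemma trans_Read: "Read p u q \<in> mealy_trans M \<Longrightarrow> p \<in> mealy_states M \<and> u \<in> verts G - part G L \<and> q \<in> mealy_states M"
  using M unfolding wf_mealy_def by fastforce

lemma trans_Act: "Act p u q v \<in> mealy_trans M \<Longrightarrow> p \<in> mealy_states M \<and> u \<in> part G L \<and> q \<in> mealy_states M \<and>
    v \<in> verts G \<and> (u, v) \<in> edges G"
  using M unfolding wf_mealy_def by fastforce

lemma move_states: "move x y \<Longrightarrow> x \<in> states \<and> y \<in> states \<and> (snd x, snd y) \<in> edges G"
  using trans_Read trans_Act edge_verts part_verts[OF L] by (cases x; cases y) (auto simp: move_def split: if_splits)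

lemma init_states: "(mealy_init M, v0) \<in> states"
  using M v0 by (auto simp: wf_mealy_def)

lemma move_exists:
  assumes "x \<in> states"
  shows "\<exists>y. move x y"
proof -
  obtain q u where x: "x = (q, u)" "q \<in> mealy_states M" "u \<in> verts G"
    using assms by auto
  then obtain \<tau> where \<tau>: "\<tau> \<in> mealy_trans M" "trans_key \<tau> = (q, u)"
    using M unfolding wf_mealy_def by blast
  show ?thesis
  proof (cases \<tau>)
    case (Read p w q')
    obtain v where "(u, v) \<in> edges G" using G x(3) by (auto simp: wf_game_def)
    then have "move x (q', v)"
      using Read \<tau> x trans_Read[of p w q'] by (auto simp: move_def)
    then show ?thesis by blast
  next
    case (Act p w q' v)
    then have "move x (q', v)"
      using \<tau> x trans_Act[of p w q' v] by (auto simp: move_def)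
    then show ?thesis by blast
  qed
qed

lemma win_states: "win i k \<subseteq> states"
  by (cases k) (auto simp: win_step_def)

lemma win_step_mono: "A \<subseteq> B \<Longrightarrow> win_step i A \<subseteq> win_step i B"
  by (simp add: win_step_def subset_iff) blast

lemma win_Suc_mono: "win i k \<subseteq> win i (Suc k)"
proof (induction k)
  case (Suc k)
  then show ?case unfolding win.simps by (rule win_step_mono)
qed (auto simp: win_step_def)

lemma win_mono: "j \<le> k \<Longrightarrow> win i j \<subseteq> win i k"
  using win_Suc_mono by (rule lift_Suc_mono_le)

text \<open>Each set of the chain is a function of the previous one, so the chain is constant once
  two successive sets agree, and before that it grows by at least one state in each step.\<close>

lemma win_stable:
  assumes "card states \<le> N"
  shows "win i k \<subseteq> win i N"
proof -
  have "finite (range (win i))"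
    using win_states finite_states by (intro finite_subset[of "range (win i)" "Pow states"]) auto
  then have "win i (card states) = (\<Union>n. win i n)"
    using win_states finite_states
    by (intro finite_mono_strict_prefix_implies_finite_fixpoint finite_mono_remains_stable_implies_strict_prefix)
      (auto simp: mono_iff_le_Suc win_Suc_mono[unfolded win.simps])
  then show ?thesis using win_mono[OF assms, of i] by blast
qed

section \<open>Outcomes, and runs of the machine along plays\<close>

lemma history_of_play:
  assumes "is_play G \<pi>" "\<pi> 0 = v0"
  shows "is_history G v0 (map \<pi> [0..<Suc n])"
  unfolding is_history_def
proof (intro conjI)
  show "successively (\<lambda>u v. (u, v) \<in> edges G) (map \<pi> [0..<Suc n])"
    using assms(1) by (induction n) (auto simp: successively_append_iff is_play_def)
qed (use assms in \<open>auto simp: is_play_def hd_map upt_conv_Cons simp del: upt_Suc\<close>)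

lemma upd_profile:
  "is_profile G v0 \<sigma> \<Longrightarrow> is_strategy G v0 i s \<Longrightarrow> is_profile G v0 (\<sigma>(i := s))"
  by (auto simp: is_profile_def)

lemma outcome_compatible: "is_profile G v0 \<sigma> \<Longrightarrow> compatible_play G v0 \<sigma> (outcome G v0 \<sigma>)"
  unfolding outcome_def by (rule theI'[OF ex1_compatible_play[OF G v0]])

lemma outcome_eqI: "is_profile G v0 \<sigma> \<Longrightarrow> compatible_play G v0 \<sigma> \<pi> \<Longrightarrow> outcome G v0 \<sigma> = \<pi>"
  using ex1_compatible_play[OF G v0, of \<sigma>] outcome_compatible[of \<sigma>] by blast

lemma compatible_step:
  assumes "compatible_play G v0 \<sigma> \<pi>" "i \<in> players G" "\<pi> n \<in> part G i"
  shows "\<pi> (Suc n) = \<sigma> i (map \<pi> [0..<Suc n])"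
  using assms unfolding compatible_play_def by blast

definition machine_run :: "('v list \<Rightarrow> 'v) \<Rightarrow> ('v list \<Rightarrow> 'q) \<Rightarrow> bool" where
  "machine_run s st \<longleftrightarrow> st [] = mealy_init M \<and> (\<forall>h v. is_history G v0 (h @ [v]) \<longrightarrow>
     (if v \<in> part G L then Act (st h) v (st (h @ [v])) (s (h @ [v])) \<in> mealy_trans M
      else Read (st h) v (st (h @ [v])) \<in> mealy_trans M))"

lemma Comp_iff: "s \<in> Comp G v0 L M \<longleftrightarrow> is_strategy G v0 L s \<and> (\<exists>st. machine_run s st)"
  by (simp add: Comp_def machine_run_def)

lemma machine_run_move:
  assumes st: "machine_run (\<sigma> L) st" and \<pi>: "compatible_play G v0 \<sigma> \<pi>"
  shows "move (st (map \<pi> [0..<n]), \<pi> n) (st (map \<pi> [0..<Suc n]), \<pi> (Suc n))"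
proof -
  have p: "is_play G \<pi>" "\<pi> 0 = v0" using \<pi> by (auto simp: compatible_play_def)
  have e: "map \<pi> [0..<Suc n] = map \<pi> [0..<n] @ [\<pi> n]" by simp
  have "if \<pi> n \<in> part G L
    then Act (st (map \<pi> [0..<n])) (\<pi> n) (st (map \<pi> [0..<Suc n])) (\<sigma> L (map \<pi> [0..<Suc n])) \<in> mealy_trans M
    else Read (st (map \<pi> [0..<n])) (\<pi> n) (st (map \<pi> [0..<Suc n])) \<in> mealy_trans M"
    using st history_of_play[OF p, of n] unfolding machine_run_def e by blast
  then show ?thesis
    using compatible_step[OF \<pi> L, of n] p by (auto simp: move_def is_play_def simp del: upt_Suc split: if_splits)
qed

text \<open>A player \<open>i\<close> who could force a visit after leaving for \<open>v\<close> is
  given the strategy \<open>s\<close> that leaves and then stays in the attractor. Leader's strategy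
  is unchanged, so the machine states \<open>st\<close> also cover the new play. Since
  \<open>s\<close> does not pay, the original play visits the target by time
  \<open>n + 1 + k\<close>.\<close>

lemma secure_path_of_fixed_NE:
  assumes NE: "fixed_NE G v0 L \<sigma>" and C: "\<sigma> L \<in> Comp G v0 L M"
  shows "\<exists>\<rho>. path \<rho> \<and> secure \<rho> \<and> (\<lambda>n. snd (\<rho> n)) = outcome G v0 \<sigma>"
proof -
  define \<pi> where "\<pi> = outcome G v0 \<sigma>"
  have prof: "is_profile G v0 \<sigma>" using NE by (simp add: fixed_NE_def)
  have \<pi>: "compatible_play G v0 \<sigma> \<pi>" unfolding \<pi>_def by (rule outcome_compatible[OF prof])
  have play: "is_play G \<pi>" "\<pi> 0 = v0" using \<pi> by (auto simp: compatible_play_def)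
  obtain st where st: "machine_run (\<sigma> L) st" using C by (auto simp: Comp_iff)
  define \<rho> where "\<rho> n = (st (map \<pi> [0..<n]), \<pi> n)" for n
  have "path \<rho>"
    using machine_run_move[OF st \<pi>] st play(2) by (simp add: path_def \<rho>_def machine_run_def del: upt_Suc)
  moreover have "secure \<rho>"
    unfolding secure_def
  proof (intro ballI allI impI)
    fix i n v k
    assume i: "i \<in> players G - {L}"
      and dev: "snd (\<rho> n) \<in> part G i \<and> (snd (\<rho> n), v) \<in> edges G \<and> (fst (\<rho> (Suc n)), v) \<in> win i k"
    define P where "P = map \<pi> [0..<Suc n]"
    \<comment> \<open>The target is due at position \<open>n + 1 + k\<close>. The vertex chosen
      after \<open>h\<close> has position \<open>length h\<close>, which leaves
      \<open>k + n + 1 - length h\<close> steps.\<close>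
    define good where "good h v' \<longleftrightarrow> (last h, v') \<in> edges G \<and> (st h, v') \<in> win i (k + n + 1 - length h)" for h v'
    define s where "s h = (if h = P then v else if length h > Suc n \<and> (\<exists>v'. good h v') then SOME v'. good h v' else \<sigma> i h)" for h
    have good: "good h (s h)" if "length h > Suc n" "good h v'" for h v'
    proof -
      have "h \<noteq> P" using that(1) by (auto simp: P_def)
      then show ?thesis using that someI[of "good h" v'] by (auto simp: s_def)
    qed
    have s: "is_strategy G v0 i s"
      unfolding is_strategy_def
    proof (intro allI impI)
      fix h assume h: "is_history G v0 h \<and> last h \<in> part G i"
      then have "(last h, \<sigma> i h) \<in> edges G"
        using prof i by (auto simp: is_profile_def is_strategy_def)
      moreover have "last P = \<pi> n" by (simp add: P_def)
      moreover have "(last h, s h) \<in> edges G" if "length h > Suc n" "good h v'" for v'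
        using good[OF that] by (simp add: good_def)
      moreover have "s h = \<sigma> i h" if "h \<noteq> P" "\<not> (length h > Suc n \<and> (\<exists>v'. good h v'))"
        using that by (auto simp: s_def)
      moreover have "s P = v" by (simp add: s_def)
      ultimately show "(last h, s h) \<in> edges G"
        using dev unfolding \<rho>_def snd_conv by metis
    qed
    define \<sigma>' where "\<sigma>' = \<sigma>(i := s)"
    have prof': "is_profile G v0 \<sigma>'" unfolding \<sigma>'_def by (rule upd_profile[OF prof s])
    define \<pi>' where "\<pi>' = outcome G v0 \<sigma>'"
    have \<pi>': "compatible_play G v0 \<sigma>' \<pi>'" unfolding \<pi>'_def by (rule outcome_compatible[OF prof'])
    have play': "is_play G \<pi>'" "\<pi>' 0 = v0" using \<pi>' by (auto simp: compatible_play_def)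
    have \<sigma>'L: "\<sigma>' L = \<sigma> L" using i by (auto simp: \<sigma>'_def)
    have st': "machine_run (\<sigma>' L) st" using st by (simp add: \<sigma>'L)
    have same: "\<pi>' m = \<pi> m" if "m \<le> n" for m
      using that
    proof (induction m rule: less_induct)
      case (less m)
      show ?case
      proof (cases m)
        case 0
        then show ?thesis by (simp add: play play')
      next
        case (Suc l)
        have h: "map \<pi>' [0..<Suc l] = map \<pi> [0..<Suc l]" "\<pi>' l = \<pi> l"
          using less Suc by auto
        obtain j where j: "j \<in> players G" "\<pi> l \<in> part G j"
          using owner_exists play(1) by (auto simp: is_play_def)
        have "map \<pi> [0..<Suc l] \<noteq> P" "\<not> length (map \<pi> [0..<Suc l]) > Suc n"
          using less.prems Suc by (auto simp: P_def dest: arg_cong[of _ _ length])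
        then have "\<sigma>' j (map \<pi> [0..<Suc l]) = \<sigma> j (map \<pi> [0..<Suc l])"
          by (auto simp: \<sigma>'_def s_def)
        then show ?thesis
          using compatible_step[OF \<pi> j] compatible_step[OF \<pi>' j(1), of l] j
          unfolding h Suc by simp
      qed
    qed
    have P': "map \<pi>' [0..<Suc n] = P"
      using same by (auto simp: P_def)
    have i_n: "\<pi>' n \<in> part G i" using dev same[of n] by (simp add: \<rho>_def)
    have "\<pi>' (Suc n) = s P"
      using compatible_step[OF \<pi>', of i n] i i_n by (simp add: P' \<sigma>'_def del: upt_Suc)
    then have v: "\<pi>' (Suc n) = v" by (simp add: s_def)
    define q where "q m = st (map \<pi>' [0..<m])" for m
    have mv: "move (q m, \<pi>' m) (q (Suc m), \<pi>' (Suc m))" for m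
      unfolding q_def by (rule machine_run_move[OF st' \<pi>'])
    \<comment> \<open>After \<open>j\<close> steps of the deviation the target has been seen or can
      be forced within the remaining \<open>k - j\<close> steps; for \<open>j = k\<close> both cases
      are a visit.\<close>
    have "(\<exists>m \<le> n + 1 + j. \<pi>' m \<in> T i) \<or> (q (n + 1 + j), \<pi>' (n + 1 + j)) \<in> win i (k - j)" if "j \<le> k" for j
      using that
    proof (induction j)
      case 0
      then show ?case using dev v by (simp add: q_def P' \<rho>_def P_def del: upt_Suc)
    next
      case (Suc j)
      let ?m = "n + 1 + j"
      show ?case
      proof (cases "\<exists>m \<le> ?m. \<pi>' m \<in> T i")
        case True
        then obtain m where "m \<le> ?m" "\<pi>' m \<in> T i" by blast
        then show ?thesis by (intro disjI1 exI[of _ m]) auto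
      next
        case False
        then have w: "(q ?m, \<pi>' ?m) \<in> win i (k - j)" using Suc by auto
        obtain l where l: "k - j = Suc l" "k - Suc j = l" using Suc.prems
          by (metis Suc_diff_Suc less_eq_Suc_le)
        have nT: "\<pi>' ?m \<notin> T i" using False by blast
        have "(q (Suc ?m), \<pi>' (Suc ?m)) \<in> win i l"
        proof (cases "\<pi>' ?m \<in> part G i")
          case True
          let ?h = "map \<pi>' [0..<Suc ?m]"
          have "\<pi>' ?m \<notin> part G L" using owner_unique[of i L] True i L by blast
          then have "Read (q ?m) (\<pi>' ?m) (q (Suc ?m)) \<in> mealy_trans M"
            using mv[of ?m] by (auto simp: move_def)
          then obtain v' where "(\<pi>' ?m, v') \<in> edges G" "(q (Suc ?m), v') \<in> win i l"
            using w True nT i by (auto simp: l win_step_def)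
          then have "good ?h v'"
            using l by (simp add: good_def q_def del: upt_Suc) (simp add: Suc_diff_le)
          then have "good ?h (s ?h)"
            by (intro good) auto
          moreover have "\<pi>' (Suc ?m) = s ?h"
            using compatible_step[OF \<pi>', of i ?m] True i by (simp add: \<sigma>'_def del: upt_Suc)
          ultimately show ?thesis
            using l by (auto simp: good_def q_def simp del: upt_Suc)
        next
          case False
          then show ?thesis using w nT mv[of ?m] by (auto simp: l win_step_def)
        qed
        then show ?thesis by (simp add: l)
      qed
    qed
    from this[of k] have "\<exists>m \<le> n + 1 + k. \<pi>' m \<in> T i" by auto
    then obtain m where m: "m \<le> n + 1 + k" "\<pi>' m \<in> T i" by blast
    have "payoff G i \<pi>' \<le> payoff G i \<pi>"
      using NE i s unfolding fixed_NE_def \<pi>_def \<pi>'_def \<sigma>'_def by blast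
    then have "reach_payoff (T i) \<pi>' \<le> reach_payoff (T i) \<pi>"
      using payoff i play play' by simp
    then obtain m' where "m' \<le> m" "\<pi> m' \<in> T i"
      using m unfolding reach_payoff_le_iff by blast
    then show "\<exists>m \<le> n + 1 + k. snd (\<rho> m) \<in> T i"
      using m by (intro exI[of _ m']) (auto simp: \<rho>_def)
  qed
  moreover have "(\<lambda>n. snd (\<rho> n)) = outcome G v0 \<sigma>" by (simp add: \<rho>_def \<pi>_def)
  ultimately show ?thesis by blast
qed

text \<open>If every \<open>a\<close> were bad for some \<open>k\<close> with \<open>Q k\<close>,
  then the largest of these finitely many \<open>k\<close> would still satisfy \<open>Q\<close>, and
  there every \<open>a\<close> would be bad. This turns one good move per deadline into a single
  move for all deadlines.\<close>

lemma uniform_choice: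
  fixes Q :: "nat \<Rightarrow> bool"
  assumes "finite A" "A \<noteq> {}"
    and Q: "\<And>j k. j \<le> k \<Longrightarrow> Q k \<Longrightarrow> Q j" and B: "\<And>a j k. j \<le> k \<Longrightarrow> B a j \<Longrightarrow> B a k"
    and ex: "\<And>k. Q k \<Longrightarrow> \<exists>a \<in> A. \<not> B a k"
  shows "\<exists>a \<in> A. \<forall>k. Q k \<longrightarrow> \<not> B a k"
proof (rule ccontr)
  assume "\<not> ?thesis"
  then obtain f where f: "\<And>a. a \<in> A \<Longrightarrow> Q (f a) \<and> B a (f a)" by metis
  have K: "Max (f ` A) \<in> f ` A" using assms(1,2) by (intro Max_in) auto
  then have "Q (Max (f ` A))" using f by auto
  then obtain a where a: "a \<in> A" "\<not> B a (Max (f ` A))" using ex by blast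
  have "f a \<le> Max (f ` A)" using assms(1) a by auto
  then show False using a f B by blast
qed

text \<open>A move of the coalition against player \<open>i\<close> that delays the attractor as long as possible.
  In a state of player \<open>i\<close> the coalition only chooses the next state of the machine.\<close>

definition delays :: "'p \<Rightarrow> 'q \<times> 'v \<Rightarrow> 'q \<times> 'v \<Rightarrow> bool" where
  "delays i x y \<longleftrightarrow> move x y \<and> (\<forall>k. x \<notin> win i (Suc k) \<longrightarrow>
     (if snd x \<in> part G i \<and> i \<noteq> L then \<forall>v. (snd x, v) \<in> edges G \<longrightarrow> (fst y, v) \<notin> win i k
      else y \<notin> win i k))"

lemma delays_exists:
  assumes x: "x \<in> states" and i: "i \<in> players G"
  shows "\<exists>y. delays i x y"
proof -
  let ?A = "{y. move x y}"
  let ?B = "\<lambda>y k. if snd x \<in> part G i \<and> i \<noteq> L then \<exists>v. (snd x, v) \<in> edges G \<and> (fst y, v) \<in> win i k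
    else y \<in> win i k"
  have "?A \<subseteq> states" using move_states by blast
  then have "finite ?A" using finite_states by (rule finite_subset)
  moreover have "?A \<noteq> {}" using move_exists[OF x] by blast
  moreover have "j \<le> k \<Longrightarrow> x \<notin> win i (Suc k) \<Longrightarrow> x \<notin> win i (Suc j)" for j k
    using win_mono[of "Suc j" "Suc k" i] by blast
  moreover have "j \<le> k \<Longrightarrow> ?B a j \<Longrightarrow> ?B a k" for a j k
    using win_mono[of j k i] by (auto split: if_splits)
  moreover have "\<exists>a \<in> ?A. \<not> ?B a k" if k: "x \<notin> win i (Suc k)" for k
  proof (cases "snd x \<in> part G i \<and> i \<noteq> L")
    case True
    then obtain q' where q': "Read (fst x) (snd x) q' \<in> mealy_trans M"
      "\<And>v. (snd x, v) \<in> edges G \<Longrightarrow> (q', v) \<notin> win i k"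
      using k x by (auto simp: win_step_def)
    \<comment> \<open>Any successor completes \<open>q'\<close> to a move, because in a state of
      player \<open>i\<close> only the machine state of the move counts.\<close>
    obtain v where "(snd x, v) \<in> edges G" using G x by (auto simp: wf_game_def)
    then have "move x (q', v)"
      using q' trans_Read[OF q'(1)] by (simp add: move_def)
    then show ?thesis using q' True by (intro bexI[of _ "(q', v)"]) auto
  next
    case False
    then show ?thesis using k x by (auto simp: win_step_def split: if_splits)
  qed
  ultimately have "\<exists>y \<in> ?A. \<forall>k. x \<notin> win i (Suc k) \<longrightarrow> \<not> ?B y k"
    by (rule uniform_choice[where Q = "\<lambda>k. x \<notin> win i (Suc k)" and B = ?B])
  then show ?thesis unfolding delays_def by (auto split: if_splits)
qed

text \<open>All players, Leader included, use the same \<open>f\<close>: they follow the path and,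
  once somebody has left it, delay the attractor of the culprit, with \<open>st\<close> taking the
  corresponding transitions. By security the play after a deviation is outside
  \<open>win i k\<close> for every deadline that would be an improvement, and delaying moves keep it
  outside until the deadline has passed.\<close>

lemma fixed_NE_of_secure_path:
  assumes \<rho>: "path \<rho>" and sec: "secure \<rho>"
  shows "\<exists>\<sigma>. fixed_NE G v0 L \<sigma> \<and> \<sigma> L \<in> Comp G v0 L M \<and> outcome G v0 \<sigma> = (\<lambda>n. snd (\<rho> n))"
proof -
  define \<pi> where "\<pi> n = snd (\<rho> n)" for n
  have mv: "move (\<rho> n) (\<rho> (Suc n))" for n using \<rho> by (simp add: path_def)
  have \<pi>0: "\<pi> 0 = v0" using \<rho> by (simp add: path_def \<pi>_def)
  have play: "is_play G \<pi>"
    using move_states[OF mv] by (auto simp: is_play_def \<pi>_def mem_Times_iff)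
  define own where "own u = (SOME i. i \<in> players G \<and> u \<in> part G i)" for u
  have own: "own u \<in> players G \<and> u \<in> part G (own u)" if "u \<in> verts G" for u
    unfolding own_def by (rule someI_ex) (use owner_exists[OF that] in blast)
  define on where "on h \<longleftrightarrow> h = map \<pi> [0..<length h]" for h
  text \<open>The player who is the first to leave the path.\<close>
  define culprit where "culprit h = own (\<pi> ((LEAST n. n < length h \<and> h ! n \<noteq> \<pi> n) - 1))" for h
  define c where "c i x = (SOME y. delays i x y)" for i x
  \<comment> \<open>Histories grow at the end, so the recursion runs over reversed
    histories.\<close>
  define rst where "rst = rec_list (mealy_init M) (\<lambda>v h q. if on (rev (v # h)) then fst (\<rho> (Suc (length h)))
    else fst (c (culprit (rev (v # h))) (q, v)))"
  define st where "st h = rst (rev h)" for h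
  have st_Nil: "st [] = mealy_init M" by (simp add: st_def rst_def)
  have st_snoc: "st (h @ [v]) = (if on (h @ [v]) then fst (\<rho> (Suc (length h)))
    else fst (c (culprit (h @ [v])) (st h, v)))" for h v
    by (simp add: st_def rst_def)
  \<comment> \<open>Off the path, \<open>st h\<close> and \<open>f h\<close> are the two components
    of the same choice \<open>c\<close>; hence they form a legal transition also where Leader
    moves.\<close>
  define f where "f h = (if on h then \<pi> (length h) else snd (c (culprit h) (st (butlast h), last h)))" for h
  have culprit: "culprit h \<in> players G" for h
    using own play by (auto simp: culprit_def is_play_def)
  have c: "delays i x (c i x)" if "x \<in> states" "i \<in> players G" for i x
    unfolding c_def by (rule someI_ex) (rule delays_exists[OF that])
  have on_map: "on (map \<pi> [0..<n])" for n by (simp add: on_def)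
  have st_on: "st (map \<pi> [0..<n]) = fst (\<rho> n)" for n
  proof (cases n)
    case 0
    then show ?thesis using \<rho> by (simp add: st_Nil path_def)
  next
    case (Suc m)
    then show ?thesis using st_snoc[of "map \<pi> [0..<m]" "\<pi> m"] on_map[of "Suc m"] by simp
  qed
  have hist_step: "is_history G v0 h" if "is_history G v0 (h @ [v])" "h \<noteq> []" for h v
    using that by (auto simp: is_history_def successively_append_iff)
  \<comment> \<open>The move is part of the induction, because only the legality of the previous
    transition ensures that the machine state from which \<open>c\<close> chooses exists.\<close>
  have run: "move (st h, v) (st (h @ [v]), f (h @ [v])) \<and> (\<not> on (h @ [v]) \<longrightarrow>
      (st (h @ [v]), f (h @ [v])) = c (culprit (h @ [v])) (st h, v) \<and> (st h, v) \<in> states)"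
    if "is_history G v0 (h @ [v])" for h v
    using that
  proof (induction h arbitrary: v rule: rev_induct)
    case Nil
    then have "v = v0" by (simp add: is_history_def)
    then have "on ([] @ [v])" by (simp add: on_def \<pi>0)
    then show ?case
      using mv[of 0] \<rho> \<open>v = v0\<close> st_snoc[of "[]" v] by (simp add: f_def st_Nil path_def \<pi>_def)
  next
    case (snoc u h)
    then have q: "move (st h, u) (st (h @ [u]), f (h @ [u]))"
      using hist_step[of "h @ [u]" v] by auto
    have x: "(st (h @ [u]), v) \<in> states"
      using move_states[OF q] snoc.prems by (auto simp: is_history_def)
    show ?case
    proof (cases "on (h @ [u, v])")
      case True
      then have e: "h @ [u] = map \<pi> [0..<Suc (length h)]" "v = \<pi> (Suc (length h))"
        by (auto simp: on_def)
      have "f (h @ [u, v]) = \<pi> (Suc (Suc (length h)))" using True by (simp add: f_def)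
      moreover have "st ((h @ [u]) @ [v]) = fst (\<rho> (Suc (Suc (length h))))"
        using True by (simp only: st_snoc) simp
      moreover have "st (h @ [u]) = fst (\<rho> (Suc (length h)))"
        unfolding e(1) by (rule st_on)
      ultimately show ?thesis
        using mv[of "Suc (length h)"] e True by (simp add: \<pi>_def)
    next
      case False
      then have "(st (h @ [u, v]), f (h @ [u, v])) = c (culprit (h @ [u, v])) (st (h @ [u]), v)"
        using st_snoc[of "h @ [u]" v] by (simp add: f_def butlast_append)
      moreover have "move (st (h @ [u]), v) (c (culprit (h @ [u, v])) (st (h @ [u]), v))"
        using c[OF x culprit] by (simp add: delays_def)
      ultimately show ?thesis using x False by simp
    qed
  qed
  define \<sigma> where "\<sigma> i = f" for i :: 'p
  have strat: "is_strategy G v0 i f" for i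
    unfolding is_strategy_def
  proof (intro allI impI)
    fix h assume h: "is_history G v0 h \<and> last h \<in> part G i"
    then have e: "h = butlast h @ [last h]" by (simp add: is_history_def)
    from run[of "butlast h" "last h"] h e have "move (st (butlast h), last h) (st h, f h)" by simp
    from move_states[OF this] show "(last h, f h) \<in> edges G" by simp
  qed
  have prof: "is_profile G v0 \<sigma>" by (simp add: is_profile_def \<sigma>_def strat)
  have st: "machine_run f st"
    unfolding machine_run_def
  proof (intro conjI allI impI)
    fix h v assume "is_history G v0 (h @ [v])"
    from run[OF this] show "if v \<in> part G L then Act (st h) v (st (h @ [v])) (f (h @ [v])) \<in> mealy_trans M
      else Read (st h) v (st (h @ [v])) \<in> mealy_trans M"
      by (auto simp: move_def split: if_splits)
  qed (rule st_Nil)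
  have comp: "\<sigma> L \<in> Comp G v0 L M"
    using strat st by (auto simp: Comp_iff \<sigma>_def)
  have cp: "compatible_play G v0 \<sigma> \<pi>"
    using play \<pi>0 on_map by (simp add: compatible_play_def \<sigma>_def f_def del: upt_Suc)
  have out: "outcome G v0 \<sigma> = \<pi>" by (rule outcome_eqI[OF prof cp])
  have "payoff G i (outcome G v0 (\<sigma>(i := s))) \<le> payoff G i (outcome G v0 \<sigma>)"
    if i: "i \<in> players G - {L}" and s: "is_strategy G v0 i s" for i s
  proof -
    define \<sigma>' where "\<sigma>' = \<sigma>(i := s)"
    have prof': "is_profile G v0 \<sigma>'" unfolding \<sigma>'_def by (rule upd_profile[OF prof s])
    define \<pi>' where "\<pi>' = outcome G v0 \<sigma>'"
    have \<pi>': "compatible_play G v0 \<sigma>' \<pi>'" unfolding \<pi>'_def by (rule outcome_compatible[OF prof'])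
    have play': "is_play G \<pi>'" "\<pi>' 0 = v0" using \<pi>' by (auto simp: compatible_play_def)
    have st': "machine_run (\<sigma>' L) st" using i st by (auto simp: \<sigma>'_def \<sigma>_def)
    have "\<exists>m' \<le> m. \<pi> m' \<in> T i" if m: "\<pi>' m \<in> T i" for m
    proof (cases "\<forall>n \<le> m. \<pi>' n = \<pi> n")
      case True
      then show ?thesis using m by auto
    next
      case False
      define d where "d = (LEAST n. \<pi>' n \<noteq> \<pi> n)"
      have ex: "\<exists>n. \<pi>' n \<noteq> \<pi> n" using False by blast
      have d: "\<pi>' d \<noteq> \<pi> d" unfolding d_def using ex by (rule LeastI_ex)
      have less_d: "\<pi>' n = \<pi> n" if "n < d" for n
        using not_less_Least[of n "\<lambda>n. \<pi>' n \<noteq> \<pi> n"] that by (auto simp: d_def)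
      have "d \<le> m" using False by (auto simp: d_def intro: Least_le order_trans)
      have "d \<noteq> 0" using d \<pi>0 play' by metis
      then obtain n where n: "d = Suc n" by (cases d) auto
      have pre: "map \<pi>' [0..<Suc n] = map \<pi> [0..<Suc n]"
        using less_d by (simp add: n)
      have "\<pi> n \<in> verts G" using play by (simp add: is_play_def)
      note own_n = own[OF this]
      \<comment> \<open>Everybody but \<open>i\<close> plays \<open>f\<close>, which never leaves
        the path first, so the vertex before the first difference belongs to
        \<open>i\<close>.\<close>
      have own_i: "own (\<pi> n) = i"
      proof (rule ccontr)
        assume "own (\<pi> n) \<noteq> i"
        then have "\<pi>' (Suc n) = f (map \<pi> [0..<Suc n])"
          using compatible_step[OF \<pi>', of "own (\<pi> n)" n] own_n less_d[of n] n pre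
          by (simp add: \<sigma>'_def \<sigma>_def del: upt_Suc)
        then show False using d on_map[of "Suc n"] by (simp add: f_def n del: upt_Suc)
      qed
      have off: "\<not> on (map \<pi>' [0..<l]) \<and> culprit (map \<pi>' [0..<l]) = i" if "l > Suc n" for l
      proof
        show "\<not> on (map \<pi>' [0..<l])"
          using d that by (auto simp: on_def n)
        have "(LEAST n. n < l \<and> map \<pi>' [0..<l] ! n \<noteq> \<pi> n) = Suc n"
          using d less_d that by (intro Least_equality) (auto simp: n not_less[symmetric])
        then show "culprit (map \<pi>' [0..<l]) = i"
          by (simp add: culprit_def own_i)
      qed
      define q where "q l = st (map \<pi>' [0..<l])" for l
      have mv': "move (q l, \<pi>' l) (q (Suc l), \<pi>' (Suc l))" for l
        unfolding q_def by (rule machine_run_move[OF st' \<pi>'])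
      have qn: "q (Suc n) = fst (\<rho> (Suc n))" unfolding q_def pre by (rule st_on)
      obtain k where k: "m = n + 1 + k" using \<open>d \<le> m\<close> n by (metis Suc_eq_plus1 le_Suc_ex)
      show ?thesis
      proof (rule ccontr)
        assume no: "\<not> ?thesis"
        have e: "(\<pi> n, \<pi>' (Suc n)) \<in> edges G"
          using play'(1) less_d[of n] n by (auto simp: is_play_def) (metis lessI)
        \<comment> \<open>\<open>k - j\<close> is the time left until position \<open>m\<close>. For
          \<open>j = k\<close> the play is outside \<open>win i 0\<close>, that is, outside the
          target, contrary to the visit at \<open>m\<close>.\<close>
        have notin: "(q (n + 1 + j), \<pi>' (n + 1 + j)) \<notin> win i (k - j)" if "j \<le> k" for j
          using that
        proof (induction j)
          case 0
          show ?case
          proof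
            assume "(q (n + 1 + 0), \<pi>' (n + 1 + 0)) \<in> win i (k - 0)"
            then have "\<exists>m \<le> n + 1 + k. snd (\<rho> m) \<in> T i"
              using sec i own_n own_i e qn unfolding secure_def \<pi>_def by auto
            then show False using no k by (auto simp: \<pi>_def)
          qed
        next
          case (Suc j)
          let ?m = "n + 1 + j"
          let ?h = "map \<pi>' [0..<?m]"
          obtain l where l: "k - j = Suc l" "k - Suc j = l" using Suc.prems
            by (metis Suc_diff_Suc less_eq_Suc_le)
          have x: "(q ?m, \<pi>' ?m) \<notin> win i (Suc l)" using Suc l by auto
          have h: "?h @ [\<pi>' ?m] = map \<pi>' [0..<Suc ?m]" by simp
          have "is_history G v0 (?h @ [\<pi>' ?m])"
            unfolding h by (rule history_of_play[OF play'])
          from run[OF this] off[of "Suc ?m"]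
          have y: "(q (Suc ?m), f (map \<pi>' [0..<Suc ?m])) = c i (q ?m, \<pi>' ?m)" "(q ?m, \<pi>' ?m) \<in> states"
            unfolding h by (auto simp: q_def simp del: upt_Suc)
          from c[OF y(2), of i] i have dl: "delays i (q ?m, \<pi>' ?m) (q (Suc ?m), f (map \<pi>' [0..<Suc ?m]))"
            unfolding y(1) by blast
          have "(q (Suc ?m), \<pi>' (Suc ?m)) \<notin> win i l"
          proof (cases "\<pi>' ?m \<in> part G i")
            case True
            have "(\<pi>' ?m, \<pi>' (Suc ?m)) \<in> edges G" using play'(1) by (simp add: is_play_def)
            then show ?thesis using dl x True i unfolding delays_def by simp
          next
            case False
            have "\<pi>' ?m \<in> verts G" using play'(1) by (simp add: is_play_def)
            then obtain j' where j': "j' \<in> players G" "\<pi>' ?m \<in> part G j'" using owner_exists by blast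
            then have "j' \<noteq> i" using False by blast
            then have "\<pi>' (Suc ?m) = f (map \<pi>' [0..<Suc ?m])"
              using compatible_step[OF \<pi>' j'] by (simp add: \<sigma>'_def \<sigma>_def del: upt_Suc)
            then show ?thesis using dl x False unfolding delays_def by simp
          qed
          then show ?case by (simp add: l)
        qed
        from notin[of k] have "(q m, \<pi>' m) \<notin> win i 0" by (simp add: k)
        moreover have "(q m, \<pi>' m) \<in> states" using move_states[OF mv'] by blast
        ultimately show False using m by simp
      qed
    qed
    then have "reach_payoff (T i) \<pi>' \<le> reach_payoff (T i) \<pi>"
      unfolding reach_payoff_le_iff by blast
    then show ?thesis
      using payoff i play play' out by (simp add: \<pi>'_def \<sigma>'_def)
  qed
  then have "fixed_NE G v0 L \<sigma>"
    using prof by (simp add: fixed_NE_def)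
  then show ?thesis using comp out by (auto simp: \<pi>_def fun_eq_iff)
qed

lemma not_rational_verification_iff:
  "\<not> rational_verification G v0 L M t \<longleftrightarrow>
    (\<exists>\<rho>. path \<rho> \<and> secure \<rho> \<and> reach_payoff (T L) (\<lambda>n. snd (\<rho> n)) \<le> real_of_rat t)"
proof -
  have play: "is_play G (\<lambda>n. snd (\<rho> n))" if "path \<rho>" for \<rho>
    unfolding is_play_def
  proof (intro allI)
    fix n
    from that have "move (\<rho> n) (\<rho> (Suc n))" by (simp add: path_def)
    from move_states[OF this] show "snd (\<rho> n) \<in> verts G \<and> (snd (\<rho> n), snd (\<rho> (Suc n))) \<in> edges G"
      by auto
  qed
  show ?thesis
  proof
    assume "\<not> rational_verification G v0 L M t"
    then obtain \<sigma> where \<sigma>: "fixed_NE G v0 L \<sigma>" "\<sigma> L \<in> Comp G v0 L M"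
      "payoff G L (outcome G v0 \<sigma>) \<le> real_of_rat t"
      by (auto simp: rational_verification_def not_less)
    then obtain \<rho> where "path \<rho>" "secure \<rho>" "(\<lambda>n. snd (\<rho> n)) = outcome G v0 \<sigma>"
      using secure_path_of_fixed_NE by blast
    then show "\<exists>\<rho>. path \<rho> \<and> secure \<rho> \<and> reach_payoff (T L) (\<lambda>n. snd (\<rho> n)) \<le> real_of_rat t"
      using \<sigma>(3) payoff[OF L play, of \<rho>] by auto
  next
    assume "\<exists>\<rho>. path \<rho> \<and> secure \<rho> \<and> reach_payoff (T L) (\<lambda>n. snd (\<rho> n)) \<le> real_of_rat t"
    then obtain \<rho> where \<rho>: "path \<rho>" "secure \<rho>" "reach_payoff (T L) (\<lambda>n. snd (\<rho> n)) \<le> real_of_rat t" by blast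
    then obtain \<sigma> where "fixed_NE G v0 L \<sigma>" "\<sigma> L \<in> Comp G v0 L M" "outcome G v0 \<sigma> = (\<lambda>n. snd (\<rho> n))"
      using fixed_NE_of_secure_path by blast
    then show "\<not> rational_verification G v0 L M t"
      using \<rho>(3) payoff[OF L play[OF \<rho>(1)]] by (auto simp: rational_verification_def not_less)
  qed
qed

end

subsection \<open>Finite certificates\<close>

context leader_game
begin

text \<open>A finite path whose last \<open>N\<close> steps visit no new target. If \<open>N\<close> is at least the number of
  states, then these steps contain a cycle, which can be repeated forever.\<close>

definition secure_prefix :: "nat \<Rightarrow> ('q \<times> 'v) list \<Rightarrow> bool" where
  "secure_prefix N rs \<longleftrightarrow> N < length rs \<and> rs ! 0 = (mealy_init M, v0) \<and>
     (\<forall>n. Suc n < length rs \<longrightarrow> move (rs ! n) (rs ! Suc n)) \<and>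
     (\<forall>i \<in> players G. \<forall>n < length rs. snd (rs ! n) \<in> T i \<longrightarrow>
        (\<exists>m < length rs - N. snd (rs ! m) \<in> T i)) \<and>
     (\<forall>i \<in> players G - {L}. \<forall>n. Suc n < length rs \<and> snd (rs ! n) \<in> part G i \<longrightarrow>
        (\<forall>v k. (snd (rs ! n), v) \<in> edges G \<and> k \<le> N \<and> (fst (rs ! Suc n), v) \<in> win i k \<longrightarrow>
          (\<exists>m < length rs. m \<le> n + 1 + k \<and> snd (rs ! m) \<in> T i)))"

text \<open>The last \<open>N + 1\<close> positions cannot carry distinct states, and the cycle
  found there is repeated forever. Position \<open>n\<close> of the path is a copy of a position
  \<open>idx n \<le> n\<close> of the prefix, so every deadline only becomes later, and all visits
  that count happen before the cycle.\<close>

lemma secure_path_of_prefix: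
  assumes rs: "secure_prefix N rs" and N: "card states \<le> N" and t: "0 \<le> t"
    and pay: "\<And>n. n < length rs \<Longrightarrow> snd (rs ! n) \<in> T L \<Longrightarrow> 1 / (1 + real n) \<le> t"
  shows "\<exists>\<rho>. path \<rho> \<and> secure \<rho> \<and> reach_payoff (T L) (\<lambda>n. snd (\<rho> n)) \<le> t"
proof -
  note rs' = rs[unfolded secure_prefix_def]
  \<comment> \<open>The first of the last \<open>N + 1\<close> positions.\<close>
  define a where "a = length rs - 1 - N"
  have "N < length rs" using rs' by simp
  then have len: "length rs = a + N + 1" by (simp add: a_def)
  have mv: "move (rs ! n) (rs ! Suc n)" if "Suc n < length rs" for n
    using rs' that by blast
  have tail: "\<exists>m \<le> a. snd (rs ! m) \<in> T i" if "i \<in> players G" "n < length rs" "snd (rs ! n) \<in> T i" for i n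
    using rs' that by (simp add: len less_Suc_eq_le)
  have in_states: "rs ! n \<in> states" if "n < length rs" for n
  proof (cases n)
    case 0
    then show ?thesis using rs' init_states by auto
  next
    case (Suc m)
    then show ?thesis using move_states[OF mv[of m]] that by simp
  qed
  have "\<not> inj_on (\<lambda>n. rs ! n) {a..a + N}"
  proof
    assume "inj_on (\<lambda>n. rs ! n) {a..a + N}"
    moreover have "(\<lambda>n. rs ! n) ` {a..a + N} \<subseteq> states"
      using in_states len by (intro image_subsetI) simp
    ultimately have "card {a..a + N} \<le> card states"
      using finite_states by (rule card_inj_on_le)
    then show False using N by simp
  qed
  then obtain p' r' where "p' \<in> {a..a + N}" "r' \<in> {a..a + N}" "p' \<noteq> r'" "rs ! p' = rs ! r'"
    by (auto simp: inj_on_def)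
  then obtain p r where pr: "a \<le> p" "p < r" "r < length rs" "rs ! p = rs ! r"
    by (cases p' r' rule: linorder_cases) (auto simp: len)
  \<comment> \<open>Positions from \<open>p\<close> on are folded into the cycle
    \<open>{p..<r}\<close>.\<close>
  define idx where "idx n = (if n < p then n else p + (n - p) mod (r - p))" for n
  define \<rho> where "\<rho> n = rs ! idx n" for n
  have idx: "idx n < r" "idx n \<le> n" for n
  proof -
    have "(n - p) mod (r - p) < r - p" using pr by simp
    then have "p + (n - p) mod (r - p) < r" by linarith
    then show "idx n < r" using pr by (auto simp: idx_def)
    have "(n - p) mod (r - p) \<le> n - p" by (rule mod_less_eq_dividend)
    then have "\<not> n < p \<Longrightarrow> p + (n - p) mod (r - p) \<le> n" by linarith
    then show "idx n \<le> n" by (auto simp: idx_def)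
  qed
  have \<rho>_Suc: "\<rho> (Suc n) = rs ! Suc (idx n)" for n
  proof (cases "Suc n < p \<or> Suc n = p")
    case True
    then show ?thesis by (auto simp: \<rho>_def idx_def)
  next
    case False
    then have "p \<le> n" by simp
    then have "Suc n - p = Suc (n - p)" by simp
    moreover have "Suc (p + (n - p) mod (r - p)) = r" if "Suc ((n - p) mod (r - p)) = r - p"
      using that pr by linarith
    ultimately show ?thesis
      using pr \<open>p \<le> n\<close> by (auto simp: \<rho>_def idx_def mod_Suc)
  qed
  have \<rho>_small: "\<rho> m = rs ! m" if "m \<le> a" for m
    using that pr by (cases "m = p") (auto simp: \<rho>_def idx_def)
  have "path \<rho>"
    unfolding path_def
  proof (intro conjI allI)
    show "\<rho> 0 = (mealy_init M, v0)" using \<rho>_small[of 0] rs' by simp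
    show "move (\<rho> n) (\<rho> (Suc n))" for n
      unfolding \<rho>_Suc using mv[of "idx n"] idx[of n] pr by (simp add: \<rho>_def)
  qed
  moreover have "secure \<rho>"
    unfolding secure_def
  proof (intro ballI allI impI)
    fix i n v k
    assume i: "i \<in> players G - {L}" and dev: "snd (\<rho> n) \<in> part G i \<and> (snd (\<rho> n), v) \<in> edges G \<and>
      (fst (\<rho> (Suc n)), v) \<in> win i k"
    \<comment> \<open>The prefix only controls deadlines up to \<open>N\<close>; a later one reduces
      to \<open>N\<close>, where the attractor is already stable.\<close>
    define k' where "k' = min k N"
    have w: "(fst (rs ! Suc (idx n)), v) \<in> win i k'"
      using dev win_stable[OF N, of i k] by (auto simp: k'_def \<rho>_Suc min_def)
    have "Suc (idx n) < length rs" using idx(1)[of n] pr by simp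
    then have "\<exists>m < length rs. m \<le> idx n + 1 + k' \<and> snd (rs ! m) \<in> T i"
      using rs' i w dev by (auto simp: \<rho>_def k'_def)
    then obtain m where m: "m < length rs" "m \<le> idx n + 1 + k'" "snd (rs ! m) \<in> T i" by blast
    \<comment> \<open>A visit in the tail is never the first one, so it can be replaced by a visit
      up to position \<open>a\<close>, where path and prefix coincide.\<close>
    obtain m' where "m' \<le> a" "m' \<le> m" "snd (rs ! m') \<in> T i"
      using tail[of i m] m i by (cases "m \<le> a") (auto intro: that)
    then show "\<exists>m \<le> n + 1 + k. snd (\<rho> m) \<in> T i"
      using m idx(2)[of n] by (intro exI[of _ m']) (auto simp: \<rho>_small k'_def)
  qed
  moreover have "reach_payoff (T L) (\<lambda>n. snd (\<rho> n)) \<le> t"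
    unfolding reach_payoff_le_const_iff
  proof (intro conjI allI impI t)
    fix n assume "snd (\<rho> n) \<in> T L"
    then have "1 / (1 + real (idx n)) \<le> t"
      using pay[of "idx n"] idx(1)[of n] pr by (simp add: \<rho>_def)
    moreover have "1 / (1 + real n) \<le> 1 / (1 + real (idx n))"
      using idx(2)[of n] by (simp add: field_simps)
    ultimately show "1 / (1 + real n) \<le> t" by simp
  qed
  ultimately show ?thesis by blast
qed

text \<open>Time is cut into windows of length \<open>w\<close>. The first visits of the players
  fall into at most \<open>card (players G)\<close> windows, so one of the first
  \<open>card (players G) + 1\<close> windows is free of them, and the prefix ends inside that
  one.\<close>

lemma secure_prefix_of_path:
  assumes \<rho>: "path \<rho>" and sec: "secure \<rho>" and pay: "reach_payoff (T L) (\<lambda>n. snd (\<rho> n)) \<le> t"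
  shows "\<exists>rs. secure_prefix N rs \<and> length rs \<le> (card (players G) + 1) * (2 * N + 2) \<and> 0 \<le> t \<and>
    set rs \<subseteq> states \<and> (\<forall>n < length rs. snd (rs ! n) \<in> T L \<longrightarrow> 1 / (1 + real n) \<le> t)"
proof -
  \<comment> \<open>A window holds the \<open>N\<close> steps of the tail and, after them, the
    \<open>N\<close> steps that a deviation at its end may still take; the latest deadline is
    \<open>a + 2 * N\<close>.\<close>
  define w where "w = 2 * N + 2"
  define hit where "hit i n \<longleftrightarrow> snd (\<rho> n) \<in> T i" for i n
  define d where "d i = (LEAST n. hit i n)" for i
  have finP: "finite (players G)" using G by (simp add: wf_game_def)
  \<comment> \<open>For a player who never reaches the target, \<open>d i\<close> is an unspecified
    number; it blocks at most one window all the same.\<close>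
  have "card ((\<lambda>i. d i div w) ` players G) < card {..card (players G)}"
    using card_image_le[OF finP, of "\<lambda>i. d i div w"] by simp
  then have "\<not> {..card (players G)} \<subseteq> (\<lambda>i. d i div w) ` players G"
    using finP by (meson card_mono finite_imageI not_less)
  then obtain b where b: "b \<le> card (players G)" "\<And>i. i \<in> players G \<Longrightarrow> d i div w \<noteq> b"
    by auto
  define a where "a = b * w"
  text \<open>No target is visited for the first time between the times \<open>a\<close> and \<open>a + w\<close>.\<close>
  have gap: "hit i (d i) \<and> d i < a \<and> d i \<le> m" if "i \<in> players G" "hit i m" "m < a + w" for i m
  proof -
    have h: "hit i (d i)" "d i \<le> m" unfolding d_def using that(2) by (auto intro: LeastI Least_le)
    have "\<not> a \<le> d i"
    proof
      assume "a \<le> d i"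
      then have "d i div w = b"
        using h that by (intro div_nat_eqI) (auto simp: a_def w_def mult.commute)
      then show False using b that by blast
    qed
    then show ?thesis using h by simp
  qed
  define rs where "rs = map \<rho> [0..<a + N + 1]"
  have len: "length rs = a + N + 1" by (simp add: rs_def)
  have nth: "rs ! n = \<rho> n" if "n < length rs" for n using that by (simp add: rs_def del: upt_Suc)
  have mv: "move (\<rho> n) (\<rho> (Suc n))" for n using \<rho> by (simp add: path_def)
  have "secure_prefix N rs"
    unfolding secure_prefix_def
  proof (intro conjI allI ballI impI)
    show "N < length rs" by (simp add: len)
    show "rs ! 0 = (mealy_init M, v0)" using \<rho> nth[of 0] by (simp add: path_def len)
    show "move (rs ! n) (rs ! Suc n)" if "Suc n < length rs" for n
      using that mv by (simp add: nth)
    show "\<exists>m < length rs - N. snd (rs ! m) \<in> T i"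
      if "i \<in> players G" "n < length rs" "snd (rs ! n) \<in> T i" for i n
      using gap[of i n] that by (intro exI[of _ "d i"]) (auto simp: nth len hit_def w_def)
    show "\<exists>m < length rs. m \<le> n + 1 + k \<and> snd (rs ! m) \<in> T i"
      if i: "i \<in> players G - {L}" and n: "Suc n < length rs \<and> snd (rs ! n) \<in> part G i"
        and v: "(snd (rs ! n), v) \<in> edges G \<and> k \<le> N \<and> (fst (rs ! Suc n), v) \<in> win i k" for i n v k
    proof -
      obtain m where m: "m \<le> n + 1 + k" "hit i m"
        using sec i n v nth[of n] nth[of "Suc n"] unfolding secure_def hit_def by (metis Suc_lessD)
      then have "hit i (d i) \<and> d i < a \<and> d i \<le> m"
        using i n v by (intro gap) (auto simp: len w_def)
      then show ?thesis
        using m by (intro exI[of _ "d i"]) (auto simp: nth len hit_def)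
    qed
  qed
  moreover have "length rs \<le> (card (players G) + 1) * (2 * N + 2)"
  proof -
    have "b * w \<le> card (players G) * w" using b(1) by (rule mult_le_mono1)
    then show ?thesis by (simp add: len a_def w_def)
  qed
  moreover have "set rs \<subseteq> states"
    unfolding rs_def set_map using move_states[OF mv] by (intro image_subsetI) blast
  moreover have "0 \<le> t" "\<forall>n < length rs. snd (rs ! n) \<in> T L \<longrightarrow> 1 / (1 + real n) \<le> t"
    using pay by (auto simp: reach_payoff_le_const_iff nth)
  ultimately show ?thesis by blast
qed

theorem not_rational_verification_iff_prefix:
  assumes N: "card states \<le> N"
  shows "\<not> rational_verification G v0 L M t \<longleftrightarrow>
    (\<exists>rs. secure_prefix N rs \<and> length rs \<le> (card (players G) + 1) * (2 * N + 2) \<and> 0 \<le> t \<and>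
      set rs \<subseteq> states \<and>
      (\<forall>n < length rs. snd (rs ! n) \<in> T L \<longrightarrow> 1 / (1 + real n) \<le> real_of_rat t))"
  unfolding not_rational_verification_iff
  using secure_path_of_prefix[OF _ N, of _ "real_of_rat t"] secure_prefix_of_path[of _ "real_of_rat t" N]
  by (metis zero_le_of_rat_iff)

end

section \<open>Constraint satisfaction as rational verification\<close>

text \<open>There are \<open>N\<close> positions with values below \<open>k\<close>, and a literal is a number \<open>p * k + a\<close>, which
  says that position \<open>p\<close> has the value \<open>a\<close>. A clause is a disjunction of literals.\<close>

definition csp_sat :: "nat \<Rightarrow> nat \<Rightarrow> nat list list \<Rightarrow> (nat \<Rightarrow> nat) \<Rightarrow> bool" where
  "csp_sat k N cls a \<longleftrightarrow> a 0 = 0 \<and> (\<forall>p < N. a p < k) \<and> (\<forall>c \<in> set cls. \<exists>p < N. p * k + a p \<in> set c)"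

text \<open>The literals are the vertices of the choosing player \<open>m + 1\<close>, who walks through the positions.
  Then each of the \<open>m\<close> clauses is a player, who may leave for the exit \<open>e\<close>, the target of Leader
  and of all clauses. This is a profitable deviation unless a literal of the clause has been visited.\<close>

definition csp_inst :: "nat \<Rightarrow> nat \<Rightarrow> nat list list \<Rightarrow> inst" where
  "csp_inst k N cls = (let m = length cls; e = N * k + m + 1 in
    \<lparr> inst_owner = replicate (N * k) (m + 1) @ [0..<m] @ [m + 1, m + 1],
      inst_targets = map (\<lambda>c. e # c) cls @ [[e], [0]],
      inst_edges = concat (map (\<lambda>p. concat (map (\<lambda>a. map (\<lambda>b. (p * k + a, (p + 1) * k + b)) [0..<k]) [0..<k])) [0..<N - 1])
        @ map (\<lambda>a. ((N - 1) * k + a, N * k)) [0..<k]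
        @ map (\<lambda>j. (N * k + j, N * k + j + 1)) [0..<m]
        @ map (\<lambda>j. (N * k + j, e)) [0..<m]
        @ [(N * k + m, N * k + m), (e, e)],
      inst_start = 0, inst_leader = m, inst_num = 0, inst_den = 1,
      inst_states = 1, inst_init = 0,
      inst_read = map (\<lambda>u. (0, u, 0)) [0..<N * k + m + 2], inst_act = [] \<rparr>)"

context
  fixes k N :: nat and cls :: "nat list list"
  assumes k: "k > 0" and N: "N > 0" and cls: "\<And>c x. c \<in> set cls \<Longrightarrow> x \<in> set c \<Longrightarrow> x < N * k"
begin

private abbreviation "m \<equiv> length cls"
private abbreviation "e \<equiv> N * k + m + 1"
private abbreviation "I \<equiv> csp_inst k N cls"
private abbreviation "G \<equiv> inst_game I"
private abbreviation "T i \<equiv> set (inst_targets I ! i)"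

private lemma players: "players G = {..<m + 2}"
  by (simp add: inst_game_def csp_inst_def Let_def)

private lemma verts: "verts G = {..<N * k + m + 2}"
  by (simp add: inst_game_def csp_inst_def Let_def)

private lemma owner: "u < N * k + m + 2 \<Longrightarrow>
    inst_owner I ! u = (if N * k \<le> u \<and> u < N * k + m then u - N * k else m + 1)"
  by (auto simp: csp_inst_def Let_def nth_append nth_Cons' not_less less_Suc_eq)

private lemma part: "part G i = {u. u < N * k + m + 2 \<and>
    i = (if N * k \<le> u \<and> u < N * k + m then u - N * k else m + 1)}"
proof -
  have "part G i = {u. u < N * k + m + 2 \<and> inst_owner I ! u = i}"
    by (simp add: inst_game_def) (simp add: csp_inst_def Let_def)
  then show ?thesis using owner by auto
qed

private lemma targets: "T i = (if i < m then insert e (set (cls ! i)) else if i = m then {e} else {0})"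
  if "i < m + 2"
  using that by (auto simp: csp_inst_def Let_def nth_append nth_Cons')

private lemma edges: "(u, v) \<in> edges G \<longleftrightarrow>
    (\<exists>p a b. p < N - 1 \<and> a < k \<and> b < k \<and> u = p * k + a \<and> v = (p + 1) * k + b) \<or>
    (\<exists>a < k. u = (N - 1) * k + a \<and> v = N * k) \<or>
    (\<exists>j < m. u = N * k + j \<and> (v = N * k + j + 1 \<or> v = e)) \<or>
    u = N * k + m \<and> v = u \<or> u = e \<and> v = e"
proof -
  have 1: "(u, v) \<in> set (concat (map (\<lambda>p. concat (map (\<lambda>a. map (\<lambda>b. (p * k + a, (p + 1) * k + b)) [0..<k]) [0..<k])) [0..<N - 1]))
      \<longleftrightarrow> (\<exists>p a b. p < N - 1 \<and> a < k \<and> b < k \<and> u = p * k + a \<and> v = (p + 1) * k + b)"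
    (is "?l \<longleftrightarrow> ?r")
  proof
    show "?l \<Longrightarrow> ?r" by auto
    assume ?r
    then obtain p a b where "p < N - 1" "a < k" "b < k" "u = p * k + a" "v = (p + 1) * k + b" by blast
    then show ?l
      unfolding set_concat set_map image_image by (intro UN_I[of p] UN_I[of a] image_eqI[of _ _ b]) auto
  qed
  have 2: "(u, v) \<in> set (map (\<lambda>a. ((N - 1) * k + a, N * k)) [0..<k]) \<longleftrightarrow> (\<exists>a < k. u = (N - 1) * k + a \<and> v = N * k)"
    by auto
  have 3: "(u, v) \<in> set (map (\<lambda>j. (N * k + j, N * k + j + 1)) [0..<m]) \<longleftrightarrow> (\<exists>j < m. u = N * k + j \<and> v = N * k + j + 1)"
    by auto
  have 4: "(u, v) \<in> set (map (\<lambda>j. (N * k + j, e)) [0..<m]) \<longleftrightarrow> (\<exists>j < m. u = N * k + j \<and> v = e)"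
    by auto
  have 5: "(u, v) \<in> set [(N * k + m, N * k + m), (e, e)] \<longleftrightarrow> u = N * k + m \<and> v = u \<or> u = e \<and> v = e"
    by auto
  have 6: "inst_edges I =
      concat (map (\<lambda>p. concat (map (\<lambda>a. map (\<lambda>b. (p * k + a, (p + 1) * k + b)) [0..<k]) [0..<k])) [0..<N - 1])
        @ map (\<lambda>a. ((N - 1) * k + a, N * k)) [0..<k]
        @ map (\<lambda>j. (N * k + j, N * k + j + 1)) [0..<m]
        @ map (\<lambda>j. (N * k + j, e)) [0..<m]
        @ [(N * k + m, N * k + m), (e, e)]"
    by (simp only: csp_inst_def Let_def inst.simps)
  have "edges G = set (inst_edges I)" by (simp add: inst_game_def)
  then show ?thesis
    unfolding 6 set_append 1 2 3 4 5 by (simp only: Un_iff 1 2 3 4 5) blast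
qed

private lemma literal_bound: "p < N \<Longrightarrow> a < k \<Longrightarrow> p * k + a < N * k"
proof -
  assume "p < N" "a < k"
  then have "p * k + a < Suc p * k" by simp
  also have "\<dots> \<le> N * k" using \<open>p < N\<close> by (intro mult_le_mono1) simp
  finally show ?thesis .
qed

private lemma literal_cases:
  assumes "u < N * k"
  obtains p a where "p < N" "a < k" "u = p * k + a"
  using assms k by (intro that[of "u div k" "u mod k"]) (auto simp: less_mult_imp_div_less)

private lemma literal_unique: "p * k + a = q * k + b \<Longrightarrow> a < k \<Longrightarrow> b < k \<Longrightarrow> p = q \<and> a = b"
proof -
  assume *: "p * k + a = q * k + b" "a < k" "b < k"
  have "p = (p * k + a) div k" "q = (q * k + b) div k" using *(2,3) by auto
  with *(1) show ?thesis by simp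
qed

private lemma wf_G: "wf_game G"
  unfolding wf_game_def
proof (intro conjI)
  show "edges G \<subseteq> verts G \<times> verts G"
  proof (rule subrelI)
    fix u v assume "(u, v) \<in> edges G"
    then consider p a b where "p < N - 1" "a < k" "b < k" "u = p * k + a" "v = (p + 1) * k + b"
      | a where "a < k" "u = (N - 1) * k + a" "v = N * k"
      | "N * k \<le> u" "u \<le> e" "N * k \<le> v" "v \<le> e"
      unfolding edges by auto
    then show "(u, v) \<in> verts G \<times> verts G"
    proof cases
      case 1
      then have "p < N" "p + 1 < N" by auto
      with 1 show ?thesis using literal_bound[of p a] literal_bound[of "p + 1" b] by (simp add: verts)
    next
      case 2
      then show ?thesis using literal_bound[of "N - 1" a] N by (simp add: verts)
    qed (simp add: verts)
  qed
  show "\<forall>u \<in> verts G. \<exists>v. (u, v) \<in> edges G"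
  proof
    fix u assume u: "u \<in> verts G"
    consider "u < N * k" | j where "u = N * k + j" "j < m" | "u = N * k + m" | "u = e"
      using u by (auto simp: verts) (metis add_Suc_right le_Suc_ex less_Suc_eq nat_add_left_cancel_less not_less)
    then show "\<exists>v. (u, v) \<in> edges G"
    proof cases
      case 1
      then obtain p a where "p < N" "a < k" "u = p * k + a" by (rule literal_cases)
      then consider "p < N - 1" | "p = N - 1" by linarith
      then show ?thesis
      proof cases
        case 1
        then have "(u, (p + 1) * k + 0) \<in> edges G"
          unfolding edges using \<open>a < k\<close> \<open>u = p * k + a\<close> k by blast
        then show ?thesis by blast
      next
        case 2
        then have "(u, N * k) \<in> edges G"
          unfolding edges using \<open>a < k\<close> \<open>u = p * k + a\<close> by blast
        then show ?thesis by blast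
      qed
    qed (auto simp: edges)
  qed
  show "(\<Union>i \<in> players G. part G i) = verts G"
  proof -
    have "u \<in> part G (if N * k \<le> u \<and> u < N * k + m then u - N * k else m + 1)" if "u \<in> verts G" for u
      using that by (simp add: part verts)
    moreover have "(if N * k \<le> u \<and> u < N * k + m then u - N * k else m + 1) \<in> players G" for u
      by (auto simp: players)
    moreover have "part G i \<subseteq> verts G" for i by (auto simp: part verts)
    ultimately show ?thesis by blast
  qed
qed (auto simp: players verts part)

private lemma target_verts: "i < m + 2 \<Longrightarrow> T i \<subseteq> verts G"
  using cls[of "cls ! i"] by (auto simp: targets verts) (metis less_SucI nth_mem trans_less_add1)

private lemma payoff: "payoff G i \<pi> = reach_payoff (T i) \<pi>"
  by (simp add: inst_game_def)

private lemma leader_part: "part G m = {}"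
  by (auto simp: part)

private lemma mealy: "mealy_states (inst_mealy I) = {0}" "mealy_init (inst_mealy I) = 0"
    "mealy_trans (inst_mealy I) = {Read 0 u 0 | u. u \<in> verts G}"
proof -
  have "inst_read I = map (\<lambda>u. (0, u, 0)) [0..<N * k + m + 2]" "inst_act I = []"
    by (simp_all add: csp_inst_def Let_def)
  then show "mealy_trans (inst_mealy I) = {Read 0 u 0 | u. u \<in> verts G}"
    unfolding inst_mealy_def verts by (simp del: upt_Suc add: image_iff)
qed (simp_all add: inst_mealy_def csp_inst_def Let_def less_Suc_eq lessThan_Suc)

private lemma wf_M: "wf_mealy G m (inst_mealy I)"
  by (auto simp: wf_mealy_def mealy leader_part)

lemma csp_inst_valid: "valid_inst I"
proof -
  have l: "inst_leader I = m" "inst_start I = 0" "inst_den I = 1"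
    "length (inst_targets I) = m + 2"
    by (simp_all add: csp_inst_def Let_def)
  have "quantitative_reachability_game G"
    unfolding quantitative_reachability_game_def
  proof (intro conjI exI[of _ "\<lambda>i. T i"] ballI allI impI)
    show "T i \<subseteq> verts G" if "i \<in> players G" for i
      using that by (intro target_verts) (simp add: players)
  qed (rule wf_G payoff)+
  moreover have "set S \<subseteq> verts G" if "S \<in> set (inst_targets I)" for S
  proof -
    obtain i where "i < m + 2" "S = inst_targets I ! i" using \<open>S \<in> set (inst_targets I)\<close> l by (metis in_set_conv_nth)
    then show ?thesis using target_verts by blast
  qed
  ultimately show ?thesis
    using wf_M N k by (simp add: valid_inst_def l verts players)
qed

lemma csp_inst_deterministic: "deterministic_mealy G (inst_mealy I)"
  unfolding deterministic_mealy_def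
proof (intro ballI)
  fix p u assume "p \<in> mealy_states (inst_mealy I)" "u \<in> verts G"
  then show "\<exists>!\<tau>. \<tau> \<in> mealy_trans (inst_mealy I) \<and> trans_key \<tau> = (p, u)"
    by (intro ex1I[of _ "Read 0 u 0"]) (auto simp: mealy)
qed

interpretation leader_game G 0 m "inst_mealy I" "\<lambda>i. T i"
  by standard (use wf_G wf_M in \<open>auto simp: verts players payoff\<close>)

private lemma move_iff: "move x y \<longleftrightarrow> fst x = 0 \<and> fst y = 0 \<and> (snd x, snd y) \<in> edges G"
  using wf_G by (cases x; cases y) (auto simp: move_def leader_part mealy wf_game_def)

text \<open>A play that avoids the exit passes one literal per position and then all clause vertices
  in order before it stays in the sink \<open>N * k + m\<close>, so it describes an assignment;
  \<open>a 0 = 0\<close> reflects the start in literal 0. The exit is an immediate win for each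
  clause, so security says that each clause has seen one of its literals.\<close>

lemma csp_inst_iff: "\<not> inst_rational_verification I \<longleftrightarrow> (\<exists>a. csp_sat k N cls a)"
proof -
  have t: "inst_threshold I = 0" "inst_leader I = m" "inst_start I = 0"
    by (simp_all add: inst_threshold_def csp_inst_def Let_def)
  have "(\<exists>\<rho>. path \<rho> \<and> secure \<rho> \<and> reach_payoff (T m) (\<lambda>n. snd (\<rho> n)) \<le> 0) \<longleftrightarrow> (\<exists>a. csp_sat k N cls a)"
  proof
    assume "\<exists>\<rho>. path \<rho> \<and> secure \<rho> \<and> reach_payoff (T m) (\<lambda>n. snd (\<rho> n)) \<le> 0"
    then obtain \<rho> where \<rho>: "path \<rho>" "secure \<rho>" "reach_payoff (T m) (\<lambda>n. snd (\<rho> n)) \<le> 0" by blast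
    define v where "v n = snd (\<rho> n)" for n
    \<comment> \<open>With threshold 0, Leader's payoff is small enough exactly if the exit is never
      visited.\<close>
    have not_e: "v n \<noteq> e" for n
      using \<rho>(3) by (auto simp: reach_payoff_le_const_iff targets v_def not_le)
    have v0: "v 0 = 0" using \<rho>(1) by (simp add: path_def v_def)
    have mv: "fst (\<rho> n) = 0" "(v n, v (Suc n)) \<in> edges G" for n
      using \<rho>(1) by (auto simp: path_def v_def move_iff)
    have lit: "\<exists>a < k. v n = n * k + a" if "n < N" for n
      using that
    proof (induction n)
      case (Suc n)
      then obtain a where a: "a < k" "v n = n * k + a" by auto
      have "v n < N * k" using literal_bound[of n a] a Suc.prems by simp
      then show ?case
        using mv(2)[of n] a Suc.prems unfolding edges
        by (auto dest!: literal_unique)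
    qed (use v0 k in auto)
    have clause: "v (N + j) = N * k + j" if "j \<le> m" for j
      using that
    proof (induction j)
      case 0
      obtain a where a: "a < k" "v (N - 1) = (N - 1) * k + a" using lit[of "N - 1"] N by auto
      have "v (N - 1) < N * k" using literal_bound[of "N - 1" a] a N by simp
      then show ?case
        using mv(2)[of "N - 1"] a N unfolding edges
        by (auto dest!: literal_unique)
    next
      case (Suc j)
      have "(v (N + j), v (Suc (N + j))) \<in> edges G" by (rule mv)
      moreover have "p * k + a < N * k" if "p < N - 1" "a < k" for p a
        using literal_bound[of p a] that by simp
      moreover have "(N - 1) * k + a < N * k" if "a < k" for a
        using literal_bound[of "N - 1" a] that N by simp
      ultimately show ?case
        using Suc not_e[of "Suc (N + j)"] unfolding edges by fastforce
    qed
    have sink: "v (N + m + j) = N * k + m" for j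
    proof (induction j)
      case (Suc j)
      have "(v (N + m + j), v (Suc (N + m + j))) \<in> edges G" by (rule mv)
      moreover have "p * k + a < N * k" if "p < N - 1" "a < k" for p a
        using literal_bound[of p a] that by simp
      moreover have "(N - 1) * k + a < N * k" if "a < k" for a
        using literal_bound[of "N - 1" a] that N by simp
      ultimately show ?case
        using Suc not_e[of "Suc (N + m + j)"] unfolding edges by fastforce
    qed (use clause[of m] in simp)
    have late: "v n \<ge> N * k" if "n \<ge> N" for n
    proof (cases "n \<le> N + m")
      case True
      then show ?thesis using clause[of "n - N"] that by simp
    next
      case False
      then show ?thesis using sink[of "n - (N + m)"] by simp
    qed
    define a where "a n = v n - n * k" for n
    have a: "a n < k" "v n = n * k + a n" if "n < N" for n
      using lit[OF that] by (auto simp: a_def)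
    have "csp_sat k N cls a"
      unfolding csp_sat_def
    proof (intro conjI allI impI ballI)
      show "a 0 = 0" by (simp add: a_def v0)
      show "a p < k" if "p < N" for p by (rule a(1)[OF that])
      fix c assume "c \<in> set cls"
      then obtain j where j: "j < m" "cls ! j = c" by (auto simp: in_set_conv_nth)
      \<comment> \<open>Leaving for the exit wins in 0 further steps, so the path must have visited
        the target of \<open>j\<close> by then, and not by way of the exit.\<close>
      have "(0, e) \<in> win j 0" using j by (simp add: targets mealy verts)
      moreover have "v (N + j) \<in> part G j" "(v (N + j), e) \<in> edges G"
        using clause[of j] j by (auto simp: part edges)
      ultimately have "\<exists>n \<le> N + j + 1 + 0. v n \<in> T j"
        using \<rho>(2) mv(1)[of "Suc (N + j)"] j unfolding secure_def v_def players
        by (metis DiffI lessThan_iff less_not_refl singletonD trans_less_add1)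
      then obtain n where n: "v n \<in> T j" by blast
      then have "v n \<in> set c" using j not_e by (auto simp: targets)
      moreover have "n < N"
        using late[of n] cls[OF \<open>c \<in> set cls\<close> calculation] by (cases "n < N") auto
      ultimately show "\<exists>p < N. p * k + a p \<in> set c" using a(2) by metis
    qed
    then show "\<exists>a. csp_sat k N cls a" by blast
  next
    assume "\<exists>a. csp_sat k N cls a"
    then obtain a where a: "csp_sat k N cls a" by blast
    \<comment> \<open>The minimum keeps the play in the sink, whose number is one below the
      exit.\<close>
    define v where "v n = (if n < N then n * k + a n else min (N * k + (n - N)) (N * k + m))" for n
    define \<rho> where "\<rho> n = (0 :: nat, v n)" for n
    have v0: "v 0 = 0" using a N by (simp add: v_def csp_sat_def)
    have ak: "p < N \<Longrightarrow> a p < k" for p using a by (simp add: csp_sat_def)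
    have small: "v n < N * k" if "n < N" for n
      using literal_bound[OF that ak[OF that]] that by (simp add: v_def)
    have "(v n, v (Suc n)) \<in> edges G" for n
    proof -
      consider "Suc n < N" | "Suc n = N" | "N \<le> n" "n < N + m" | "N + m \<le> n" by linarith
      then show ?thesis
      proof cases
        case 1
        then show ?thesis using ak[of n] ak[of "Suc n"] unfolding edges
          by (intro disjI1 exI[of _ n] exI[of _ "a n"] exI[of _ "a (Suc n)"]) (auto simp: v_def)
      next
        case 2
        then have "n = N - 1" by simp
        then show ?thesis using ak[of n] 2 unfolding edges
          by (intro disjI2 disjI1 exI[of _ "a n"]) (auto simp: v_def simp del: diff_Suc_1)
      next
        case 3
        then have "\<exists>j < m. v n = N * k + j \<and> (v (Suc n) = N * k + j + 1 \<or> v (Suc n) = e)"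
          by (intro exI[of _ "n - N"]) (auto simp: v_def)
        then show ?thesis unfolding edges by blast
      next
        case 4
        then have "v n = N * k + m \<and> v (Suc n) = v n" by (auto simp: v_def)
        then show ?thesis unfolding edges by blast
      qed
    qed
    then have "path \<rho>"
      by (simp add: path_def \<rho>_def move_iff v0 mealy)
    moreover have "secure \<rho>"
      unfolding secure_def
    proof (intro ballI allI impI)
      fix i n w l
      assume i: "i \<in> players G - {m}" and dev: "snd (\<rho> n) \<in> part G i \<and> (snd (\<rho> n), w) \<in> edges G \<and>
        (fst (\<rho> (Suc n)), w) \<in> win i l"
      show "\<exists>n' \<le> n + 1 + l. snd (\<rho> n') \<in> T i"
      proof (cases "i < m")
        case True
        then have "v n = N * k + i" using dev by (auto simp: \<rho>_def part split: if_splits)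
        then have "N \<le> n" using small[of n] by (cases "N \<le> n") auto
        obtain p where p: "p < N" "p * k + a p \<in> set (cls ! i)"
          using a nth_mem[OF True] unfolding csp_sat_def by blast
        then show ?thesis using True \<open>N \<le> n\<close>
          by (intro exI[of _ p]) (auto simp: \<rho>_def v_def targets)
      next
        case False
        \<comment> \<open>The target of the choosing player is the start, so no deviation improves
          the payoff.\<close>
        then have "i = m + 1" using i by (auto simp: players)
        then show ?thesis by (intro exI[of _ 0]) (auto simp: \<rho>_def v0 targets)
      qed
    qed
    moreover have "v n \<noteq> e" for n
      using small[of n] by (cases "n < N") (auto simp: v_def)
    then have "reach_payoff (T m) (\<lambda>n. snd (\<rho> n)) \<le> 0"
      unfolding reach_payoff_le_const_iff by (auto simp: targets \<rho>_def)
    ultimately show "\<exists>\<rho>. path \<rho> \<and> secure \<rho> \<and> reach_payoff (T m) (\<lambda>n. snd (\<rho> n)) \<le> 0" by blast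
  qed
  then show ?thesis
    using not_rational_verification_iff[of 0]
    by (simp add: inst_rational_verification_def t)
qed

end

section \<open>Turing machine computations as constraint satisfaction\<close>

subsection \<open>Clauses of a constraint\<close>

text \<open>A constraint on the positions in a scope is expressed by excluding its falsifying values.\<close>

definition exclude :: "nat \<Rightarrow> nat \<Rightarrow> nat list \<Rightarrow> nat list \<Rightarrow> nat list" where
  "exclude k r sc bad = concat (map (\<lambda>i. map (\<lambda>v. nth_default 0 sc i * k + v)
     (filter (\<lambda>v. v \<noteq> nth_default 0 bad i) [0..<k])) [0..<r])"

text \<open>The arity \<open>r\<close> and the number \<open>k\<close> of values will not depend on
  the input of the reduction, so all \<open>k ^ r\<close> tuples of values can be listed and
  \<open>Q\<close> may be any predicate.\<close>

definition clauses_of :: "nat \<Rightarrow> nat \<Rightarrow> (nat list \<Rightarrow> bool) \<Rightarrow> nat list list \<Rightarrow> nat list list" where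
  "clauses_of k r Q scs = concat (map (\<lambda>sc. map (exclude k r sc)
     (filter (\<lambda>vs. \<not> Q vs) (List.n_lists r [0..<k]))) scs)"

text \<open>Division by \<open>k\<close> recovers position and value from a literal, so a true
  literal of the clause is an index at which the assignment differs from \<open>bad\<close>.\<close>

lemma exclude_sat:
  assumes a: "\<And>p. p < N \<Longrightarrow> a p < k" and sc: "length sc = r" "set sc \<subseteq> {..<N}"
    and bad: "length bad = r"
  shows "(\<exists>p < N. p * k + a p \<in> set (exclude k r sc bad)) \<longleftrightarrow> map a sc \<noteq> bad"
proof
  assume "\<exists>p < N. p * k + a p \<in> set (exclude k r sc bad)"
  then obtain p i v where p: "p < N" "i < r" "v < k" "v \<noteq> bad ! i" "p * k + a p = sc ! i * k + v"
    using sc(1) bad by (auto simp: exclude_def nth_default_def)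
  have "(p * k + a p) div k = p" "(sc ! i * k + v) div k = sc ! i"
    using a[OF p(1)] p(3) by auto
  then have "sc ! i = p" "v = a p" using p(5) by auto
  then have "map a sc ! i \<noteq> bad ! i" using p sc by simp
  then show "map a sc \<noteq> bad" by blast
next
  assume "map a sc \<noteq> bad"
  then obtain i where i: "i < r" "a (sc ! i) \<noteq> bad ! i"
    using sc bad by (auto simp: list_eq_iff_nth_eq)
  then have "sc ! i < N" using sc by (metis lessThan_iff nth_mem subset_iff)
  then have "sc ! i * k + a (sc ! i) \<in> set (exclude k r sc bad)"
    using i a[of "sc ! i"] sc bad unfolding exclude_def
    by (auto simp: nth_default_def intro!: bexI[of _ i])
  then show "\<exists>p < N. p * k + a p \<in> set (exclude k r sc bad)"
    using \<open>sc ! i < N\<close> by blast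
qed

lemma clauses_of_sat:
  assumes a: "\<And>p. p < N \<Longrightarrow> a p < k" and scs: "\<forall>sc \<in> set scs. length sc = r \<and> set sc \<subseteq> {..<N}"
  shows "(\<forall>c \<in> set (clauses_of k r Q scs). \<exists>p < N. p * k + a p \<in> set c) \<longleftrightarrow> (\<forall>sc \<in> set scs. Q (map a sc))"
proof -
  have "(\<forall>c \<in> exclude k r sc ` {vs \<in> set (List.n_lists r [0..<k]). \<not> Q vs}. \<exists>p < N. p * k + a p \<in> set c) \<longleftrightarrow> Q (map a sc)"
    if "sc \<in> set scs" for sc
  proof -
    have sc: "length sc = r" "set sc \<subseteq> {..<N}" using scs that by auto
    have "map a sc \<in> set (List.n_lists r [0..<k])"
      using sc a by (auto simp: set_n_lists)
    moreover have "length vs = r" if "vs \<in> set (List.n_lists r [0..<k])" for vs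
      using that by (simp add: set_n_lists)
    ultimately show ?thesis
      using exclude_sat[of N a k sc r, OF a sc] by auto
  qed
  then show ?thesis by (auto simp: clauses_of_def)
qed

lemma clauses_of_bound:
  assumes "\<forall>sc \<in> set scs. length sc = r \<and> set sc \<subseteq> {..<N}" "c \<in> set (clauses_of k r Q scs)" "l \<in> set c"
  shows "l < N * k"
proof -
  obtain sc bad where sc: "sc \<in> set scs" "c = exclude k r sc bad"
    using assms(2) by (auto simp: clauses_of_def)
  then obtain i v where i: "i < r" "v < k" "l = nth_default 0 sc i * k + v"
    using assms(3) by (auto simp: exclude_def)
  have "sc ! i < N" using assms(1) sc(1) i(1) by (metis lessThan_iff nth_mem subset_iff)
  moreover have "l = sc ! i * k + v" using i assms(1) sc(1) by (simp add: nth_default_def)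
  ultimately have "l < Suc (sc ! i) * k" "Suc (sc ! i) * k \<le> N * k" using i(2) by (auto simp del: mult_Suc intro: mult_le_mono1) simp
  then show ?thesis by (rule less_le_trans)
qed

text \<open>The code of the certificate consists of bits 1 and 2, of two closing parentheses 3 and 4
  and of blanks 0, each of which takes two cells.\<close>

definition pair_of :: "nat \<Rightarrow> nat" where
  "pair_of v = v mod 5"

definition left_symbol :: "nat \<Rightarrow> nat" where
  "left_symbol p = (if p = 0 then 0 else if p \<le> 2 then 1 else 2)"

definition right_symbol :: "nat \<Rightarrow> nat" where
  "right_symbol p = (if p = 0 then 0 else if p = 1 then 1 else 2)"

text \<open>The two closing parentheses look alike on the tape. Distinct numbers for them allow a
  constraint on neighbours to enforce that there are exactly two.\<close>

definition pair_next :: "nat \<Rightarrow> nat \<Rightarrow> bool" where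
  "pair_next p p' \<longleftrightarrow> (if p = 1 \<or> p = 2 then p' = 1 \<or> p' = 2 \<or> p' = 3 else if p = 3 then p' = 4 else p' = 0)"

definition cert_pair :: "bool list \<Rightarrow> nat \<Rightarrow> nat" where
  "cert_pair u j = (if j < length u then if u ! j then 2 else 1 else if j = length u then 3
     else if j = Suc (length u) then 4 else 0)"

definition prefix_word :: "bool list \<Rightarrow> bool list" where
  "prefix_word x = [True, False] @ enc_list enc_bit x @ [True, False]"

lemma enc_pair_prefix: "enc_pair x u = prefix_word x @ concat (map enc_bit u) @ [True, True, True, True]"
  by (simp add: enc_pair_def enc_paren_def prefix_word_def enc_list_def)

lemma length_concat_enc_bit: "length (concat (map enc_bit u)) = 2 * length u"
  by (induction u) (auto simp: enc_bit_def)

lemma length_enc_pair: "length (enc_pair x u) = length (prefix_word x) + 2 * length u + 4"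
  by (simp add: enc_pair_prefix length_concat_enc_bit)

lemma nth_concat_enc_bit:
  "j < length u \<Longrightarrow> concat (map enc_bit u) ! (2 * j) = False \<and> concat (map enc_bit u) ! Suc (2 * j) = u ! j"
proof (induction u arbitrary: j)
  case (Cons b u)
  then show ?case using Cons.IH[of "j - 1"] by (cases j) (auto simp: enc_bit_def)
qed simp

lemma word_content_cert:
  fixes x :: "bool list"
  defines "l \<equiv> length (prefix_word x)"
  shows "word_content (enc_pair x u) (int (l + 2 * j)) = left_symbol (cert_pair u j)"
    and "word_content (enc_pair x u) (int (Suc (l + 2 * j))) = right_symbol (cert_pair u j)"
proof -
  have *: "word_content (enc_pair x u) (int (l + i)) =
      (if i < 2 * length u + 4 then if (concat (map enc_bit u) @ [True, True, True, True]) ! i then 2 else 1 else 0)" for i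
  proof -
    let ?r = "concat (map enc_bit u) @ [True, True, True, True]"
    have w: "word_content v (int n) = (if n < length v then if v ! n then 2 else 1 else 0)" for v n
      by (simp add: word_content_def)
    have "(prefix_word x @ ?r) ! (l + i) = ?r ! i"
      unfolding l_def by (rule nth_append_length_plus)
    moreover have "length ?r = 2 * length u + 4" by (simp add: length_concat_enc_bit)
    ultimately show ?thesis
      unfolding w enc_pair_prefix length_append by (simp add: l_def)
  qed
  have odd: "Suc (l + 2 * j) = l + Suc (2 * j)" by simp
  consider "j < length u" | "j = length u" | "j = Suc (length u)" | "j > Suc (length u)" by linarith
  then show "word_content (enc_pair x u) (int (l + 2 * j)) = left_symbol (cert_pair u j)"
    "word_content (enc_pair x u) (int (Suc (l + 2 * j))) = right_symbol (cert_pair u j)"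
    unfolding odd *
    by (cases; auto simp: cert_pair_def left_symbol_def right_symbol_def nth_append length_concat_enc_bit
        nth_concat_enc_bit nth_Cons' less_Suc_eq)+
qed

subsection \<open>Runs that are continued after halting\<close>

lemma fst_tape_act: "fst (tape_act t a) i = (if i = snd t then fst a else fst t i)"
  by (cases t; cases a) simp

lemma set_tape_read:
  assumes "length ts = n" "\<forall>j < n. \<forall>i. fst (ts ! j) i < b"
  shows "set (map tape_read ts) \<subseteq> {..<b}"
proof
  fix s assume "s \<in> set (map tape_read ts)"
  then obtain j where "j < n" "s = tape_read (ts ! j)"
    using assms(1) by (auto simp: in_set_conv_nth)
  then show "s \<in> {..<b}" using assms(2) by (simp add: tape_read_eq)
qed

locale tm_run =
  fixes M :: tm
  assumes M: "wf_tm M"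
begin

text \<open>A halted run is frozen, so that acceptance can be read off at one fixed time.\<close>

definition config_at :: "bool list \<Rightarrow> nat \<Rightarrow> config" where
  "config_at w t = ((\<lambda>c. case tm_step M c of None \<Rightarrow> c | Some c' \<Rightarrow> c') ^^ t) (tm_init M w)"

definition cell_at :: "bool list \<Rightarrow> nat \<Rightarrow> nat \<Rightarrow> int \<Rightarrow> nat \<times> bool" where
  "cell_at w t j i = (fst (snd (config_at w t) ! j) i, snd (snd (config_at w t) ! j) = i)"

text \<open>The view is shared by all tapes. Given the view, a cell depends only on three cells of
  the same tape one step earlier, so the arity of the constraints does not grow with the number of
  tapes.\<close>

definition view_at :: "bool list \<Rightarrow> nat \<Rightarrow> nat \<times> nat list" where
  "view_at w t = (fst (config_at w t), map tape_read (snd (config_at w t)))"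

definition next_state :: "nat \<times> nat list \<Rightarrow> nat" where
  "next_state z = (case tm_delta M (fst z) (snd z) of None \<Rightarrow> fst z | Some (q', acts) \<Rightarrow> q')"

definition next_cell :: "nat \<Rightarrow> nat \<times> nat list \<Rightarrow> nat \<times> bool \<Rightarrow> nat \<times> bool \<Rightarrow> nat \<times> bool \<Rightarrow> nat \<times> bool" where
  "next_cell j z l m r = (case tm_delta M (fst z) (snd z) of None \<Rightarrow> m
     | Some (q', acts) \<Rightarrow> (if snd m then fst (acts ! j) else fst m,
         snd l \<and> snd (acts ! j) = Move_Right \<or> snd m \<and> snd (acts ! j) = Stay
           \<or> snd r \<and> snd (acts ! j) = Move_Left))"

lemma config_at_Suc: "config_at w (Suc t) = (case tm_step M (config_at w t) of None \<Rightarrow> config_at w t | Some c' \<Rightarrow> c')"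
  by (cases "tm_step M (config_at w t)") (simp_all add: config_at_def)

lemma delta_wf:
  assumes "tm_delta M q ss = Some (q', acts)" "q < tm_states M" "length ss = tm_tapes M"
    "set ss \<subseteq> {..<tm_symbols M}"
  shows "q' < tm_states M \<and> length acts = tm_tapes M \<and> (\<forall>(s, d) \<in> set acts. s < tm_symbols M)"
proof -
  have "case tm_delta M q ss of None \<Rightarrow> True
     | Some (q', acts) \<Rightarrow> q' < tm_states M \<and> length acts = tm_tapes M \<and>
         (\<forall>(s, d) \<in> set acts. s < tm_symbols M)"
    using M[unfolded wf_tm_def, THEN conjunct2, THEN conjunct2, THEN conjunct2, THEN spec, THEN mp,
        OF assms(2), THEN spec, THEN mp, OF conjI[OF assms(3,4)]] .
  then show ?thesis by (simp add: assms(1))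
qed

lemma config_at_wf:
  "fst (config_at w t) < tm_states M \<and> length (snd (config_at w t)) = tm_tapes M \<and>
    (\<forall>j < tm_tapes M. \<forall>i. fst (snd (config_at w t) ! j) i < tm_symbols M)"
proof (induction t)
  case 0
  have "word_content w' i < tm_symbols M" for w' i
    using M by (auto simp: wf_tm_def word_content_def)
  then show ?case
    using M by (auto simp: config_at_def tm_init_def wf_tm_def nth_Cons')
next
  case (Suc t)
  obtain q ts where c: "config_at w t = (q, ts)" by (cases "config_at w t")
  show ?case
  proof (cases "tm_delta M q (map tape_read ts)")
    case None
    then show ?thesis using Suc by (simp add: config_at_Suc c)
  next
    case (Some qa)
    obtain q' acts where qa: "qa = (q', acts)" by (cases qa)
    have "set (map tape_read ts) \<subseteq> {..<tm_symbols M}"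
      using Suc by (intro set_tape_read[of ts "tm_tapes M"]) (simp_all add: c)
    then have d: "q' < tm_states M" "length acts = tm_tapes M" "\<forall>(s, d) \<in> set acts. s < tm_symbols M"
      using delta_wf[of q "map tape_read ts" q' acts] Suc Some qa by (auto simp: c)
    have "fst (tape_act (ts ! j) (acts ! j)) i < tm_symbols M" if "j < tm_tapes M" for j i
    proof -
      have "fst (acts ! j) < tm_symbols M" using d that by (auto simp: case_prod_beta)
      moreover have "fst (ts ! j) i < tm_symbols M" using Suc that by (simp add: c)
      ultimately show ?thesis by (simp add: fst_tape_act)
    qed
    then show ?thesis using Suc Some qa d by (simp add: config_at_Suc c)
  qed
qed

lemma view_at_Suc: "fst (view_at w (Suc t)) = next_state (view_at w t)"
  by (cases "config_at w t")
    (auto simp: view_at_def next_state_def config_at_Suc split: option.split)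

lemma cell_at_Suc:
  assumes j: "j < tm_tapes M"
  shows "cell_at w (Suc t) j i =
    next_cell j (view_at w t) (cell_at w t j (i - 1)) (cell_at w t j i) (cell_at w t j (i + 1))"
proof -
  obtain q ts where c: "config_at w t = (q, ts)" by (cases "config_at w t")
  have len: "length ts = tm_tapes M" using config_at_wf[of w t] by (simp add: c)
  show ?thesis
  proof (cases "tm_delta M q (map tape_read ts)")
    case None
    then show ?thesis by (simp add: cell_at_def next_cell_def view_at_def config_at_Suc c)
  next
    case (Some qa)
    obtain q' acts where qa: "qa = (q', acts)" by (cases qa)
    have "set (map tape_read ts) \<subseteq> {..<tm_symbols M}"
      using config_at_wf[of w t] by (intro set_tape_read[of ts "tm_tapes M"]) (simp_all add: c)
    then have d: "length acts = tm_tapes M"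
      using delta_wf[of q "map tape_read ts" q' acts] config_at_wf[of w t] Some qa by (auto simp: c)
    obtain f p where t: "ts ! j = (f, p)" by (cases "ts ! j")
    obtain s mv where a: "acts ! j = (s, mv)" by (cases "acts ! j")
    have "snd (config_at w (Suc t)) ! j = (f(p := s), p + move_offset mv)"
      using Some qa d len j t a by (simp add: config_at_Suc c)
    then show ?thesis
      using Some qa t a by (cases mv) (auto simp: cell_at_def next_cell_def view_at_def c)
  qed
qed

lemma cell_at_0:
  assumes "j < tm_tapes M"
  shows "cell_at w 0 j i = (if j = 0 then word_content w i else 0, i = 0)"
  using assms by (auto simp: cell_at_def config_at_def tm_init_def nth_Cons' word_content_def)

lemma head_bound:
  assumes j: "j < tm_tapes M"
  shows "snd (cell_at w t j i) \<Longrightarrow> \<bar>i\<bar> \<le> int t"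
proof (induction t arbitrary: i)
  case (Suc t)
  from Suc.prems have "snd (cell_at w t j (i - 1)) \<or> snd (cell_at w t j i) \<or> snd (cell_at w t j (i + 1))"
    unfolding cell_at_Suc[OF j] next_cell_def by (auto split: option.splits prod.splits)
  then have "\<bar>i - 1\<bar> \<le> int t \<or> \<bar>i\<bar> \<le> int t \<or> \<bar>i + 1\<bar> \<le> int t"
    using Suc.IH by blast
  then show ?case by linarith
qed (simp add: cell_at_0[OF j])

lemma cell_at_far:
  assumes j: "j < tm_tapes M"
  shows "i < - int t \<or> (i > int t \<and> i \<ge> int (length w)) \<Longrightarrow> cell_at w t j i = (0, False)"
proof (induction t)
  case 0
  then show ?case by (auto simp: cell_at_0[OF j] word_content_def)
next
  case (Suc t)
  have "cell_at w t j i = (0, False)" by (rule Suc.IH) (use Suc.prems in auto)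
  then have "fst (cell_at w (Suc t) j i) = 0"
    unfolding cell_at_Suc[OF j] next_cell_def by (auto split: option.splits prod.splits)
  moreover have "\<not> snd (cell_at w (Suc t) j i)"
    using head_bound[OF j, of w "Suc t" i] Suc.prems by linarith
  ultimately show ?case by (simp add: prod_eq_iff)
qed

lemma view_at_reads:
  assumes "j < tm_tapes M" "cell_at w t j i = (s, True)"
  shows "snd (view_at w t) ! j = s"
  using assms config_at_wf[of w t] by (auto simp: view_at_def cell_at_def tape_read_eq)

lemma head_exists: "\<exists>i. snd (cell_at w t j i)"
  by (simp add: cell_at_def)

lemma config_at_halt:
  assumes "tm_computes_within M w y n" "n \<le> t"
  shows "fst (cell_at w t (tm_tapes M - 1) 0) = word_content y 0"
proof -
  obtain m c where m: "m \<le> n" "(tm_init M w, c) \<in> {(c, c'). tm_step M c = Some c'} ^^ m"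
    "tm_step M c = None" "fst (last (snd c)) = word_content y"
    using assms(1) unfolding tm_computes_within_def by blast
  have "config_at w i = c'" if "(tm_init M w, c') \<in> {(c, c'). tm_step M c = Some c'} ^^ i" for i c'
    using that
  proof (induction i arbitrary: c')
    case 0
    then show ?case by (simp add: config_at_def)
  next
    case (Suc i)
    then obtain c1 where "(tm_init M w, c1) \<in> {(c, c'). tm_step M c = Some c'} ^^ i" "tm_step M c1 = Some c'"
      by auto
    then show ?case using Suc.IH by (simp add: config_at_Suc)
  qed
  from this[OF m(2)] have "config_at w m = c" .
  then have "config_at w (m + i) = c" for i
    by (induction i) (simp_all add: config_at_Suc m(3))
  from this[of "t - m"] have "config_at w t = c" using m(1) assms(2) by simp
  moreover have "snd c \<noteq> []" "length (snd c) = tm_tapes M"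
    using config_at_wf[of w t] M calculation by (auto simp: wf_tm_def)
  ultimately show ?thesis using m(4) by (simp add: cell_at_def last_conv_nth)
qed

subsection \<open>The tableau\<close>

definition views :: "(nat \<times> nat list) list" where
  "views = List.product [0..<tm_states M] (List.n_lists (tm_tapes M) [0..<tm_symbols M])"

text \<open>Views, cells and certificate pairs share one range of values, and the sum exceeds the
  number of each of the three. Decoding takes remainders, so every value means something in each
  role and no constraint has to rule out meaningless values.\<close>

definition alphabet :: nat where
  "alphabet = length views + 2 * tm_symbols M + 5"

definition view_of :: "nat \<Rightarrow> nat \<times> nat list" where
  "view_of v = views ! (v mod length views)"

definition cell_of :: "nat \<Rightarrow> nat \<times> bool" where
  "cell_of v = (v mod tm_symbols M, odd (v div tm_symbols M))"

lemma view_at_in_views: "view_at w t \<in> set views"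
  using config_at_wf[of w t] set_tape_read[of "snd (config_at w t)" "tm_tapes M" "tm_symbols M"]
  by (simp add: views_def view_at_def set_n_lists atLeast0LessThan)

lemma views_nonempty: "views \<noteq> []"
  using view_at_in_views by fastforce

lemma view_of_surj: "z \<in> set views \<Longrightarrow> \<exists>v < alphabet. view_of v = z"
  by (auto simp: in_set_conv_nth view_of_def alphabet_def) (metis mod_less trans_less_add1)

lemma view_of_in_views: "view_of v \<in> set views"
  using views_nonempty by (simp add: view_of_def)

lemma cell_of_surj: "s < tm_symbols M \<Longrightarrow> \<exists>v < alphabet. cell_of v = (s, b)"
  by (rule exI[of _ "s + (if b then tm_symbols M else 0)"]) (auto simp: cell_of_def alphabet_def)

end

text \<open>The bits must stop because the last entry is blank, and what follows them is forced to
  be 3, 4 and blanks. There are \<open>P + 3\<close> entries: up to \<open>P\<close> bits, two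
  parentheses and one blank that witnesses the end.\<close>

lemma cert_of_pairs:
  assumes "p 0 \<in> {1, 2, 3}" "\<And>j. j < P + 2 \<Longrightarrow> pair_next (p j) (p (Suc j))" "p (P + 2) = 0"
  shows "\<exists>u. length u \<le> P \<and> (\<forall>j < P + 3. p j = cert_pair u j)"
proof -
  define n where "n = (LEAST j. p j \<noteq> 1 \<and> p j \<noteq> 2)"
  have ex: "\<exists>j. p j \<noteq> 1 \<and> p j \<noteq> 2" using assms(3) by (intro exI[of _ "P + 2"]) simp
  have n: "p n \<noteq> 1 \<and> p n \<noteq> 2" unfolding n_def using ex by (rule LeastI_ex)
  have bits: "p j = 1 \<or> p j = 2" if "j < n" for j
    using not_less_Least[of j "\<lambda>j. p j \<noteq> 1 \<and> p j \<noteq> 2"] that by (auto simp: n_def)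
  have n_le: "n \<le> P + 2" unfolding n_def using assms(3) by (intro Least_le) simp
  have pn: "p n = 3"
  proof (cases n)
    case 0
    then show ?thesis using n assms(1) by auto
  next
    case (Suc m)
    then show ?thesis using assms(2)[of m] bits[of m] n n_le by (auto simp: pair_next_def)
  qed
  then have "n < P + 2" using assms(3) n_le by (cases "n = P + 2") auto
  then have pn1: "p (Suc n) = 4" using assms(2)[of n] pn by (simp add: pair_next_def)
  have "Suc n \<noteq> P + 2" using pn1 assms(3) by (intro notI) simp
  then have "n \<le> P" using \<open>n < P + 2\<close> by simp
  have zero: "p (n + 2 + i) = 0" if "n + 2 + i \<le> P + 2" for i
    using that
  proof (induction i)
    case 0
    then show ?case using assms(2)[of "Suc n"] pn1 by (simp add: pair_next_def)
  next
    case (Suc i)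
    then show ?case using assms(2)[of "n + 2 + i"] by (simp add: pair_next_def)
  qed
  have "p j = cert_pair (map (\<lambda>j. p j = 2) [0..<n]) j" if "j < P + 3" for j
  proof -
    consider "j < n" | "j = n" | "j = Suc n" | "n + 2 \<le> j" by linarith
    then show ?thesis
    proof cases
      case 4
      then obtain i where "j = n + 2 + i" by (metis le_iff_add)
      then show ?thesis using zero[of i] that by (simp add: cert_pair_def)
    qed (use bits[of j] pn pn1 in \<open>auto simp: cert_pair_def\<close>)
  qed
  then show ?thesis using \<open>n \<le> P\<close> by (intro exI[of _ "map (\<lambda>j. p j = 2) [0..<n]"]) auto
qed

lemma pair_next_cert: "pair_next (cert_pair u j) (cert_pair u (Suc j))"
  by (auto simp: pair_next_def cert_pair_def)

lemma cert_pair_less: "cert_pair u j < 5"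
  by (auto simp: cert_pair_def)

context tm_run
begin

context
  fixes x :: "bool list" and P T :: nat
begin

text \<open>Column \<open>c\<close> of the tableau is the cell \<open>c - (T + 1)\<close> of a tape.\<close>

definition width :: nat where
  "width = 2 * T + length (prefix_word x) + 2 * P + 9"

text \<open>Position 0 is a dummy, since its value is prescribed by \<open>csp_sat\<close>. The
  views follow at 1 to \<open>T + 1\<close>, the certificate at \<open>T + 2\<close> to
  \<open>T + P + 4\<close>, and the cells from \<open>T + P + 5\<close> on.\<close>

definition zpos :: "nat \<Rightarrow> nat" where
  "zpos t = Suc t"

definition wpos :: "nat \<Rightarrow> nat" where
  "wpos j = T + 2 + j"

definition ypos :: "nat \<Rightarrow> nat \<Rightarrow> nat \<Rightarrow> nat" where
  "ypos t j c = T + P + 5 + ((t * tm_tapes M + j) * width + c)"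

definition npos :: nat where
  "npos = T + P + 5 + Suc T * tm_tapes M * width"

text \<open>Only the state of a view is propagated from one time to the next; its symbols are tied
  to the cells that carry a head. The border columns are fixed as blank because the local rule lacks
  a neighbour there.\<close>

definition tableau :: "nat list list" where
  "tableau =
    clauses_of alphabet 1 (\<lambda>v. fst (view_of (v ! 0)) = 0) [[zpos 0]] @
    clauses_of alphabet 2 (\<lambda>v. fst (view_of (v ! 1)) = next_state (view_of (v ! 0)))
      (map (\<lambda>t. [zpos t, zpos (Suc t)]) [0..<T]) @
    clauses_of alphabet 1 (\<lambda>v. pair_of (v ! 0) \<in> {1, 2, 3}) [[wpos 0]] @
    clauses_of alphabet 2 (\<lambda>v. pair_next (pair_of (v ! 0)) (pair_of (v ! 1)))
      (map (\<lambda>j. [wpos j, wpos (Suc j)]) [0..<P + 2]) @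
    clauses_of alphabet 1 (\<lambda>v. pair_of (v ! 0) = 0) [[wpos (P + 2)]] @
    clauses_of alphabet 1 (\<lambda>v. fst (cell_of (v ! 0)) = 2) [[ypos T (tm_tapes M - 1) (Suc T)]] @
    clauses_of alphabet 2 (\<lambda>v. cell_of (v ! 1) = (left_symbol (pair_of (v ! 0)), False))
      (map (\<lambda>j. [wpos j, ypos 0 0 (Suc T + (length (prefix_word x) + 2 * j))]) [0..<P + 3]) @
    clauses_of alphabet 2 (\<lambda>v. cell_of (v ! 1) = (right_symbol (pair_of (v ! 0)), False))
      (map (\<lambda>j. [wpos j, ypos 0 0 (Suc T + Suc (length (prefix_word x) + 2 * j))]) [0..<P + 3]) @
    clauses_of alphabet 1 (\<lambda>v. cell_of (v ! 0) = (1, False))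
      (map (\<lambda>i. [ypos 0 0 (Suc T + i)])
        (filter (\<lambda>i. \<not> nth_default False (prefix_word x) i) [0..<length (prefix_word x)])) @
    clauses_of alphabet 1 (\<lambda>v. cell_of (v ! 0) = (2, False))
      (map (\<lambda>i. [ypos 0 0 (Suc T + i)])
        (filter (\<lambda>i. i \<noteq> 0 \<and> nth_default False (prefix_word x) i) [0..<length (prefix_word x)])) @
    clauses_of alphabet 1 (\<lambda>v. cell_of (v ! 0) = (2, True)) [[ypos 0 0 (Suc T)]] @
    clauses_of alphabet 1 (\<lambda>v. cell_of (v ! 0) = (0, False))
      (map (\<lambda>c. [ypos 0 0 c])
        (filter (\<lambda>c. c < Suc T \<or> Suc T + (length (prefix_word x) + 2 * (P + 3)) \<le> c) [0..<width])) @
    concat (map (\<lambda>j.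
      clauses_of alphabet 1 (\<lambda>v. cell_of (v ! 0) = (0, True)) [[ypos 0 j (Suc T)]] @
      clauses_of alphabet 1 (\<lambda>v. cell_of (v ! 0) = (0, False))
        (map (\<lambda>c. [ypos 0 j c]) (filter (\<lambda>c. c \<noteq> Suc T) [0..<width]))) [1..<tm_tapes M]) @
    concat (map (\<lambda>j.
      clauses_of alphabet 2 (\<lambda>v. snd (cell_of (v ! 1)) \<longrightarrow> fst (cell_of (v ! 1)) = snd (view_of (v ! 0)) ! j)
        (concat (map (\<lambda>t. map (\<lambda>c. [zpos t, ypos t j c]) [0..<width]) [0..<Suc T])) @
      clauses_of alphabet 5
        (\<lambda>v. cell_of (v ! 4) = next_cell j (view_of (v ! 0)) (cell_of (v ! 1)) (cell_of (v ! 2)) (cell_of (v ! 3)))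
        (concat (map (\<lambda>t. map (\<lambda>c. [zpos t, ypos t j c, ypos t j (Suc c), ypos t j (Suc (Suc c)),
          ypos (Suc t) j (Suc c)]) [0..<width - 2]) [0..<T])) @
      clauses_of alphabet 1 (\<lambda>v. cell_of (v ! 0) = (0, False))
        (concat (map (\<lambda>t. [[ypos t j 0], [ypos t j (width - 1)]]) [0..<Suc T]))) [0..<tm_tapes M])"

lemma zpos_less: "t \<le> T \<Longrightarrow> zpos t < npos"
  by (simp add: zpos_def npos_def)

lemma wpos_less: "j < P + 3 \<Longrightarrow> wpos j < npos"
  by (simp add: wpos_def npos_def)

lemma ypos_less: "t \<le> T \<Longrightarrow> j < tm_tapes M \<Longrightarrow> c < width \<Longrightarrow> ypos t j c < npos"
proof -
  assume *: "t \<le> T" "j < tm_tapes M" "c < width"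
  have "t * tm_tapes M + j < Suc t * tm_tapes M" using * by simp
  also have "\<dots> \<le> Suc T * tm_tapes M" using * by (intro mult_le_mono1) simp
  finally have "Suc (t * tm_tapes M + j) * width \<le> Suc T * tm_tapes M * width"
    by (intro mult_le_mono1) simp
  then show ?thesis using * by (simp add: ypos_def npos_def)
qed

lemma tapes_pos: "0 < tm_tapes M"
  using M by (simp add: wf_tm_def)

definition tableau_sat :: "(nat \<Rightarrow> nat) \<Rightarrow> bool" where
  "tableau_sat a \<longleftrightarrow>
    fst (view_of (a (zpos 0))) = 0 \<and>
    (\<forall>t < T. fst (view_of (a (zpos (Suc t)))) = next_state (view_of (a (zpos t)))) \<and>
    pair_of (a (wpos 0)) \<in> {1, 2, 3} \<and>
    (\<forall>j < P + 2. pair_next (pair_of (a (wpos j))) (pair_of (a (wpos (Suc j))))) \<and>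
    pair_of (a (wpos (P + 2))) = 0 \<and>
    fst (cell_of (a (ypos T (tm_tapes M - 1) (Suc T)))) = 2 \<and>
    (\<forall>j < P + 3. cell_of (a (ypos 0 0 (Suc T + (length (prefix_word x) + 2 * j)))) = (left_symbol (pair_of (a (wpos j))), False)) \<and>
    (\<forall>j < P + 3. cell_of (a (ypos 0 0 (Suc T + Suc (length (prefix_word x) + 2 * j)))) = (right_symbol (pair_of (a (wpos j))), False)) \<and>
    (\<forall>i < length (prefix_word x). \<not> prefix_word x ! i \<longrightarrow> cell_of (a (ypos 0 0 (Suc T + i))) = (1, False)) \<and>
    (\<forall>i < length (prefix_word x). i \<noteq> 0 \<and> prefix_word x ! i \<longrightarrow> cell_of (a (ypos 0 0 (Suc T + i))) = (2, False)) \<and>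
    cell_of (a (ypos 0 0 (Suc T))) = (2, True) \<and>
    (\<forall>c < width. c < Suc T \<or> Suc T + (length (prefix_word x) + 2 * (P + 3)) \<le> c \<longrightarrow> cell_of (a (ypos 0 0 c)) = (0, False)) \<and>
    (\<forall>j \<in> {1..<tm_tapes M}. cell_of (a (ypos 0 j (Suc T))) = (0, True)) \<and>
    (\<forall>j \<in> {1..<tm_tapes M}. \<forall>c < width. c \<noteq> Suc T \<longrightarrow> cell_of (a (ypos 0 j c)) = (0, False)) \<and>
    (\<forall>j < tm_tapes M. \<forall>t \<le> T. \<forall>c < width. snd (cell_of (a (ypos t j c))) \<longrightarrow>
      fst (cell_of (a (ypos t j c))) = snd (view_of (a (zpos t))) ! j) \<and>
    (\<forall>j < tm_tapes M. \<forall>t < T. \<forall>c < width - 2. cell_of (a (ypos (Suc t) j (Suc c))) =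
      next_cell j (view_of (a (zpos t))) (cell_of (a (ypos t j c))) (cell_of (a (ypos t j (Suc c))))
        (cell_of (a (ypos t j (Suc (Suc c)))))) \<and>
    (\<forall>j < tm_tapes M. \<forall>t \<le> T. cell_of (a (ypos t j 0)) = (0, False) \<and> cell_of (a (ypos t j (width - 1))) = (0, False))"

definition scope_ok :: "nat \<Rightarrow> nat list list \<Rightarrow> bool" where
  "scope_ok r scs \<longleftrightarrow> (\<forall>sc \<in> set scs. length sc = r \<and> set sc \<subseteq> {..<npos})"

lemma scopes_ok1:
  "scope_ok 1 [[zpos 0]]" "scope_ok 2 (map (\<lambda>t. [zpos t, zpos (Suc t)]) [0..<T])" "scope_ok 1 [[wpos 0]]"
  "scope_ok 2 (map (\<lambda>j. [wpos j, wpos (Suc j)]) [0..<P + 2])" "scope_ok 1 [[wpos (P + 2)]]"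
  "scope_ok 1 [[ypos T (tm_tapes M - 1) (Suc T)]]"
  "scope_ok 2 (map (\<lambda>j. [wpos j, ypos 0 0 (Suc T + (length (prefix_word x) + 2 * j))]) [0..<P + 3])"
  "scope_ok 2 (map (\<lambda>j. [wpos j, ypos 0 0 (Suc T + Suc (length (prefix_word x) + 2 * j))]) [0..<P + 3])"
  "scope_ok 1 [[ypos 0 0 (Suc T)]]"
  "scope_ok 1 (map (\<lambda>i. [ypos 0 0 (Suc T + i)]) (filter Q [0..<length (prefix_word x)]))"
  "scope_ok 1 (map (\<lambda>c. [ypos 0 0 c]) (filter Q [0..<width]))"
  using tapes_pos by (auto simp: scope_ok_def zpos_less wpos_less width_def intro!: ypos_less)

lemma scopes_ok2:
  assumes "j \<in> set [i..<tm_tapes M]"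
  shows "scope_ok 1 [[ypos 0 j (Suc T)]]"
    "scope_ok 1 (map (\<lambda>c. [ypos 0 j c]) (filter Q [0..<width]))"
    "scope_ok 2 (concat (map (\<lambda>t. map (\<lambda>c. [zpos t, ypos t j c]) [0..<width]) [0..<Suc T]))"
    "scope_ok 5 (concat (map (\<lambda>t. map (\<lambda>c. [zpos t, ypos t j c, ypos t j (Suc c), ypos t j (Suc (Suc c)),
          ypos (Suc t) j (Suc c)]) [0..<width - 2]) [0..<T]))"
    "scope_ok 1 (concat (map (\<lambda>t. [[ypos t j 0], [ypos t j (width - 1)]]) [0..<Suc T]))"
proof -
  have w: "Suc T < width" by (simp add: width_def)
  show "scope_ok 1 [[ypos 0 j (Suc T)]]"
    "scope_ok 1 (map (\<lambda>c. [ypos 0 j c]) (filter Q [0..<width]))"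
    "scope_ok 2 (concat (map (\<lambda>t. map (\<lambda>c. [zpos t, ypos t j c]) [0..<width]) [0..<Suc T]))"
    "scope_ok 5 (concat (map (\<lambda>t. map (\<lambda>c. [zpos t, ypos t j c, ypos t j (Suc c), ypos t j (Suc (Suc c)),
          ypos (Suc t) j (Suc c)]) [0..<width - 2]) [0..<T]))"
    "scope_ok 1 (concat (map (\<lambda>t. [[ypos t j 0], [ypos t j (width - 1)]]) [0..<Suc T]))"
    using assms w by (auto simp: scope_ok_def zpos_less intro!: ypos_less)
qed

lemma ball_set_append: "(\<forall>c \<in> set (xs @ ys). R c) \<longleftrightarrow> (\<forall>c \<in> set xs. R c) \<and> (\<forall>c \<in> set ys. R c)"
  by auto

lemma ball_set_concat_map: "(\<forall>c \<in> set (concat (map f js)). R c) \<longleftrightarrow> (\<forall>j \<in> set js. \<forall>c \<in> set (f j). R c)"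
  by auto

lemma tableau_bound:
  assumes "c \<in> set tableau" "l \<in> set c"
  shows "l < npos * alphabet"
proof -
  have b: "\<forall>c \<in> set (clauses_of alphabet r Q scs). \<forall>l \<in> set c. l < npos * alphabet" if "scope_ok r scs" for r Q scs
    using clauses_of_bound[of scs r npos] that by (auto simp: scope_ok_def)
  have "\<forall>c \<in> set tableau. \<forall>l \<in> set c. l < npos * alphabet"
    unfolding tableau_def ball_set_append ball_set_concat_map
    by (intro conjI; (rule b, rule scopes_ok1)?) (intro ballI[of "set [_..<_]"] conjI b scopes_ok2; assumption)+
  then show ?thesis using assms by blast
qed

lemma tableau_sat_iff:
  assumes a: "\<And>p. p < npos \<Longrightarrow> a p < alphabet"
  shows "(\<forall>c \<in> set tableau. \<exists>p < npos. p * alphabet + a p \<in> set c) \<longleftrightarrow> tableau_sat a"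
proof -
  define sat where "sat c \<longleftrightarrow> (\<exists>p < npos. p * alphabet + a p \<in> set c)" for c
  have s: "(\<forall>c \<in> set (clauses_of alphabet r Q scs). sat c) \<longleftrightarrow> (\<forall>sc \<in> set scs. Q (map a sc))" if "scope_ok r scs" for r Q scs
    using clauses_of_sat[where N = npos and a = a and k = alphabet and scs = scs and r = r and Q = Q] a that
    by (simp add: sat_def scope_ok_def)
  have h13: "(\<forall>c \<in> set (concat (map (\<lambda>j.
      clauses_of alphabet 1 (\<lambda>v. cell_of (v ! 0) = (0, True)) [[ypos 0 j (Suc T)]] @
      clauses_of alphabet 1 (\<lambda>v. cell_of (v ! 0) = (0, False))
        (map (\<lambda>c. [ypos 0 j c]) (filter (\<lambda>c. c \<noteq> Suc T) [0..<width]))) [1..<tm_tapes M])). sat c) \<longleftrightarrow>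
    (\<forall>j \<in> {1..<tm_tapes M}. cell_of (a (ypos 0 j (Suc T))) = (0, True)) \<and>
    (\<forall>j \<in> {1..<tm_tapes M}. \<forall>c < width. c \<noteq> Suc T \<longrightarrow> cell_of (a (ypos 0 j c)) = (0, False))"
    unfolding ball_set_concat_map ball_set_append ball_conj_distrib
    using s[OF scopes_ok2(1)[of _ 1]] s[OF scopes_ok2(2)[of _ 1]] by (intro arg_cong2[of _ _ _ _ "(\<and>)"] ball_cong) auto
  have h15: "(\<forall>c \<in> set (concat (map (\<lambda>j.
      clauses_of alphabet 2 (\<lambda>v. snd (cell_of (v ! 1)) \<longrightarrow> fst (cell_of (v ! 1)) = snd (view_of (v ! 0)) ! j)
        (concat (map (\<lambda>t. map (\<lambda>c. [zpos t, ypos t j c]) [0..<width]) [0..<Suc T])) @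
      clauses_of alphabet 5
        (\<lambda>v. cell_of (v ! 4) = next_cell j (view_of (v ! 0)) (cell_of (v ! 1)) (cell_of (v ! 2)) (cell_of (v ! 3)))
        (concat (map (\<lambda>t. map (\<lambda>c. [zpos t, ypos t j c, ypos t j (Suc c), ypos t j (Suc (Suc c)),
          ypos (Suc t) j (Suc c)]) [0..<width - 2]) [0..<T])) @
      clauses_of alphabet 1 (\<lambda>v. cell_of (v ! 0) = (0, False))
        (concat (map (\<lambda>t. [[ypos t j 0], [ypos t j (width - 1)]]) [0..<Suc T]))) [0..<tm_tapes M])). sat c) \<longleftrightarrow>
    (\<forall>j \<in> set [0..<tm_tapes M]. \<forall>t \<le> T. \<forall>c < width. snd (cell_of (a (ypos t j c))) \<longrightarrow>
      fst (cell_of (a (ypos t j c))) = snd (view_of (a (zpos t))) ! j) \<and>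
    (\<forall>j \<in> set [0..<tm_tapes M]. \<forall>t < T. \<forall>c < width - 2. cell_of (a (ypos (Suc t) j (Suc c))) =
      next_cell j (view_of (a (zpos t))) (cell_of (a (ypos t j c))) (cell_of (a (ypos t j (Suc c))))
        (cell_of (a (ypos t j (Suc (Suc c)))))) \<and>
    (\<forall>j \<in> set [0..<tm_tapes M]. \<forall>t \<le> T. cell_of (a (ypos t j 0)) = (0, False) \<and> cell_of (a (ypos t j (width - 1))) = (0, False))"
    unfolding ball_set_concat_map ball_set_append ball_conj_distrib
  proof (intro arg_cong2[of _ _ _ _ "(\<and>)"] ball_cong refl)
    fix j assume j: "j \<in> set [0..<tm_tapes M]"
    show "(\<forall>c\<in>set (clauses_of alphabet 2 (\<lambda>v. snd (cell_of (v ! 1)) \<longrightarrow> fst (cell_of (v ! 1)) = snd (view_of (v ! 0)) ! j)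
        (concat (map (\<lambda>t. map (\<lambda>c. [zpos t, ypos t j c]) [0..<width]) [0..<Suc T]))). sat c) \<longleftrightarrow>
      (\<forall>t \<le> T. \<forall>c < width. snd (cell_of (a (ypos t j c))) \<longrightarrow>
        fst (cell_of (a (ypos t j c))) = snd (view_of (a (zpos t))) ! j)"
      unfolding s[OF scopes_ok2(3)[OF j]] by (auto simp: less_Suc_eq_le simp del: upt_Suc)
    show "(\<forall>c\<in>set (clauses_of alphabet 5
        (\<lambda>v. cell_of (v ! 4) = next_cell j (view_of (v ! 0)) (cell_of (v ! 1)) (cell_of (v ! 2)) (cell_of (v ! 3)))
        (concat (map (\<lambda>t. map (\<lambda>c. [zpos t, ypos t j c, ypos t j (Suc c), ypos t j (Suc (Suc c)),
          ypos (Suc t) j (Suc c)]) [0..<width - 2]) [0..<T]))). sat c) \<longleftrightarrow>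
      (\<forall>t < T. \<forall>c < width - 2. cell_of (a (ypos (Suc t) j (Suc c))) =
        next_cell j (view_of (a (zpos t))) (cell_of (a (ypos t j c))) (cell_of (a (ypos t j (Suc c))))
          (cell_of (a (ypos t j (Suc (Suc c))))))"
      unfolding s[OF scopes_ok2(4)[OF j]] by auto
    show "(\<forall>c\<in>set (clauses_of alphabet 1 (\<lambda>v. cell_of (v ! 0) = (0, False))
        (concat (map (\<lambda>t. [[ypos t j 0], [ypos t j (width - 1)]]) [0..<Suc T]))). sat c) \<longleftrightarrow>
      (\<forall>t \<le> T. cell_of (a (ypos t j 0)) = (0, False) \<and> cell_of (a (ypos t j (width - 1))) = (0, False))"
      unfolding s[OF scopes_ok2(5)[OF j]] by (auto simp: less_Suc_eq_le simp del: upt_Suc)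
  qed
  have "(\<forall>c \<in> set tableau. sat c) \<longleftrightarrow> tableau_sat a"
    unfolding tableau_def tableau_sat_def ball_set_append[of "clauses_of _ _ _ _"] h13 h15 s[OF scopes_ok1(1)] s[OF scopes_ok1(2)] s[OF scopes_ok1(3)]
      s[OF scopes_ok1(4)] s[OF scopes_ok1(5)] s[OF scopes_ok1(6)] s[OF scopes_ok1(7)] s[OF scopes_ok1(8)] s[OF scopes_ok1(9)] s[OF scopes_ok1(10)] s[OF scopes_ok1(11)]
      ball_set_append[of "concat _"] conj_assoc
    by (intro arg_cong2[of _ _ _ _ "(\<and>)"]) (auto simp: nth_default_def simp del: upt_Suc)
  then show ?thesis by (simp add: sat_def)
qed

section \<open>Satisfying assignments of the tableau and accepting runs\<close>

lemma length_snd_view_of: "length (snd (view_of v)) = tm_tapes M"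
  using view_of_in_views[of v] by (auto simp: views_def set_n_lists)

lemma prefix_word_nth: "word_content (enc_pair x u) (int i) = (if prefix_word x ! i then 2 else 1)"
  if "i < length (prefix_word x)"
  using that by (simp add: word_content_def length_enc_pair enc_pair_prefix nth_append)

lemma prefix_word_0: "prefix_word x ! 0" "0 < length (prefix_word x)"
  by (simp_all add: prefix_word_def)

text \<open>By induction on the time, the state and all columns agree with the run on the pair of
  \<open>x\<close> and the certificate read off the assignment. The border columns lie beyond all
  cells that a head reaches within \<open>T\<close> steps or that the input occupies, so they are
  blank in the run, too.\<close>

lemma tableau_sat_run:
  assumes sat: "tableau_sat a"
  shows "\<exists>u. length u \<le> P \<and> fst (cell_at (enc_pair x u) T (tm_tapes M - 1) 0) = 2"
proof -
  note S = sat[unfolded tableau_sat_def]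
  obtain u where u: "length u \<le> P" "\<And>j. j < P + 3 \<Longrightarrow> pair_of (a (wpos j)) = cert_pair u j"
    using cert_of_pairs[of "\<lambda>j. pair_of (a (wpos j))" P] S by auto
  define w where "w = enc_pair x u"
  define l where "l = length (prefix_word x)"
  have lw: "int (length w) \<le> int (l + 2 * P + 4)" using u(1) by (simp add: w_def length_enc_pair l_def)
  have width: "width = 2 * T + l + 2 * P + 9" by (simp add: width_def l_def)
  define col where "col c = int c - int (Suc T)" for c
  define inv where "inv t \<longleftrightarrow> (\<forall>j < tm_tapes M. \<forall>c < width. cell_of (a (ypos t j c)) = cell_at w t j (col c)) \<and>
    fst (view_of (a (zpos t))) = fst (view_at w t)" for t
  \<comment> \<open>The head of each tape is within distance \<open>t\<close> of the origin, hence
    in some column of the tableau, and that column pins down the symbol in the view.\<close>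
  have view: "view_of (a (zpos t)) = view_at w t" if "t \<le> T" "inv t" for t
  proof -
    have "snd (view_of (a (zpos t))) ! j = snd (view_at w t) ! j" if j: "j < tm_tapes M" for j
    proof -
      obtain i where i: "snd (cell_at w t j i)" using head_exists by blast
      have b: "\<bar>i\<bar> \<le> int t" by (rule head_bound[OF j i])
      define c where "c = nat (i + int (Suc T))"
      have c: "c < width" "col c = i" using b \<open>t \<le> T\<close> by (auto simp: c_def col_def width)
      have e: "cell_of (a (ypos t j c)) = cell_at w t j i" using \<open>inv t\<close> j c by (simp add: inv_def)
      have "fst (cell_of (a (ypos t j c))) = snd (view_of (a (zpos t))) ! j"
        using S j c(1) \<open>t \<le> T\<close> i unfolding e[symmetric] by blast
      moreover have "snd (view_at w t) ! j = fst (cell_at w t j i)"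
        using view_at_reads[OF j, of w t i "fst (cell_at w t j i)"] i by (simp add: prod_eq_iff)
      ultimately show ?thesis by (simp add: e)
    qed
    moreover have "length (snd (view_at w t)) = tm_tapes M"
      using config_at_wf[of w t] by (simp add: view_at_def)
    ultimately have "snd (view_of (a (zpos t))) = snd (view_at w t)"
      by (intro nth_equalityI) (simp_all add: length_snd_view_of)
    then show ?thesis using \<open>inv t\<close> by (simp add: inv_def prod_eq_iff)
  qed
  have "inv t" if "t \<le> T" for t
    using that
  proof (induction t)
    case 0
    have "cell_of (a (ypos 0 j c)) = cell_at w 0 j (col c)" if j: "j < tm_tapes M" and c: "c < width" for j c
    proof (cases "j = 0")
      case False
      then have "j \<in> {1..<tm_tapes M}" using j by auto
      then have "cell_of (a (ypos 0 j c)) = (if c = Suc T then (0, True) else (0, False))"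
        using S c by simp
      then show ?thesis using False by (auto simp: cell_at_0[OF j] col_def)
    next
      case True
      have cell: "cell_at w 0 0 i = (word_content w i, i = 0)" for i by (simp add: cell_at_0[OF tapes_pos])
      have wn: "word_content w i = 0" if "i < 0" for i using that by (simp add: word_content_def)
      \<comment> \<open>The first row: blanks on the left, the fixed prefix, the left and right
        cells of the certificate pairs, and blanks on the right.\<close>
      consider "c < Suc T" | i where "c = Suc T + i" "i < l" | j where "c = Suc T + (l + 2 * j)" "j < P + 3"
        | j where "c = Suc T + Suc (l + 2 * j)" "j < P + 3" | "Suc T + (l + 2 * (P + 3)) \<le> c"
      proof -
        consider "c < Suc T" | "Suc T \<le> c" "c < Suc T + l" | "Suc T + l \<le> c" "c < Suc T + (l + 2 * (P + 3))"
          | "Suc T + (l + 2 * (P + 3)) \<le> c" by linarith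
        then show ?thesis
        proof cases
          case 2
          then show ?thesis using that(2)[of "c - Suc T"] by simp
        next
          case 3
          then obtain i where i: "c = Suc T + l + i" "i < 2 * (P + 3)" by (metis add.assoc le_iff_add nat_add_left_cancel_less)
          show ?thesis
          proof (cases "even i")
            case True
            then obtain j where "i = 2 * j" by blast
            then show ?thesis using that(3)[of j] i by simp
          next
            case False
            then obtain j where "i = 2 * j + 1" using oddE by blast
            then show ?thesis using that(4)[of j] i by simp
          qed
        qed (use that in auto)
      qed
      then have "cell_of (a (ypos 0 0 c)) = cell_at w 0 0 (col c)"
      proof cases
        case 1
        then have "cell_of (a (ypos 0 0 c)) = (0, False)" using S c by blast
        then show ?thesis using 1 wn[of "col c"] by (auto simp: cell col_def)
      next
        case (2 i)
        have ci: "col c = int i" by (simp add: col_def 2)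
        have wc: "word_content w (int i) = (if prefix_word x ! i then 2 else 1)"
          unfolding w_def using prefix_word_nth 2 by (simp add: l_def)
        show ?thesis
        proof (cases "i = 0")
          case True
          have "col (Suc T) = 0" by (simp add: col_def)
          then show ?thesis using True S wc prefix_word_0 2 by (simp add: cell)
        next
          case False
          then have "cell_of (a (ypos 0 0 (Suc T + i))) = (if prefix_word x ! i then (2, False) else (1, False))"
            using S 2 by (simp add: l_def)
          moreover have "cell_at w 0 0 (col c) = (if prefix_word x ! i then 2 else 1, False)"
            unfolding cell ci using wc False by simp
          ultimately show ?thesis using 2 by simp
        qed
      next
        case (3 j)
        then have "cell_of (a (ypos 0 0 c)) = (left_symbol (cert_pair u j), False)"
          using S u(2)[of j] by (simp add: l_def)
        moreover have "col c = int (l + 2 * j)" by (simp add: col_def 3)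
        ultimately show ?thesis
          using word_content_cert(1)[of x u j] prefix_word_0(2)
          by (simp add: cell w_def[symmetric] l_def[symmetric])
      next
        case (4 j)
        then have "cell_of (a (ypos 0 0 c)) = (right_symbol (cert_pair u j), False)"
          using S u(2)[of j] by (simp add: l_def)
        moreover have "col c = int (Suc (l + 2 * j))" by (simp add: col_def 4)
        ultimately show ?thesis
          using word_content_cert(2)[of x u j] by (simp add: cell w_def[symmetric] l_def[symmetric])
      next
        case 5
        then have "cell_of (a (ypos 0 0 c)) = (0, False)" using S c by (simp add: l_def)
        moreover have "word_content w (col c) = 0" using 5 lw by (auto simp: word_content_def col_def)
        moreover have "col c \<noteq> 0" using 5 prefix_word_0(2) by (auto simp: col_def l_def)
        ultimately show ?thesis by (simp add: cell)
      qed
      then show ?thesis using True by simp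
    qed
    moreover have "fst (view_of (a (zpos 0))) = fst (view_at w 0)"
      using S by (simp add: view_at_def config_at_def tm_init_def)
    ultimately show ?case by (simp add: inv_def)
  next
    case (Suc t)
    then have I: "inv t" "t \<le> T" "t < T" by auto
    note v = view[OF I(2,1)]
    have "cell_of (a (ypos (Suc t) j c)) = cell_at w (Suc t) j (col c)" if j: "j < tm_tapes M" and c: "c < width" for j c
    proof -
      have "c = 0 \<or> c = width - 1 \<or> (\<exists>c'. c = Suc c' \<and> c' < width - 2)"
        using c by (cases c) auto
      then consider "c = 0" | "c = width - 1" | c' where "c = Suc c'" "c' < width - 2" by blast
      then show ?thesis
      proof cases
        case 1
        then have "cell_of (a (ypos (Suc t) j c)) = (0, False)" using S j Suc.prems by simp
        then show ?thesis using cell_at_far[OF j, of "col c" "Suc t" w] 1 Suc.prems by (simp add: col_def)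
      next
        case 2
        then have "cell_of (a (ypos (Suc t) j c)) = (0, False)" using S j Suc.prems by simp
        moreover have "cell_at w (Suc t) j (col c) = (0, False)"
          using 2 Suc.prems lw by (intro cell_at_far[OF j] disjI2) (auto simp: col_def width)
        ultimately show ?thesis by simp
      next
        case (3 c')
        have e: "col c' = col c - 1" "col (Suc (Suc c')) = col c + 1" by (simp_all add: col_def 3)
        have "cell_of (a (ypos t j c')) = cell_at w t j (col c - 1)"
          "cell_of (a (ypos t j (Suc c'))) = cell_at w t j (col c)"
          "cell_of (a (ypos t j (Suc (Suc c')))) = cell_at w t j (col c + 1)"
          using I(1) j 3 c unfolding inv_def e[symmetric] by auto
        then show ?thesis
          using S j 3 I(3) v unfolding cell_at_Suc[OF j] by simp
      qed
    qed
    moreover have "fst (view_of (a (zpos (Suc t)))) = fst (view_at w (Suc t))"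
      using S I(3) v by (simp add: view_at_Suc)
    ultimately show ?case by (simp add: inv_def)
  qed
  then have "inv T" by simp
  then have "cell_of (a (ypos T (tm_tapes M - 1) (Suc T))) = cell_at w T (tm_tapes M - 1) (col (Suc T))"
    using tapes_pos by (simp add: inv_def width)
  then have "fst (cell_at w T (tm_tapes M - 1) 0) = 2"
    using S by (simp add: col_def)
  then show ?thesis using u(1) by (auto simp: w_def)
qed

lemma run_tableau_sat:
  assumes u: "length u \<le> P" and acc: "fst (cell_at (enc_pair x u) T (tm_tapes M - 1) 0) = 2"
  shows "\<exists>a. a 0 = 0 \<and> (\<forall>p. a p < alphabet) \<and> tableau_sat a"
proof -
  define w where "w = enc_pair x u"
  define l where "l = length (prefix_word x)"
  have lw: "int (length w) \<le> int (l + 2 * P + 4)" using u by (simp add: w_def length_enc_pair l_def)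
  have width: "width = 2 * T + l + 2 * P + 9" by (simp add: width_def l_def)
  define col where "col c = int c - int (Suc T)" for c
  define zc where "zc t = (SOME v. v < alphabet \<and> view_of v = view_at w t)" for t
  define yc where "yc t j c = (SOME v. v < alphabet \<and> (j < tm_tapes M \<longrightarrow> cell_of v = cell_at w t j (col c)))" for t j c
  have zc: "zc t < alphabet \<and> view_of (zc t) = view_at w t" for t
    unfolding zc_def by (rule someI_ex) (use view_of_surj[OF view_at_in_views] in blast)
  have yc: "yc t j c < alphabet \<and> (j < tm_tapes M \<longrightarrow> cell_of (yc t j c) = cell_at w t j (col c))" for t j c
    unfolding yc_def
  proof (rule someI_ex, cases "j < tm_tapes M")
    case True
    then have "fst (cell_at w t j (col c)) < tm_symbols M"
      using config_at_wf[of w t] by (simp add: cell_at_def)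
    from cell_of_surj[OF this, of "snd (cell_at w t j (col c))"]
    show "\<exists>v. v < alphabet \<and> (j < tm_tapes M \<longrightarrow> cell_of v = cell_at w t j (col c))" by auto
  next
    case False
    have "0 < alphabet" by (simp add: alphabet_def)
    then show "\<exists>v. v < alphabet \<and> (j < tm_tapes M \<longrightarrow> cell_of v = cell_at w t j (col c))" using False by blast
  qed
  \<comment> \<open>Quotients and remainders invert the numbering of the positions. A certificate
    pair is below 5 and is its own code.\<close>
  define a where "a p = (if p = 0 then 0 else if p < T + 2 then zc (p - 1)
    else if p < T + P + 5 then cert_pair u (p - (T + 2))
    else let r = p - (T + P + 5) in yc (r div width div tm_tapes M) (r div width mod tm_tapes M) (r mod width))" for p
  have a_z: "view_of (a (zpos t)) = view_at w t" if "t \<le> T" for t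
    using that zc by (simp add: a_def zpos_def)
  have a_w: "pair_of (a (wpos j)) = cert_pair u j" if "j < P + 3" for j
    using that cert_pair_less[of u j] by (simp add: a_def wpos_def pair_of_def)
  have a_y: "cell_of (a (ypos t j c)) = cell_at w t j (col c)" if "j < tm_tapes M" "c < width" for t j c
  proof -
    have "((t * tm_tapes M + j) * width + c) div width = t * tm_tapes M + j" "((t * tm_tapes M + j) * width + c) mod width = c"
      "(t * tm_tapes M + j) div tm_tapes M = t" "(t * tm_tapes M + j) mod tm_tapes M = j"
      using that by auto
    then have "a (ypos t j c) = yc t j c" by (simp add: a_def ypos_def Let_def)
    then show ?thesis using yc that by simp
  qed
  have "cert_pair u j < alphabet" for j
    using cert_pair_less[of u j] by (simp add: alphabet_def)
  moreover have "0 < alphabet" by (simp add: alphabet_def)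
  ultimately have a_less: "a p < alphabet" for p
    using zc yc by (simp add: a_def Let_def)
  have cell0: "cell_at w 0 0 i = (word_content w i, i = 0)" for i by (simp add: cell_at_0[OF tapes_pos])
  have K: "0 < tm_tapes M" by (rule tapes_pos)
  have "tableau_sat a"
    unfolding tableau_sat_def
  proof (intro conjI allI ballI impI)
    show "fst (view_of (a (zpos 0))) = 0" by (simp add: a_z view_at_def config_at_def tm_init_def)
    show "fst (view_of (a (zpos (Suc t)))) = next_state (view_of (a (zpos t)))" if "t < T" for t
      using that by (simp add: a_z view_at_Suc)
    show "pair_of (a (wpos 0)) \<in> {1, 2, 3}" by (simp add: a_w cert_pair_def)
    show "pair_next (pair_of (a (wpos j))) (pair_of (a (wpos (Suc j))))" if "j < P + 2" for j
      using that by (simp add: a_w pair_next_cert)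
    show "pair_of (a (wpos (P + 2))) = 0" using u by (simp add: a_w cert_pair_def)
    show "fst (cell_of (a (ypos T (tm_tapes M - 1) (Suc T)))) = 2"
      using acc K by (subst a_y) (auto simp: width col_def w_def)
    show "cell_of (a (ypos 0 0 (Suc T + (length (prefix_word x) + 2 * j)))) = (left_symbol (pair_of (a (wpos j))), False)"
      if "j < P + 3" for j
    proof -
      have "col (Suc T + (l + 2 * j)) = int (l + 2 * j)" by (simp add: col_def)
      then show ?thesis
        using that K word_content_cert(1)[of x u j] prefix_word_0(2) a_y[of 0 "Suc T + (l + 2 * j)" 0]
        by (simp add: width a_w cell0 l_def[symmetric] w_def[symmetric])
    qed
    show "cell_of (a (ypos 0 0 (Suc T + Suc (length (prefix_word x) + 2 * j)))) = (right_symbol (pair_of (a (wpos j))), False)"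
      if "j < P + 3" for j
    proof -
      have "col (Suc T + Suc (l + 2 * j)) = int (Suc (l + 2 * j))" by (simp add: col_def)
      then show ?thesis
        using that K word_content_cert(2)[of x u j] a_y[of 0 "Suc T + Suc (l + 2 * j)" 0]
        by (simp add: width a_w cell0 l_def[symmetric] w_def[symmetric])
    qed
    have pre: "cell_of (a (ypos 0 0 (Suc T + i))) = (if prefix_word x ! i then 2 else 1, i = 0)" if "i < length (prefix_word x)" for i
    proof -
      have "col (Suc T + i) = int i" by (simp add: col_def)
      then show ?thesis
        using that K prefix_word_nth[OF that, of u] a_y[of 0 "Suc T + i" 0]
        by (simp add: width cell0 l_def[symmetric] w_def[symmetric])
    qed
    show "cell_of (a (ypos 0 0 (Suc T + i))) = (1, False)" if "i < length (prefix_word x)" "\<not> prefix_word x ! i" for i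
      using pre[OF that(1)] that(2) prefix_word_0 by (cases "i = 0") auto
    show "cell_of (a (ypos 0 0 (Suc T + i))) = (2, False)" if "i < length (prefix_word x)" "i \<noteq> 0 \<and> prefix_word x ! i" for i
      using pre[OF that(1)] that(2) by simp
    show "cell_of (a (ypos 0 0 (Suc T))) = (2, True)"
      using pre[of 0] prefix_word_0 by simp
    show "cell_of (a (ypos 0 0 c)) = (0, False)"
      if "c < width" "c < Suc T \<or> Suc T + (length (prefix_word x) + 2 * (P + 3)) \<le> c" for c
    proof -
      have "col c < 0 \<or> (0 < col c \<and> int (length w) \<le> col c)"
        using that(2) lw by (auto simp: col_def l_def)
      then show ?thesis
        using a_y[OF K that(1)] by (auto simp: cell0 word_content_def)
    qed
    show "cell_of (a (ypos 0 j (Suc T))) = (0, True)" if "j \<in> {1..<tm_tapes M}" for j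
      using that by (subst a_y) (auto simp: width cell_at_0 col_def)
    show "cell_of (a (ypos 0 j c)) = (0, False)" if "j \<in> {1..<tm_tapes M}" "c < width" "c \<noteq> Suc T" for j c
      using that by (subst a_y) (auto simp: cell_at_0 col_def)
    show "fst (cell_of (a (ypos t j c))) = snd (view_of (a (zpos t))) ! j"
      if "j < tm_tapes M" "t \<le> T" "c < width" "snd (cell_of (a (ypos t j c)))" for j t c
      using that view_at_reads[of j w t "col c" "fst (cell_at w t j (col c))"]
      by (simp add: a_y a_z prod_eq_iff)
    show "cell_of (a (ypos (Suc t) j (Suc c))) = next_cell j (view_of (a (zpos t))) (cell_of (a (ypos t j c)))
        (cell_of (a (ypos t j (Suc c)))) (cell_of (a (ypos t j (Suc (Suc c)))))"
      if "j < tm_tapes M" "t < T" "c < width - 2" for j t c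
    proof -
      have "col c = col (Suc c) - 1" "col (Suc (Suc c)) = col (Suc c) + 1" by (simp_all add: col_def)
      then show ?thesis using that cell_at_Suc[OF that(1), of w t "col (Suc c)"]
        by (simp add: a_y a_z)
    qed
    show "cell_of (a (ypos t j 0)) = (0, False)" if "j < tm_tapes M" "t \<le> T" for j t
      using that cell_at_far[OF that(1), of "col 0" t w] by (simp add: a_y width col_def)
    show "cell_of (a (ypos t j (width - 1))) = (0, False)" if "j < tm_tapes M" "t \<le> T" for j t
      using that lw cell_at_far[OF that(1), of "col (width - 1)" t w] by (simp add: a_y width col_def)
  qed
  moreover have "a 0 = 0" by (simp add: a_def)
  ultimately show ?thesis using a_less by blast
qed

lemma csp_tableau_iff:
  "(\<exists>a. csp_sat alphabet npos tableau a) \<longleftrightarrow>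
    (\<exists>u. length u \<le> P \<and> fst (cell_at (enc_pair x u) T (tm_tapes M - 1) 0) = 2)"
proof
  assume "\<exists>a. csp_sat alphabet npos tableau a"
  then obtain a where "csp_sat alphabet npos tableau a" by blast
  then have "tableau_sat a" using tableau_sat_iff[of a] by (simp add: csp_sat_def)
  then show "\<exists>u. length u \<le> P \<and> fst (cell_at (enc_pair x u) T (tm_tapes M - 1) 0) = 2"
    by (rule tableau_sat_run)
next
  assume "\<exists>u. length u \<le> P \<and> fst (cell_at (enc_pair x u) T (tm_tapes M - 1) 0) = 2"
  then obtain a where "a 0 = 0" "\<And>p. a p < alphabet" "tableau_sat a" using run_tableau_sat by blast
  then show "\<exists>a. csp_sat alphabet npos tableau a"
    using tableau_sat_iff[of a] by (auto simp: csp_sat_def)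
qed

end

end

section \<open>Hardness\<close>

lemma FP_enc_list [FP_intros]: "FP f \<Longrightarrow> FP l \<Longrightarrow> FP (\<lambda>c. enc_list f (l c))"
  unfolding enc_list_def enc_paren_def
  by (intro FP_append FP_const FP_concat FP_map) (auto intro: FP_comp FP_snd)

lemma FP_enc_bit [FP_intros]: "FP b \<Longrightarrow> FP (\<lambda>c. enc_bit (b c))"
  unfolding enc_bit_def by (intro FP_intros)

lemma FP_nat_bits [FP_intros]:
  assumes "FP n"
  shows "FP (\<lambda>c. nat_bits (n c))"
proof -
  define s where "s p = (if fst p = 0 then p else (fst p div 2, odd (fst p) # snd p))" for p :: "nat \<times> bool list"
  have inv: "rev (snd ((s ^^ i) (m, []))) @ nat_bits (fst ((s ^^ i) (m, []))) = nat_bits m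
      \<and> fst ((s ^^ i) (m, [])) \<le> m - i \<and> length (snd ((s ^^ i) (m, []))) \<le> i" for i m
  proof (induction i)
    case (Suc i)
    obtain k bs where k: "(s ^^ i) (m, []) = (k, bs)" by (cases "(s ^^ i) (m, [])")
    have "nat_bits k = odd k # nat_bits (k div 2)" "k div 2 \<le> k - 1" if "k \<noteq> 0"
      using that nat_bits.simps[of k] by simp_all
    then show ?case
      using Suc unfolding funpow.simps comp_apply k by (cases "k = 0") (auto simp: s_def)
  qed simp
  have e: "rev (snd ((s ^^ m) (m, []))) = nat_bits m" for m
    using inv[of m m] nat_bits.simps[of 0] by (simp, metis append_Nil2)
  have "FP (\<lambda>c. rev (snd ((s ^^ n c) (n c, []))))"
  proof (intro FP_rev FP_snd' FP_funpow[where B = "\<lambda>c. 2 * n c + 1 + (n c * (3 + 1) + 1) + 1"])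
    have "FP (\<lambda>p :: 'a \<times> nat \<times> bool list. if fst (snd p) = 0 then snd p
        else (fst (snd p) div 2, odd (fst (snd p)) # snd (snd p)))"
      by (intro FP_intros)
    then show "FP (\<lambda>p :: 'a \<times> nat \<times> bool list. s (snd p))" by (simp add: s_def)
    show "sz ((s ^^ i) (n c, [])) \<le> 2 * n c + 1 + (n c * (3 + 1) + 1) + 1" if "i \<le> n c" for c i
    proof -
      obtain k bs where k: "(s ^^ i) (n c, []) = (k, bs)" by (cases "(s ^^ i) (n c, [])")
      have "k \<le> n c" "length bs \<le> n c" using inv[of i "n c"] that by (auto simp: k)
      moreover have "sz bs \<le> n c * (3 + 1) + 1"
        using \<open>length bs \<le> n c\<close> by (rule sz_list_le) (rule sz_bool_le)
      ultimately show ?thesis by (simp add: k sz_nat)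
    qed
  qed (intro FP_intros assms polybd_intros polybd_FP_nat)+
  then show ?thesis by (simp add: e)
qed

lemma FP_enc_nat [FP_intros]: "FP n \<Longrightarrow> FP (\<lambda>c. enc_nat (n c))"
  unfolding enc_nat_def by (intro FP_intros)

lemma FP_poly:
  fixes p :: "nat poly"
  assumes "FP n"
  shows "FP (\<lambda>c. poly p (n c))"
proof (induction p)
  case (pCons a p)
  then show ?case by (simp, intro FP_intros assms)
qed (simp add: FP_const)

text \<open>The list \<open>js\<close> is constant, so one program per element suffices;
  \<open>f j c\<close> need not be computable uniformly in \<open>j\<close>. It is used with the
  tapes of the simulated machine for \<open>js\<close>.\<close>

lemma FP_concat_const:
  assumes "\<And>j. j \<in> set js \<Longrightarrow> FP (f j)"
  shows "FP (\<lambda>c. concat (map (\<lambda>j. f j c) js))"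
  using assms by (induction js) (auto intro: FP_intros)

text \<open>Only the scopes depend on the argument. The list of tuples that falsify \<open>Q\<close>
  is a constant of the program, so \<open>Q\<close> itself is never evaluated.\<close>

lemma FP_clauses_of:
  assumes "FP scs"
  shows "FP (\<lambda>c. clauses_of k r Q (scs c))"
  unfolding clauses_of_def exclude_def by (intro FP_intros assms)

lemma FP_csp_inst:
  assumes "FP n" "FP cls"
  shows "FP (\<lambda>c. encode_inst (csp_inst k (n c) (cls c)))"
  unfolding encode_inst_def csp_inst_def Let_def inst.simps enc_paren_def list.map concat.simps append_Nil2 case_prod_beta
  by (intro FP_intros assms FP_comp[OF assms(1)] FP_comp[OF assms(2)])

lemma (in tm_run) FP_tableau:
  assumes "FP p" "FP t"
  shows "FP (\<lambda>x. tableau x (p x) (t x))" "FP (\<lambda>x. npos x (p x) (t x))"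
proof -
  note arith = zpos_def wpos_def ypos_def npos_def width_def prefix_word_def
  show "FP (\<lambda>x. npos x (p x) (t x))"
    unfolding arith by (intro FP_intros assms)
  show "FP (\<lambda>x. tableau x (p x) (t x))"
    unfolding tableau_def
    by (intro FP_append FP_concat_const FP_clauses_of; unfold arith,
      intro FP_intros assms FP_comp[OF assms(1)] FP_comp[OF assms(2)])
qed

text \<open>A single reduction for both problems: its instances are valid and deterministic, so
  membership in either language is decided by the verification property alone.\<close>

lemma coNP_hard:
  assumes A: "A \<in> class_coNP"
  shows "\<exists>f. polytime_computable f \<and> (\<forall>x. \<exists>I. f x = encode_inst I \<and> valid_inst I \<and>
    deterministic_mealy (inst_game I) (inst_mealy I) \<and> (x \<in> A \<longleftrightarrow> inst_rational_verification I))"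
proof -
  obtain R p where R: "R \<in> class_P"
    and p: "\<And>x. x \<in> - A \<longleftrightarrow> (\<exists>u. length u \<le> poly p (length x) \<and> enc_pair x u \<in> R)"
    using A unfolding class_coNP_def class_NP_def by blast
  obtain M q where wf: "wf_tm M" and run: "\<And>w. tm_computes_within M w [w \<in> R] (poly q (length w))"
    using R unfolding class_P_def polytime_computable_def by blast
  interpret tm_run M by standard (rule wf)
  define P where "P x = poly p (length x)" for x :: "bool list"
  \<comment> \<open>The length of the pair of \<open>x\<close> and a certificate of maximal length
    \<open>P x\<close>. Polynomials over the natural numbers are monotone, so \<open>T x\<close>
    also covers shorter certificates.\<close>
  define T where "T x = poly q (length (prefix_word x) + 2 * P x + 4)" for x
  define I where "I x = csp_inst alphabet (npos x (P x) (T x)) (tableau x (P x) (T x))" for x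
  have FP_P: "FP P" unfolding P_def by (intro FP_poly FP_intros)
  have FP_T: "FP T" unfolding T_def prefix_word_def by (intro FP_poly FP_intros FP_P)
  have "FP (\<lambda>x. encode_inst (I x))"
    unfolding I_def by (intro FP_csp_inst FP_tableau FP_P FP_T)
  then have "polytime_computable (\<lambda>x. encode_inst (I x))" by (rule polytime_computable_FP)
  moreover have "valid_inst (I x) \<and> deterministic_mealy (inst_game (I x)) (inst_mealy (I x)) \<and>
      (x \<in> A \<longleftrightarrow> inst_rational_verification (I x))" for x
  proof -
    have k: "alphabet > 0" by (simp add: alphabet_def)
    have N: "npos x (P x) (T x) > 0" by (simp add: npos_def)
    have cls: "l < npos x (P x) (T x) * alphabet"
      if "c \<in> set (tableau x (P x) (T x))" "l \<in> set c" for c l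
      using tableau_bound that by blast
    have "fst (cell_at (enc_pair x u) (T x) (tm_tapes M - 1) 0) = 2 \<longleftrightarrow> enc_pair x u \<in> R"
      if "length u \<le> P x" for u
    proof -
      have "poly q (length (enc_pair x u)) \<le> T x"
        unfolding T_def using that by (intro poly_nat_mono) (simp add: length_enc_pair)
      from config_at_halt[OF run this] show ?thesis
        by (simp add: word_content_def)
    qed
    then have "(\<exists>u. length u \<le> P x \<and> fst (cell_at (enc_pair x u) (T x) (tm_tapes M - 1) 0) = 2) \<longleftrightarrow> x \<notin> A"
      using p[of x] by (auto simp: P_def)
    moreover have "valid_inst (I x)"
      unfolding I_def by (rule csp_inst_valid[OF k N]) (rule cls)
    moreover have "deterministic_mealy (inst_game (I x)) (inst_mealy (I x))"
      unfolding I_def by (rule csp_inst_deterministic[OF k N]) (rule cls)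
    moreover have "\<not> inst_rational_verification (I x) \<longleftrightarrow> (\<exists>a. csp_sat alphabet (npos x (P x) (T x)) (tableau x (P x) (T x)) a)"
      unfolding I_def by (rule csp_inst_iff[OF k N]) (rule cls)
    ultimately show ?thesis
      using csp_tableau_iff[of x "P x" "T x"] by blast
  qed
  ultimately show ?thesis by blast
qed

section \<open>Parsing\<close>

text \<open>The equivalence states correctness, completeness and unique readability at once, as
  \<open>p\<close> is a function. The size bound is linear so that combined parsers satisfy such a
  bound again; it controls the accumulated items and, later on, the length of certificates.\<close>

definition good_parser :: "('a :: rep \<Rightarrow> bool list) \<Rightarrow> (bool list \<Rightarrow> ('a \<times> bool list) option) \<Rightarrow> bool" where
  "good_parser enc p \<longleftrightarrow> FP p \<and> (\<forall>r a s. p r = Some (a, s) \<longleftrightarrow> r = enc a @ s) \<and>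
     (\<exists>C. \<forall>a. sz a \<le> C * length (enc a))"

lemma good_parserD:
  assumes "good_parser enc p"
  shows "FP p" "p r = Some (a, s) \<longleftrightarrow> r = enc a @ s"
  using assms by (auto simp: good_parser_def)

text \<open>The second half of \<open>item_enc\<close>: two bits suffice to decide whether a list
  ends or another item follows.\<close>

definition not_closing :: "('a \<Rightarrow> bool list) \<Rightarrow> bool" where
  "not_closing enc \<longleftrightarrow> (\<forall>x. \<exists>a b w. enc x = a # b # w \<and> \<not> (a \<and> b))"

definition p_bit :: "bool list \<Rightarrow> (bool \<times> bool list) option" where
  "p_bit r = (case r of [] \<Rightarrow> None | a # r1 \<Rightarrow> (case r1 of [] \<Rightarrow> None | b # r2 \<Rightarrow>
     if a then None else Some (b, r2)))"

lemma good_parser_bit: "good_parser enc_bit p_bit"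
  unfolding good_parser_def
proof (intro conjI allI)
  show "FP p_bit" unfolding p_bit_def by (intro FP_intros)
  show "p_bit r = Some (a, s) \<longleftrightarrow> r = enc_bit a @ s" for r a s
    by (auto simp: p_bit_def enc_bit_def split: list.split)
  show "\<exists>C. \<forall>a. sz a \<le> C * length (enc_bit a)"
    by (rule exI[of _ 2]) (use sz_bool_le in \<open>auto simp: enc_bit_def intro: order_trans[of _ 3]\<close>)
qed

lemma not_closing_bit: "not_closing enc_bit"
  by (auto simp: not_closing_def enc_bit_def)

lemma not_closing_list: "not_closing (enc_list f)"
  by (auto simp: not_closing_def enc_list_def enc_paren_def)

text \<open>A state consists of the items read so far, of the remaining input, and of a flag for success.\<close>

definition many_step :: "(bool list \<Rightarrow> ('a \<times> bool list) option) \<Rightarrow>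
    'a list \<times> bool list \<times> bool \<Rightarrow> 'a list \<times> bool list \<times> bool" where
  "many_step p st = (if snd (snd st) then st else
     (case fst (snd st) of [] \<Rightarrow> st | a # r1 \<Rightarrow> (case r1 of [] \<Rightarrow> st | b # r2 \<Rightarrow>
       if a \<and> b then (fst st, r2, True) else
         (case p (fst (snd st)) of None \<Rightarrow> st | Some z \<Rightarrow> (fst z # fst st, snd z, False)))))"

definition p_list :: "(bool list \<Rightarrow> ('a :: rep \<times> bool list) option) \<Rightarrow> bool list \<Rightarrow> ('a list \<times> bool list) option" where
  "p_list p r = (case r of [] \<Rightarrow> None | a # r1 \<Rightarrow> (case r1 of [] \<Rightarrow> None | b # r2 \<Rightarrow>
     if a \<and> \<not> b then
       (let st = (many_step p ^^ sz r2) ([], r2, False)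
        in if snd (snd st) then Some (rev (fst st), fst (snd st)) else None)
     else None))"

text \<open>Every item takes at least two bits, so \<open>sz r2\<close> rounds are enough to reach
  the closing parenthesis. Afterwards, or after a failure, the state no longer changes.\<close>

lemma good_parser_list:
  assumes p: "good_parser enc p" and nc: "not_closing enc"
  shows "good_parser (enc_list enc) (p_list p)"
proof -
  note pD = good_parserD[OF p]
  obtain C where C: "\<And>a. sz a \<le> C * length (enc a)"
    using p by (auto simp: good_parser_def)
  have len: "length (enc a) \<ge> 2" for a
  proof -
    obtain b c w where "enc a = b # c # w" using nc unfolding not_closing_def by meson
    then show ?thesis by simp
  qed
  let ?it = "\<lambda>r i. (many_step p ^^ i) ([], r, False)"
  \<comment> \<open>Nothing is lost: the input is what has been read followed by the remaining
    input. This gives soundness and also bounds the size of the state.\<close>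
  have inv: "r = concat (map enc (rev (fst (?it r i)))) @ (if snd (snd (?it r i)) then [True, True] else []) @ fst (snd (?it r i))"
    for r i
  proof (induction i)
    case (Suc i)
    obtain acc r' b where st: "?it r i = (acc, r', b)" by (cases "?it r i") auto
    show ?case
      using Suc by (auto simp: st many_step_def pD(2) split: list.split option.split)
  qed simp
  have run: "?it (concat (map enc xs) @ [True, True] @ s) i =
      (rev (take i xs), concat (map enc (drop i xs)) @ [True, True] @ s, False)" if "i \<le> length xs" for xs s i
    using that
  proof (induction i)
    case (Suc i)
    have d: "drop i xs = xs ! i # drop (Suc i) xs" using Suc.prems by (simp add: Cons_nth_drop_Suc)
    obtain a b w where e: "enc (xs ! i) = a # b # w" "\<not> (a \<and> b)"
      using nc unfolding not_closing_def by meson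
    have "p (a # b # w @ concat (map enc (drop (Suc i) xs)) @ [True, True] @ s) =
        Some (xs ! i, concat (map enc (drop (Suc i) xs)) @ [True, True] @ s)"
      unfolding pD(2) by (simp add: e)
    then show ?case
      using Suc e by (simp add: many_step_def d take_Suc_conv_app_nth)
  qed simp
  have complete: "?it (concat (map enc xs) @ [True, True] @ s) (length xs + 1 + i) = (rev xs, s, True)" for xs s i
  proof (induction i)
    case 0
    have "many_step p (rev xs, True # True # s, False) = (rev xs, s, True)"
      by (simp add: many_step_def)
    then show ?case using run[of "length xs" xs s] by simp
  next
    case (Suc i)
    have "many_step p (rev xs, s, True) = (rev xs, s, True)"
      by (simp add: many_step_def)
    then show ?case using Suc by simp
  qed
  have eq: "p_list p r = Some (xs, s) \<longleftrightarrow> r = enc_list enc xs @ s" for r xs s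
  proof
    assume "p_list p r = Some (xs, s)"
    then obtain r2 where r2: "r = True # False # r2"
      "snd (snd (?it r2 (sz r2)))" "xs = rev (fst (?it r2 (sz r2)))" "s = fst (snd (?it r2 (sz r2)))"
      by (auto simp: p_list_def Let_def split: list.splits if_splits)
    then show "r = enc_list enc xs @ s"
      using inv[of r2 "sz r2"] by (simp add: enc_list_def enc_paren_def)
  next
    assume r: "r = enc_list enc xs @ s"
    define r2 where "r2 = concat (map enc xs) @ [True, True] @ s"
    have "length xs \<le> length (concat (map enc xs))"
    proof (induction xs)
      case (Cons a xs)
      then show ?case using len[of a] by simp
    qed simp
    then have "length xs + 1 \<le> length r2" by (simp add: r2_def)
    also have "\<dots> < sz r2" by (rule length_less_sz)
    finally obtain i where "sz r2 = length xs + 1 + i" by (metis le_iff_add less_imp_le)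
    then have "?it r2 (sz r2) = (rev xs, s, True)" using complete[where xs = xs and s = s and i = i] by (simp add: r2_def)
    moreover have "r = True # False # r2" by (simp add: r r2_def enc_list_def enc_paren_def)
    ultimately show "p_list p r = Some (xs, s)" by (simp add: p_list_def Let_def)
  qed
  \<comment> \<open>The additional one in \<open>C + 1\<close> pays for the list node of each
    item.\<close>
  have szc: "sz as \<le> (C + 1) * length (concat (map enc as)) + 1" for as
  proof (induction as)
    case (Cons a as)
    then show ?case using C[of a] len[of a] by (simp add: algebra_simps)
  qed simp
  have "FP (p_list p)"
  proof -
    have step: "FP (\<lambda>q :: bool list \<times> 'a list \<times> bool list \<times> bool. many_step p (snd q))"
      unfolding many_step_def by (intro FP_intros FP_comp[OF pD(1)])
    have "FP (\<lambda>r. (many_step p ^^ sz r) ([], r, False))"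
    proof (intro FP_iterate[where B = "\<lambda>r. (C + 1) * sz r + 1 + sz r + 3 + 2"] step FP_intros polybd_intros)
      fix r and i :: nat
      obtain acc r' b where st: "?it r i = (acc, r', b)" by (cases "?it r i") auto
      define pre where "pre = concat (map enc (rev acc)) @ (if b then [True, True] else [])"
      have r: "r = pre @ r'"
        using inv[of r i] by (simp add: st pre_def)
      have "length (concat (map enc (rev acc))) \<le> length pre" by (simp add: pre_def)
      then have "length (concat (map enc (rev acc))) \<le> length r" by (simp add: r)
      moreover have sz_r': "sz r' \<le> sz r" using sz_drop_le[of "length pre" r] by (simp add: r)
      moreover have "sz acc \<le> (C + 1) * length (concat (map enc (rev acc))) + 1"
        using szc[of "rev acc"] by simp
      moreover have "length r \<le> sz r" using length_less_sz[of r] by simp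
      ultimately have "sz acc \<le> (C + 1) * sz r + 1"
        by (meson add_le_mono1 le_trans mult_le_mono2)
      then show "sz (?it r i) \<le> (C + 1) * sz r + 1 + sz r + 3 + 2"
        using sz_r' sz_bool_le[of b] by (simp add: st)
    qed
    note it = FP_comp[OF this]
    show ?thesis
      unfolding p_list_def by (intro FP_intros it)
  qed
  moreover have "sz xs \<le> (C + 1) * length (enc_list enc xs)" for xs
    using szc[of xs] by (simp add: enc_list_def enc_paren_def algebra_simps)
  ultimately show ?thesis using eq unfolding good_parser_def by blast
qed

definition p_seq where
  "p_seq p q r = (case p r of None \<Rightarrow> None | Some z \<Rightarrow>
     (case q (snd z) of None \<Rightarrow> None | Some y \<Rightarrow> Some ((fst z, fst y), snd y)))"

lemma good_parser_seq:
  assumes p: "good_parser f p" and q: "good_parser g q"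
  shows "good_parser (\<lambda>a. f (fst a) @ g (snd a)) (p_seq p q)"
proof -
  note pD = good_parserD[OF p] and qD = good_parserD[OF q]
  obtain C where C: "\<And>a. sz a \<le> C * length (f a)"
    using p by (auto simp: good_parser_def)
  obtain D where D: "\<And>a. sz a \<le> D * length (g a)"
    using q by (auto simp: good_parser_def)
  have "FP (p_seq p q)"
    unfolding p_seq_def by (intro FP_intros pD(1) FP_comp[OF qD(1)])
  moreover have "p_seq p q r = Some (a, s) \<longleftrightarrow> r = (f (fst a) @ g (snd a)) @ s" for r a s
  proof
    assume "p_seq p q r = Some (a, s)"
    then obtain z y where "p r = Some z" "q (snd z) = Some y" "a = (fst z, fst y)" "s = snd y"
      by (auto simp: p_seq_def split: option.splits)
    then show "r = (f (fst a) @ g (snd a)) @ s"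
      using pD(2)[of r "fst z" "snd z"] qD(2)[of "snd z" "fst y" "snd y"] by simp
  next
    assume r: "r = (f (fst a) @ g (snd a)) @ s"
    then have "p r = Some (fst a, g (snd a) @ s)" by (simp add: pD(2))
    moreover have "q (g (snd a) @ s) = Some (snd a, s)" by (simp add: qD(2))
    ultimately show "p_seq p q r = Some (a, s)" by (simp add: p_seq_def)
  qed
  moreover have "sz a \<le> (C + D + 1) * length (f (fst a) @ g (snd a))" for a
  proof -
    define m n where "m = length (f (fst a))" and "n = length (g (snd a))"
    have "sz (fst a) \<le> C * m" "sz (snd a) \<le> D * n" unfolding m_def n_def by (rule C, rule D)
    \<comment> \<open>The node of the pair is paid for by the code of the first part, which is not
      empty.\<close>
    moreover have "m > 0" using C[of "fst a"] sz_pos[of "fst a"] unfolding m_def by (intro gr0I) simp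
    then have "C * m + D * n + 1 \<le> (C + D + 1) * (m + n)"
      by (simp add: algebra_simps)
    moreover have "sz a = sz (fst a) + sz (snd a) + 1" by (cases a) simp
    ultimately have "sz a \<le> (C + D + 1) * (m + n)" by linarith
    then show ?thesis by (simp add: m_def n_def)
  qed
  ultimately show ?thesis unfolding good_parser_def by blast
qed

definition p_paren where
  "p_paren p r = (case r of [] \<Rightarrow> None | a # r1 \<Rightarrow> (case r1 of [] \<Rightarrow> None | b # r2 \<Rightarrow>
     if a \<and> \<not> b then (case p r2 of None \<Rightarrow> None | Some z \<Rightarrow>
       (case snd z of [] \<Rightarrow> None | c # s1 \<Rightarrow> (case s1 of [] \<Rightarrow> None | d # s2 \<Rightarrow>
         if c \<and> d then Some (fst z, s2) else None)))
     else None))"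

lemma good_parser_paren:
  assumes p: "good_parser f p"
  shows "good_parser (\<lambda>a. [True, False] @ f a @ [True, True]) (p_paren p)"
proof -
  note pD = good_parserD[OF p]
  obtain C where C: "\<And>a. sz a \<le> C * length (f a)"
    using p by (auto simp: good_parser_def)
  have "FP (p_paren p)"
    unfolding p_paren_def by (intro FP_intros FP_comp[OF pD(1)])
  moreover have "p_paren p r = Some (a, s) \<longleftrightarrow> r = ([True, False] @ f a @ [True, True]) @ s" for r a s
  proof
    assume "p_paren p r = Some (a, s)"
    then obtain r2 z where "r = True # False # r2" "p r2 = Some z" "snd z = True # True # s" "fst z = a"
      by (auto simp: p_paren_def split: list.splits option.splits if_splits)
    then show "r = ([True, False] @ f a @ [True, True]) @ s"
      using pD(2)[of r2 "fst z" "snd z"] by (cases z) simp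
  next
    assume r: "r = ([True, False] @ f a @ [True, True]) @ s"
    have "p (f a @ True # True # s) = Some (a, True # True # s)" by (simp add: pD(2))
    then show "p_paren p r = Some (a, s)" by (simp add: p_paren_def r)
  qed
  moreover have "sz a \<le> C * length ([True, False] @ f a @ [True, True])" for a
    using C[of a] by (simp add: algebra_simps)
  ultimately show ?thesis unfolding good_parser_def by blast
qed

section \<open>Binary numbers\<close>

fun bits_val :: "bool list \<Rightarrow> nat" where
  "bits_val [] = 0"
| "bits_val (b # bs) = (if b then 1 else 0) + 2 * bits_val bs"

text \<open>The most significant bit comes last, so this excludes leading zeros.\<close>

definition canonical :: "bool list \<Rightarrow> bool" where
  "canonical bs \<longleftrightarrow> (case rev bs of [] \<Rightarrow> True | b # _ \<Rightarrow> b)"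

lemma canonical_Cons: "canonical (b # bs) \<longleftrightarrow> (if bs = [] then b else canonical bs)"
  by (cases bs rule: rev_cases) (auto simp: canonical_def)

lemma nat_bits_0 [simp]: "nat_bits 0 = []"
  by (simp add: nat_bits.simps)

lemma bits_val_nat_bits [simp]: "bits_val (nat_bits n) = n"
proof (induction n rule: nat_bits.induct)
  case (1 n)
  then show ?case by (cases "n = 0") (simp_all add: nat_bits.simps[of n])
qed

lemma canonical_nat_bits: "canonical (nat_bits n)"
proof (induction n rule: nat_bits.induct)
  case (1 n)
  show ?case
  proof (cases "n = 0")
    case True
    then show ?thesis by (simp add: nat_bits.simps[of n] canonical_def)
  next
    case False
    have "nat_bits (n div 2) = [] \<Longrightarrow> n div 2 = 0"
      by (subst (asm) nat_bits.simps) (auto split: if_splits)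
    then have "nat_bits (n div 2) = [] \<Longrightarrow> n = 1" using False by simp
    then show ?thesis using 1 False by (auto simp: nat_bits.simps[of n] canonical_Cons)
  qed
qed

lemma nat_bits_bits_val: "canonical bs \<Longrightarrow> nat_bits (bits_val bs) = bs"
proof (induction bs)
  case Nil
  then show ?case by (simp add: nat_bits.simps)
next
  case (Cons b bs)
  show ?case
  proof (cases "bs = []")
    case True
    then have b using Cons.prems by (simp add: canonical_Cons)
    then show ?thesis using True by (simp add: nat_bits.simps)
  next
    case False
    then have c: "nat_bits (bits_val bs) = bs" using Cons by (simp add: canonical_Cons)
    then have "bits_val bs \<noteq> 0" using False by (intro notI) (simp add: nat_bits.simps)
    then show ?thesis using c by (subst nat_bits.simps) auto
  qed
qed

text \<open>A binary numeral may be exponentially long in unary. Capping in every step of Horner's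
  scheme keeps all values at most \<open>B\<close>, and doubling never lowers a value, so the result
  is the capped value of the numeral.\<close>

definition capped_val :: "nat \<Rightarrow> bool list \<Rightarrow> nat" where
  "capped_val B bs = fold (\<lambda>b a. min B ((if b then 1 else 0) + 2 * a)) (rev bs) 0"

lemma capped_val_eq: "capped_val B bs = min B (bits_val bs)"
  by (induction bs) (auto simp: capped_val_def)

lemma FP_canonical [FP_intros]: "FP b \<Longrightarrow> FP (\<lambda>c. canonical (b c))"
  unfolding canonical_def by (intro FP_intros)

lemma FP_capped_val [FP_intros]:
  assumes "FP B" "FP b"
  shows "FP (\<lambda>c. capped_val (B c) (b c))"
  unfolding capped_val_def
proof (rule FP_fold[where B = "\<lambda>c. 2 * B c + 1"])
  fix c k
  have "fold (\<lambda>b a. min (B c) ((if b then 1 else 0) + 2 * a)) bs a \<le> B c" if "a \<le> B c" for bs a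
    using that by (induction bs arbitrary: a) auto
  then show "sz (fold (\<lambda>b a. min (B c) ((if b then 1 else 0) + 2 * a)) (take k (rev (b c))) 0) \<le> 2 * B c + 1"
    by (simp add: sz_nat)
qed (intro FP_intros assms FP_comp[OF assms(1)] polybd_intros polybd_FP_nat)+

text \<open>The state consists of the carry of the product and of the result of the comparison so far.\<close>

fun le_mult_step :: "nat \<Rightarrow> bool \<times> bool \<Rightarrow> nat \<times> bool \<Rightarrow> nat \<times> bool" where
  "le_mult_step k (d, b) (c, le) = (let s = (if b then k else 0) + c in
     (s div 2, if d = odd s then le else odd s))"

text \<open>Schoolbook multiplication of a binary numeral by a small number, from the lowest bit on,
  interleaved with a comparison in which the last differing bit decides. A final carry means that
  the product exceeds every number with as many bits.\<close>

definition le_mult :: "bool list \<Rightarrow> bool list \<Rightarrow> nat \<Rightarrow> bool" where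
  "le_mult ds bs k = (let st = fold (\<lambda>i. le_mult_step k (nth_default False ds i, nth_default False bs i))
     [0..<length ds + length bs] (0, True) in fst st > 0 \<or> snd st)"

lemma bits_val_less: "bits_val bs < 2 ^ length bs"
  by (induction bs) auto

lemma bits_val_take_Suc: "bits_val (take (Suc i) bs) = bits_val (take i bs) + (if nth_default False bs i then 2 ^ i else 0)"
proof (induction bs arbitrary: i)
  case (Cons b bs)
  then show ?case by (cases i) auto
qed (simp add: nth_default_def)

lemma le_mult_iff: "le_mult ds bs k \<longleftrightarrow> bits_val ds \<le> bits_val bs * k"
proof -
  let ?s = "\<lambda>i. fold (\<lambda>i. le_mult_step k (nth_default False ds i, nth_default False bs i)) [0..<i] (0, True)"
  \<comment> \<open>\<open>low\<close> consists of the \<open>i\<close> lowest bits of the product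
    so far, and the carry has weight \<open>2 ^ i\<close>.\<close>
  have inv: "\<exists>low. k * bits_val (take i bs) = low + 2 ^ i * fst (?s i) \<and> low < 2 ^ i \<and>
      (snd (?s i) \<longleftrightarrow> bits_val (take i ds) \<le> low)" for i
  proof (induction i)
    case (Suc i)
    obtain c le where st: "?s i = (c, le)" by (cases "?s i")
    obtain low where low: "k * bits_val (take i bs) = low + 2 ^ i * c" "low < 2 ^ i"
      "le \<longleftrightarrow> bits_val (take i ds) \<le> low" using Suc by (auto simp: st)
    define s where "s = (if nth_default False bs i then k else 0) + c"
    define low' where "low' = low + (if odd s then 2 ^ i else 0)"
    have st': "?s (Suc i) = (s div 2, if nth_default False ds i = odd s then le else odd s)"
      by (simp add: st s_def Let_def del: even_add odd_add)
    have dl: "bits_val (take i ds) < 2 ^ i"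
      by (rule less_le_trans[OF bits_val_less]) (rule power_increasing, auto)
    have "k * bits_val (take (Suc i) bs) = low + 2 ^ i * s"
      using low(1) by (simp add: bits_val_take_Suc s_def algebra_simps)
    also have "\<dots> = low' + 2 ^ Suc i * (s div 2)"
      by (cases "odd s") (auto elim!: evenE oddE simp: low'_def algebra_simps)
    finally have 1: "k * bits_val (take (Suc i) bs) = low' + 2 ^ Suc i * (s div 2)" .
    have 2: "low' < 2 ^ Suc i" using low(2) by (simp add: low'_def)
    have 3: "(if nth_default False ds i = odd s then le else odd s) \<longleftrightarrow> bits_val (take (Suc i) ds) \<le> low'"
      using low(2,3) dl by (auto simp: bits_val_take_Suc low'_def)
    show ?case unfolding st' using 1 2 3 by (intro exI[of _ low']) simp
  qed simp
  let ?n = "length ds + length bs"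
  obtain low where low: "k * bits_val bs = low + 2 ^ ?n * fst (?s ?n)" "low < 2 ^ ?n"
    "snd (?s ?n) \<longleftrightarrow> bits_val ds \<le> low" using inv[of ?n] by auto
  have ds: "bits_val ds < 2 ^ ?n"
    by (rule less_le_trans[OF bits_val_less]) (rule power_increasing, auto)
  show ?thesis
  proof (cases "fst (?s ?n) > 0")
    case True
    then have "2 ^ ?n \<le> 2 ^ ?n * fst (?s ?n)" by simp
    then have "bits_val ds \<le> k * bits_val bs" using low ds by linarith
    then show ?thesis using True by (simp add: le_mult_def Let_def mult.commute)
  next
    case False
    then show ?thesis using low by (simp add: le_mult_def Let_def mult.commute)
  qed
qed

lemma FP_le_mult [FP_intros]:
  assumes "FP d" "FP b" "FP k"
  shows "FP (\<lambda>c. le_mult (d c) (b c) (k c))"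
proof -
  let ?f = "\<lambda>c i. le_mult_step (k c) (nth_default False (d c) i, nth_default False (b c) i)"
  have step: "?f c i q = (((if nth_default False (b c) i then k c else 0) + fst q) div 2,
      if nth_default False (d c) i = odd ((if nth_default False (b c) i then k c else 0) + fst q) then snd q
      else odd ((if nth_default False (b c) i then k c else 0) + fst q))" for c i q
    by (cases q) (simp add: Let_def del: even_add odd_add)
  have "FP (\<lambda>c. fold (?f c) [0..<length (d c) + length (b c)] (0, True))"
  proof (rule FP_fold[where B = "\<lambda>c. 2 * k c + 1 + 3 + 1"])
    fix c j
    \<comment> \<open>The carry never exceeds the factor, because half of \<open>k + k\<close> is
      \<open>k\<close>; so it stays small in unary.\<close>
    have "fst (fold (?f c) js q) \<le> k c" if "fst q \<le> k c" for js q
      using that by (induction js arbitrary: q) (auto simp: step)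
    from this[of "(0, True)" "take j [0..<length (d c) + length (b c)]"]
    show "sz (fold (?f c) (take j [0..<length (d c) + length (b c)]) (0, True)) \<le> 2 * k c + 1 + 3 + 1"
      using sz_bool_le[of "snd (fold (?f c) (take j [0..<length (d c) + length (b c)]) (0, True))"]
      by (cases "fold (?f c) (take j [0..<length (d c) + length (b c)]) (0, True)") (simp add: sz_nat)
    show "FP (\<lambda>p. ?f (fst p) (fst (snd p)) (snd (snd p)))"
      unfolding step by (intro FP_intros FP_comp[OF assms(1)] FP_comp[OF assms(2)] FP_comp[OF assms(3)])
  qed (intro FP_intros assms polybd_intros polybd_FP_nat)+
  then show ?thesis
    unfolding le_mult_def by (intro FP_intros)
qed

section \<open>Instances\<close>

text \<open>Raw instances have the fields of \<open>inst\<close>, with numbers in binary and tuples as lists.\<close>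

type_synonym raw_inst = "bool list list \<times> bool list list list \<times> bool list list list \<times> bool list \<times> bool list \<times>
  (bool \<times> bool list) \<times> bool list \<times> bool list \<times> bool list \<times> bool list list list \<times> bool list list list"

definition raw_of :: "inst \<Rightarrow> raw_inst" where
  "raw_of I = (map nat_bits (inst_owner I), map (map nat_bits) (inst_targets I),
     map (\<lambda>(u, v). [nat_bits u, nat_bits v]) (inst_edges I), nat_bits (inst_start I), nat_bits (inst_leader I),
     (inst_num I < 0, nat_bits (nat \<bar>inst_num I\<bar>)), nat_bits (inst_den I), nat_bits (inst_states I),
     nat_bits (inst_init I), map (\<lambda>(p, u, q). [nat_bits p, nat_bits u, nat_bits q]) (inst_read I),
     map (\<lambda>(p, u, q, v). [nat_bits p, nat_bits u, nat_bits q, nat_bits v]) (inst_act I))"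

abbreviation "enc_num \<equiv> enc_list enc_bit"
abbreviation "enc_nums \<equiv> enc_list enc_num"
abbreviation "enc_numss \<equiv> enc_list enc_nums"
abbreviation "p_num \<equiv> p_list p_bit"
abbreviation "p_nums \<equiv> p_list p_num"
abbreviation "p_numss \<equiv> p_list p_nums"

definition p_raw where
  "p_raw = p_paren (p_seq p_nums (p_seq p_numss (p_seq p_numss (p_seq p_num (p_seq p_num
     (p_seq (p_paren (p_seq p_bit p_num)) (p_seq p_num (p_seq p_num (p_seq p_num (p_seq p_numss p_numss))))))))))"

lemma good_parser_num: "good_parser enc_num p_num"
  by (rule good_parser_list[OF good_parser_bit not_closing_bit])

lemma good_parser_nums: "good_parser enc_nums p_nums"
  by (rule good_parser_list[OF good_parser_num not_closing_list])

lemma good_parser_numss: "good_parser enc_numss p_numss"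
  by (rule good_parser_list[OF good_parser_nums not_closing_list])

lemmas good_parser_raw = good_parser_paren[OF good_parser_seq[OF good_parser_nums good_parser_seq[OF good_parser_numss
  good_parser_seq[OF good_parser_numss good_parser_seq[OF good_parser_num good_parser_seq[OF good_parser_num
  good_parser_seq[OF good_parser_paren[OF good_parser_seq[OF good_parser_bit good_parser_num]]
  good_parser_seq[OF good_parser_num good_parser_seq[OF good_parser_num good_parser_seq[OF good_parser_num
  good_parser_seq[OF good_parser_numss good_parser_numss]]]]]]]]]], folded p_raw_def]

lemma enc_list_map: "enc_list f (map g xs) = enc_list (\<lambda>x. f (g x)) xs"
  by (simp add: enc_list_def comp_def)

lemma enc_nat_fun: "enc_nat = (\<lambda>n. enc_num (nat_bits n))"
  by (simp add: fun_eq_iff enc_nat_def)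

lemma p_raw_iff: "p_raw x = Some (raw_of I, []) \<longleftrightarrow> x = encode_inst I"
proof -
  have "p_raw x = Some (d, []) \<longleftrightarrow> x = [True, False] @ (enc_nums (fst d) @ enc_numss (fst (snd d)) @ enc_numss (fst (snd (snd d))) @
      enc_num (fst (snd (snd (snd d)))) @ enc_num (fst (snd (snd (snd (snd d))))) @
      ([True, False] @ (enc_bit (fst (fst (snd (snd (snd (snd (snd d))))))) @ enc_num (snd (fst (snd (snd (snd (snd (snd d)))))))) @ [True, True]) @
      enc_num (fst (snd (snd (snd (snd (snd (snd d))))))) @ enc_num (fst (snd (snd (snd (snd (snd (snd (snd d)))))))) @
      enc_num (fst (snd (snd (snd (snd (snd (snd (snd (snd d))))))))) @
      enc_numss (fst (snd (snd (snd (snd (snd (snd (snd (snd (snd d)))))))))) @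
      enc_numss (snd (snd (snd (snd (snd (snd (snd (snd (snd (snd d))))))))))) @ [True, True]" for d
    using good_parserD(2)[OF good_parser_raw, of x d "[]"] by simp
  moreover have "(\<lambda>(u, v). enc_list enc_nat [u, v]) = (\<lambda>e. enc_nums [nat_bits (fst e), nat_bits (snd e)])"
    "(\<lambda>(p, u, q). enc_list enc_nat [p, u, q]) = (\<lambda>e. enc_nums [nat_bits (fst e), nat_bits (fst (snd e)), nat_bits (snd (snd e))])"
    "(\<lambda>(p, u, q, v). enc_list enc_nat [p, u, q, v]) = (\<lambda>e. enc_nums [nat_bits (fst e), nat_bits (fst (snd e)),
      nat_bits (fst (snd (snd e))), nat_bits (snd (snd (snd e)))])"
    by (auto simp: fun_eq_iff enc_list_def enc_nat_def)
  ultimately show ?thesis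
    by (simp add: raw_of_def encode_inst_def enc_paren_def enc_int_def enc_list_map enc_nat_fun)
      (simp add: case_prod_beta)
qed

definition "r_owner d = fst (d :: raw_inst)"
definition "r_targets d = fst (snd (d :: raw_inst))"
definition "r_edges d = fst (snd (snd (d :: raw_inst)))"
definition "r_start d = fst (snd (snd (snd (d :: raw_inst))))"
definition "r_leader d = fst (snd (snd (snd (snd (d :: raw_inst)))))"
definition "r_num d = fst (snd (snd (snd (snd (snd (d :: raw_inst))))))"
definition "r_den d = fst (snd (snd (snd (snd (snd (snd (d :: raw_inst)))))))"
definition "r_states d = fst (snd (snd (snd (snd (snd (snd (snd (d :: raw_inst))))))))"
definition "r_init d = fst (snd (snd (snd (snd (snd (snd (snd (snd (d :: raw_inst)))))))))"
definition "r_read d = fst (snd (snd (snd (snd (snd (snd (snd (snd (snd (d :: raw_inst))))))))))"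
definition "r_act d = snd (snd (snd (snd (snd (snd (snd (snd (snd (snd (d :: raw_inst))))))))))"

lemmas raw_defs = r_owner_def r_targets_def r_edges_def r_start_def r_leader_def r_num_def r_den_def
  r_states_def r_init_def r_read_def r_act_def

lemma raw_sel [simp]:
  "r_owner (raw_of I) = map nat_bits (inst_owner I)"
  "r_targets (raw_of I) = map (map nat_bits) (inst_targets I)"
  "r_edges (raw_of I) = map (\<lambda>(u, v). [nat_bits u, nat_bits v]) (inst_edges I)"
  "r_start (raw_of I) = nat_bits (inst_start I)" "r_leader (raw_of I) = nat_bits (inst_leader I)"
  "r_num (raw_of I) = (inst_num I < 0, nat_bits (nat \<bar>inst_num I\<bar>))"
  "r_den (raw_of I) = nat_bits (inst_den I)"
  "r_states (raw_of I) = nat_bits (inst_states I)" "r_init (raw_of I) = nat_bits (inst_init I)"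
  "r_read (raw_of I) = map (\<lambda>(p, u, q). [nat_bits p, nat_bits u, nat_bits q]) (inst_read I)"
  "r_act (raw_of I) = map (\<lambda>(p, u, q, v). [nat_bits p, nat_bits u, nat_bits q, nat_bits v]) (inst_act I)"
  by (simp_all add: raw_defs raw_of_def)

text \<open>The parser takes any bit lists for numerals and tuples. Codes of instances are those
  without leading zeros, without a negative zero and with tuples of the right length.\<close>

definition raw_ok :: "raw_inst \<Rightarrow> bool" where
  "raw_ok d \<longleftrightarrow> (\<forall>b \<in> set (r_owner d). canonical b) \<and> (\<forall>S \<in> set (r_targets d). \<forall>b \<in> set S. canonical b) \<and>
     (\<forall>e \<in> set (r_edges d). length e = 2 \<and> (\<forall>b \<in> set e. canonical b)) \<and>
     canonical (r_start d) \<and> canonical (r_leader d) \<and> canonical (snd (r_num d)) \<and>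
     (fst (r_num d) \<longrightarrow> snd (r_num d) \<noteq> []) \<and> canonical (r_den d) \<and> canonical (r_states d) \<and> canonical (r_init d) \<and>
     (\<forall>e \<in> set (r_read d). length e = 3 \<and> (\<forall>b \<in> set e. canonical b)) \<and>
     (\<forall>e \<in> set (r_act d). length e = 4 \<and> (\<forall>b \<in> set e. canonical b))"

lemma nat_bits_eq_Nil_iff: "nat_bits n = [] \<longleftrightarrow> n = 0"
  by (subst nat_bits.simps) simp

lemma map_canonical: "(\<forall>b \<in> set bs. canonical b) \<Longrightarrow> map (\<lambda>b. nat_bits (bits_val b)) bs = bs"
  by (induction bs) (auto simp: nat_bits_bits_val)

lemma raw_ok_iff: "raw_ok d \<longleftrightarrow> (\<exists>I. d = raw_of I)"
proof
  assume ok: "raw_ok d"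
  let ?v = "\<lambda>e i. bits_val (e ! i)"
  define I where "I = \<lparr> inst_owner = map bits_val (r_owner d), inst_targets = map (map bits_val) (r_targets d),
    inst_edges = map (\<lambda>e. (?v e 0, ?v e 1)) (r_edges d), inst_start = bits_val (r_start d),
    inst_leader = bits_val (r_leader d),
    inst_num = (if fst (r_num d) then - int (bits_val (snd (r_num d))) else int (bits_val (snd (r_num d)))),
    inst_den = bits_val (r_den d), inst_states = bits_val (r_states d), inst_init = bits_val (r_init d),
    inst_read = map (\<lambda>e. (?v e 0, ?v e 1, ?v e 2)) (r_read d),
    inst_act = map (\<lambda>e. (?v e 0, ?v e 1, ?v e 2, ?v e 3)) (r_act d) \<rparr>"
  have l2: "e = [e ! 0, e ! 1]" if "length e = 2" for e :: "bool list list"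
    using that by (auto simp: list_eq_iff_nth_eq less_Suc_eq numeral_2_eq_2)
  have l3: "e = [e ! 0, e ! 1, e ! 2]" if "length e = 3" for e :: "bool list list"
    using that by (auto simp: list_eq_iff_nth_eq less_Suc_eq numeral_3_eq_3 numeral_2_eq_2)
  have l4: "e = [e ! 0, e ! 1, e ! 2, e ! 3]" if "length e = 4" for e :: "bool list list"
    using that by (auto simp: list_eq_iff_nth_eq less_Suc_eq eval_nat_numeral)
  have c: "nat_bits (?v e i) = e ! i" if "i < length e" "\<forall>b \<in> set e. canonical b" for e i
    using that by (simp add: nat_bits_bits_val)
  have "map (\<lambda>e. [nat_bits (?v e 0), nat_bits (?v e 1)]) (r_edges d) = r_edges d"
    by (rule map_idI) (use ok l2 in \<open>auto simp: raw_ok_def c\<close>)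
  moreover have "map (\<lambda>e. [nat_bits (?v e 0), nat_bits (?v e 1), nat_bits (?v e 2)]) (r_read d) = r_read d"
    by (rule map_idI) (use ok l3 in \<open>auto simp: raw_ok_def c\<close>)
  moreover have "map (\<lambda>e. [nat_bits (?v e 0), nat_bits (?v e 1), nat_bits (?v e 2), nat_bits (?v e 3)]) (r_act d) = r_act d"
    by (rule map_idI) (use ok l4 in \<open>auto simp: raw_ok_def c\<close>)
  moreover have "map (\<lambda>S. map (\<lambda>b. nat_bits (bits_val b)) S) (r_targets d) = r_targets d"
    by (rule map_idI) (use ok in \<open>simp add: raw_ok_def map_canonical\<close>)
  moreover have "(if fst (r_num d) then 0 < bits_val (snd (r_num d)) else False, snd (r_num d)) = r_num d"
  proof (cases "fst (r_num d)")
    case True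
    then have "nat_bits (bits_val (snd (r_num d))) = snd (r_num d)" "snd (r_num d) \<noteq> []"
      using ok by (auto simp: raw_ok_def nat_bits_bits_val)
    then have "bits_val (snd (r_num d)) \<noteq> 0" by (metis nat_bits_0)
    then show ?thesis using True by (simp add: prod_eq_iff)
  qed (simp add: prod_eq_iff)
  ultimately have "raw_of I = d"
    using ok by (simp add: raw_of_def I_def raw_ok_def comp_def map_canonical nat_bits_bits_val)
      (simp add: raw_defs prod_eq_iff split: if_splits)
  then show "\<exists>I. d = raw_of I" by blast
next
  assume "\<exists>I. d = raw_of I"
  then show "raw_ok d"
    by (auto simp: raw_ok_def canonical_nat_bits nat_bits_eq_Nil_iff)
qed

text \<open>The fields of an instance other than the threshold, which is the only one that may be large.\<close>

type_synonym game_data = "nat list \<times> nat list list \<times> (nat \<times> nat) list \<times> nat \<times> nat \<times> nat \<times> nat \<times>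
  (nat \<times> nat \<times> nat) list \<times> (nat \<times> nat \<times> nat \<times> nat) list"

definition "g_owner g = fst (g :: game_data)"
definition "g_targets g = fst (snd (g :: game_data))"
definition "g_edges g = fst (snd (snd (g :: game_data)))"
definition "g_start g = fst (snd (snd (snd (g :: game_data))))"
definition "g_leader g = fst (snd (snd (snd (snd (g :: game_data)))))"
definition "g_states g = fst (snd (snd (snd (snd (snd (g :: game_data))))))"
definition "g_init g = fst (snd (snd (snd (snd (snd (snd (g :: game_data)))))))"
definition "g_read g = fst (snd (snd (snd (snd (snd (snd (snd (g :: game_data))))))))"
definition "g_act g = snd (snd (snd (snd (snd (snd (snd (snd (g :: game_data))))))))"

lemmas game_data_defs = g_owner_def g_targets_def g_edges_def g_start_def g_leader_def g_states_def
  g_init_def g_read_def g_act_def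

definition game_data_of :: "inst \<Rightarrow> game_data" where
  "game_data_of I = (inst_owner I, inst_targets I, inst_edges I, inst_start I, inst_leader I, inst_states I,
     inst_init I, inst_read I, inst_act I)"

lemma game_data_sel [simp]:
  "g_owner (game_data_of I) = inst_owner I" "g_targets (game_data_of I) = inst_targets I"
  "g_edges (game_data_of I) = inst_edges I" "g_start (game_data_of I) = inst_start I"
  "g_leader (game_data_of I) = inst_leader I" "g_states (game_data_of I) = inst_states I"
  "g_init (game_data_of I) = inst_init I" "g_read (game_data_of I) = inst_read I"
  "g_act (game_data_of I) = inst_act I"
  by (simp_all add: game_data_defs game_data_of_def)

text \<open>Vertices and players are bounded by the lengths of the lists of owners and targets, and
  machine states by the number of transitions. Hence every number of a valid instance outside the
  threshold is below this bound.\<close>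

definition raw_bound :: "raw_inst \<Rightarrow> nat" where
  "raw_bound d = Suc (length (r_owner d) + length (r_targets d) + length (r_read d) + length (r_act d))"

definition small :: "nat \<Rightarrow> bool list \<Rightarrow> bool" where
  "small B b \<longleftrightarrow> capped_val B b < B"

lemma small_iff: "small B b \<longleftrightarrow> bits_val b < B"
  by (auto simp: small_def capped_val_eq)

definition raw_small :: "raw_inst \<Rightarrow> bool" where
  "raw_small d \<longleftrightarrow> (\<forall>b \<in> set (r_owner d). small (raw_bound d) b) \<and>
     (\<forall>S \<in> set (r_targets d). \<forall>b \<in> set S. small (raw_bound d) b) \<and>
     (\<forall>e \<in> set (r_edges d). \<forall>b \<in> set e. small (raw_bound d) b) \<and>
     small (raw_bound d) (r_start d) \<and> small (raw_bound d) (r_leader d) \<and>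
     small (raw_bound d) (r_states d) \<and> small (raw_bound d) (r_init d) \<and>
     (\<forall>e \<in> set (r_read d). \<forall>b \<in> set e. small (raw_bound d) b) \<and>
     (\<forall>e \<in> set (r_act d). \<forall>b \<in> set e. small (raw_bound d) b)"

definition unary :: "raw_inst \<Rightarrow> game_data" where
  "unary d = (let v = capped_val (raw_bound d); n = (\<lambda>e i. v (nth_default [] e i)) in
     (map v (r_owner d), map (map v) (r_targets d), map (\<lambda>e. (n e 0, n e 1)) (r_edges d),
      v (r_start d), v (r_leader d), v (r_states d), v (r_init d),
      map (\<lambda>e. (n e 0, n e 1, n e 2)) (r_read d), map (\<lambda>e. (n e 0, n e 1, n e 2, n e 3)) (r_act d)))"

lemma unary_raw_of:
  assumes "raw_small (raw_of I)"
  shows "unary (raw_of I) = game_data_of I"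
proof -
  let ?B = "raw_bound (raw_of I)"
  have v: "capped_val ?B (nat_bits n) = n" if "n < ?B" for n
    using that by (simp add: capped_val_eq)
  note s = assms[unfolded raw_small_def small_iff, simplified]
  have 1: "map (\<lambda>x. capped_val ?B (nat_bits x)) (inst_owner I) = inst_owner I"
    by (rule map_idI) (use s in \<open>auto simp: v\<close>)
  have 2: "map (\<lambda>S. map (\<lambda>x. capped_val ?B (nat_bits x)) S) (inst_targets I) = inst_targets I"
    by (intro map_idI) (use s in \<open>auto simp: v\<close>)
  have 3: "map (\<lambda>e. (capped_val ?B (nat_bits (fst e)), capped_val ?B (nat_bits (snd e)))) (inst_edges I) = inst_edges I"
    by (rule map_idI) (use s in \<open>auto simp: v\<close>)
  have 4: "map (\<lambda>e. (capped_val ?B (nat_bits (fst e)), capped_val ?B (nat_bits (fst (snd e))),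
      capped_val ?B (nat_bits (snd (snd e))))) (inst_read I) = inst_read I"
    by (rule map_idI) (use s in \<open>auto simp: v\<close>)
  have 5: "map (\<lambda>e. (capped_val ?B (nat_bits (fst e)), capped_val ?B (nat_bits (fst (snd e))),
      capped_val ?B (nat_bits (fst (snd (snd e)))), capped_val ?B (nat_bits (snd (snd (snd e)))))) (inst_act I) = inst_act I"
    by (rule map_idI) (use s in \<open>auto simp: v\<close>)
  show ?thesis
    using 1 2 3 4 5 s
    by (simp add: unary_def Let_def game_data_of_def comp_def case_prod_beta nth_default_def v)
qed

lemma FP_raw_ok: "FP raw_ok"
  unfolding raw_ok_def raw_defs by (intro FP_intros FP_is_Nil)

lemma FP_raw_bound [FP_intros]: "FP d \<Longrightarrow> FP (\<lambda>c. raw_bound (d c))"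
  unfolding raw_bound_def raw_defs by (intro FP_intros)

lemma FP_small [FP_intros]: "FP B \<Longrightarrow> FP b \<Longrightarrow> FP (\<lambda>c. small (B c) (b c))"
  unfolding small_def by (intro FP_intros)

lemma FP_raw_small: "FP raw_small"
  unfolding raw_small_def raw_defs by (intro FP_intros)

lemma FP_unary: "FP unary"
  unfolding unary_def Let_def raw_defs by (intro FP_intros)

section \<open>Verification of certificates\<close>

text \<open>The default is not the number of any player.\<close>

definition g_part :: "game_data \<Rightarrow> nat \<Rightarrow> nat" where
  "g_part g u = nth_default (length (g_targets g)) (g_owner g) u"

definition g_target :: "game_data \<Rightarrow> nat \<Rightarrow> nat list" where
  "g_target g i = nth_default [] (g_targets g) i"

definition valid_data :: "game_data \<Rightarrow> bool" where
  "valid_data g \<longleftrightarrow>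
     (\<forall>e \<in> set (g_edges g). fst e < length (g_owner g) \<and> snd e < length (g_owner g)) \<and>
     (\<forall>u < length (g_owner g). \<exists>e \<in> set (g_edges g). fst e = u) \<and>
     (\<forall>i \<in> set (g_owner g). i < length (g_targets g)) \<and>
     (\<forall>S \<in> set (g_targets g). \<forall>v \<in> set S. v < length (g_owner g)) \<and>
     g_start g < length (g_owner g) \<and> g_leader g < length (g_targets g) \<and> g_init g < g_states g \<and>
     (\<forall>\<tau> \<in> set (g_read g). fst \<tau> < g_states g \<and> fst (snd \<tau>) < length (g_owner g) \<and>
        g_part g (fst (snd \<tau>)) \<noteq> g_leader g \<and> snd (snd \<tau>) < g_states g) \<and>
     (\<forall>\<tau> \<in> set (g_act g). fst \<tau> < g_states g \<and> fst (snd \<tau>) < length (g_owner g) \<and>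
        g_part g (fst (snd \<tau>)) = g_leader g \<and> fst (snd (snd \<tau>)) < g_states g \<and>
        snd (snd (snd \<tau>)) < length (g_owner g) \<and> (fst (snd \<tau>), snd (snd (snd \<tau>))) \<in> set (g_edges g)) \<and>
     (\<forall>p < g_states g. \<forall>u < length (g_owner g).
        (\<exists>\<tau> \<in> set (g_read g). fst \<tau> = p \<and> fst (snd \<tau>) = u) \<or> (\<exists>\<tau> \<in> set (g_act g). fst \<tau> = p \<and> fst (snd \<tau>) = u))"

definition det_data :: "game_data \<Rightarrow> bool" where
  "det_data g \<longleftrightarrow>
     (\<forall>\<tau> \<in> set (g_read g). \<forall>\<tau>' \<in> set (g_read g). fst \<tau> = fst \<tau>' \<and> fst (snd \<tau>) = fst (snd \<tau>') \<longrightarrow> \<tau> = \<tau>') \<and>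
     (\<forall>\<tau> \<in> set (g_act g). \<forall>\<tau>' \<in> set (g_act g). fst \<tau> = fst \<tau>' \<and> fst (snd \<tau>) = fst (snd \<tau>') \<longrightarrow> \<tau> = \<tau>')"

definition g_all :: "game_data \<Rightarrow> (nat \<times> nat) list" where
  "g_all g = concat (map (\<lambda>q. map (\<lambda>v. (q, v)) [0..<length (g_owner g)]) [0..<g_states g])"

definition g_move :: "game_data \<Rightarrow> nat \<times> nat \<Rightarrow> nat \<times> nat \<Rightarrow> bool" where
  "g_move g x y \<longleftrightarrow> (if g_part g (snd x) = g_leader g then (fst x, snd x, fst y, snd y) \<in> set (g_act g)
     else (fst x, snd x, fst y) \<in> set (g_read g) \<and> (snd x, snd y) \<in> set (g_edges g))"

definition g_win_step :: "game_data \<Rightarrow> nat \<Rightarrow> (nat \<times> nat) list \<Rightarrow> (nat \<times> nat) list" where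
  "g_win_step g i W = filter (\<lambda>x. snd x \<in> set (g_target g i) \<or>
     (if g_part g (snd x) = i \<and> i \<noteq> g_leader g
      then \<forall>\<tau> \<in> set (g_read g). fst \<tau> = fst x \<and> fst (snd \<tau>) = snd x \<longrightarrow>
        (\<exists>e \<in> set (g_edges g). fst e = snd x \<and> (snd (snd \<tau>), snd e) \<in> set W)
      else \<forall>y \<in> set (g_all g). g_move g x y \<longrightarrow> y \<in> set W)) (g_all g)"

definition g_win :: "game_data \<Rightarrow> nat \<Rightarrow> nat \<Rightarrow> (nat \<times> nat) list" where
  "g_win g i k = (g_win_step g i ^^ k) (filter (\<lambda>x. snd x \<in> set (g_target g i)) (g_all g))"

abbreviation "at_pos rs n \<equiv> nth_default (0 :: nat, 0 :: nat) rs n"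

text \<open>\<open>secure_prefix\<close> with the number of product states for \<open>N\<close>.
  Each quantifier ranges over a list or below a unary number, so the closure properties of
  \<open>FP\<close> apply directly.\<close>

definition g_secure :: "game_data \<Rightarrow> (nat \<times> nat) list \<Rightarrow> bool" where
  "g_secure g rs \<longleftrightarrow> g_states g * length (g_owner g) < length rs \<and> at_pos rs 0 = (g_init g, g_start g) \<and>
     (\<forall>n < length rs - 1. g_move g (at_pos rs n) (at_pos rs (Suc n))) \<and>
     (\<forall>i < length (g_targets g). \<forall>n < length rs. snd (at_pos rs n) \<in> set (g_target g i) \<longrightarrow>
        (\<exists>m < length rs - g_states g * length (g_owner g). snd (at_pos rs m) \<in> set (g_target g i))) \<and>
     (\<forall>i < length (g_targets g). i \<noteq> g_leader g \<longrightarrow> (\<forall>n < length rs - 1. g_part g (snd (at_pos rs n)) = i \<longrightarrow>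
        (\<forall>e \<in> set (g_edges g). fst e = snd (at_pos rs n) \<longrightarrow> (\<forall>k < Suc (g_states g * length (g_owner g)).
          (fst (at_pos rs (Suc n)), snd e) \<in> set (g_win g i k) \<longrightarrow>
          (\<exists>m < length rs. m \<le> n + 1 + k \<and> snd (at_pos rs m) \<in> set (g_target g i))))))"

text \<open>The inequality \<open>1 / (1 + n) \<le> num / den\<close> with denominators cleared; a
  negative threshold is never met.\<close>

definition g_pay :: "game_data \<Rightarrow> bool \<times> bool list \<Rightarrow> bool list \<Rightarrow> (nat \<times> nat) list \<Rightarrow> bool" where
  "g_pay g num den rs \<longleftrightarrow> \<not> fst num \<and> (\<forall>n < length rs. snd (at_pos rs n) \<in> set (g_target g (g_leader g)) \<longrightarrow>
     le_mult den (snd num) (Suc n))"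

lemma FP_valid_data [FP_intros]: "FP g \<Longrightarrow> FP (\<lambda>c. valid_data (g c))"
  by (rule FP_comp[of valid_data]) (unfold valid_data_def g_part_def game_data_defs, intro FP_intros)

lemma FP_det_data [FP_intros]: "FP g \<Longrightarrow> FP (\<lambda>c. det_data (g c))"
  by (rule FP_comp[of det_data]) (unfold det_data_def game_data_defs, intro FP_intros)

text \<open>All iterates are sublists of \<open>g_all\<close>, which bounds the sizes during the
  iteration.\<close>

lemma FP_g_win:
  assumes "FP g" "FP i" "FP k"
  shows "FP (\<lambda>c. g_win (g c) (i c) (k c))"
proof (rule FP_comp3[OF _ assms])
  have step: "FP (\<lambda>q :: (game_data \<times> nat \<times> nat) \<times> (nat \<times> nat) list. g_win_step (fst (fst q)) (fst (snd (fst q))) (snd q))"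
    unfolding g_win_step_def g_all_def g_move_def g_part_def g_target_def game_data_defs by (intro FP_intros)
  have all: "FP g_all" unfolding g_all_def game_data_defs by (intro FP_intros)
  have "FP (\<lambda>p :: game_data \<times> nat \<times> nat. (g_win_step (fst p) (fst (snd p)) ^^ snd (snd p))
      (filter (\<lambda>x. snd x \<in> set (g_target (fst p) (fst (snd p)))) (g_all (fst p))))"
  proof (rule FP_funpow[where B = "\<lambda>p. sz (g_all (fst p))"])
    show "FP (\<lambda>p :: game_data \<times> nat \<times> nat. filter (\<lambda>x. snd x \<in> set (g_target (fst p) (fst (snd p)))) (g_all (fst p)))"
      unfolding g_all_def g_target_def game_data_defs by (intro FP_intros)
    show "polybd sz (\<lambda>p :: game_data \<times> nat \<times> nat. sz (g_all (fst p)))"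
      by (intro polybd_FP FP_comp[OF all] FP_intros)
    show "sz ((g_win_step (fst c) (fst (snd c)) ^^ i) (filter (\<lambda>x. snd x \<in> set (g_target (fst c) (fst (snd c)))) (g_all (fst c))))
        \<le> sz (g_all (fst c))" for c :: "game_data \<times> nat \<times> nat" and i
      by (cases i) (simp_all add: g_win_step_def sz_filter_le)
  qed (intro FP_intros step)+
  then show "FP (\<lambda>p. g_win (fst p) (fst (snd p)) (snd (snd p)))"
    by (simp add: g_win_def)
qed

lemma FP_g_secure [FP_intros]: "FP g \<Longrightarrow> FP rs \<Longrightarrow> FP (\<lambda>c. g_secure (g c) (rs c))"
proof (rule FP_comp2[of g_secure])
  show "FP (\<lambda>p. g_secure (fst p) (snd p))"
    unfolding g_secure_def g_move_def g_part_def g_target_def game_data_defs by (intro FP_intros FP_g_win)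
qed

lemma FP_g_pay:
  assumes "FP g" "FP num" "FP den" "FP rs"
  shows "FP (\<lambda>c. g_pay (g c) (num c) (den c) (rs c))"
proof -
  have "FP (\<lambda>q. g_pay (fst q) (fst (snd q)) (fst (snd (snd q))) (snd (snd (snd q))))"
    unfolding g_pay_def g_target_def game_data_defs by (intro FP_intros)
  from FP_comp[OF this FP_Pair[OF assms(1) FP_Pair[OF assms(2) FP_Pair[OF assms(3,4)]]]]
  show ?thesis by simp
qed

subsection \<open>Soundness and completeness\<close>

context
  fixes I :: inst
begin

private abbreviation "g \<equiv> game_data_of I"
private abbreviation "arena \<equiv> inst_game I"
private abbreviation "n \<equiv> length (inst_owner I)"
private abbreviation "np \<equiv> length (inst_targets I)"

private lemma arena_verts: "verts arena = {..<n}" by (simp add: inst_game_def)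
private lemma arena_players: "players arena = {..<np}" by (simp add: inst_game_def)
private lemma arena_edges: "edges arena = set (inst_edges I)" by (simp add: inst_game_def)

private lemma part_iff: "i < np \<Longrightarrow> u \<in> part arena i \<longleftrightarrow> g_part g u = i"
  by (auto simp: inst_game_def g_part_def nth_default_def)

private lemma part_less: "u \<in> part arena i \<Longrightarrow> u < n"
  by (simp add: inst_game_def)

private lemma mealy_states: "mealy_states (inst_mealy I) = {..<inst_states I}"
  and mealy_init: "mealy_init (inst_mealy I) = inst_init I"
  by (simp_all add: inst_mealy_def)

private lemma Read_iff: "Read p u q \<in> mealy_trans (inst_mealy I) \<longleftrightarrow> (p, u, q) \<in> set (inst_read I)"
  and Act_iff: "Act p u q v \<in> mealy_trans (inst_mealy I) \<longleftrightarrow> (p, u, q, v) \<in> set (inst_act I)"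
  by (auto simp: inst_mealy_def)

private lemma trans_iff: "(\<exists>\<tau> \<in> mealy_trans (inst_mealy I). R \<tau>) \<longleftrightarrow>
    (\<exists>t \<in> set (inst_read I). R (Read (fst t) (fst (snd t)) (snd (snd t)))) \<or>
    (\<exists>t \<in> set (inst_act I). R (Act (fst t) (fst (snd t)) (fst (snd (snd t))) (snd (snd (snd t)))))"
  by (auto simp: inst_mealy_def) force+

private lemma all_trans_iff: "(\<forall>\<tau> \<in> mealy_trans (inst_mealy I). R \<tau>) \<longleftrightarrow>
    (\<forall>t \<in> set (inst_read I). R (Read (fst t) (fst (snd t)) (snd (snd t)))) \<and>
    (\<forall>t \<in> set (inst_act I). R (Act (fst t) (fst (snd t)) (fst (snd (snd t))) (snd (snd (snd t)))))"
  using trans_iff[of "\<lambda>\<tau>. \<not> R \<tau>"] by blast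

private lemma wf_game_iff: "wf_game arena \<longleftrightarrow>
     (\<forall>e \<in> set (inst_edges I). fst e < n \<and> snd e < n) \<and>
     (\<forall>u < n. \<exists>e \<in> set (inst_edges I). fst e = u) \<and> (\<forall>i \<in> set (inst_owner I). i < np)"
proof -
  have "(\<Union>i \<in> players arena. part arena i) = verts arena \<longleftrightarrow> (\<forall>i \<in> set (inst_owner I). i < np)"
  proof -
    have "(\<Union>i \<in> players arena. part arena i) = {u. u < n \<and> inst_owner I ! u < np}"
      by (auto simp: inst_game_def)
    also have "\<dots> = verts arena \<longleftrightarrow> (\<forall>u < n. inst_owner I ! u < np)"
      unfolding arena_verts by blast
    finally show ?thesis by (simp add: all_set_conv_all_nth)
  qed
  moreover have "(\<forall>u \<in> verts arena. \<exists>v. (u, v) \<in> edges arena) \<longleftrightarrow> (\<forall>u < n. \<exists>e \<in> set (inst_edges I). fst e = u)"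
    by (force simp: arena_verts arena_edges)
  moreover have "edges arena \<subseteq> verts arena \<times> verts arena \<longleftrightarrow> (\<forall>e \<in> set (inst_edges I). fst e < n \<and> snd e < n)"
    by (auto simp: arena_verts arena_edges)
  moreover have "\<forall>i \<in> players arena. \<forall>j \<in> players arena. i \<noteq> j \<longrightarrow> part arena i \<inter> part arena j = {}"
    by (auto simp: inst_game_def)
  ultimately show ?thesis by (auto simp: wf_game_def arena_players arena_verts)
qed

private lemma wf_mealy_iff:
  assumes "inst_leader I < np"
  shows "wf_mealy arena (inst_leader I) (inst_mealy I) \<longleftrightarrow> inst_init I < inst_states I \<and>
     (\<forall>\<tau> \<in> set (inst_read I). fst \<tau> < inst_states I \<and> fst (snd \<tau>) < n \<and>
        g_part g (fst (snd \<tau>)) \<noteq> inst_leader I \<and> snd (snd \<tau>) < inst_states I) \<and>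
     (\<forall>\<tau> \<in> set (inst_act I). fst \<tau> < inst_states I \<and> fst (snd \<tau>) < n \<and>
        g_part g (fst (snd \<tau>)) = inst_leader I \<and> fst (snd (snd \<tau>)) < inst_states I \<and>
        snd (snd (snd \<tau>)) < n \<and> (fst (snd \<tau>), snd (snd (snd \<tau>))) \<in> set (inst_edges I)) \<and>
     (\<forall>p < inst_states I. \<forall>u < n.
        (\<exists>\<tau> \<in> set (inst_read I). fst \<tau> = p \<and> fst (snd \<tau>) = u) \<or> (\<exists>\<tau> \<in> set (inst_act I). fst \<tau> = p \<and> fst (snd \<tau>) = u))"
proof -
  let ?L = "inst_leader I" and ?M = "inst_mealy I"
  let ?R = "{Read p u q | p u q. p \<in> mealy_states ?M \<and> u \<in> verts arena - part arena ?L \<and> q \<in> mealy_states ?M}"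
  let ?A = "{Act p u q v | p u q v. p \<in> mealy_states ?M \<and> u \<in> part arena ?L \<and> q \<in> mealy_states ?M \<and>
          v \<in> verts arena \<and> (u, v) \<in> edges arena}"
  have "mealy_trans ?M \<subseteq> ?R \<union> ?A \<longleftrightarrow>
      (\<forall>t \<in> set (inst_read I). Read (fst t) (fst (snd t)) (snd (snd t)) \<in> ?R) \<and>
      (\<forall>t \<in> set (inst_act I). Act (fst t) (fst (snd t)) (fst (snd (snd t))) (snd (snd (snd t))) \<in> ?A)"
    unfolding subset_iff Ball_def[symmetric] all_trans_iff by blast
  moreover have "Read p u q \<in> ?R \<longleftrightarrow> p < inst_states I \<and> u < n \<and> g_part g u \<noteq> ?L \<and> q < inst_states I" for p u q
    using part_iff[OF assms, of u] by (auto simp: mealy_states arena_verts)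
  moreover have "Act p u q v \<in> ?A \<longleftrightarrow> p < inst_states I \<and> u < n \<and> g_part g u = ?L \<and> q < inst_states I \<and> v < n \<and>
      (u, v) \<in> set (inst_edges I)" for p u q v
    using part_iff[OF assms, of u] part_less by (auto simp: mealy_states arena_verts arena_edges)
  moreover have "(\<forall>p \<in> mealy_states ?M. \<forall>u \<in> verts arena. \<exists>\<tau> \<in> mealy_trans ?M. trans_key \<tau> = (p, u)) \<longleftrightarrow>
      (\<forall>p < inst_states I. \<forall>u < n. (\<exists>\<tau> \<in> set (inst_read I). fst \<tau> = p \<and> fst (snd \<tau>) = u) \<or>
        (\<exists>\<tau> \<in> set (inst_act I). fst \<tau> = p \<and> fst (snd \<tau>) = u))"
    unfolding trans_iff by (simp add: mealy_states arena_verts Ball_def)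
  ultimately show ?thesis
    unfolding wf_mealy_def by (simp add: mealy_states mealy_init)
qed

text \<open>The targets of the instance witness the existential quantifier over target sets, so
  being a reachability game reduces to well-formedness.\<close>

lemma valid_inst_iff: "valid_inst I \<longleftrightarrow> valid_data (game_data_of I) \<and> inst_den I > 0"
proof -
  have "quantitative_reachability_game arena \<longleftrightarrow> wf_game arena"
    if "\<forall>S \<in> set (inst_targets I). set S \<subseteq> verts arena"
    unfolding quantitative_reachability_game_def
  proof (safe intro!: exI[of _ "\<lambda>i. set (inst_targets I ! i)"])
    fix i u assume "i \<in> players arena" "u \<in> set (inst_targets I ! i)"
    then show "u \<in> verts arena" using that by (auto simp: arena_players)
  qed (simp add: inst_game_def)
  moreover have "(\<forall>S \<in> set (inst_targets I). set S \<subseteq> verts arena) \<longleftrightarrow> (\<forall>S \<in> set (inst_targets I). \<forall>v \<in> set S. v < n)"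
    by (auto simp: arena_verts)
  ultimately show ?thesis
    unfolding valid_inst_def valid_data_def
    by (cases "inst_leader I < np") (simp_all add: wf_game_iff wf_mealy_iff arena_players arena_verts, blast)
qed

context
  assumes valid: "valid_inst I"
begin

private lemma valid_parts: "valid_data g" "inst_den I > 0"
  using valid by (auto simp: valid_inst_iff)

private lemma leader_less: "inst_leader I < np" and start_less: "inst_start I < n"
  using valid_parts(1) by (auto simp: valid_data_def)

text \<open>Reading and acting transitions need no comparison with each other, because in a valid
  instance the owner of the vertex decides which kind there is.\<close>

lemma deterministic_iff: "deterministic_mealy (inst_game I) (inst_mealy I) \<longleftrightarrow> det_data (game_data_of I)"
proof
  assume d: "deterministic_mealy arena (inst_mealy I)"
  have uniq: "\<tau> = \<tau>'" if "\<tau> \<in> mealy_trans (inst_mealy I)" "\<tau>' \<in> mealy_trans (inst_mealy I)"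
    "trans_key \<tau> = (p, u)" "trans_key \<tau>' = (p, u)" "p < inst_states I" "u < n" for \<tau> \<tau>' p u
    using d that unfolding deterministic_mealy_def mealy_states arena_verts by blast
  show "det_data g"
    unfolding det_data_def
  proof (intro conjI ballI impI)
    fix \<tau> \<tau>' assume t: "\<tau> \<in> set (g_read g)" "\<tau>' \<in> set (g_read g)" "fst \<tau> = fst \<tau>' \<and> fst (snd \<tau>) = fst (snd \<tau>')"
    then have "fst \<tau> < inst_states I" "fst (snd \<tau>) < n" using valid_parts(1) by (auto simp: valid_data_def)
    then have "Read (fst \<tau>) (fst (snd \<tau>)) (snd (snd \<tau>)) = Read (fst \<tau>') (fst (snd \<tau>')) (snd (snd \<tau>'))"
      using t by (cases \<tau>; cases \<tau>'; intro uniq[of _ _ "fst \<tau>" "fst (snd \<tau>)"]) (simp_all add: Read_iff)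
    then show "\<tau> = \<tau>'" by (simp add: prod_eq_iff)
  next
    fix \<tau> \<tau>' assume t: "\<tau> \<in> set (g_act g)" "\<tau>' \<in> set (g_act g)" "fst \<tau> = fst \<tau>' \<and> fst (snd \<tau>) = fst (snd \<tau>')"
    then have "fst \<tau> < inst_states I" "fst (snd \<tau>) < n" using valid_parts(1) by (auto simp: valid_data_def)
    then have "Act (fst \<tau>) (fst (snd \<tau>)) (fst (snd (snd \<tau>))) (snd (snd (snd \<tau>))) =
        Act (fst \<tau>') (fst (snd \<tau>')) (fst (snd (snd \<tau>'))) (snd (snd (snd \<tau>')))"
      using t by (cases \<tau>; cases \<tau>'; intro uniq[of _ _ "fst \<tau>" "fst (snd \<tau>)"]) (simp_all add: Act_iff)
    then show "\<tau> = \<tau>'" by (simp add: prod_eq_iff)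
  qed
next
  assume d: "det_data g"
  show "deterministic_mealy arena (inst_mealy I)"
    unfolding deterministic_mealy_def
  proof (intro ballI)
    fix p u assume pu: "p \<in> mealy_states (inst_mealy I)" "u \<in> verts arena"
    obtain \<tau> where \<tau>: "\<tau> \<in> mealy_trans (inst_mealy I)" "trans_key \<tau> = (p, u)"
      using valid pu unfolding valid_inst_def wf_mealy_def by blast
    moreover have "\<tau>' = \<tau>" if \<tau>': "\<tau>' \<in> mealy_trans (inst_mealy I)" "trans_key \<tau>' = (p, u)" for \<tau>'
    proof (cases \<tau>; cases \<tau>')
      fix a b c a' b' c' assume "\<tau> = Read a b c" "\<tau>' = Read a' b' c'"
      then show ?thesis using \<tau> \<tau>' d unfolding det_data_def by (fastforce simp: Read_iff)
    next
      fix a b c e a' b' c' e' assume "\<tau> = Act a b c e" "\<tau>' = Act a' b' c' e'"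
      then show ?thesis using \<tau> \<tau>' d unfolding det_data_def by (fastforce simp: Act_iff)
    next
      fix a b c a' b' c' e' assume "\<tau> = Read a b c" "\<tau>' = Act a' b' c' e'"
      then show ?thesis using \<tau> \<tau>' valid_parts(1) unfolding valid_data_def by (fastforce simp: Read_iff Act_iff)
    next
      fix a b c e a' b' c' assume "\<tau> = Act a b c e" "\<tau>' = Read a' b' c'"
      then show ?thesis using \<tau> \<tau>' valid_parts(1) unfolding valid_data_def by (fastforce simp: Read_iff Act_iff)
    qed
    ultimately show "\<exists>!\<tau>. \<tau> \<in> mealy_trans (inst_mealy I) \<and> trans_key \<tau> = (p, u)" by blast
  qed
qed

text \<open>Every machine state has a transition for the start vertex. So the number of states,
  although given in binary, is not exponential in the length of the code.\<close>

lemma states_le: "inst_states I \<le> length (inst_read I) + length (inst_act I)"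
proof -
  have "{..<inst_states I} \<subseteq> fst ` set (inst_read I) \<union> fst ` set (inst_act I)"
  proof
    fix p assume "p \<in> {..<inst_states I}"
    then show "p \<in> fst ` set (inst_read I) \<union> fst ` set (inst_act I)"
      using valid_parts(1) start_less unfolding valid_data_def by (auto simp: image_iff) metis
  qed
  then have "inst_states I \<le> card (fst ` set (inst_read I) \<union> fst ` set (inst_act I))"
    using card_mono[of "fst ` set (inst_read I) \<union> fst ` set (inst_act I)" "{..<inst_states I}"] by simp
  also have "\<dots> \<le> card (fst ` set (inst_read I)) + card (fst ` set (inst_act I))"
    by (rule card_Un_le)
  also have "\<dots> \<le> length (inst_read I) + length (inst_act I)"
    by (intro add_mono order_trans[OF card_image_le] card_length) auto
  finally show ?thesis .
qed

lemma raw_small_raw_of: "raw_small (raw_of I)"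
proof -
  have b: "raw_bound (raw_of I) = Suc (n + np + length (inst_read I) + length (inst_act I))"
    by (simp add: raw_bound_def)
  note v = valid_parts(1)[unfolded valid_data_def, simplified]
  have Q: "q < raw_bound (raw_of I)" if "q \<le> inst_states I" for q using states_le that b by simp
  have N: "u < raw_bound (raw_of I)" if "u < n" for u using that b by simp
  have P: "i < raw_bound (raw_of I)" if "i < np" for i using that b by simp
  show ?thesis
    unfolding raw_small_def small_iff
    using v Q N P by (auto simp: less_imp_le)
qed

interpretation leader_game "inst_game I" "inst_start I" "inst_leader I" "inst_mealy I" "\<lambda>i. set (inst_targets I ! i)"
  by standard (use valid in \<open>auto simp: valid_inst_def quantitative_reachability_game_def inst_game_def\<close>)

private lemma target: "i < np \<Longrightarrow> set (g_target g i) = set (inst_targets I ! i)"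
  by (simp add: g_target_def nth_default_def)

private lemma set_all: "set (g_all g) = states"
  by (auto simp: g_all_def mealy_states arena_verts)

private lemma g_move_iff: "move x y \<longleftrightarrow> g_move g x y"
  using part_iff[OF leader_less] by (simp add: move_def g_move_def Read_iff Act_iff arena_edges)

private lemma win_eq:
  assumes i: "i < np"
  shows "set (g_win g i k) = win i k"
proof (induction k)
  case 0
  then show ?case using target[OF i] set_all by (auto simp: g_win_def)
next
  case (Suc k)
  have step: "set (g_win g i (Suc k)) = set (g_win_step g i (g_win g i k))"
    by (simp add: g_win_def)
  have "(\<forall>\<tau> \<in> set (g_read g). fst \<tau> = fst x \<and> fst (snd \<tau>) = snd x \<longrightarrow>
        (\<exists>e \<in> set (g_edges g). fst e = snd x \<and> (snd (snd \<tau>), snd e) \<in> set (g_win g i k))) \<longleftrightarrow>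
      (\<forall>q'. Read (fst x) (snd x) q' \<in> mealy_trans (inst_mealy I) \<longrightarrow> (\<exists>v. (snd x, v) \<in> edges arena \<and> (q', v) \<in> win i k))" for x
    unfolding Suc arena_edges Read_iff by (cases x) force
  moreover have "(\<forall>y \<in> set (g_all g). g_move g x y \<longrightarrow> y \<in> set (g_win g i k)) \<longleftrightarrow> (\<forall>y. move x y \<longrightarrow> y \<in> win i k)" for x
    unfolding Suc set_all g_move_iff[symmetric] using move_states by blast
  moreover have "g_part g (snd x) = i \<longleftrightarrow> snd x \<in> part arena i" for x :: "nat \<times> nat"
    using part_iff[OF i] by simp
  ultimately show ?case
    unfolding step g_win_step_def win.simps win_step_def set_filter set_all
    by (simp add: target[OF i])
qed

private lemma card_states: "card states = inst_states I * n"
  by (simp add: mealy_states arena_verts card_cartesian_product)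

private lemma secure_iff: "secure_prefix (inst_states I * n) rs \<longleftrightarrow> g_secure g rs"
proof -
  let ?N = "inst_states I * n"
  have at: "at_pos rs j = rs ! j" if "j < length rs" for j using that by (simp add: nth_default_def)
  have 1: "(\<forall>j. Suc j < length rs \<longrightarrow> move (rs ! j) (rs ! Suc j)) \<longleftrightarrow>
      (\<forall>j < length rs - 1. g_move g (at_pos rs j) (at_pos rs (Suc j)))"
    by (auto simp: at g_move_iff)
  have 2: "(\<forall>i \<in> players arena. \<forall>j < length rs. snd (rs ! j) \<in> set (inst_targets I ! i) \<longrightarrow>
        (\<exists>l < length rs - ?N. snd (rs ! l) \<in> set (inst_targets I ! i))) \<longleftrightarrow>
      (\<forall>i < np. \<forall>j < length rs. snd (at_pos rs j) \<in> set (g_target g i) \<longrightarrow>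
        (\<exists>l < length rs - ?N. snd (at_pos rs l) \<in> set (g_target g i)))"
  proof -
    have "(\<exists>l < length rs - ?N. snd (rs ! l) \<in> S) \<longleftrightarrow> (\<exists>l < length rs - ?N. snd (at_pos rs l) \<in> S)" for S
      by (metis at diff_le_self less_le_trans)
    then show ?thesis by (auto simp: at arena_players target)
  qed
  have 3: "(\<forall>i \<in> players arena - {inst_leader I}. \<forall>j. Suc j < length rs \<and> snd (rs ! j) \<in> part arena i \<longrightarrow>
        (\<forall>v k. (snd (rs ! j), v) \<in> edges arena \<and> k \<le> ?N \<and> (fst (rs ! Suc j), v) \<in> win i k \<longrightarrow>
          (\<exists>l < length rs. l \<le> j + 1 + k \<and> snd (rs ! l) \<in> set (inst_targets I ! i)))) \<longleftrightarrow>
      (\<forall>i < np. i \<noteq> inst_leader I \<longrightarrow> (\<forall>j < length rs - 1. g_part g (snd (at_pos rs j)) = i \<longrightarrow>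
        (\<forall>e \<in> set (inst_edges I). fst e = snd (at_pos rs j) \<longrightarrow> (\<forall>k < Suc ?N.
          (fst (at_pos rs (Suc j)), snd e) \<in> set (g_win g i k) \<longrightarrow>
          (\<exists>l < length rs. l \<le> j + 1 + k \<and> snd (at_pos rs l) \<in> set (g_target g i))))))"
    (is "?l \<longleftrightarrow> ?r")
  proof
    assume ?l
    show ?r
    proof (intro allI impI ballI)
      fix i j e k
      assume a: "i < np" "i \<noteq> inst_leader I" "j < length rs - 1" "g_part g (snd (at_pos rs j)) = i"
        "e \<in> set (inst_edges I)" "fst e = snd (at_pos rs j)" "k < Suc ?N"
        "(fst (at_pos rs (Suc j)), snd e) \<in> set (g_win g i k)"
      then have "\<exists>l < length rs. l \<le> j + 1 + k \<and> snd (rs ! l) \<in> set (inst_targets I ! i)"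
        using \<open>?l\<close>[rule_format, of i j "snd e" k]
        by (cases e) (auto simp: at arena_players part_iff arena_edges win_eq)
      then show "\<exists>l < length rs. l \<le> j + 1 + k \<and> snd (at_pos rs l) \<in> set (g_target g i)"
        using a(1) by (auto simp: at target)
    qed
  next
    assume ?r
    show ?l
    proof (intro allI impI ballI)
      fix i j v k
      assume a: "i \<in> players arena - {inst_leader I}" "Suc j < length rs \<and> snd (rs ! j) \<in> part arena i"
        "(snd (rs ! j), v) \<in> edges arena \<and> k \<le> ?N \<and> (fst (rs ! Suc j), v) \<in> win i k"
      then have "\<exists>l < length rs. l \<le> j + 1 + k \<and> snd (at_pos rs l) \<in> set (g_target g i)"
        using \<open>?r\<close>[rule_format, of i j "(snd (rs ! j), v)" k]
        by (auto simp: at arena_players part_iff arena_edges win_eq less_Suc_eq_le)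
      then show "\<exists>l < length rs. l \<le> j + 1 + k \<and> snd (rs ! l) \<in> set (inst_targets I ! i)"
        using a(1) by (auto simp: at target arena_players)
    qed
  qed
  have 4: "?N < length rs \<Longrightarrow> rs ! 0 = at_pos rs 0" by (rule at[symmetric]) auto
  show ?thesis
    unfolding secure_prefix_def g_secure_def 1 2 3 using 4 by (auto simp: mealy_init)
qed

private lemma pay_iff: "0 \<le> inst_threshold I \<and> (\<forall>j < length rs. snd (rs ! j) \<in> set (inst_targets I ! inst_leader I) \<longrightarrow>
      1 / (1 + real j) \<le> real_of_rat (inst_threshold I)) \<longleftrightarrow>
    g_pay g (inst_num I < 0, nat_bits (nat \<bar>inst_num I\<bar>)) (nat_bits (inst_den I)) rs"
proof -
  have den: "inst_den I > 0" by (rule valid_parts)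
  have "0 \<le> inst_threshold I \<longleftrightarrow> \<not> inst_num I < 0"
    using den by (auto simp: inst_threshold_def zero_le_divide_iff not_less)
  moreover have "1 / (1 + real j) \<le> real_of_rat (inst_threshold I) \<longleftrightarrow>
      le_mult (nat_bits (inst_den I)) (nat_bits (nat \<bar>inst_num I\<bar>)) (Suc j)" if "\<not> inst_num I < 0" for j
  proof -
    have "real_of_rat (inst_threshold I) = real (nat \<bar>inst_num I\<bar>) / real (inst_den I)"
      using that by (simp add: inst_threshold_def of_rat_divide)
    also have "1 / (1 + real j) \<le> \<dots> \<longleftrightarrow> real (inst_den I) \<le> real (nat \<bar>inst_num I\<bar> * Suc j)"
      using den by (simp add: field_simps del: of_nat_Suc)
    finally show ?thesis by (simp only: of_nat_le_iff le_mult_iff bits_val_nat_bits)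
  qed
  ultimately show ?thesis
    using target[OF leader_less] by (auto simp: g_pay_def nth_default_def)
qed

lemma verification_iff_certificate:
  "\<not> inst_rational_verification I \<longleftrightarrow>
    (\<exists>rs. length rs \<le> (np + 1) * (2 * (inst_states I * n) + 2) \<and> set rs \<subseteq> set (g_all g) \<and> g_secure g rs \<and>
      g_pay g (inst_num I < 0, nat_bits (nat \<bar>inst_num I\<bar>)) (nat_bits (inst_den I)) rs)"
  unfolding inst_rational_verification_def not_rational_verification_iff_prefix[OF order_refl]
    card_states secure_iff pay_iff[symmetric] set_all arena_players card_lessThan by blast

text \<open>Soundness rests on the two tests that the verifier performs; the bound on the length is
  a matter of the certificates that are guaranteed to exist.\<close>

lemma certificate_sound:
  assumes "g_secure g rs" "g_pay g (inst_num I < 0, nat_bits (nat \<bar>inst_num I\<bar>)) (nat_bits (inst_den I)) rs"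
  shows "\<not> inst_rational_verification I"
proof -
  have "\<exists>\<rho>. path \<rho> \<and> secure \<rho> \<and> reach_payoff (set (inst_targets I ! inst_leader I)) (\<lambda>n. snd (\<rho> n)) \<le> real_of_rat (inst_threshold I)"
    using assms by (intro secure_path_of_prefix[of "inst_states I * n" rs])
      (auto simp: secure_iff pay_iff[symmetric] card_states)
  then show ?thesis
    unfolding inst_rational_verification_def not_rational_verification_iff .
qed

end

end

section \<open>coNP-completeness\<close>

text \<open>A certificate is a list of numbers, written in unary and terminated by \<open>False\<close>.\<close>

definition unary_runs_step :: "bool \<Rightarrow> nat \<times> nat list \<Rightarrow> nat \<times> nat list" where
  "unary_runs_step b s = (if b then (Suc (fst s), snd s) else (0, fst s # snd s))"

definition unary_runs :: "bool list \<Rightarrow> nat list" where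
  "unary_runs u = rev (snd (fold unary_runs_step u (0, [])))"

definition unary_word :: "nat list \<Rightarrow> bool list" where
  "unary_word ns = concat (map (\<lambda>j. replicate j True @ [False]) ns)"

lemma unary_runs_unary_word: "unary_runs (unary_word ns) = ns"
proof -
  have "fold unary_runs_step (replicate j True) (k, l) = (j + k, l)" for j k l
    by (induction j arbitrary: k) (simp_all add: unary_runs_step_def)
  then have "fold unary_runs_step (unary_word ns) (0, l) = (0, rev ns @ l)" for l
    by (induction ns arbitrary: l) (simp_all add: unary_word_def unary_runs_step_def)
  then show ?thesis by (simp add: unary_runs_def)
qed

lemma length_unary_word: "\<forall>j \<in> set ns. j \<le> B \<Longrightarrow> length (unary_word ns) \<le> length ns * (B + 1)"
  by (induction ns) (auto simp: unary_word_def intro: add_mono)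

lemma FP_unary_runs: "FP unary_runs"
proof -
  have sz: "sz (fold unary_runs_step u s) \<le> sz s + 2 * length u" for u s
  proof (induction u arbitrary: s)
    case (Cons b u)
    have "sz (unary_runs_step b s) \<le> sz s + 2" by (cases s) (simp add: unary_runs_step_def)
    then show ?case using Cons[of "unary_runs_step b s"] by simp
  qed simp
  have "FP (\<lambda>u. fold unary_runs_step u (0, []))"
  proof (rule FP_fold[where B = "\<lambda>u. 3 + 2 * length u"])
    show "sz (fold unary_runs_step (take k u) (0, [])) \<le> 3 + 2 * length u" for k u
      using sz[of "take k u" "(0, [])"] by simp
    show "FP (\<lambda>p :: bool list \<times> bool \<times> nat \<times> nat list. unary_runs_step (fst (snd p)) (snd (snd p)))"
      unfolding unary_runs_step_def by (intro FP_intros)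
  qed (intro FP_intros polybd_intros polybd_FP_length)+
  then show ?thesis unfolding unary_runs_def by (intro FP_intros)
qed

text \<open>A certificate names product states by their indices in \<open>g_all g\<close>. An index
  out of range becomes \<open>(0, 0)\<close>, and the resulting path is tested like any
  other.\<close>

definition g_path :: "game_data \<Rightarrow> bool list \<Rightarrow> (nat \<times> nat) list" where
  "g_path g u = map (\<lambda>j. nth_default (0, 0) (g_all g) j) (unary_runs u)"

lemma g_path_onto:
  assumes "set rs \<subseteq> set (g_all g)"
  obtains u where "g_path g u = rs" "length u \<le> length rs * (g_states g * length (g_owner g) + 1)"
proof -
  have "\<forall>r \<in> set rs. \<exists>j < length (g_all g). g_all g ! j = r"
    using assms by (auto simp: in_set_conv_nth)
  then obtain ix where ix: "ix r < length (g_all g)" "g_all g ! ix r = r" if "r \<in> set rs" for r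
    by metis
  have len: "length (g_all g) = g_states g * length (g_owner g)"
    by (simp add: g_all_def length_concat comp_def sum_list_triv)
  have "g_path g (unary_word (map ix rs)) = rs"
    unfolding g_path_def unary_runs_unary_word by (simp add: map_idI ix nth_default_def)
  moreover have "length (unary_word (map ix rs)) \<le> length rs * (length (g_all g) + 1)"
    using length_unary_word[of "map ix rs" "length (g_all g)"] ix(1) by (simp add: less_imp_le)
  ultimately show thesis using that len by metis
qed

text \<open>With \<open>b\<close>, the Mealy machine must be deterministic. Every word that is not a valid instance is in
  the complement of the problem and is accepted with any certificate.\<close>

definition valid_raw :: "bool \<Rightarrow> raw_inst \<Rightarrow> bool" where
  "valid_raw b d \<longleftrightarrow> raw_ok d \<and> raw_small d \<and> valid_data (unary d) \<and> r_den d \<noteq> [] \<and> (b \<longrightarrow> det_data (unary d))"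

definition accepts :: "bool \<Rightarrow> raw_inst \<Rightarrow> bool list \<Rightarrow> bool" where
  "accepts b d u \<longleftrightarrow> valid_raw b d \<longrightarrow> g_secure (unary d) (g_path (unary d) u) \<and>
     g_pay (unary d) (r_num d) (r_den d) (g_path (unary d) u)"

text \<open>A word that does not start with a pair is rejected. A first component that is not parsed
  completely codes no instance and is accepted.\<close>

definition verify :: "bool \<Rightarrow> bool list \<Rightarrow> bool" where
  "verify b w = (case p_paren (p_seq p_num p_num) w of None \<Rightarrow> False | Some z \<Rightarrow>
     (case p_raw (fst (fst z)) of None \<Rightarrow> True | Some y \<Rightarrow> snd y = [] \<longrightarrow> accepts b (fst y) (snd (fst z))))"

lemmas good_parser_pair = good_parser_paren[OF good_parser_seq[OF good_parser_num good_parser_num]]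

lemma verify_pair: "verify b (enc_pair x u) \<longleftrightarrow> (\<forall>d. p_raw x = Some (d, []) \<longrightarrow> accepts b d u)"
proof -
  have "p_paren (p_seq p_num p_num) (enc_pair x u) = Some ((x, u), [])"
    using good_parserD(2)[OF good_parser_pair] by (simp add: enc_pair_def enc_paren_def)
  then show ?thesis by (auto simp: verify_def split: option.split)
qed

lemma FP_accepts:
  assumes "FP d" "FP u"
  shows "FP (\<lambda>c. accepts b (d c) (u c))"
proof (rule FP_comp2[of "accepts b", OF _ assms])
  note r = FP_comp[OF FP_raw_ok] FP_comp[OF FP_raw_small] FP_comp[OF FP_unary] FP_comp[OF FP_unary_runs]
  have "FP g_all" unfolding g_all_def game_data_defs by (intro FP_intros)
  note a = FP_comp[OF this]
  have "FP (\<lambda>p. g_path (fst p) (snd p))"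
    unfolding g_path_def by (intro FP_intros r a)
  note p = FP_comp2[of g_path, OF this]
  show "FP (\<lambda>p. accepts b (fst p) (snd p))"
    unfolding accepts_def valid_raw_def r_den_def r_num_def
    by (intro FP_intros FP_g_pay FP_is_Nil p r)
qed

lemma verify_in_P: "{w. verify b w} \<in> class_P"
proof -
  note r = FP_comp[OF good_parserD(1)[OF good_parser_pair]] FP_comp[OF good_parserD(1)[OF good_parser_raw]]
  have "FP (\<lambda>w. [verify b w])"
    unfolding verify_def by (intro FP_intros FP_is_Nil FP_accepts r)
  from polytime_computable_FP[OF this] show ?thesis by (simp add: class_P_def)
qed

definition verification_language :: "bool \<Rightarrow> language" where
  "verification_language b = {encode_inst I | I. valid_inst I \<and>
     (b \<longrightarrow> deterministic_mealy (inst_game I) (inst_mealy I)) \<and> inst_rational_verification I}"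

lemma encode_in_verification_language: "encode_inst I \<in> verification_language b \<longleftrightarrow> valid_inst I \<and>
     (b \<longrightarrow> deterministic_mealy (inst_game I) (inst_mealy I)) \<and> inst_rational_verification I"
  using inj_encode_inst by (auto simp: verification_language_def inj_def)

lemma valid_raw_of: "valid_raw b (raw_of I) \<longleftrightarrow>
    valid_inst I \<and> (b \<longrightarrow> deterministic_mealy (inst_game I) (inst_mealy I))"
proof -
  have "raw_ok (raw_of I)" by (auto simp: raw_ok_iff)
  then have "valid_raw b (raw_of I) \<longleftrightarrow> raw_small (raw_of I) \<and> valid_inst I \<and> (b \<longrightarrow> det_data (game_data_of I))"
    by (auto simp: valid_raw_def unary_raw_of valid_inst_iff nat_bits_eq_Nil_iff)
  then show ?thesis using deterministic_iff raw_small_raw_of by blast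
qed

text \<open>For valid instances certificates are indices of secure prefixes, whose length is
  polynomial because all numbers involved are at most linear in the length of the code. Other words
  are accepted outright.\<close>

lemma not_in_verification_language_iff:
  "\<exists>p :: nat poly. \<forall>x. x \<notin> verification_language b \<longleftrightarrow>
     (\<exists>u. length u \<le> poly p (length x) \<and> verify b (enc_pair x u))"
proof -
  \<comment> \<open>The encoder in \<open>good_parser_raw\<close> is a long expression. It is kept
    abstract here and identified with \<open>encode_inst\<close> through the parser.\<close>
  have "\<exists>C. \<forall>I. sz (raw_of I) \<le> C * length (encode_inst I)" if p: "good_parser enc p_raw" for enc
  proof -
    obtain C where C: "\<And>d. sz d \<le> C * length (enc d)"
      using p unfolding good_parser_def by blast
    have "encode_inst I = enc (raw_of I)" for I
      using p_raw_iff[of "encode_inst I" I] good_parserD(2)[OF p, of "encode_inst I" "raw_of I" "[]"] by simp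
    with C have "sz (raw_of I) \<le> C * length (encode_inst I)" for I by simp
    then show ?thesis by blast
  qed
  from this[OF good_parser_raw] obtain C where C: "\<And>I. sz (raw_of I) \<le> C * length (encode_inst I)" by blast
  \<comment> \<open>At most \<open>(s + 1) * (2 * (s * s) + 2)\<close> product states, each given by
    a unary index of at most \<open>s * s + 1\<close> bits, where \<open>s\<close> bounds the
    numbers of players, vertices and machine states.\<close>
  define bnd where "bnd s = (s + 1) * (2 * (s * s) + 2) * (s * s + 1)" for s :: nat
  have "polybd length (\<lambda>x :: bool list. bnd (C * length x))"
    unfolding bnd_def by (intro polybd_intros)
  then obtain p :: "nat poly" where p: "\<And>x :: bool list. bnd (C * length x) \<le> poly p (length x)"
    using polybd_length_imp_poly by blast
  have "x \<notin> verification_language b \<longleftrightarrow> (\<exists>u. length u \<le> poly p (length x) \<and> verify b (enc_pair x u))" for x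
  proof (cases "\<exists>I. x = encode_inst I \<and> valid_raw b (raw_of I)")
    case False
    \<comment> \<open>Such a word is the code of no admissible instance, so acceptance is vacuous
      and the empty certificate will do.\<close>
    have "accepts b d u" if "p_raw x = Some (d, [])" for d u
    proof (cases "raw_ok d")
      case True
      then obtain I where "d = raw_of I" by (auto simp: raw_ok_iff)
      then show ?thesis using that False p_raw_iff unfolding accepts_def by blast
    qed (simp add: accepts_def valid_raw_def)
    then have "\<exists>u. length u \<le> poly p (length x) \<and> verify b (enc_pair x u)"
      unfolding verify_pair by (intro exI[of _ "[]"]) simp
    moreover have "x \<notin> verification_language b"
      using False unfolding verification_language_def valid_raw_of by blast
    ultimately show ?thesis by blast
  next
    case True
    then obtain I where I: "x = encode_inst I" "valid_raw b (raw_of I)" by blast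
    let ?g = "game_data_of I"
    let ?c = "\<lambda>rs. g_secure ?g rs \<and>
      g_pay ?g (inst_num I < 0, nat_bits (nat \<bar>inst_num I\<bar>)) (nat_bits (inst_den I)) rs"
    have v: "valid_inst I" "b \<longrightarrow> deterministic_mealy (inst_game I) (inst_mealy I)"
      using I(2) valid_raw_of by blast+
    have "p_raw x = Some (d, []) \<longleftrightarrow> d = raw_of I" for d
      using p_raw_iff[of x I] I(1) by auto
    then have ver: "verify b (enc_pair x u) \<longleftrightarrow> ?c (g_path ?g u)" for u
      using I(2) by (simp add: verify_pair accepts_def unary_raw_of[OF raw_small_raw_of[OF v(1)]])
    have "\<exists>u. length u \<le> poly p (length x) \<and> ?c (g_path ?g u)" if no: "\<not> inst_rational_verification I"
    proof -
      let ?n = "length (inst_owner I)" and ?m = "length (inst_targets I)"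
      obtain rs where rs: "length rs \<le> (?m + 1) * (2 * (inst_states I * ?n) + 2)" "set rs \<subseteq> set (g_all ?g)" "?c rs"
        using no verification_iff_certificate[OF v(1)] by blast
      obtain u where u: "g_path ?g u = rs" "length u \<le> length rs * (inst_states I * ?n + 1)"
        using g_path_onto[OF rs(2)] by (metis game_data_sel(1,6))
      define s where "s = C * length x"
      have "length (r_owner d) + length (r_targets d) + length (r_read d) + length (r_act d) \<le> sz d" for d
      proof -
        obtain a1 a2 a3 a4 a5 a6 a7 a8 a9 a10 a11 where "d = (a1, a2, a3, a4, a5, a6, a7, a8, a9, a10, a11)"
          by (metis prod.exhaust)
        then show ?thesis
          using length_less_sz[of "r_owner d"] length_less_sz[of "r_targets d"] length_less_sz[of "r_read d"]
            length_less_sz[of "r_act d"]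
          unfolding raw_defs by simp
      qed
      from this[of "raw_of I"] have "?n + ?m + length (inst_read I) + length (inst_act I) \<le> s"
        using C[of I] I(1) by (simp add: s_def)
      then have s: "?n \<le> s" "?m \<le> s" "inst_states I \<le> s"
        using states_le[OF v(1)] by linarith+
      then have Q: "inst_states I * ?n \<le> s * s" by (intro mult_mono) auto
      note u(2)
      also have "length rs * (inst_states I * ?n + 1) \<le> bnd s"
        unfolding bnd_def using Q s by (intro mult_mono order_trans[OF rs(1)] add_mono) auto
      also have "\<dots> \<le> poly p (length x)" unfolding s_def by (rule p)
      finally show ?thesis using u(1) rs(3) by auto
    qed
    moreover have "\<not> inst_rational_verification I" if "?c (g_path ?g u)" for u
      using certificate_sound[OF v(1)] that by blast
    ultimately show ?thesis
      unfolding ver using v I(1) by (auto simp: encode_in_verification_language)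
  qed
  then show ?thesis by blast
qed

lemma verification_language_complete: "coNP_complete (verification_language b)"
  unfolding coNP_complete_def
proof (intro conjI ballI)
  show "verification_language b \<in> class_coNP"
    unfolding class_coNP_def class_NP_def using verify_in_P[of b] not_in_verification_language_iff[of b]
    by (intro CollectI bexI[of _ "{w. verify b w}"]) simp_all
next
  fix A :: language
  assume "A \<in> class_coNP"
  from coNP_hard[OF this] show "polytime_reducible A (verification_language b)"
    unfolding polytime_reducible_def by (metis encode_in_verification_language)
qed

theorem theorem17:
  shows "coNP_complete nash_rational_verification \<and> coNP_complete det_nash_rational_verification"
  using verification_language_complete[of False] verification_language_complete[of True]
  by (simp add: verification_language_def nash_rational_verification_def det_nash_rational_verification_def)

end
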